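(* Let $\Gamma=\Gamma_0^+(2)$. Suppose that $Q(z)$, a nonzero meromorphic modular form of weight $4$ on $\Gamma$, satisfies condition $(\mathrm H_\Gamma)$ (given in the context) with $\kappa_\infty\in\frac12\mathbb Z_{\ge0}$. With $\ell$, $F(z)$ and $\hat{}$ as in the context, the following statements hold for the equation $y''=-4\pi^2Q(z)y$. (i) The cusp $\infty$ is not apparent. (ii) Let $y_1(z)=(\hat y_+|_\ell S)(z)/F(z)$ and $y_2(z)=y_+(z)$, where $y_+(z)$ is the unique solution of the form $q^{\kappa_\infty}(1+\sum_{j\ge1}c_jq^j)$. Then $\{y_1(z),y_2(z)\}$ is a fundamental system of solutions. Moreover, $$\hat y_1(z)=\left(\frac2\ell\right)\sqrt2\,z\,\hat y_2(z)+\hat m_1(z)$$ for some modular form $\hat m_1(z)\in\mathcal M_{\ell-1}\left(\Gamma_0^+(2),\left(\frac2\ell\right)\right)$, where $\left(\frac2\ell\right)=1$ if $\ell\equiv1,7\bmod 8$ and $\left(\frac2\ell\right)=-1$ if $\ell\equiv3,5\bmod 8$. (iii) The ratio $h(z)=\left(\frac2\ell\right)\frac{y_1(z)}{\sqrt2\,y_2(z)}$ is equivariant with respect to $\Gamma_0^+(2)$, that is, $h(\gamma z)=\frac{ah(z)+b}{ch(z)+d}$ for all $\gamma=\begin{pmatrix}a&b\\c&d\end{pmatrix}\in\Gamma_0^+(2)$. (iv) Let $M_2^\ast(z)=(2E_2(2z)+E_2(z))/3$ and write $$\hat y_+(z)=\left(\frac2\ell\right)\frac{\pi i}{4\sqrt2}\,\hat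 m_1(z)M_2^\ast(z)+\hat m_2(z).$$ Then $\hat m_2(z)\in\mathcal M_{\ell+1}\left(\Gamma_0^+(2),\left(\frac2\ell\right)\right)$. Consequently, $\hat y_+(z)$ is a quasimodular form in $\widetilde{\mathcal M}_{\ell+1}^{\le1}\left(\Gamma_0^+(2),\left(\frac2\ell\right)\right)$.
   Context: Notation: $\mathbb H$ is the upper half-plane, $\mathbb N=\{1,2,\dots\}$, $q=e^{2\pi iz}$, $S=\frac1{\sqrt2}\begin{pmatrix}0&-1\\2&0\end{pmatrix}$; $\Gamma_0^+(2)\subset\mathrm{SL}(2,\mathbb R)$ is generated by $\Gamma_0(2)$ and $S$. It has one cusp $\infty$ (width 1) and two elliptic points $\rho_1=i/\sqrt2$ (order 2) and $\rho_2=(1+i)/2$ (order 4). $(f|_k\gamma)(z)=(cz+d)^{-k}f(\gamma z)$ for $\gamma=\begin{pmatrix}a&b\\c&d\end{pmatrix}\in\mathrm{SL}(2,\mathbb R)$. $E_2,E_4,E_6$ are the Eisenstein series with constant term 1, $\eta$ the Dedekind eta function. $\mathcal M_k(\Gamma_0^+(2),\pm1)$ is the space of holomorphic modular forms $f$ of weight $k$ on $\Gamma_0(2)$ with $f|_kS=\pm f$. $\widetilde{\mathcal M}_k^{\le1}(\Gamma_0^+(2),\epsilon)$ is the space of holomorphic parts $f_0$ of nearly holomorphic modular forms $f_0(z)+f_1(z)/(z-\bar z)$ ($f_0,f_1$ holomorphic on $\mathbb H$) of weight $k$ on $\Gamma_0(2)$, with finite limits at cusps, whose eigenvalue under $|_kS$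 is $\epsilon$; equivalently, it is $\mathcal M_k(\Gamma_0^+(2),\epsilon)\oplus M_2^\ast\mathcal M_{k-2}(\Gamma_0^+(2),\epsilon)$. ODE terminology for $y''=-4\pi^2Qy$: it is Fuchsian on $\mathbb H$ if all poles of $Q$ on $\mathbb H$ have order $\le2$. If $Q=A(z-z_0)^{-2}+O((z-z_0)^{-1})$, the local exponents at $z_0$ are the roots of $x(x-1)=-4\pi^2A$, written $1/2\pm\kappa_{z_0}$. A point $z_0\in\mathbb H$ is apparent if $\kappa_{z_0}\in\frac12\mathbb Z_{\ge0}$ and no solution has a logarithmic singularity at $z_0$. At the cusp the equation is $(q\,d/dq)^2y=Qy$; it is Fuchsian at $\infty$ iff $Q$ is holomorphic at $\infty$, and the local exponents at $\infty$ are $\pm\kappa_\infty$, $\kappa_\infty=\sqrt{Q(\infty)}$. If $\kappa_\infty\in\frac12\mathbb Z_{\ge0}$, the cusp is apparent if no solution has a logarithmic singularity at $q=0$, and not apparent otherwise. Condition $(\mathrm H_\Gamma)$ for $\Gamma=\Gamma_0^+(2)$: (i) the equation is Fuchsian on $\mathbb H$ and at the cusp; (ii) at any singular point $z_0\in\mathbb H$ the local exponents are $1/2\pm\kappa_{z_0}$ with $\kappa_{z_0}\in\frac12\mathbb N$, and $z_0$ is apparent; (iii) at $\rho_1,\rho_2$ the local exponents are $1/2\pm\kappa_{\rho_1}$, $1/2\pm\kappa_{\rho_2}$ with $\kappa_{\rho_1},\kappa_{\rho_2}\in\frac12\mathbb N$ and $\gcd(2\kappa_{\rho_1},2)=\gcd(2\kappa_{\rho_2},4)=1$.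 Let $z_1,\dots,z_m$ be representatives of the $\Gamma$-inequivalent poles of $Q$ on $\mathbb H$ that are not elliptic points, with local exponents $1/2\pm\kappa_j$ at $z_j$. Put $M_2(z)=2E_2(2z)-E_2(z)$, $M_4(z)=(4E_4(2z)+E_4(z))/5$, $M_6(z)=(8E_6(2z)+E_6(z))/9$, $M_8(z)=\eta(z)^8\eta(2z)^8$, $t_j=M_4(z_j)^2/M_8(z_j)$, $F_j=M_4^2-t_jM_8$, $$F(z)=M_8(z)^{\kappa_\infty}\left(\frac{M_6(z)}{M_2(z)}\right)^{\kappa_{\rho_1}-1/2}M_2(z)^{\kappa_{\rho_2}-1/2}\prod_{j=1}^mF_j(z)^{\kappa_j-1/2},$$ $$\ell=-1+8\kappa_\infty+4\left(\kappa_{\rho_1}-\tfrac12\right)+2\left(\kappa_{\rho_2}-\tfrac12\right)+8\sum_{j=1}^m\left(\kappa_j-\tfrac12\right).$$ Then $\ell$ is an odd integer. For any function $f$ put $\hat f(z)=F(z)f(z)$; for a (possibly multivalued, analytically continued) solution $y$ of the equation, $\hat y=Fy$ is a single-valued holomorphic function on $\mathbb H$ (a branch of $F$ being fixed near $i\infty$ and continued together with $y$). *)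

theory Defs
  imports "HOL-Complex_Analysis.Complex_Analysis" "HOL-Algebra.Generated_Groups"
begin

section \<open>Upper half-plane and matrix groups\<close>

definition half_plane :: "real \<Rightarrow> complex set" where
  "half_plane C = {z. Im z > C}"

abbreviation uhp :: "complex set" where
  "uhp \<equiv> half_plane 0"

definition at_ii_inf :: "complex filter" where
  "at_ii_inf = filtercomap Im at_top"

definition qq :: "complex \<Rightarrow> complex" where
  "qq z = exp (2 * of_real pi * \<i> * z)"

definition SL2R :: "(real^2^2) monoid" where
  "SL2R = \<lparr>carrier = {A. det A = 1}, mult = (**), one = mat 1\<rparr>"

definition SL2Z :: "(real^2^2) set" where
  "SL2Z = {A. det A = 1 \<and> (\<forall>i j. A $ i $ j \<in> \<int>)}"

definition Gamma0_2 :: "(real^2^2) set" where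
  "Gamma0_2 = {A \<in> SL2Z. \<exists>k::int. A $ 2 $ 1 = 2 * of_int k}"

definition S_mat :: "real^2^2" where
  "S_mat = vector [vector [0, - 1 / sqrt 2], vector [2 / sqrt 2, 0]]"

definition Gamma0p_2 :: "(real^2^2) set" where
  "Gamma0p_2 = generate SL2R (Gamma0_2 \<union> {S_mat})"

lemma group_SL2R: "group SL2R"
proof (rule groupI)
  fix A assume "A \<in> carrier SL2R"
  then have d: "det A = 1" by (simp add: SL2R_def)
  then have "invertible A" by (simp add: invertible_det_nz)
  then obtain B where B: "A ** B = mat 1" "B ** A = mat 1"
    by (auto simp: invertible_def)
  from B(1) d have "det B = 1" by (metis det_I det_mul mult_1)
  with B show "\<exists>y\<in>carrier SL2R. y \<otimes>\<^bsub>SL2R\<^esub> A = \<one>\<^bsub>SL2R\<^esub>"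
    by (auto simp: SL2R_def)
qed (auto simp: SL2R_def det_mul matrix_mul_assoc)

definition automorphy :: "real^2^2 \<Rightarrow> complex \<Rightarrow> complex" where
  "automorphy A z = of_real (A $ 2 $ 1) * z + of_real (A $ 2 $ 2)"

definition moebius :: "real^2^2 \<Rightarrow> complex \<Rightarrow> complex" where
  "moebius A z = (of_real (A $ 1 $ 1) * z + of_real (A $ 1 $ 2)) / automorphy A z"

definition slash :: "int \<Rightarrow> real^2^2 \<Rightarrow> (complex \<Rightarrow> complex) \<Rightarrow> complex \<Rightarrow> complex" where
  "slash k A f z = automorphy A z powi (- k) * f (moebius A z)"

definition Gamma_equiv :: "complex \<Rightarrow> complex \<Rightarrow> bool" where
  "Gamma_equiv z w \<longleftrightarrow> (\<exists>A\<in>Gamma0p_2. w = moebius A z)"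

definition rho1 :: complex where "rho1 = \<i> / of_real (sqrt 2)"
definition rho2 :: complex where "rho2 = (1 + \<i>) / 2"

definition elliptic_point :: "complex \<Rightarrow> bool" where
  "elliptic_point z \<longleftrightarrow> Gamma_equiv z rho1 \<or> Gamma_equiv z rho2"


section \<open>Spaces of modular and quasimodular forms\<close>

text \<open>The cusps are tested on all translates by the full modular group. For a holomorphic
  function invariant under a translation, a finite limit at infinity is the same as a
  \<open>q\<close>-expansion without negative exponents.\<close>

definition finite_at_cusps :: "int \<Rightarrow> (complex \<Rightarrow> complex) \<Rightarrow> bool" where
  "finite_at_cusps k f \<longleftrightarrow> (\<forall>A\<in>SL2Z. \<exists>L. (slash k A f \<longlongrightarrow> L) at_ii_inf)"

definition modular_forms :: "int \<Rightarrow> complex \<Rightarrow> (complex \<Rightarrow> complex) set" where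
  "modular_forms k e = {f. f holomorphic_on uhp \<and>
     (\<forall>A\<in>Gamma0_2. \<forall>z\<in>uhp. slash k A f z = f z) \<and>
     finite_at_cusps k f \<and>
     (\<forall>z\<in>uhp. slash k S_mat f z = e * f z)}"

definition quasimodular_forms :: "int \<Rightarrow> complex \<Rightarrow> (complex \<Rightarrow> complex) set" where
  "quasimodular_forms k e = {f0. \<exists>f1 f.
     f0 holomorphic_on uhp \<and> f1 holomorphic_on uhp \<and>
     (\<forall>z. f z = f0 z + f1 z / (z - cnj z)) \<and>
     (\<forall>A\<in>Gamma0_2. \<forall>z\<in>uhp. slash k A f z = f z) \<and>
     finite_at_cusps k f \<and>
     (\<forall>z\<in>uhp. slash k S_mat f z = e * f z)}"

text \<open>A meromorphic function is represented by its normal form (value \<open>0\<close> at poles, no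
  removable singularities), so that the functional equation can be imposed at every point.\<close>

definition meromorphic_modular_form :: "int \<Rightarrow> (complex \<Rightarrow> complex) \<Rightarrow> bool" where
  "meromorphic_modular_form k f \<longleftrightarrow>
     f nicely_meromorphic_on uhp \<and>
     (\<forall>A\<in>Gamma0p_2. \<forall>z\<in>uhp. slash k A f z = f z) \<and>
     (\<exists>g. g meromorphic_on {0} \<and> (\<forall>\<^sub>F z in at_ii_inf. f z = g (qq z)))"

text \<open>For \<open>z\<close> and \<open>\<gamma> z\<close> not poles the identity is required literally; at the poles
  (value \<open>\<infinity>\<close>) it then follows by continuity.\<close>

definition equivariant :: "(complex \<Rightarrow> complex) \<Rightarrow> bool" where
  "equivariant h \<longleftrightarrow> h meromorphic_on uhp \<and>
     (\<forall>A\<in>Gamma0p_2. \<forall>z\<in>uhp. \<not> is_pole h z \<and> \<not> is_pole h (moebius A z) \<longrightarrow>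
        of_real (A $ 2 $ 1) * h z + of_real (A $ 2 $ 2) \<noteq> 0 \<and>
        h (moebius A z) = (of_real (A $ 1 $ 1) * h z + of_real (A $ 1 $ 2)) /
                          (of_real (A $ 2 $ 1) * h z + of_real (A $ 2 $ 2)))"


section \<open>Eisenstein series, eta function\<close>

definition sigma_pow :: "nat \<Rightarrow> nat \<Rightarrow> nat" where
  "sigma_pow k n = (\<Sum>d | d dvd n. d ^ k)"

definition E2 :: "complex \<Rightarrow> complex" where
  "E2 z = 1 - 24 * (\<Sum>n. of_nat (sigma_pow 1 (Suc n)) * qq z ^ Suc n)"

definition E4 :: "complex \<Rightarrow> complex" where
  "E4 z = 1 + 240 * (\<Sum>n. of_nat (sigma_pow 3 (Suc n)) * qq z ^ Suc n)"

definition E6 :: "complex \<Rightarrow> complex" where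
  "E6 z = 1 - 504 * (\<Sum>n. of_nat (sigma_pow 5 (Suc n)) * qq z ^ Suc n)"

definition eta :: "complex \<Rightarrow> complex" where
  "eta z = exp (2 * of_real pi * \<i> * z / 24) * (\<Prod>n. 1 - qq z ^ Suc n)"

definition M2 :: "complex \<Rightarrow> complex" where "M2 z = 2 * E2 (2 * z) - E2 z"
definition M4 :: "complex \<Rightarrow> complex" where "M4 z = (4 * E4 (2 * z) + E4 z) / 5"
definition M6 :: "complex \<Rightarrow> complex" where "M6 z = (8 * E6 (2 * z) + E6 z) / 9"
definition M8 :: "complex \<Rightarrow> complex" where "M8 z = eta z ^ 8 * eta (2 * z) ^ 8"
definition M2_star :: "complex \<Rightarrow> complex" where "M2_star z = (2 * E2 (2 * z) + E2 z) / 3"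

text \<open>\<open>F_pt w\<close> is the form \<open>F\<^sub>j\<close> attached to the point \<open>w = z\<^sub>j\<close>.\<close>

definition F_pt :: "complex \<Rightarrow> complex \<Rightarrow> complex" where
  "F_pt w z = M4 z ^ 2 - (M4 w ^ 2 / M8 w) * M8 z"


section \<open>The differential equation\<close>

definition solves_ode :: "(complex \<Rightarrow> complex) \<Rightarrow> complex set \<Rightarrow> (complex \<Rightarrow> complex) \<Rightarrow> bool" where
  "solves_ode Q U y \<longleftrightarrow> y holomorphic_on U \<and>
     (\<forall>z\<in>U. (deriv ^^ 2) y z = - 4 * of_real pi ^ 2 * Q z * y z)"

definition fundamental_system ::
  "(complex \<Rightarrow> complex) \<Rightarrow> complex set \<Rightarrow> (complex \<Rightarrow> complex) \<Rightarrow> (complex \<Rightarrow> complex) \<Rightarrow> bool" where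
  "fundamental_system Q U y1 y2 \<longleftrightarrow>
     solves_ode Q U y1 \<and> solves_ode Q U y2 \<and>
     (\<forall>a b. (\<forall>z\<in>U. a * y1 z + b * y2 z = 0) \<longrightarrow> a = 0 \<and> b = 0) \<and>
     (\<forall>y. solves_ode Q U y \<longrightarrow> (\<exists>a b. \<forall>z\<in>U. y z = a * y1 z + b * y2 z))"

definition fuchsian_on_uhp :: "(complex \<Rightarrow> complex) \<Rightarrow> bool" where
  "fuchsian_on_uhp Q \<longleftrightarrow> (\<forall>z\<in>uhp. is_pole Q z \<longrightarrow> zorder Q z \<ge> - 2)"

definition fuchsian_at_cusp :: "(complex \<Rightarrow> complex) \<Rightarrow> bool" where
  "fuchsian_at_cusp Q \<longleftrightarrow> (\<exists>L. (Q \<longlongrightarrow> L) at_ii_inf)"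

definition local_exponents :: "(complex \<Rightarrow> complex) \<Rightarrow> complex \<Rightarrow> complex set" where
  "local_exponents Q z0 =
     {x. x * (x - 1) = - 4 * of_real pi ^ 2 * fls_nth (laurent_expansion Q z0) (- 2)}"

definition has_kappa :: "(complex \<Rightarrow> complex) \<Rightarrow> complex \<Rightarrow> real \<Rightarrow> bool" where
  "has_kappa Q z0 k \<longleftrightarrow> k \<ge> 0 \<and>
     local_exponents Q z0 = {1 / 2 + complex_of_real k, 1 / 2 - complex_of_real k}"

definition has_kappa_cusp :: "(complex \<Rightarrow> complex) \<Rightarrow> real \<Rightarrow> bool" where
  "has_kappa_cusp Q k \<longleftrightarrow> k \<ge> 0 \<and> (Q \<longlongrightarrow> complex_of_real k ^ 2) at_ii_inf"

text \<open>Near a singular point solutions are multivalued; they are viewed through their branches on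
  discs slit along the direction of the negative real axis, where \<open>Ln (z - z0)\<close> is
  holomorphic. A logarithmic singularity means that the logarithm really occurs in the
  Frobenius form.\<close>

definition slit_disc :: "complex \<Rightarrow> real \<Rightarrow> complex set" where
  "slit_disc z0 r = {z \<in> ball z0 r. z - z0 \<notin> \<real>\<^sub>\<le>\<^sub>0}"

definition log_singularity :: "(complex \<Rightarrow> complex) \<Rightarrow> complex \<Rightarrow> real \<Rightarrow> bool" where
  "log_singularity y z0 r \<longleftrightarrow> (\<exists>x g h.
     g holomorphic_on ball z0 r \<and> h holomorphic_on ball z0 r \<and> (\<exists>z\<in>ball z0 r. h z \<noteq> 0) \<and>
     (\<forall>z\<in>slit_disc z0 r. y z = exp (x * Ln (z - z0)) * (g z + Ln (z - z0) * h z)))"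

definition apparent :: "(complex \<Rightarrow> complex) \<Rightarrow> complex \<Rightarrow> bool" where
  "apparent Q z0 \<longleftrightarrow> (\<exists>n::nat. has_kappa Q z0 (real n / 2)) \<and>
     (\<forall>r y. r > 0 \<and> ball z0 r \<subseteq> uhp \<and> Q holomorphic_on (ball z0 r - {z0}) \<and>
        solves_ode Q (slit_disc z0 r) y \<longrightarrow> \<not> log_singularity y z0 r)"

text \<open>At the cusp the logarithm is \<open>log q = 2 \<pi> i z\<close>.\<close>

definition log_singularity_cusp :: "(complex \<Rightarrow> complex) \<Rightarrow> real \<Rightarrow> bool" where
  "log_singularity_cusp y C \<longleftrightarrow> (\<exists>x g h.
     g holomorphic_on ball 0 (exp (- 2 * pi * C)) \<and> h holomorphic_on ball 0 (exp (- 2 * pi * C)) \<and>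
     (\<exists>w\<in>ball 0 (exp (- 2 * pi * C)). h w \<noteq> 0) \<and>
     (\<forall>z\<in>half_plane C. y z =
        exp (2 * of_real pi * \<i> * x * z) * (g (qq z) + 2 * of_real pi * \<i> * z * h (qq z))))"

definition cusp_apparent :: "(complex \<Rightarrow> complex) \<Rightarrow> bool" where
  "cusp_apparent Q \<longleftrightarrow> (\<exists>n::nat. has_kappa_cusp Q (real n / 2)) \<and>
     (\<forall>C y. C \<ge> 0 \<and> Q holomorphic_on half_plane C \<and> solves_ode Q (half_plane C) y \<longrightarrow>
        \<not> log_singularity_cusp y C)"

definition condition_H :: "(complex \<Rightarrow> complex) \<Rightarrow> bool" where
  "condition_H Q \<longleftrightarrow>
     fuchsian_on_uhp Q \<and> fuchsian_at_cusp Q \<and>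
     (\<forall>z\<in>uhp. is_pole Q z \<longrightarrow>
        (\<exists>n::nat. n \<ge> 1 \<and> has_kappa Q z (real n / 2)) \<and> apparent Q z) \<and>
     (\<exists>n::nat. n \<ge> 1 \<and> has_kappa Q rho1 (real n / 2) \<and> gcd n 2 = 1) \<and>
     (\<exists>n::nat. n \<ge> 1 \<and> has_kappa Q rho2 (real n / 2) \<and> gcd n 4 = 1)"

definition nonelliptic_poles :: "(complex \<Rightarrow> complex) \<Rightarrow> complex set" where
  "nonelliptic_poles Q = {z \<in> uhp. is_pole Q z \<and> \<not> elliptic_point z}"

definition pole_representatives :: "(complex \<Rightarrow> complex) \<Rightarrow> nat \<Rightarrow> (nat \<Rightarrow> complex) \<Rightarrow> bool" where
  "pole_representatives Q m zs \<longleftrightarrow>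
     (\<forall>j\<in>{1..m}. zs j \<in> nonelliptic_poles Q) \<and>
     (\<forall>w\<in>nonelliptic_poles Q. \<exists>!j. j \<in> {1..m} \<and> Gamma_equiv w (zs j))"

text \<open>The function \<open>F\<close> is multivalued. A branch on \<open>U\<close> arises from branches on \<open>U\<close> of the
  logarithms of its factors, which in particular must not vanish on \<open>U\<close>.\<close>

definition F_branch ::
  "real \<Rightarrow> real \<Rightarrow> real \<Rightarrow> nat \<Rightarrow> (nat \<Rightarrow> complex) \<Rightarrow> (nat \<Rightarrow> real) \<Rightarrow>
   complex set \<Rightarrow> (complex \<Rightarrow> complex) \<Rightarrow> bool" where
  "F_branch kinf k1 k2 m zs ks U F \<longleftrightarrow> (\<exists>L8 L6 L2 L.
     L8 holomorphic_on U \<and> (\<forall>z\<in>U. exp (L8 z) = M8 z) \<and>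
     L6 holomorphic_on U \<and> (\<forall>z\<in>U. exp (L6 z) = M6 z / M2 z) \<and>
     L2 holomorphic_on U \<and> (\<forall>z\<in>U. exp (L2 z) = M2 z) \<and>
     (\<forall>j\<in>{1..m}. L j holomorphic_on U \<and> (\<forall>z\<in>U. exp (L j z) = F_pt (zs j) z)) \<and>
     (\<forall>z\<in>U. F z = exp (of_real kinf * L8 z) * exp (of_real (k1 - 1 / 2) * L6 z) *
                   exp (of_real (k2 - 1 / 2) * L2 z) *
                   (\<Prod>j=1..m. exp (of_real (ks j - 1 / 2) * L j z))))"

definition y_plus :: "(complex \<Rightarrow> complex) \<Rightarrow> real \<Rightarrow> real \<Rightarrow> (complex \<Rightarrow> complex) \<Rightarrow> bool" where
  "y_plus Q kinf C y \<longleftrightarrow> solves_ode Q (half_plane C) y \<and>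
     (\<exists>c. c 0 = 1 \<and> (\<forall>z\<in>half_plane C. summable (\<lambda>j. c j * qq z ^ j) \<and>
        y z = exp (2 * of_real pi * \<i> * of_real kinf * z) * (\<Sum>j. c j * qq z ^ j)))"

text \<open>\<open>Yp\<close> is the single-valued function \<open>F y\<^sub>+\<close> on the upper half-plane: near infinity a branch
  \<open>F\<close> is fixed, and \<open>Yp\<close> is the (unique) holomorphic continuation of \<open>F yp\<close>.\<close>

definition y_plus_hat ::
  "(complex \<Rightarrow> complex) \<Rightarrow> real \<Rightarrow> real \<Rightarrow> real \<Rightarrow> nat \<Rightarrow> (nat \<Rightarrow> complex) \<Rightarrow> (nat \<Rightarrow> real) \<Rightarrow>
   (complex \<Rightarrow> complex) \<Rightarrow> bool" where
  "y_plus_hat Q kinf k1 k2 m zs ks Yp \<longleftrightarrow> Yp holomorphic_on uhp \<and>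
     (\<exists>C F yp. C \<ge> 0 \<and> Q holomorphic_on half_plane C \<and>
        F_branch kinf k1 k2 m zs ks (half_plane C) F \<and> y_plus Q kinf C yp \<and>
        (\<forall>z\<in>half_plane C. Yp z = F z * yp z))"

text \<open>For functions \<open>Y\<close> on the upper half-plane, the multivalued functions \<open>Y1 / F\<close> and \<open>Y2 / F\<close>
  form a fundamental system if their branches do, on every region carrying a branch of \<open>F\<close>.\<close>

definition hat_fundamental_system ::
  "(complex \<Rightarrow> complex) \<Rightarrow> real \<Rightarrow> real \<Rightarrow> real \<Rightarrow> nat \<Rightarrow> (nat \<Rightarrow> complex) \<Rightarrow> (nat \<Rightarrow> real) \<Rightarrow>
   (complex \<Rightarrow> complex) \<Rightarrow> (complex \<Rightarrow> complex) \<Rightarrow> bool" where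
  "hat_fundamental_system Q kinf k1 k2 m zs ks Y1 Y2 \<longleftrightarrow>
     (\<forall>U F. open U \<and> connected U \<and> U \<noteq> {} \<and> U \<subseteq> uhp \<and> Q holomorphic_on U \<and>
        F_branch kinf k1 k2 m zs ks U F \<longrightarrow>
        fundamental_system Q U (\<lambda>z. Y1 z / F z) (\<lambda>z. Y2 z / F z))"

definition ell_real :: "real \<Rightarrow> real \<Rightarrow> real \<Rightarrow> nat \<Rightarrow> (nat \<Rightarrow> real) \<Rightarrow> real" where
  "ell_real kinf k1 k2 m ks =
     - 1 + 8 * kinf + 4 * (k1 - 1 / 2) + 2 * (k2 - 1 / 2) + 8 * (\<Sum>j=1..m. ks j - 1 / 2)"

text \<open>The symbol \<open>(2 / l)\<close>; the value at even arguments is irrelevant.\<close>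

definition jacobi2 :: "int \<Rightarrow> complex" where
  "jacobi2 l = (if l mod 8 \<in> {1, 7} then 1 else if l mod 8 \<in> {3, 5} then - 1 else 0)"

end

theory Submission
 imports Defs
begin

text \<open>
  Why the theorem holds. The equation \<open>y'' = -4 \<pi>\<^sup>2 Q y\<close> has multivalued solutions, but \<open>F\<close> is built from
  forms with simple zeros in such a way that \<open>Y = F y\<close> is single valued. With \<open>\<Lambda> = F'/F\<close> (called \<open>lam\<close>
  below) and \<open>\<nabla> = d/dz - \<Lambda>\<close> the function \<open>Y\<close> satisfies \<open>\<nabla>\<^sup>2 Y = -4 \<pi>\<^sup>2 Q Y\<close>. This equation has single valued
  coefficients, and at each point \<open>p\<close> its exponents are \<open>0\<close> and some \<open>n \<ge> 1\<close>. Absence of logarithms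
  therefore gives a basis of solutions that are holomorphic at \<open>p\<close> (\<open>local_basis\<close>), and the
  Frobenius solution at the cusp continues to the whole half-plane (\<open>continuation\<close>): this is \<open>Yp\<close>.

  Under the Fricke involution \<open>z \<mapsto> -1/(2z)\<close> the form \<open>\<Lambda> dz\<close> changes by \<open>(l + 1) dz/z\<close>, which is how the
  weight \<open>l\<close> arises; consequently the slash action of weight \<open>l\<close> maps solutions to solutions
  (\<open>twisted_slash\<close>), and \<open>Y1 = Yp | S\<close> is a solution. As \<open>l\<close> is odd, \<open>Y1 | S = - Yp\<close>. Translation fixes
  \<open>Yp\<close> and sends \<open>Y1\<close> to \<open>Y1 + b Yp\<close>, where \<open>b\<close> is a multiple of the coefficient of the logarithm at the
  cusp. Evaluating the two laws at \<open>\<rho>\<^sub>2\<close>, which is fixed by \<open>z \<mapsto> 1 - 1/(2z)\<close>, gives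
  \<open>b = \<mu> + 1/\<mu> = 2 cos (\<pi> l/4) = (2/l) \<surd>2\<close> with \<open>\<mu> = exp (\<pi> i l/4)\<close> (\<open>monodromy\<close>). As \<open>b\<close> is not zero, the
  cusp is not apparent. Moreover \<open>m1 = Y1 - b z Yp\<close> is periodic, bounded at the cusp and an eigenform
  of \<open>S\<close>, hence modular. The quasimodular \<open>M2_star\<close> has the anomaly that turns the law of \<open>Yp\<close>,
  which involves \<open>m1\<close>, into that of the form \<open>m2\<close>. Finally \<open>(Y1, Yp)\<close> transforms, up to a scalar
  factor and a constant rescaling, by the matrix itself, which is the equivariance of the ratio.

  The exponents of \<open>F\<close> are controlled by the zeros of \<open>M2\<close>, of \<open>N4 = M6/M2\<close> and of the forms \<open>F_pt w\<close>. All of them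
  are simple and each form vanishes on exactly one orbit. This is read off the Hauptmodul
  \<open>t = M2\<^sup>4/M8\<close>: its derivative is a multiple of \<open>M2\<^sup>3 N4/M8\<close>, one has \<open>N4\<^sup>2 = M2\<^sup>4 - 256 M8\<close>, and \<open>t\<close> separates
  the orbits (\<open>hauptmodul_eq_iff\<close>). The identities rest on the vanishing of cusp forms of weight 0
  and on the inversion formulas of the Eisenstein series, which are derived from the Lipschitz formula.
\<close>

abbreviation tpi :: complex where "tpi \<equiv> 2 * of_real pi * \<i>"

section \<open>Power series in the nome\<close>

definition pow_series :: "(nat => complex) => complex => complex" where
 "pow_series a x = (\<Sum>n. a n * x ^ n)"

text \<open>Coefficients of polynomial growth form a class that is closed under differentiation of the series and
  contains the divisor sums.\<close>

definition poly_growth :: "(nat => complex) => bool" where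
 "poly_growth a \<longleftrightarrow> (\<exists>C k. \<forall>n. norm (a n) <= C * real (Suc n) ^ k)"

lemma summable_poly_geometric:
 fixes r :: real assumes "0 <= r" "r < 1"
 shows "summable (%n. real (Suc n) ^ k * r ^ n)"
proof (cases "r = 0")
 case True
 have "summable (%n. if n = 0 then 1 else (0::real))" by simp
 then show ?thesis by (rule back_subst[of summable]) (auto simp: True fun_eq_iff)
next
 case False
 with assms have r: "r > 0" by simp
 have "(%n. (real n + 2) / (real n + 1)) \<longlonglongrightarrow> 1" by real_asymp
 from tendsto_power[OF this, of k] tendsto_mult_right[of _ 1 _ r]
 have "(%n. ((real n + 2) / (real n + 1)) ^ k * r) \<longlonglongrightarrow> r" by fastforce
 moreover obtain c where c: "r < c" "c < 1" using assms dense by blast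
 ultimately have "eventually (%n. ((real n + 2) / (real n + 1)) ^ k * r < c) sequentially"
  by (simp add: order_tendstoD)
 then obtain N where N: "!!n. n >= N ==> ((real n + 2) / (real n + 1)) ^ k * r < c"
  by (auto simp: eventually_sequentially)
 show ?thesis
 proof (rule summable_ratio_test[OF c(2)])
  fix n assume "n >= N"
  have "real (Suc (Suc n)) ^ k * r ^ Suc n
    = (((real n + 2) / (real n + 1)) ^ k * r) * (real (Suc n) ^ k * r ^ n)"
   by (simp add: field_simps power_divide)
  also have "\<dots> <= c * (real (Suc n) ^ k * r ^ n)"
   using N[OF \<open>n >= N\<close>] r by (intro mult_right_mono) auto
  finally show "norm (real (Suc (Suc n)) ^ k * r ^ Suc n) <= c * norm (real (Suc n) ^ k * r ^ n)"
   using r by simp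
 qed
qed

lemma poly_growth_abs_summable:
 assumes "poly_growth a" "norm x < 1"
 shows "summable (%n. norm (a n * x ^ n))"
proof -
 obtain C k where C: "!!n. norm (a n) <= C * real (Suc n) ^ k"
  using assms(1) by (auto simp: poly_growth_def)
 show ?thesis
 proof (rule summable_comparison_test')
  show "summable (%n. C * (real (Suc n) ^ k * norm x ^ n))"
   by (intro summable_mult summable_poly_geometric) (use assms in auto)
  fix n :: nat
  show "norm (norm (a n * x ^ n)) <= C * (real (Suc n) ^ k * norm x ^ n)"
   using mult_right_mono[OF C[of n], of "norm x ^ n"] by (simp add: norm_mult norm_power mult.assoc)
 qed
qed

lemma poly_growth_summable:
 "poly_growth a ==> norm x < 1 ==> summable (%n. a n * x ^ n)"
 by (rule summable_norm_cancel[OF poly_growth_abs_summable])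

lemma poly_growth_times_index:
 assumes "poly_growth a" shows "poly_growth (%n. of_nat n * a n)"
proof -
 obtain C k where C: "!!n. norm (a n) <= C * real (Suc n) ^ k"
  using assms(1) by (auto simp: poly_growth_def)
 have "norm (of_nat n * a n) <= C * real (Suc n) ^ Suc k" for n
 proof -
  have "0 <= C * real (Suc n) ^ k" using C[of n] norm_ge_zero order_trans by blast
  then have "real n * norm (a n) <= real (Suc n) * (C * real (Suc n) ^ k)"
   using C[of n] by (intro mult_mono) auto
  then show ?thesis by (simp add: norm_mult algebra_simps)
 qed
 then show ?thesis unfolding poly_growth_def by blast
qed

lemma has_field_derivative_pow_series:
 assumes "poly_growth a" "norm x < 1"
 shows "(pow_series a has_field_derivative pow_series (%n. of_nat (Suc n) * a (Suc n)) x) (at x)"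
proof -
 have "((%x. \<Sum>n. a n * x ^ n) has_field_derivative (\<Sum>n. diffs a n * x ^ n)) (at x)"
  by (rule termdiffs_strong'[of 1]) (use assms poly_growth_summable in auto)
 then show ?thesis by (simp add: pow_series_def[abs_def] diffs_def)
qed

lemma holomorphic_pow_series:
 "poly_growth a ==> pow_series a holomorphic_on ball 0 1"
 unfolding holomorphic_on_open[OF open_ball]
 by (intro ballI exI, rule has_field_derivative_pow_series) auto

lemma euler_operator_pow_series:
 assumes "poly_growth a" "norm x < 1"
 shows "x * deriv (pow_series a) x = pow_series (%n. of_nat n * a n) x"
proof -
 have s: "summable (%n. of_nat n * a n * x ^ n)"
  using poly_growth_summable[OF poly_growth_times_index[OF assms(1)] assms(2)] .
 have "pow_series (%n. of_nat n * a n) x = (\<Sum>n. x * (of_nat (Suc n) * a (Suc n) * x ^ n))"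
  unfolding pow_series_def using suminf_split_head[OF s] by (simp add: algebra_simps)
 also have "\<dots> = x * pow_series (%n. of_nat (Suc n) * a (Suc n)) x"
 proof (cases "x = 0")
  case False
  have "summable (%n. of_nat (Suc n) * a (Suc n) * x ^ Suc n)"
   using s by (subst summable_Suc_iff)
  then have "summable (%n. inverse x * (of_nat (Suc n) * a (Suc n) * x ^ Suc n))"
   by (rule summable_mult)
  then have "summable (%n. of_nat (Suc n) * a (Suc n) * x ^ n)"
   by (rule back_subst[of summable]) (use False in \<open>auto simp: fun_eq_iff\<close>)
  then show ?thesis unfolding pow_series_def by (rule suminf_mult)
 qed auto
 finally show ?thesis
  using DERIV_imp_deriv[OF has_field_derivative_pow_series[OF assms]] by simp
qed

lemma poly_growth_power: "poly_growth (%n. of_nat n ^ k)"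
 unfolding poly_growth_def
proof (intro exI allI)
 show "norm (of_nat n ^ k :: complex) <= 1 * real (Suc n) ^ k" for n
  using power_mono[of "real n" "real (Suc n)" k] by (simp add: norm_power)
qed

lemma sigma_pow_0 [simp]: "sigma_pow k 0 = 0"
 by (simp add: sigma_pow_def)

lemma poly_growth_sigma: "poly_growth (%n. of_nat (sigma_pow k n))"
proof -
 have "sigma_pow k n <= Suc n ^ Suc k" for n
 proof (cases "n = 0")
  case False
  have "sigma_pow k n <= (\<Sum>d | d dvd n. Suc n ^ k)"
   unfolding sigma_pow_def using False
   by (intro sum_mono power_mono) (auto dest: dvd_imp_le)
  also have "\<dots> = card {d. d dvd n} * Suc n ^ k" by simp
  also have "card {d. d dvd n} <= card {..n}"
   using False by (intro card_mono) (auto dest: dvd_imp_le)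
  finally show ?thesis by (simp add: mult_right_mono)
 qed auto
 then have "norm (of_nat (sigma_pow k n) :: complex) <= 1 * real (Suc n) ^ Suc k" for n
  by (metis mult_1 norm_of_nat of_nat_le_iff of_nat_power)
 then show ?thesis unfolding poly_growth_def by blast
qed

lemma suminf_Suc_eq_pow_series:
 assumes "poly_growth a" "norm x < 1" "a 0 = 0"
 shows "(\<Sum>n. a (Suc n) * x ^ Suc n) = pow_series a x"
 unfolding pow_series_def using suminf_split_head[OF poly_growth_summable[OF assms(1,2)]] assms(3) by simp

lemma uhp_iff [simp]: "z \<in> half_plane C \<longleftrightarrow> Im z > C"
 by (simp add: half_plane_def)

lemma open_half_plane [simp]: "open (half_plane C)"
 unfolding half_plane_def by (rule open_halfspace_Im_gt)

lemma convex_half_plane [simp]: "convex (half_plane C)"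
 unfolding half_plane_def by (rule convex_halfspace_Im_gt)

lemma norm_qq: "norm (qq z) = exp (- 2 * pi * Im z)"
 by (simp add: qq_def)

lemma norm_qq_less_1: "Im z > 0 ==> norm (qq z) < 1"
 by (simp add: norm_qq)

lemma qq_nonzero [simp]: "qq z ~= 0"
 by (simp add: qq_def)

lemma qq_mult_nat: "qq (of_nat m * z) = qq z ^ m"
 by (simp add: qq_def exp_of_nat_mult [symmetric] mult_ac)

lemma qq_double: "qq (2 * z) = qq z ^ 2"
 using qq_mult_nat[of 2 z] by simp

lemma qq_plus_1 [simp]: "qq (z + 1) = qq z"
 by (simp add: qq_def ring_distribs exp_add)

lemma has_field_derivative_qq [derivative_intros]:
 "(qq has_field_derivative tpi * qq z) (at z within A)"
 unfolding qq_def[abs_def] by (auto intro!: derivative_eq_intros)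

lemma holomorphic_qq [holomorphic_intros]: "qq holomorphic_on A"
 unfolding qq_def[abs_def] by (intro holomorphic_intros)

section \<open>The transformation laws of the Eisenstein series\<close>

text \<open>The logarithmic derivative of the reflection formula of the Gamma function; it brings the cotangent into a
  form whose repeated derivatives are polygamma values, that is, series over a half line of integers.\<close>

lemma digamma_reflection:
 fixes z :: complex assumes z: "z \<notin> \<int>"
 shows "Digamma (1 - z) - Digamma z = of_real pi * cot (of_real pi * z)"
proof -
 have nz: "z \<notin> \<int>\<^sub>\<le>\<^sub>0" "1 - z \<notin> \<int>\<^sub>\<le>\<^sub>0"
  using z nonpos_Ints_Int[of z] nonpos_Ints_Int[of "1 - z"] Ints_diff[OF Ints_1, of "1 - z"] by auto
 have sin: "sin (of_real pi * z) ~= 0"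
  using Gamma_reflection_complex[of z] Gamma_eq_zero_iff[of z] Gamma_eq_zero_iff[of "1 - z"] nz by auto
 have "((%z. Gamma z * Gamma (1 - z)) has_field_derivative
      Gamma z * Gamma (1 - z) * (Digamma z - Digamma (1 - z))) (at z)"
  using nz by (auto intro!: derivative_eq_intros simp: algebra_simps)
 moreover have "((%z. of_real pi / sin (of_real pi * z)) has_field_derivative
      - (of_real pi ^ 2 * cos (of_real pi * z)) / sin (of_real pi * z) ^ 2) (at z)"
  using sin by (auto intro!: derivative_eq_intros simp: power2_eq_square)
 ultimately have "Gamma z * Gamma (1 - z) * (Digamma z - Digamma (1 - z)) =
      - (of_real pi ^ 2 * cos (of_real pi * z)) / sin (of_real pi * z) ^ 2"
  unfolding Gamma_reflection_complex by (rule DERIV_unique)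
 then have "of_real pi / sin (of_real pi * z) * (Digamma z - Digamma (1 - z)) =
      - (of_real pi ^ 2 * cos (of_real pi * z)) / sin (of_real pi * z) ^ 2"
  by (simp only: Gamma_reflection_complex)
 moreover have "- d = p * (c / s)" if "p / s * d = - (p ^ 2 * c) / s ^ 2" "s ~= 0" "p ~= 0" for p s d c :: complex
 proof -
  have "d = s / p * (p / s * d)" using that(2,3) by simp
  then show ?thesis unfolding that(1) using that(2,3) by (simp add: power2_eq_square)
 qed
 ultimately have "- (Digamma z - Digamma (1 - z)) = of_real pi * (cos (of_real pi * z) / sin (of_real pi * z))"
  using sin by (metis of_real_eq_0_iff pi_neq_zero)
 then show ?thesis by (simp only: cot_def minus_diff_eq)
qed

lemma cot_nome:
 assumes "Im z > 0"
 shows "of_real pi * cot (of_real pi * z) = - of_real pi * \<i> - 2 * of_real pi * \<i> * (qq z / (1 - qq z))"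
proof -
 define e where "e = exp (\<i> * of_real pi * z)"
 have e: "e ~= 0" "qq z = e ^ 2"
  by (auto simp: e_def qq_def power2_eq_square exp_add [symmetric] algebra_simps)
 have n: "qq z ~= 1" using norm_qq_less_1[OF assms] by auto
 have "sin (of_real pi * z) = (e - inverse e) / (2 * \<i>)" "cos (of_real pi * z) = (e + inverse e) / 2"
  by (simp_all add: sin_exp_eq cos_exp_eq e_def exp_minus mult_ac)
 then have "cot (of_real pi * z) = \<i> * (e + inverse e) / (e - inverse e)"
 proof -
  have "(c / 2) / (d / (2 * \<i>)) = \<i> * c / d" for c d :: complex
   by (cases "d = 0") (simp_all add: field_simps)
  then show ?thesis
   by (simp only: cot_def \<open>sin _ = _\<close> \<open>cos _ = _\<close>)
 qed
 also have "\<dots> = \<i> * (e ^ 2 + 1) / (e ^ 2 - 1)"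
 proof -
  have "e - inverse e = (e ^ 2 - 1) / e" "e + inverse e = (e ^ 2 + 1) / e"
   using e by (auto simp: field_simps power2_eq_square)
  then show ?thesis using e(1) by simp
 qed
 finally show ?thesis using n unfolding e(2) by (auto simp: field_simps)
qed

text \<open>Differentiating the reflection formula termwise turns the cotangent expansion into the
  Lipschitz formula, in which both sides are sums over a row of a lattice.\<close>

lemma polygamma_reflection:
 assumes "Im z > 0"
 shows "(-1) ^ k * Polygamma k (1 - z) - Polygamma k z =
      (if k = 0 then - of_real pi * \<i> else 0) -
      tpi ^ Suc k * pow_series (%n. if n = 0 then 0 else of_nat n ^ k) (qq z)"
 using assms
proof (induction k arbitrary: z)
 case 0
 then have z: "z \<notin> \<int>" by (auto simp: complex_is_Int_iff)
 have "pow_series (%n. if n = 0 then 0 else of_nat n ^ 0) (qq z) = (\<Sum>n. qq z * qq z ^ n)"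
 proof -
  have "poly_growth (%n. if n = 0 then 0 else 1)"
   by (auto simp: poly_growth_def intro!: exI[of _ 1] exI[of _ "0::nat"])
  from suminf_Suc_eq_pow_series[OF this norm_qq_less_1[OF 0]] show ?thesis by (simp cong: if_cong)
 qed
 also have "\<dots> = qq z / (1 - qq z)"
  using norm_qq_less_1[OF 0] by (simp add: suminf_mult suminf_geometric summable_geometric)
 finally show ?case using digamma_reflection[OF z] cot_nome[OF 0] by simp
next
 case (Suc k)
 define a :: "nat => complex" where "a = (%n. if n = 0 then 0 else of_nat n ^ k)"
 have a: "poly_growth a"
  unfolding poly_growth_def
 proof (intro exI allI)
  show "norm (a n) <= 1 * real (Suc n) ^ k" for n
   using power_mono[of "real n" "real (Suc n)" k] by (simp add: norm_power a_def)
 qed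
 have nz: "z \<notin> \<int>\<^sub>\<le>\<^sub>0" "1 - z \<notin> \<int>\<^sub>\<le>\<^sub>0"
  using Suc.prems by (auto elim!: nonpos_Ints_cases simp: complex_eq_iff)
 have "((%z. (-1) ^ k * Polygamma k (1 - z) - Polygamma k z) has_field_derivative
     (-1) ^ Suc k * Polygamma (Suc k) (1 - z) - Polygamma (Suc k) z) (at z)"
  using nz by (auto intro!: derivative_eq_intros)
 moreover have "((%z. (if k = 0 then - of_real pi * \<i> else 0) -
      tpi ^ Suc k * pow_series a (qq z)) has_field_derivative
      - (tpi ^ Suc k *
        (deriv (pow_series a) (qq z) * (tpi * qq z)))) (at z)"
 proof -
  have "(pow_series a has_field_derivative deriv (pow_series a) (qq z)) (at (qq z))"
   using holomorphic_pow_series[OF a] norm_qq_less_1[OF Suc.prems]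
   by (intro holomorphic_derivI[where S = "ball 0 1"]) auto
  from DERIV_chain2[OF this has_field_derivative_qq] show ?thesis
   by (auto intro!: derivative_eq_intros)
 qed
 then have "((%z. (-1) ^ k * Polygamma k (1 - z) - Polygamma k z) has_field_derivative
      - (tpi ^ Suc k *
        (deriv (pow_series a) (qq z) * (tpi * qq z)))) (at z)"
  by (rule has_field_derivative_transform_within_open[where S = "half_plane 0"])
    (use Suc.IH Suc.prems in \<open>auto simp: a_def\<close>)
 ultimately have "(-1) ^ Suc k * Polygamma (Suc k) (1 - z) - Polygamma (Suc k) z =
   - (tpi ^ Suc (Suc k) * (qq z * deriv (pow_series a) (qq z)))"
  by (auto simp: mult_ac dest: DERIV_unique)
 also have "qq z * deriv (pow_series a) (qq z) = pow_series (%n. of_nat n * a n) (qq z)"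
  by (rule euler_operator_pow_series[OF a norm_qq_less_1[OF Suc.prems]])
 also have "(%n. of_nat n * a n) = (%n. if n = 0 then 0 else of_nat n ^ Suc k)"
  by (auto simp: a_def fun_eq_iff)
 finally show ?case by simp
qed

lemma has_sum_int_iff_split:
 fixes f :: "int => complex"
 assumes "((%n::nat. f (int n)) has_sum a) UNIV" "((%n::nat. f (- int (Suc n))) has_sum b) UNIV"
 shows "(f has_sum (a + b)) UNIV"
proof -
 have "(f has_sum a) {0..}"
  using assms(1) by (subst (asm) has_sum_reindex_bij_witness[where T = "{0..}" and j = int and i = nat and h = f and s' = a]) auto
 moreover have "(f has_sum b) {..<0}"
  using assms(2) by (subst (asm) has_sum_reindex_bij_witness[where T = "{..<0}" and j = "%n. - int (Suc n)"
     and i = "%k. nat (- k - 1)" and h = f and s' = b]) auto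
 ultimately have "(f has_sum (a + b)) ({0..} \<union> {..<0})"
  by (rule has_sum_Un_disjoint) auto
 also have "{0..} \<union> {..<0} = (UNIV :: int set)" by auto
 finally show ?thesis .
qed

lemma lattice_norm_bound:
 assumes "Im t > 0"
 obtains c where "c > 0" "!!x y. norm (of_real x * t + of_real y) >= c * (\<bar>x\<bar> + \<bar>y\<bar>)"
proof
 define d where "d = 1 + (1 + norm t) / Im t"
 have d: "d > 0" using assms by (auto simp: d_def intro!: add_pos_nonneg divide_nonneg_pos)
 then show "1 / d > 0" by simp
 fix x y :: real
 define w where "w = of_real x * t + of_real y"
 have "\<bar>x\<bar> * Im t = \<bar>Im w\<bar>" using assms by (simp add: w_def abs_mult)
 also have "\<dots> <= norm w" by (rule abs_Im_le_cmod)
 finally have x: "\<bar>x\<bar> <= norm w / Im t" using assms by (simp add: field_simps)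
 have "\<bar>y\<bar> = norm (w - of_real x * t)" by (simp add: w_def)
 also have "\<dots> <= norm w + \<bar>x\<bar> * norm t"
  by (metis norm_triangle_ineq4 norm_mult norm_of_real)
 also have "\<dots> <= norm w + norm w / Im t * norm t"
  using x by (intro add_left_mono mult_right_mono) auto
 finally have "\<bar>x\<bar> + \<bar>y\<bar> <= norm w / Im t + (norm w + norm w / Im t * norm t)" using x by linarith
 also have "\<dots> = norm w * d" by (simp add: d_def algebra_simps add_divide_distrib)
 finally have "\<bar>x\<bar> + \<bar>y\<bar> <= norm w * d" .
 then show "1 / d * (\<bar>x\<bar> + \<bar>y\<bar>) <= norm (of_real x * t + of_real y)"
  using d by (simp add: w_def field_simps)
qed

lemma lattice_norm_bound_int:
 assumes "Im t > 0"
 obtains c where "c > 0" "!!m n :: int. norm (of_int m * t + of_int n) >= c * of_int (\<bar>m\<bar> + \<bar>n\<bar>)"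
proof -
 obtain c where c: "c > 0" "!!x y. norm (of_real x * t + of_real y) >= c * (\<bar>x\<bar> + \<bar>y\<bar>)"
  using lattice_norm_bound[OF assms] by blast
 show ?thesis by (rule that[OF c(1)]) (use c(2)[of "of_int _" "of_int _"] in simp)
qed

lemma lattice_nonzero:
 assumes "Im t > 0" "m ~= 0 \<or> n ~= 0"
 shows "of_int m * t + of_int n ~= 0"
proof
 assume 0: "of_int m * t + of_int n = 0"
 from arg_cong[OF this, of Im] assms(1) have "m = 0" by simp
 with 0 assms(2) show False by simp
qed

lemma summable_on_int_powr:
 "(%n::int. (1 + \<bar>of_int n\<bar>) powr (- 3 / 2) :: real) summable_on UNIV"
proof -
 have s: "summable (%n::nat. (1 + real n) powr (- 3 / 2))"
 proof -
  have "summable (%n::nat. real n powr (- 3 / 2))" by (simp add: summable_real_powr_iff)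
  then show ?thesis by (subst (asm) summable_Suc_iff[symmetric]) (simp add: add_ac)
 qed
 have "(%n::nat. (1 + real n) powr (- 3 / 2)) summable_on UNIV"
  using s by (intro summable_nonneg_imp_summable_on) auto
 then have "(%n::int. (1 + \<bar>of_int n\<bar>) powr (- 3 / 2) :: real) summable_on {0..}"
  by (subst (asm) summable_on_reindex_bij_witness[where T = "{0..}" and j = int and i = nat
    and h = "%n. (1 + \<bar>of_int n\<bar>) powr (- 3 / 2)"]) auto
 moreover from \<open>(%n::nat. (1 + real n) powr (- 3 / 2)) summable_on UNIV\<close>
 have "(%n::nat. (1 + real n) powr (- 3 / 2)) summable_on {1..}"
  by (rule summable_on_subset_banach) auto
 then have "(%n::int. (1 + \<bar>of_int n\<bar>) powr (- 3 / 2) :: real) summable_on {..<0}"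
  by (subst (asm) summable_on_reindex_bij_witness[where T = "{..<0}" and j = "%n. - int n" and i = "%k. nat (- k)"
    and h = "%n. (1 + \<bar>of_int n\<bar>) powr (- 3 / 2)"]) auto
 ultimately have "(%n::int. (1 + \<bar>of_int n\<bar>) powr (- 3 / 2) :: real) summable_on ({0..} \<union> {..<0})"
  by (rule summable_on_Un_disjoint) auto
 also have "{0..} \<union> {..<0} = (UNIV :: int set)" by auto
 finally show ?thesis .
qed

text \<open>A majorant for the lattice sums of weight at least 3: by the inequality of means it dominates the third
  power of \<open>1/(\<bar>m\<bar> + \<bar>n\<bar>)\<close> up to a constant, and its sum over the lattice
  factors.\<close>

definition lattice_weight :: "int \<times> int => real" where
 "lattice_weight = (%(m, n). (1 + \<bar>of_int m\<bar>) powr (- 3 / 2) * (1 + \<bar>of_int n\<bar>) powr (- 3 / 2))"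

lemma summable_lattice_weight: "lattice_weight summable_on A"
proof -
 have "(%p. norm (lattice_weight p)) summable_on (UNIV \<times> UNIV)"
  unfolding lattice_weight_def
 proof (rule iffD2[OF Infinite_Sum.abs_summable_on_Sigma_iff], intro conjI ballI)
  fix m :: int
  show "(%n. norm (case (m, n) of (m, n) => (1 + \<bar>of_int m\<bar>) powr (- 3 / 2) * (1 + \<bar>real_of_int n\<bar>) powr (- 3 / 2)))
    summable_on UNIV"
   using summable_on_cmult_right[OF summable_on_int_powr, of "(1 + \<bar>of_int m\<bar>) powr (- 3 / 2)"] by simp
 next
  show "(%x. norm (infsum (%y. norm (case (x, y) of (m, n) => (1 + \<bar>real_of_int m\<bar>) powr (- 3 / 2) *
       (1 + \<bar>real_of_int n\<bar>) powr (- 3 / 2))) UNIV)) summable_on UNIV"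
   using summable_on_cmult_left[OF summable_on_int_powr]
   by (simp add: infsum_cmult_right' abs_mult)
 qed
 then have "lattice_weight summable_on UNIV"
  by (simp add: lattice_weight_def case_prod_unfold)
 then show ?thesis by (rule summable_on_subset_banach) auto
qed

lemma lattice_weight_bound:
 assumes "(m, n) ~= (0, 0)"
 shows "1 / of_int (\<bar>m\<bar> + \<bar>n\<bar>) ^ 3 <= 27 / 8 * lattice_weight (m, n)"
proof -
 define s :: real where "s = of_int (\<bar>m\<bar> + \<bar>n\<bar>)"
 have "\<bar>m\<bar> + \<bar>n\<bar> >= 1" using assms by auto
 then have s: "s >= 1" unfolding s_def by linarith
 define x y :: real where "x = 1 + \<bar>of_int m\<bar>" and "y = 1 + \<bar>of_int n\<bar>"
 have xy: "x >= 1" "y >= 1" "x + y = s + 2" by (auto simp: x_def y_def s_def)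
 have "4 * (x * y) <= (x + y) ^ 2"
  using zero_le_power2[of "x - y"] by (simp add: power2_eq_square algebra_simps)
 also have "\<dots> <= (3 * s) ^ 2" using xy s by (intro power_mono) auto
 finally have "x * y <= (3 / 2 * s) ^ 2" by (simp add: power2_eq_square)
 then have "(x * y) powr (3 / 2) <= ((3 / 2 * s) powr 2) powr (3 / 2)"
  using xy s by (intro powr_mono2) (auto simp: powr_numeral)
 also have "\<dots> = (3 / 2 * s) powr 3" by (simp only: powr_powr) simp
 also have "\<dots> = 27 / 8 * s ^ 3"
  using s by (simp add: powr_numeral power_mult_distrib power3_eq_cube)
 finally have le: "(x * y) powr (3 / 2) <= 27 / 8 * s ^ 3" .
 have "lattice_weight (m, n) = 1 / (x * y) powr (3 / 2)"
  using xy by (simp add: lattice_weight_def x_def y_def powr_mult powr_minus divide_simps)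
 also have "27 / 8 * (1 / (x * y) powr (3 / 2)) >= 27 / 8 * (1 / (27 / 8 * s ^ 3))"
  using le xy s by (intro mult_left_mono divide_left_mono) auto
 finally show ?thesis by (simp add: s_def)
qed

lemma abs_summable_eisenstein:
 assumes "Im t > 0" "k >= 3"
 shows "(%(m, n). 1 / (of_int m * t + of_int n) ^ k) summable_on (A :: (int \<times> int) set)"
proof -
 obtain c where c: "c > 0" "!!m n :: int. norm (of_int m * t + of_int n) >= c * of_int (\<bar>m\<bar> + \<bar>n\<bar>)"
  using lattice_norm_bound_int[OF assms(1)] by blast
 have "(%p. norm (case p of (m, n) => 1 / (of_int m * t + of_int n) ^ k)) summable_on A"
 proof (rule summable_on_comparison_test)
  show "(%p. 27 / 8 * (1 / c ^ k) * lattice_weight p) summable_on A"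
   by (intro summable_on_cmult_right summable_lattice_weight)
  fix p :: "int \<times> int"
  obtain m n where p: "p = (m, n)" by force
  show "norm (case p of (m, n) => 1 / (of_int m * t + of_int n) ^ k) <= 27 / 8 * (1 / c ^ k) * lattice_weight p"
  proof (cases "p = (0, 0)")
   case True
   then show ?thesis using assms(2) c(1) by (simp add: lattice_weight_def power_0_left)
  next
   case False
   define s :: real where "s = of_int (\<bar>m\<bar> + \<bar>n\<bar>)"
   have "\<bar>m\<bar> + \<bar>n\<bar> >= 1" using False by (auto simp: p)
   then have s: "s >= 1" unfolding s_def by linarith
   have "norm (1 / (of_int m * t + of_int n) ^ k) <= 1 / (c * s) ^ k"
    unfolding norm_divide norm_power norm_one s_def
    using c s lattice_nonzero[OF assms(1), of m n] False
    by (intro divide_left_mono power_mono mult_pos_pos zero_less_power) (auto simp: s_def p)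
   also have "\<dots> = 1 / c ^ k * (1 / s ^ k)" by (simp add: power_mult_distrib)
   also have "\<dots> <= 1 / c ^ k * (1 / s ^ 3)"
    using s c assms(2) by (intro mult_left_mono divide_left_mono power_increasing) auto
   also have "\<dots> <= 1 / c ^ k * (27 / 8 * lattice_weight (m, n))"
    using lattice_weight_bound[of m n] False c(1) by (intro mult_left_mono) (auto simp: p s_def)
   finally show ?thesis by (simp add: p)
  qed
 qed auto
 then show ?thesis by (rule abs_summable_summable)
qed

text \<open>The two sides of the Lipschitz formula: \<open>row_sum\<close> is the nome side of the sum of \<open>(w +
  n)\<^sup>-\<^sup>k\<close> over the integers \<open>n\<close>.\<close>

definition row_sum :: "nat => complex => complex" where
 "row_sum k w = (- 2 * of_real pi * \<i>) ^ k / fact (k - 1) *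
   pow_series (%n. of_nat n ^ (k - 1)) (qq w)"

lemma lipschitz_formula:
 assumes w: "Im w > 0" and k: "k >= 2"
 shows "((%n::int. 1 / (w + of_int n) ^ k) has_sum row_sum k w) UNIV"
proof -
 obtain c where c: "c > 0" "!!m n :: int. norm (of_int m * w + of_int n) >= c * of_int (\<bar>m\<bar> + \<bar>n\<bar>)"
  using lattice_norm_bound_int[OF w] by blast
 have bound: "norm (1 / (w + of_int n) ^ k) <= 1 / c ^ k * (1 / real_of_int (1 + \<bar>n\<bar>) ^ 2)" for n :: int
 proof -
  have "norm (1 / (w + of_int n) ^ k) <= 1 / (c * of_int (1 + \<bar>n\<bar>)) ^ k"
   unfolding norm_divide norm_power norm_one
   using c c(2)[of 1 n] lattice_nonzero[OF w, of 1 n]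
   by (intro divide_left_mono power_mono mult_pos_pos zero_less_power) auto
  also have "\<dots> = 1 / c ^ k * (1 / of_int (1 + \<bar>n\<bar>) ^ k)" by (simp add: power_mult_distrib)
  also have "\<dots> <= 1 / c ^ k * (1 / of_int (1 + \<bar>n\<bar>) ^ 2)"
   using c k by (intro mult_left_mono divide_left_mono power_increasing) auto
  finally show ?thesis .
 qed
 have s0: "summable (%n. 1 / c ^ k * (1 / real (Suc n) ^ 2))"
 proof (rule summable_mult)
  have "summable (%n. inverse (real n ^ 2))" by (rule inverse_power_summable) simp
  then show "summable (%n. 1 / real (Suc n) ^ 2)"
   by (subst (asm) summable_Suc_iff[symmetric]) (simp add: divide_inverse)
 qed
 have s1: "summable (%n::nat. norm (1 / (w + of_int (int n)) ^ k))"
  by (rule summable_comparison_test'[OF s0, of 0]) (use bound[of "int _"] in \<open>auto simp: add_ac\<close>)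
 have s2: "summable (%n::nat. norm (1 / (w + of_int (- int (Suc n))) ^ k))"
 proof (rule summable_comparison_test'[OF s0, of 0])
  fix n :: nat
  have "1 / c ^ k * (1 / real_of_int (1 + \<bar>- int (Suc n)\<bar>) ^ 2) <= 1 / c ^ k * (1 / real (Suc n) ^ 2)"
   using c(1) by (intro mult_left_mono divide_left_mono power_mono) auto
  with bound[of "- int (Suc n)"]
  show "norm (norm (1 / (w + of_int (- int (Suc n))) ^ k)) <= 1 / c ^ k * (1 / real (Suc n) ^ 2)"
   by simp
 qed
 define a b where "a = (\<Sum>n. 1 / (w + of_int (int n)) ^ k)" and "b = (\<Sum>n. 1 / (w + of_int (- int (Suc n))) ^ k)"
 have "((%n::int. 1 / (w + of_int n) ^ k) has_sum (a + b)) UNIV"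
  unfolding a_def b_def
  by (intro has_sum_int_iff_split norm_summable_imp_has_sum s1 s2 summable_sums summable_norm_cancel[OF s1]
    summable_norm_cancel[OF s2])
 moreover have "a + b = row_sum k w"
 proof -
  obtain j where j: "k = Suc j" "j >= 1" using k by (cases k) auto
  have pa: "Polygamma j w = (-1) ^ Suc j * fact j * a"
   using j by (simp add: Polygamma_def a_def divide_inverse)
  have shift: "1 / (w + of_int (- int (Suc n))) ^ Suc j = (-1) ^ Suc j * inverse ((1 - w + of_nat n) ^ Suc j)" for n
  proof -
   have "w + of_int (- int (Suc n)) = - (1 - w + of_nat n)" by simp
   then have "(w + of_int (- int (Suc n))) ^ Suc j = (-1) ^ Suc j * (1 - w + of_nat n) ^ Suc j"
    by (metis power_minus)
   moreover have "inverse ((-1) ^ Suc j) = ((-1) ^ Suc j :: complex)"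
    by (simp only: power_inverse [symmetric] inverse_minus_eq inverse_1)
   ultimately show ?thesis by (simp only: divide_inverse inverse_mult_distrib mult_1_left)
  qed
  have "b = (\<Sum>n. (-1) ^ Suc j * inverse ((1 - w + of_nat n) ^ Suc j))"
   unfolding b_def j(1) shift ..
  also have "\<dots> = (-1) ^ Suc j * (\<Sum>n. inverse ((1 - w + of_nat n) ^ Suc j))"
  proof (rule suminf_mult)
   have "summable (%n. (-1) ^ Suc j * (1 / (w + of_int (- int (Suc n))) ^ k))"
    by (rule summable_mult[OF summable_norm_cancel[OF s2]])
   also have "(%n. (-1) ^ Suc j * (1 / (w + of_int (- int (Suc n))) ^ k)) =
     (%n. inverse ((1 - w + of_nat n) ^ Suc j))"
    unfolding j(1) shift mult.assoc [symmetric] power_mult_distrib [symmetric] by simp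
   finally show "summable (%n. inverse ((1 - w + of_nat n) ^ Suc j))" .
  qed
  finally have pb: "Polygamma j (1 - w) = fact j * b"
   using j by (simp add: Polygamma_def mult_ac)
  have "(-1) ^ j * Polygamma j (1 - w) - Polygamma j w = (-1) ^ j * fact j * (a + b)"
   unfolding pa pb by (simp add: algebra_simps)
  also have "(-1) ^ j * Polygamma j (1 - w) - Polygamma j w =
    - (tpi ^ Suc j * pow_series (%n. of_nat n ^ j) (qq w))"
  proof -
   have "(%n. if n = 0 then 0 else of_nat n ^ j) = (%n. of_nat n ^ j :: complex)"
    using j(2) by (auto simp: fun_eq_iff)
   then show ?thesis using polygamma_reflection[OF w, of j] j(2) by simp
  qed
  finally have eq: "- (tpi ^ Suc j * pow_series (%n. of_nat n ^ j) (qq w)) =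
    (-1) ^ j * fact j * (a + b)" .
  have "(-1) ^ j * ((-1) ^ j * fact j * (a + b)) =
    (-1) ^ Suc j * tpi ^ Suc j * pow_series (%n. of_nat n ^ j) (qq w)"
   unfolding eq [symmetric] by simp
  also have "(-1) ^ Suc j * tpi ^ Suc j = (- 2 * of_real pi * \<i>) ^ Suc j"
   unfolding power_mult_distrib [symmetric] by simp
  also have "(-1) ^ j * ((-1) ^ j * fact j * (a + b)) = fact j * (a + b)"
   by (simp add: mult.assoc [symmetric] flip: power_mult_distrib)
  finally show ?thesis by (simp add: row_sum_def j(1) field_simps del: power_Suc)
 qed
 ultimately show ?thesis by simp
qed

text \<open>Summing over all factorisations \<open>n = m d\<close> turns the double series into divisor sums; absolute
  convergence permits the rearrangement.\<close>

lemma lambert_double_series: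
 assumes x: "norm (x :: complex) < 1"
 shows "((%(m, d). of_nat d ^ Suc j * x ^ (m * d)) has_sum
      pow_series (%n. of_nat (sigma_pow (Suc j) n)) x) ({1..} \<times> {1..})"
proof -
 define f :: "nat \<times> nat => complex" where "f = (%(m, d). of_nat d ^ Suc j * x ^ (m * d))"
 define g :: "nat \<times> nat => complex" where "g = (%(n, d). of_nat d ^ Suc j * x ^ n)"
 have inner: "((%d. g (n, d)) has_sum (of_nat (sigma_pow (Suc j) n) * x ^ n)) {d. d dvd n}" if "n \<in> {1..}" for n
  using that by (intro has_sum_finiteI) (auto simp: g_def sigma_pow_def sum_distrib_right)
 have outer_abs: "summable (%n. norm (of_nat (sigma_pow (Suc j) n) * x ^ n))"
  by (rule poly_growth_abs_summable[OF poly_growth_sigma x])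
 have outer: "((%n. of_nat (sigma_pow (Suc j) n) * x ^ n) has_sum
   pow_series (%n. of_nat (sigma_pow (Suc j) n)) x) {1..}"
 proof -
  have "((%n. of_nat (sigma_pow (Suc j) n) * x ^ n) has_sum
   pow_series (%n. of_nat (sigma_pow (Suc j) n)) x) UNIV"
   unfolding pow_series_def
   by (rule norm_summable_imp_has_sum[OF outer_abs summable_sums])
     (rule poly_growth_summable[OF poly_growth_sigma x])
  then show ?thesis by (rule has_sum_cong_neutral[THEN iffD1, rotated -1]) (auto simp: not_less_eq_eq)
 qed
 have "g summable_on Sigma {1..} (%n. {d. d dvd n})"
 proof (rule abs_summable_summable, rule iffD2[OF Infinite_Sum.abs_summable_on_Sigma_iff], intro conjI ballI)
  fix n :: nat assume "n \<in> {1..}"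
  then show "(%d. norm (g (n, d))) summable_on {d. d dvd n}"
   by (intro summable_on_finite) auto
 next
  have "summable (%n. norm (of_nat (sigma_pow (Suc j) n) * x ^ n))" by (rule outer_abs)
  then have "(%n. norm (of_nat (sigma_pow (Suc j) n) * x ^ n)) summable_on {1..}"
   by (intro summable_on_subset_banach[OF summable_nonneg_imp_summable_on]) auto
  also have "?this \<longleftrightarrow> (%n. norm (infsum (%d. norm (g (n, d))) {d. d dvd n})) summable_on {1..}"
  proof (rule summable_on_cong)
   fix n :: nat assume "n \<in> {1..}"
   then have "infsum (%d. norm (g (n, d))) {d. d dvd n} = (\<Sum>d | d dvd n. real d ^ Suc j * norm x ^ n)"
    by (subst infsum_finite) (auto simp: g_def norm_mult norm_power)
   also have "\<dots> = real (sigma_pow (Suc j) n) * norm x ^ n"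
    by (simp add: sigma_pow_def sum_distrib_right del: power_Suc)
   finally show "norm (of_nat (sigma_pow (Suc j) n) * x ^ n) = norm (infsum (%d. norm (g (n, d))) {d. d dvd n})"
    by (simp add: norm_mult norm_power)
  qed
  finally show "(%n. norm (infsum (%d. norm (g (n, d))) {d. d dvd n})) summable_on {1..}" .
 qed
 then have "(g has_sum pow_series (%n. of_nat (sigma_pow (Suc j) n)) x) (Sigma {1..} (%n. {d. d dvd n}))"
  by (intro has_sum_SigmaI[where g = "%n. of_nat (sigma_pow (Suc j) n) * x ^ n"] inner outer)
 also have "?this \<longleftrightarrow> (f has_sum pow_series (%n. of_nat (sigma_pow (Suc j) n)) x) ({1..} \<times> {1..})"
  by (rule has_sum_reindex_bij_witness[where j = "%(n, d). (n div d, d)" and i = "%(m, d). (m * d, d)"])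
    (auto simp: f_def g_def mult.commute elim!: dvdE)
 finally show ?thesis unfolding f_def .
qed

lemma lambert_series:
 assumes x: "norm (x :: complex) < 1"
 shows "((%m::nat. pow_series (%n. of_nat n ^ Suc j) (x ^ m)) has_sum
      pow_series (%n. of_nat (sigma_pow (Suc j) n)) x) {1..}"
proof (rule has_sum_SigmaD[OF lambert_double_series[OF x]])
 fix m :: nat assume m: "m \<in> {1..}"
 have xm: "norm (x ^ m) < 1"
  using x m by (simp add: norm_power power_less_one_iff)
 have "((%d. of_nat d ^ Suc j * (x ^ m) ^ d) has_sum pow_series (%n. of_nat n ^ Suc j) (x ^ m)) UNIV"
  unfolding pow_series_def
  by (rule norm_summable_imp_has_sum[OF poly_growth_abs_summable summable_sums])
    (intro poly_growth_power poly_growth_summable xm)+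
 then have "((%d. of_nat d ^ Suc j * (x ^ m) ^ d) has_sum pow_series (%n. of_nat n ^ Suc j) (x ^ m)) {1..}"
  by (rule has_sum_cong_neutral[THEN iffD1, rotated -1]) (auto simp: not_less_eq_eq)
 then show "((%y. case (m, y) of (m, d) => of_nat d ^ Suc j * x ^ (m * d)) has_sum pow_series (%n. of_nat n ^ Suc j) (x ^ m)) {1..}"
  by (simp add: power_mult del: power_Suc)
qed

lemma has_sum_row_sums:
 assumes "Im t > 0" "k >= 2"
 shows "((%m::nat. row_sum k (of_nat m * t)) has_sum
   (- 2 * of_real pi * \<i>) ^ k / fact (k - 1) * pow_series (%n. of_nat (sigma_pow (k - 1) n)) (qq t)) {1..}"
proof -
 obtain j where j: "k = Suc (Suc j)" using assms(2) by (metis Suc_le_D numeral_2_eq_2 Suc_le_mono)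
 show ?thesis
  unfolding row_sum_def qq_mult_nat
  using lambert_series[OF norm_qq_less_1[OF assms(1)], of j]
  by (intro has_sum_cmult_right) (simp add: j del: power_Suc)
qed

lemma has_sum_nonzero_int_even:
 fixes f :: "int => complex"
 assumes "((%m::nat. f (int m)) has_sum a) {1..}" "!!m. f (- m) = f m"
 shows "(f has_sum (2 * a)) (- {0})"
proof -
 have "(f has_sum a) {1..}"
  using assms(1) by (subst (asm) has_sum_reindex_bij_witness[where T = "{1..}" and j = int and i = nat and h = f and s' = a]) auto
 moreover have "(f has_sum a) {..-1}"
  using assms(1) by (subst (asm) has_sum_reindex_bij_witness[where T = "{..-1}" and j = "%n. - int n" and i = "%k. nat (- k)"
    and h = f and s' = a]) (auto simp: assms(2))
 ultimately have "(f has_sum (a + a)) ({1..} \<union> {..-1})"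
  by (rule has_sum_Un_disjoint) auto
 also have "{1..} \<union> {..-1} = - {0 :: int}" by auto
 finally show ?thesis by simp
qed

lemma row_has_sum_neg:
 assumes k: "even k" "k >= 2" and w: "Im w < 0"
 shows "((%n::int. 1 / (w + of_int n) ^ k) has_sum row_sum k (- w)) UNIV"
proof -
 have "((%n::int. 1 / (- w + of_int n) ^ k) has_sum row_sum k (- w)) UNIV"
  using lipschitz_formula[of "- w" k] w k(2) by simp
 also have "?this \<longleftrightarrow> ?thesis"
 proof (rule has_sum_reindex_bij_witness[where i = uminus and j = uminus])
  fix n :: int
  have "(w + of_int (- n)) ^ k = (- (- w + of_int n)) ^ k" by simp
  then show "1 / (w + of_int (- n)) ^ k = 1 / (- w + of_int n) ^ k"
   using k(1) by (simp only: power_minus_even)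
 qed auto
 finally show ?thesis .
qed

text \<open>In weight at least 3 the lattice sum converges absolutely, so that inverting \<open>t\<close> merely
  permutes the lattice points.\<close>

theorem eisenstein_inversion:
 assumes k: "even k" "k >= 3"
 shows "\<exists>c. \<forall>t. Im t > 0 \<longrightarrow>
   c + pow_series (%n. of_nat (sigma_pow (k - 1) n)) (qq (- 1 / t)) =
   t ^ k * (c + pow_series (%n. of_nat (sigma_pow (k - 1) n)) (qq t))"
proof -
 define A :: complex where "A = (- 2 * of_real pi * \<i>) ^ k / fact (k - 1)"
 have A: "A ~= 0" by (simp add: A_def)
 define S where "S t = pow_series (%n. of_nat (sigma_pow (k - 1) n)) (qq t)" for t
 define f where "f t = (%(m, n). 1 / (of_int m * t + of_int n) ^ k)" for t :: complex
 define c0 :: complex where "c0 = infsum (%n::int. 1 / of_int n ^ k) UNIV"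
 have expansion: "infsum (f t) UNIV = c0 + 2 * (A * S t)" if t: "Im t > 0" for t
 proof -
  define row where "row m = (if m = 0 then c0 else row_sum k (of_int \<bar>m\<bar> * t))" for m :: int
  have summ: "f t summable_on B" for B
   unfolding f_def by (rule abs_summable_eisenstein[OF t k(2)])
  have total: "(f t has_sum infsum (f t) UNIV) (UNIV \<times> UNIV)"
   using has_sum_infsum[OF summ[of UNIV]] by simp
  have rows: "((%n. f t (m, n)) has_sum row m) UNIV" for m
  proof (cases m "0 :: int" rule: linorder_cases)
   case equal
   have "f t summable_on (UNIV \<times> UNIV)" by (rule summ)
   then have "(%n. f t (0, n)) summable_on UNIV"
    using summable_on_SigmaD1[of "%m n. f t (m, n)" UNIV "%_. UNIV" 0] by simp
   then show ?thesis using equal by (simp add: row_def c0_def f_def)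
  next
   case greater
   then have "Im (of_int m * t) > 0" using t by simp
   from lipschitz_formula[OF this, of k] k show ?thesis
    using greater by (simp add: row_def f_def)
  next
   case less
   then have "Im (of_int m * t) < 0" using t by (simp add: mult_neg_pos)
   from row_has_sum_neg[OF k(1) _ this] k show ?thesis
    using less by (simp add: row_def f_def)
  qed
  have "(row has_sum infsum (f t) UNIV) UNIV"
   using has_sum_SigmaD[OF total, of row] rows by simp
  moreover have "(row has_sum (c0 + 2 * (A * S t))) UNIV"
  proof -
   have "((%m::nat. row (int m)) has_sum (A * S t)) {1..}"
    using has_sum_row_sums[OF t, of k] k
    by (rule_tac has_sum_cong[THEN iffD1, rotated]) (auto simp: row_def A_def S_def)
   then have "(row has_sum (2 * (A * S t))) (- {0})"
    by (rule has_sum_nonzero_int_even) (simp add: row_def)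
   from has_sum_insert[OF _ this, of 0] have "(row has_sum (c0 + 2 * (A * S t))) (insert 0 (- {0}))"
    by (simp add: row_def)
   also have "insert 0 (- {0 :: int}) = UNIV" by auto
   finally show ?thesis .
  qed
  ultimately show ?thesis by (rule has_sum_unique)
 qed
 have inversion: "infsum (f (- 1 / t)) UNIV = t ^ k * infsum (f t) UNIV" if t: "Im t > 0" for t
 proof -
  have t0: "t ~= 0" using t by auto
  have "infsum (f (- 1 / t)) UNIV = infsum (%p. t ^ k * f t p) UNIV"
  proof (rule infsum_reindex_bij_witness[where i = "%(m, n). (- n, m)" and j = "%(m, n). (n, - m)"])
   fix p :: "int \<times> int"
   obtain m n where p: "p = (m, n)" by force
   have "of_int m * (- 1 / t) + of_int n = (of_int n * t + of_int (- m)) / t"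
    using t0 by (simp add: field_simps)
   then show "t ^ k * f t (case p of (m, n) => (n, - m)) = f (- 1 / t) p"
    by (simp only: p f_def prod.case power_divide) (simp add: divide_inverse)
  qed auto
  also have "\<dots> = t ^ k * infsum (f t) UNIV" by (rule infsum_cmult_right')
  finally show ?thesis .
 qed
 have "c0 / (2 * A) + S (- 1 / t) = t ^ k * (c0 / (2 * A) + S t)" if t: "Im t > 0" for t
 proof -
  have t': "Im (- 1 / t) > 0" using t by (simp add: Im_divide field_simps sum_power2_gt_zero_iff)
  have "c0 + 2 * (A * S (- 1 / t)) = t ^ k * (c0 + 2 * (A * S t))"
   using inversion[OF t] expansion[OF t] expansion[OF t'] by simp
  then have "(c0 + 2 * (A * S (- 1 / t))) / (2 * A) = t ^ k * (c0 + 2 * (A * S t)) / (2 * A)" by simp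
  then show ?thesis using A by (simp add: add_divide_distrib ring_distribs)
 qed
 then show ?thesis unfolding S_def by blast
qed

lemma has_sum_neg:
 fixes f :: "'a => 'b :: real_normed_vector"
 shows "(f has_sum a) A ==> ((%x. - f x) has_sum (- a)) A"
 by (simp add: has_sum_uminus)

lemma has_sum_finite_sum:
 fixes f :: "'i => 'a => 'b :: real_normed_vector"
 assumes "finite F" "!!i. i \<in> F ==> (f i has_sum s i) A"
 shows "((%x. \<Sum>i\<in>F. f i x) has_sum (\<Sum>i\<in>F. s i)) A"
 using assms by (induction F rule: finite_induct) (auto intro!: has_sum_add)

text \<open>A sum over the integers is the limit of its symmetric partial sums, which lets the telescoping rows be
  evaluated.\<close>

lemma has_sum_int_symmetric_limit:
 fixes f :: "int => complex"
 assumes "(f has_sum a) UNIV"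
 shows "(%N::nat. \<Sum>n\<in>{- int N..<int N}. f n) \<longlonglongrightarrow> a"
proof -
 have "filterlim (%N::nat. {- int N..<int N}) (finite_subsets_at_top UNIV) sequentially"
  unfolding filterlim_finite_subsets_at_top
 proof (intro allI impI)
  fix X :: "int set" assume X: "finite X \<and> X \<subseteq> UNIV"
  define M where "M = nat (Max (insert 0 (abs ` X))) + 1"
  have "X \<subseteq> {- int N..<int N}" if "N >= M" for N
  proof
   fix x assume "x \<in> X"
   then have "\<bar>x\<bar> <= Max (insert 0 (abs ` X))" using X by (intro Max_ge) auto
   then show "x \<in> {- int N..<int N}" using that by (auto simp: M_def)
  qed
  then show "\<forall>\<^sub>F N in sequentially. finite {- int N..<int N} \<and> X \<subseteq> {- int N..<int N} \<and> {- int N..<int N} \<subseteq> UNIV"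
   by (auto simp: eventually_sequentially intro!: exI[of _ M])
 qed
 with assms show ?thesis
  unfolding has_sum_def by (rule filterlim_compose)
qed

lemma sum_int_telescope:
 fixes h :: "int => complex"
 shows "(\<Sum>n\<in>{- int N..<int N}. h n - h (n + 1)) = h (- int N) - h (int N)"
proof (induction N)
 case (Suc N)
 have "{- int (Suc N)..<int (Suc N)} = insert (- int (Suc N)) (insert (int N) {- int N..<int N})" by auto
 then show ?case using Suc by (simp add: add.commute)
qed simp

lemma tendsto_inverse_linear:
 fixes w :: complex
 shows "(%N::nat. 1 / (w + of_nat N)) \<longlonglongrightarrow> 0" "(%N::nat. 1 / (w - of_nat N)) \<longlonglongrightarrow> 0"
proof -
 have "filterlim (%N::nat. of_nat N + w) at_infinity sequentially"
  by (rule tendsto_add_filterlim_at_infinity'[OF tendsto_of_nat tendsto_const])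
 from tendsto_inverse_0[THEN filterlim_compose, OF this]
 show "(%N::nat. 1 / (w + of_nat N)) \<longlonglongrightarrow> 0" by (simp add: divide_inverse add.commute)
 have "filterlim (%N::nat. of_nat N + (- w)) at_infinity sequentially"
  by (rule tendsto_add_filterlim_at_infinity'[OF tendsto_of_nat tendsto_const])
 from tendsto_minus[OF tendsto_inverse_0[THEN filterlim_compose, OF this]]
 show "(%N::nat. 1 / (w - of_nat N)) \<longlonglongrightarrow> 0"
  by (simp add: divide_inverse flip: inverse_minus_eq)
qed

lemma summable_on_nonzero_cubic:
 assumes "Im t > 0"
 shows "(%(m, n). 1 / ((of_int m * t + of_int n) ^ 2 * (of_int m * t + of_int (n + 1)))) summable_on
      ((- {0}) \<times> (UNIV :: int set))"
proof -
 obtain c where c: "c > 0" "!!m n :: int. norm (of_int m * t + of_int n) >= c * of_int (\<bar>m\<bar> + \<bar>n\<bar>)"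
  using lattice_norm_bound_int[OF assms(1)] by blast
 have "(%p. norm (case p of (m, n) => 1 / ((of_int m * t + of_int n) ^ 2 * (of_int m * t + of_int (n + 1)))))
     summable_on ((- {0}) \<times> UNIV)"
 proof (rule summable_on_comparison_test)
  show "(%p. 2 / c ^ 3 * (27 / 8) * lattice_weight p) summable_on ((- {0}) \<times> UNIV)"
   by (intro summable_on_cmult_right summable_lattice_weight)
  fix p :: "int \<times> int" assume "p \<in> (- {0}) \<times> UNIV"
  then obtain m n where p: "p = (m, n)" "m ~= 0" by (cases p) auto
  define s :: real where "s = of_int (\<bar>m\<bar> + \<bar>n\<bar>)"
  have "\<bar>m\<bar> + \<bar>n\<bar> >= 1" using p by auto
  then have s: "s >= 1" unfolding s_def by linarith
  have "\<bar>m\<bar> + \<bar>n\<bar> <= 2 * (\<bar>m\<bar> + \<bar>n + 1\<bar>)"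
  proof -
   have "\<bar>n\<bar> <= \<bar>n + 1\<bar> + 1" "\<bar>m\<bar> >= 1" "\<bar>n + 1\<bar> >= 0" using p by auto
   moreover have "a + b <= 2 * (a + d)" if "b <= d + 1" "1 <= a" "0 <= d" for a b d :: int
    using that by presburger
   ultimately show ?thesis by blast
  qed
  then have "s <= 2 * real_of_int (\<bar>m\<bar> + \<bar>n + 1\<bar>)" unfolding s_def by linarith
  then have "c * (s / 2) <= c * of_int (\<bar>m\<bar> + \<bar>n + 1\<bar>)" using c by (intro mult_left_mono) auto
  also have "\<dots> <= norm (of_int m * t + of_int (n + 1))" by (rule c(2))
  finally have b2: "c * s / 2 <= norm (of_int m * t + of_int (n + 1))" by simp
  have b1: "c * s <= norm (of_int m * t + of_int n)" using c(2)[of m n] by (simp add: s_def)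
  have cs: "c * s > 0" "\<not> c * s <= 0" using c s by (simp_all add: not_le)
  have "norm (1 / ((of_int m * t + of_int n) ^ 2 * (of_int m * t + of_int (n + 1)))) <= 1 / ((c * s) ^ 2 * (c * s / 2))"
   unfolding norm_divide norm_power norm_mult norm_one
   using b1 b2 cs c(1) s by (intro divide_left_mono mult_mono power_mono mult_pos_pos zero_less_power) auto
  also have "\<dots> = 2 / c ^ 3 * (1 / s ^ 3)" by (simp add: power2_eq_square power3_eq_cube)
  also have "\<dots> <= 2 / c ^ 3 * (27 / 8 * lattice_weight (m, n))"
   using lattice_weight_bound[of m n] p c(1) by (intro mult_left_mono) (auto simp: s_def)
  finally show "norm (case p of (m, n) => 1 / ((of_int m * t + of_int n) ^ 2 * (of_int m * t + of_int (n + 1))))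
    <= 2 / c ^ 3 * (27 / 8) * lattice_weight p" by (simp add: p)
 qed auto
 then show ?thesis by (rule abs_summable_summable)
qed

lemma E2_eq_pow_series:
 "Im z > 0 ==> E2 z = 1 - 24 * pow_series (%n. of_nat (sigma_pow 1 n)) (qq z)"
 unfolding E2_def
 by (subst suminf_Suc_eq_pow_series[OF poly_growth_sigma norm_qq_less_1]) auto

text \<open>The correction term in the transformation law of \<open>E\<^sub>2\<close> is the difference between the two
  orders of summation of a telescoping double series; the partial fractions of the cotangent
  evaluate it.\<close>

lemma has_sum_telescoping_column:
 assumes t: "Im t > 0" and N: "N > 0"
 shows "((%m. 1 / (of_int m * t - of_nat N) - 1 / (of_int m * t + of_nat N)) has_sum
      2 / t * (t / of_nat N + of_real pi * cot (of_real pi * (of_nat N * (- 1 / t))))) (- {0})"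
  (is "(?f has_sum 2 / t * ?v) _")
proof -
 have t0: "t ~= 0" using t by auto
 define z where "z = of_nat N / t"
 have Imz: "Im z < 0" using t N by (simp add: z_def Im_divide sum_power2_gt_zero_iff mult_pos_pos divide_neg_pos)
 have nz: "1 + z ~= 0" "1 - z ~= 0" "z ~= 0" using Imz by (auto simp: complex_eq_iff)
 have zn: "z \<notin> \<int>" using Imz by (auto simp: complex_is_Int_iff)
 have summ: "summable (%n. inverse (of_nat (Suc n)) - inverse ((1 - z) + of_nat n))"
    "summable (%n. inverse (of_nat (Suc n)) - inverse ((1 + z) + of_nat n))"
  using nz by (auto intro!: summable_Digamma simp del: of_nat_Suc)
 have "(%n. (inverse (of_nat (Suc n)) - inverse ((1 + z) + of_nat n)) - (inverse (of_nat (Suc n)) - inverse ((1 - z) + of_nat n)))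
   sums (Digamma (1 + z) - Digamma (1 - z))"
  using sums_diff[OF summable_sums[OF summ(2)] summable_sums[OF summ(1)]]
  by (simp add: Digamma_def)
 then have sums: "(%n. 1 / (of_nat (Suc n) - z) - 1 / (of_nat (Suc n) + z)) sums (Digamma (1 + z) - Digamma (1 - z))"
  by (simp add: divide_inverse algebra_simps)
 have val: "Digamma (1 + z) - Digamma (1 - z) = ?v"
 proof -
  have "Digamma (1 + z) = Digamma z + 1 / z" using Digamma_plus1[of z] nz by (simp add: add.commute)
  then have "Digamma (1 + z) - Digamma (1 - z) = 1 / z - of_real pi * cot (of_real pi * z)"
   using digamma_reflection[OF zn] by (simp add: algebra_simps)
  also have "cot (of_real pi * z) = - cot (of_real pi * (of_nat N * (- 1 / t)))"
   by (simp add: z_def cot_def)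
  finally show ?thesis using t0 N by (simp add: z_def)
 qed
 have "((%m::nat. ?f (int m)) has_sum (?v / t)) {1..}"
 proof -
  obtain c where c: "c > 0" "!!m n :: int. norm (of_int m * t + of_int n) >= c * of_int (\<bar>m\<bar> + \<bar>n\<bar>)"
   using lattice_norm_bound_int[OF t] by blast
  have eq: "?f (int (Suc m)) = 1 / t * (1 / (of_nat (Suc m) - z) - 1 / (of_nat (Suc m) + z))" for m
   using t0 by (simp add: z_def right_diff_distrib diff_divide_eq_iff divide_diff_eq_iff add_divide_eq_iff mult.commute del: of_nat_Suc)
  have bound: "norm (?f (int (Suc m))) <= 2 * of_nat N / c ^ 2 * (1 / real (Suc m) ^ 2)" for m
  proof -
   let ?a = "of_int (int (Suc m)) * t + of_int (- int N)" and ?b = "of_int (int (Suc m)) * t + of_int (int N)"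
   have ab: "?a ~= 0" "?b ~= 0" by (intro lattice_nonzero[OF t]; simp)+
   have "?f (int (Suc m)) = 2 * of_nat N / (?a * ?b)" using ab by (simp add: field_simps)
   moreover have "norm \<dots> <= 2 * of_nat N / ((c * real (Suc m)) * (c * real (Suc m)))"
   proof -
    have "c * real (Suc m) <= c * of_int (\<bar>int (Suc m)\<bar> + \<bar>- int N\<bar>)" using c(1) by (intro mult_left_mono) auto
    also have "\<dots> <= norm ?a" by (rule c(2))
    finally have "c * real (Suc m) <= norm ?a" .
    moreover have "c * real (Suc m) <= c * of_int (\<bar>int (Suc m)\<bar> + \<bar>int N\<bar>)" using c(1) by (intro mult_left_mono) auto
    then have "c * real (Suc m) <= norm ?b" using c(2)[of "int (Suc m)" "int N"] by linarith
    ultimately show ?thesis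
     using ab c(1) unfolding norm_divide norm_mult
     by (intro frac_le mult_mono) auto
   qed
   ultimately show ?thesis by (simp add: power2_eq_square mult_ac)
  qed
  have "summable (%n. inverse (real n ^ 2))" by (rule inverse_power_summable) simp
  then have s0: "summable (%m. 2 * of_nat N / c ^ 2 * (1 / real (Suc m) ^ 2))"
   by (subst (asm) summable_Suc_iff[symmetric]) (intro summable_mult, simp add: divide_inverse)
  have s1: "summable (%m. norm (?f (int (Suc m))))"
   by (rule summable_comparison_test'[OF s0, of 0]) (use bound in auto)
  have "((%m. ?f (int (Suc m))) has_sum (1 / t * ?v)) UNIV"
   by (rule norm_summable_imp_has_sum[OF s1]) (unfold eq, rule sums_mult, use sums val in simp)
  then show ?thesis
   by (subst (asm) has_sum_reindex_bij_witness[where T = "{1..}" and j = Suc and i = "%n. n - 1"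
      and h = "%m. ?f (int m)" and s' = "1 / t * ?v"]) auto
 qed
 from has_sum_nonzero_int_even[OF this] show ?thesis
 proof (rule back_subst[of "%x. (?f has_sum x) (- {0})"])
  fix m :: int
  have "of_int (- m) * t - of_nat N = - (of_int m * t + of_nat N)"
     "of_int (- m) * t + of_nat N = - (of_int m * t - of_nat N)" by auto
  then show "?f (- m) = ?f m" by (simp only: divide_minus_right) simp
 qed simp
qed

theorem E2_inversion:
 assumes t: "Im t > 0"
 shows "E2 (- 1 / t) = t ^ 2 * E2 t + 6 * t / (of_real pi * \<i>)"
proof -
 have t0: "t ~= 0" using t by auto
 define t' where "t' = - 1 / t"
 have t': "Im t' > 0" using t by (simp add: t'_def Im_divide field_simps sum_power2_gt_zero_iff)
 define A where "A = (- 2 * of_real pi * \<i> :: complex) ^ 2"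
 define S where "S z = pow_series (%n. of_nat (sigma_pow 1 n)) (qq z)" for z
 define a where "a = (%(m, n). 1 / ((of_int m * t + of_int n) ^ 2 * (of_int m * t + of_int (n + 1))))"
 define b where "b m n = 1 / (of_int m * t + of_int n) - 1 / (of_int m * t + of_int (n + 1))" for m n :: int
 have ab: "a (m, n) = 1 / (of_int m * t + of_int n) ^ 2 - b m n" if "m ~= 0" for m n
 proof -
  have "of_int m * t + of_int n ~= 0" "of_int m * t + of_int (n + 1) ~= 0"
   using that by (auto intro!: lattice_nonzero[OF t] simp del: of_int_add)
  moreover have partial_fractions: "1 / (x ^ 2 * y) = 1 / x ^ 2 - (1 / x - 1 / y)" if "x ~= 0" "y ~= 0" "y = x + 1" for x y :: complex
  proof -
   have "1 / x ^ 2 - (1 / x - 1 / y) = (y - x * y + x ^ 2) / (x ^ 2 * y)"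
    using that(1,2) by (simp add: field_simps power2_eq_square)
   also have "y - x * y + x ^ 2 = 1" by (simp add: that(3) algebra_simps power2_eq_square)
   finally show ?thesis ..
  qed
  ultimately show ?thesis
   unfolding a_def b_def prod.case by (intro partial_fractions) auto
 qed
 have summ: "a summable_on ((- {0}) \<times> UNIV)" unfolding a_def by (rule summable_on_nonzero_cubic[OF t])
 define total where "total = infsum a ((- {0}) \<times> UNIV)"
 have total: "(a has_sum total) ((- {0}) \<times> UNIV)" using summ by (simp add: total_def)
 have rows: "((%m::int. row_sum 2 (of_int \<bar>m\<bar> * z)) has_sum (2 * (A * S z))) (- {0})" if "Im z > 0" for z
 proof -
  have "((%m::nat. row_sum 2 (of_int \<bar>int m\<bar> * z)) has_sum (A * S z)) {1..}"
   using has_sum_row_sums[OF that, of 2] by (simp add: A_def S_def)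
  then show ?thesis by (rule has_sum_nonzero_int_even) simp
 qed
 have Row: "((%n::int. 1 / (of_int m * z + of_int n) ^ 2) has_sum row_sum 2 (of_int \<bar>m\<bar> * z)) UNIV"
  if "m ~= 0" "Im z > 0" for m z
 proof (cases "m > 0")
  case True
  then show ?thesis using lipschitz_formula[of "of_int m * z" 2] that by simp
 next
  case False
  then have "m < 0" using that by simp
  then show ?thesis using row_has_sum_neg[of 2 "of_int m * z"] that by (simp add: mult_neg_pos)
 qed

 \<comment> \<open>Summing along rows, the telescoping part contributes nothing.\<close>
 have row: "((%n. a (m, n)) has_sum row_sum 2 (of_int \<bar>m\<bar> * t)) UNIV" if m: "m \<in> - {0}" for m
 proof -
  have "(%n. a (m, n)) summable_on UNIV"
   using summable_on_SigmaD1[of "%m n. a (m, n)" "- {0}" "%_. UNIV" m] summ m by simp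
  then have r: "((%n. a (m, n)) has_sum infsum (%n. a (m, n)) UNIV) UNIV" by simp
  have "((%n. 1 / (of_int m * t + of_int n) ^ 2 - a (m, n)) has_sum
    (row_sum 2 (of_int \<bar>m\<bar> * t) - infsum (%n. a (m, n)) UNIV)) UNIV"
   using m has_sum_add[OF Row[of m t] has_sum_neg[OF r]] t by simp
  then have "(b m has_sum (row_sum 2 (of_int \<bar>m\<bar> * t) - infsum (%n. a (m, n)) UNIV)) UNIV"
   by (subst has_sum_cong[where g = "%n. 1 / (of_int m * t + of_int n) ^ 2 - a (m, n)"]) (use m in \<open>auto simp: ab\<close>)
  then have "(%N. \<Sum>n\<in>{- int N..<int N}. b m n) \<longlonglongrightarrow> row_sum 2 (of_int \<bar>m\<bar> * t) - infsum (%n. a (m, n)) UNIV"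
   by (rule has_sum_int_symmetric_limit)
  moreover have "(%N. \<Sum>n\<in>{- int N..<int N}. b m n) \<longlonglongrightarrow> 0"
  proof -
   have "(\<Sum>n\<in>{- int N..<int N}. b m n) = 1 / (of_int m * t - of_nat N) - 1 / (of_int m * t + of_nat N)" for N
    unfolding b_def using sum_int_telescope[of "%n. 1 / (of_int m * t + of_int n)" N] by simp
   then show ?thesis using tendsto_diff[OF tendsto_inverse_linear(2,1), of "of_int m * t" "of_int m * t"] by simp
  qed
  ultimately have "row_sum 2 (of_int \<bar>m\<bar> * t) - infsum (%n. a (m, n)) UNIV = 0" by (rule LIMSEQ_unique)
  then show ?thesis using r by simp
 qed
 have total_rows: "total = 2 * (A * S t)"
  by (rule has_sum_unique[OF has_sum_SigmaD[OF total row] rows[OF t]])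

 \<comment> \<open>Summing along columns, it contributes the limit of the cotangent.\<close>
 define c0 :: complex where "c0 = of_real (pi ^ 2 / 3)"
 define col where "col n = (if n = 0 then c0 / t ^ 2 else row_sum 2 (of_int \<bar>n\<bar> * t') / t ^ 2 - 1 / of_int n ^ 2)" for n :: int
 have squares: "((%n::int. 1 / of_int n ^ 2 :: complex) has_sum c0) (- {0})"
 proof -
  have "((%n::nat. 1 / (real n + 1) ^ 2) has_sum (pi ^ 2 / 6)) UNIV"
   using inverse_squares_sums by (intro sums_nonneg_imp_has_sum) (auto simp: add.commute)
  from has_sum_of_real[OF this, where 'a = complex]
  have "((%n::nat. 1 / of_nat (Suc n) ^ 2 :: complex) has_sum of_real (pi ^ 2 / 6)) UNIV" by (simp add: add.commute)
  then have "((%n::nat. 1 / of_int (int n) ^ 2 :: complex) has_sum of_real (pi ^ 2 / 6)) {1..}"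
   by (subst (asm) has_sum_reindex_bij_witness[where T = "{1..}" and j = Suc and i = "%n. n - 1"
      and h = "%n. 1 / of_nat n ^ 2" and s' = "of_real (pi ^ 2 / 6)"]) auto
  from has_sum_nonzero_int_even[OF this] show ?thesis by (simp add: c0_def)
 qed
 have col: "((%m. 1 / (of_int m * t + of_int n) ^ 2) has_sum col n) (- {0})" for n
 proof (cases "n = 0")
  case True
  from has_sum_cmult_right[OF squares, of "1 / t ^ 2"] show ?thesis
   by (simp add: True col_def power_mult_distrib mult.commute)
 next
  case False
  have "((%m::int. 1 / (of_int n * t' + of_int m) ^ 2) has_sum row_sum 2 (of_int \<bar>n\<bar> * t')) UNIV"
   by (rule Row[OF False t'])
  from has_sum_cmult_right[OF this, of "1 / t ^ 2"]
  have "((%m::int. 1 / (t * (of_int n * t' + of_int m)) ^ 2) has_sum row_sum 2 (of_int \<bar>n\<bar> * t') / t ^ 2) UNIV"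
   by (simp add: power_mult_distrib)
  also have "?this \<longleftrightarrow> ((%m::int. 1 / (of_int m * t + of_int n) ^ 2) has_sum row_sum 2 (of_int \<bar>n\<bar> * t') / t ^ 2) UNIV"
  proof (rule has_sum_reindex_bij_witness[where i = uminus and j = uminus])
   fix m :: int
   have "t * (of_int n * t' + of_int m) = - (of_int (- m) * t + of_int n)"
    using t0 by (simp add: t'_def field_simps)
   then show "1 / (of_int (- m) * t + of_int n) ^ 2 = 1 / (t * (of_int n * t' + of_int m)) ^ 2"
    by (simp only: power2_minus)
  qed auto
  finally have "((%m::int. 1 / (of_int m * t + of_int n) ^ 2) has_sum row_sum 2 (of_int \<bar>n\<bar> * t') / t ^ 2) UNIV" .
  from has_sum_Diff[OF this has_sum_finite[of "{0}"]] show ?thesis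
   using False by (simp add: col_def Compl_eq_Diff_UNIV)
 qed
 have "((%n. col n) has_sum (2 * (A * S t') / t ^ 2 - c0)) (- {0})"
 proof -
  have "((%n. row_sum 2 (of_int \<bar>n\<bar> * t') * (1 / t ^ 2) + - (1 / of_int n ^ 2)) has_sum
    (2 * (A * S t') * (1 / t ^ 2) + - c0)) (- {0})"
   by (intro has_sum_add has_sum_cmult_left rows[OF t'] has_sum_neg squares)
  then show ?thesis by (subst has_sum_cong[where g = "%n. row_sum 2 (of_int \<bar>n\<bar> * t') * (1 / t ^ 2) + - (1 / of_int n ^ 2)"])
    (auto simp: col_def)
 qed
 note this0 = this
 have col0: "col 0 = c0 / t ^ 2" by (simp add: col_def)
 have univ: "insert 0 (- {0}) = (UNIV :: int set)" by auto
 from has_sum_insert[OF _ this0, of 0]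
 have cols: "(col has_sum (c0 / t ^ 2 + (2 * (A * S t') / t ^ 2 - c0))) UNIV"
  by (simp add: univ col0)
 define g where "g n = infsum (%m. a (m, n)) (- {0})" for n
 have swapped: "((%(n, m). a (m, n)) has_sum total) (UNIV \<times> (- {0}))"
  using total by (simp add: has_sum_swap[of a])
 have gcol: "((%m. a (m, n)) has_sum g n) (- {0})" for n
 proof -
  have "(%m. a (m, n)) summable_on - {0}"
   using summable_on_SigmaD1[of "%n m. a (m, n)" UNIV "%_. - {0}" n] swapped
   by (auto simp: has_sum_imp_summable)
  then show ?thesis by (simp add: g_def)
 qed
 have "(g has_sum total) UNIV"
  using has_sum_SigmaD[OF swapped, of g] gcol by simp
 from has_sum_int_symmetric_limit[OF has_sum_add[OF cols has_sum_neg[OF this]]]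
 have lim1: "(%N. \<Sum>n\<in>{- int N..<int N}. col n - g n) \<longlonglongrightarrow>
   c0 / t ^ 2 + (2 * (A * S t') / t ^ 2 - c0) - total" by simp
 have bcol: "((%m. b m n) has_sum (col n - g n)) (- {0})" for n
 proof -
  have "((%m. 1 / (of_int m * t + of_int n) ^ 2 + - a (m, n)) has_sum (col n + - g n)) (- {0})"
   by (intro has_sum_add col has_sum_neg gcol)
  then show ?thesis
   by (subst has_sum_cong[where g = "%m. 1 / (of_int m * t + of_int n) ^ 2 + - a (m, n)"]) (auto simp: ab)
 qed
 have part: "(\<Sum>n\<in>{- int N..<int N}. col n - g n) =
   2 / t * (t / of_nat N + of_real pi * cot (of_real pi * (of_nat N * t')))" if "N > 0" for N
 proof -
  have "((%m. \<Sum>n\<in>{- int N..<int N}. b m n) has_sum (\<Sum>n\<in>{- int N..<int N}. col n - g n)) (- {0})"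
   by (intro has_sum_finite_sum bcol) auto
  moreover have "(\<Sum>n\<in>{- int N..<int N}. b m n) = 1 / (of_int m * t - of_nat N) - 1 / (of_int m * t + of_nat N)" for m
   unfolding b_def using sum_int_telescope[of "%n. 1 / (of_int m * t + of_int n)" N] by simp
  ultimately show ?thesis
   using has_sum_telescoping_column[OF t that] by (simp add: t'_def has_sum_unique)
 qed
 have lim2: "(%N. 2 / t * (t / of_nat N + of_real pi * cot (of_real pi * (of_nat N * t')))) \<longlonglongrightarrow>
   2 / t * (0 + (- of_real pi * \<i> - 2 * of_real pi * \<i> * (0 / (1 - 0))))"
 proof (intro tendsto_mult tendsto_add tendsto_const)
  show "(%N. t / of_nat N) \<longlonglongrightarrow> 0" by (rule lim_const_over_n)
  have "(%N. qq t' ^ N) \<longlonglongrightarrow> 0" by (rule LIMSEQ_power_zero[OF norm_qq_less_1[OF t']])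
  then have "(%N. - of_real pi * \<i> - 2 * of_real pi * \<i> * (qq t' ^ N / (1 - qq t' ^ N))) \<longlonglongrightarrow>
    - of_real pi * \<i> - 2 * of_real pi * \<i> * (0 / (1 - 0))"
   by (intro tendsto_intros) (use norm_qq_less_1[OF t'] in simp_all)
  moreover have "eventually (%N. - of_real pi * \<i> - 2 * of_real pi * \<i> * (qq t' ^ N / (1 - qq t' ^ N)) =
    of_real pi * cot (of_real pi * (of_nat N * t'))) sequentially"
   using eventually_gt_at_top[of 0]
  proof eventually_elim
   case (elim N)
   then show ?case using cot_nome[of "of_nat N * t'"] t' by (simp add: qq_mult_nat)
  qed
  ultimately show "(%N. of_real pi * cot (of_real pi * (of_nat N * t'))) \<longlonglongrightarrow>
    - of_real pi * \<i> - 2 * of_real pi * \<i> * (0 / (1 - 0))"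
   by (rule Lim_transform_eventually)
 qed
 have "c0 / t ^ 2 + (2 * (A * S t') / t ^ 2 - c0) - total = 2 / t * (0 + (- of_real pi * \<i> - 2 * of_real pi * \<i> * (0 / (1 - 0))))"
 proof (rule LIMSEQ_unique[OF lim1])
  show "(%N. \<Sum>n\<in>{- int N..<int N}. col n - g n) \<longlonglongrightarrow> 2 / t * (0 + (- of_real pi * \<i> - 2 * of_real pi * \<i> * (0 / (1 - 0))))"
   by (rule Lim_transform_eventually[OF lim2]) (use part in \<open>auto simp: eventually_sequentially intro!: exI[of _ 1]\<close>)
 qed
 then have main: "(c0 + 2 * A * S t') / t ^ 2 = c0 + 2 * A * S t - 2 * of_real pi * \<i> / t"
  unfolding total_rows by (simp add: add_divide_distrib algebra_simps)
 have E: "c0 + 2 * A * S z = c0 * E2 z" if "Im z > 0" for z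
  using that by (simp add: E2_eq_pow_series S_def c0_def A_def power_mult_distrib algebra_simps)
 have c0nz: "c0 ~= 0" by (simp add: c0_def)
 have "c0 * E2 t' = t ^ 2 * (c0 * E2 t) - 2 * of_real pi * \<i> * t"
  using main t0 unfolding E[OF t] E[OF t'] by (simp add: field_simps power2_eq_square)
 then have "E2 t' = (t ^ 2 * (c0 * E2 t) - 2 * of_real pi * \<i> * t) / c0"
  by (simp add: c0nz eq_divide_eq mult.commute)
 also have "\<dots> = t ^ 2 * E2 t + 6 * t / (of_real pi * \<i>)"
  by (simp add: c0_def field_simps power2_eq_square)
 finally show ?thesis by (simp add: t'_def)
qed

section \<open>The Euler product\<close>

definition euler_product :: "complex => complex" where
 "euler_product x = (\<Prod>n. 1 - x ^ Suc n)"

lemma convergent_prod_euler: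
 assumes "norm (x :: complex) < 1" shows "convergent_prod (%n. 1 - x ^ Suc n)"
proof -
 have "convergent_prod (%n. 1 + (- (x ^ Suc n)))"
 proof (rule summable_imp_convergent_prod_complex)
  show "summable (%k. norm (- (x ^ Suc k)))"
   using summable_mult[OF summable_geometric[of "norm x"], of "norm x"] assms by (simp add: norm_mult norm_power)
  show "- (x ^ Suc k) ~= - 1" for k
  proof
   assume "- (x ^ Suc k) = - 1"
   then have "norm x ^ Suc k = 1" by (metis norm_power norm_one neg_equal_iff_equal)
   then show False using assms power_Suc_less_one[of "norm x" k] by (cases "x = 0") auto
  qed
 qed
 then show ?thesis by simp
qed

lemma euler_factor_nonzero: "norm (x :: complex) < 1 ==> 1 - x ^ Suc n ~= 0"
proof
 assume x: "norm x < 1" and "1 - x ^ Suc n = 0"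
 then have "norm x ^ Suc n = 1" by (metis eq_iff_diff_eq_0 norm_power norm_one)
 then show False using x power_Suc_less_one[of "norm x" n] by (cases "x = 0") auto
qed

lemma euler_product_nonzero: "norm x < 1 ==> euler_product x ~= 0"
 unfolding euler_product_def
 by (rule prodinf_nonzero[OF convergent_prod_euler euler_factor_nonzero])

lemma uniform_limit_euler_product:
 assumes "0 < r" "r < 1"
 shows "uniform_limit (cball 0 r) (%n x. \<Prod>k<n. 1 - x ^ Suc k) euler_product sequentially"
proof -
 have "uniformly_convergent_on (cball 0 r) (%N x :: complex. \<Prod>n<N. 1 - x ^ Suc n)"
 proof (rule uniformly_convergent_on_prod')
  show "uniformly_convergent_on (cball 0 r) (%N x :: complex. \<Sum>n<N. norm (1 - x ^ Suc n - 1))"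
  proof (rule Weierstrass_m_test'_ev)
   show "summable (%n. r * r ^ n)" using assms by (intro summable_mult summable_geometric) auto
   have "norm (norm (1 - x ^ Suc n - 1)) <= r * r ^ n" if "x \<in> cball 0 r" for x :: complex and n
    using power_mono[of "norm x" r "Suc n"] that by (simp add: norm_power norm_mult)
   then show "\<forall>\<^sub>F n in sequentially. \<forall>x\<in>cball (0 :: complex) r. norm (norm (1 - x ^ Suc n - 1)) <= r * r ^ n"
    by (intro always_eventually) blast
  qed
 qed (auto intro!: continuous_intros)
 then obtain L where L: "uniform_limit (cball 0 r) (%n x :: complex. \<Prod>k<n. 1 - x ^ Suc k) L sequentially"
  by (auto simp: uniformly_convergent_on_def)
 have "L x = euler_product x" if "x \<in> cball 0 r" for x
 proof -
  have "norm x < 1" using that assms by auto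
  then have "(%n. \<Prod>k\<le>n. 1 - x ^ Suc k) \<longlonglongrightarrow> euler_product x"
   unfolding euler_product_def by (intro convergent_prod_LIMSEQ convergent_prod_euler)
  moreover have "(%n. \<Prod>k<n. 1 - x ^ Suc k) \<longlonglongrightarrow> L x"
   by (rule tendsto_uniform_limitI[OF L that])
  from LIMSEQ_Suc[OF this] have "(%n. \<Prod>k\<le>n. 1 - x ^ Suc k) \<longlonglongrightarrow> L x"
   unfolding lessThan_Suc_atMost .
  ultimately show ?thesis using LIMSEQ_unique by blast
 qed
 then show ?thesis using L by (subst uniform_limit_cong'[where g = "%n x. \<Prod>k<n. 1 - x ^ Suc k" and i = L]) auto
qed

lemma euler_product_holomorphic: "euler_product holomorphic_on ball 0 1"
proof (rule holomorphic_uniform_sequence)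
 show "(%x. \<Prod>k<n. 1 - x ^ Suc k) holomorphic_on ball 0 1" for n :: nat
  by (intro holomorphic_intros)
 fix x :: complex assume "x \<in> ball 0 1"
 then have x: "norm x < 1" by simp
 define d where "d = (1 - norm x) / 2"
 have sub: "cball x d \<subseteq> cball 0 ((1 + norm x) / 2)"
 proof
  fix y assume "y \<in> cball x d"
  then have "norm (y - x) <= d" by (simp add: dist_norm norm_minus_commute)
  then have "norm y <= norm x + d" by (metis add.commute diff_add_cancel norm_triangle_le_diff norm_triangle_ineq add_left_mono order_trans)
  then show "y \<in> cball 0 ((1 + norm x) / 2)" by (simp add: d_def field_simps)
 qed
 have r: "0 < (1 + norm x) / 2" "(1 + norm x) / 2 < 1"
  using x by (auto intro: add_pos_nonneg)
 have "cball x d \<subseteq> ball 0 1" using sub r by force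
 then show "\<exists>d>0. cball x d \<subseteq> ball 0 1 \<and> uniform_limit (cball x d) (%n x. \<Prod>k<n. 1 - x ^ Suc k) euler_product sequentially"
  using x by (intro exI[of _ d] conjI uniform_limit_on_subset[OF uniform_limit_euler_product[OF r] sub]) (auto simp: d_def)
qed auto

text \<open>The product may be differentiated logarithmically factor by factor, because it converges locally
  uniformly; expanding each factor geometrically gives a Lambert series.\<close>

lemma euler_operator_euler_product:
 assumes x: "norm x < 1"
 shows "x * deriv euler_product x = - euler_product x * pow_series (%n. of_nat (sigma_pow 1 n)) x"
proof -
 define r where "r = (1 + norm x) / 2"
 have r: "0 < r" "r < 1" "norm x < r" using x by (auto simp: r_def intro: add_pos_nonneg)
 have "(%k. deriv (%x. 1 - x ^ Suc k) x / (1 - x ^ Suc k)) sums (deriv euler_product x / euler_product x)"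
 proof (rule logderiv_prodinf_complex_uniform_limit[where A = "ball 0 r"])
  show "uniform_limit (ball 0 r) (%n x. \<Prod>k<n. 1 - x ^ Suc k) euler_product sequentially"
   by (rule uniform_limit_on_subset[OF uniform_limit_euler_product[OF r(1,2)] ball_subset_cball])
 qed (use r euler_product_nonzero[OF x] in \<open>auto intro!: holomorphic_intros\<close>)
 also have "(%k. deriv (%x. 1 - x ^ Suc k) x / (1 - x ^ Suc k)) =
   (%k. - (of_nat (Suc k) * x ^ k) / (1 - x ^ Suc k))"
  by (intro ext arg_cong2[where f = divide] refl, rule DERIV_imp_deriv) (auto intro!: derivative_eq_intros simp del: power_Suc)
 finally have "(%k. x * (- (of_nat (Suc k) * x ^ k) / (1 - x ^ Suc k))) sums (x * (deriv euler_product x / euler_product x))"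
  by (rule sums_mult)
 then have s1: "(%k. - (of_nat (Suc k) * (x ^ Suc k / (1 - x ^ Suc k)))) sums (x * (deriv euler_product x / euler_product x))"
  by (simp add: mult_ac)
 have "((%d::nat. of_nat d * (x ^ d / (1 - x ^ d))) has_sum pow_series (%n. of_nat (sigma_pow 1 n)) x) {1..}"
 proof (rule has_sum_SigmaD)
  show "((%(d, m). of_nat d * x ^ (m * d)) has_sum pow_series (%n. of_nat (sigma_pow 1 n)) x) ({1..} \<times> {1..})"
   using lambert_double_series[OF x, of 0] by (simp add: has_sum_swap[of "%(m, d). of_nat d * x ^ (m * d)"])
  fix d :: nat assume d: "d \<in> {1..}"
  then have xd: "norm (x ^ d) < 1" using x by (simp add: norm_power power_less_one_iff)
  have "((%m. of_nat d * x ^ d * (x ^ d) ^ m) has_sum (of_nat d * x ^ d * (1 / (1 - x ^ d)))) UNIV"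
   using xd by (intro has_sum_cmult_right norm_summable_imp_has_sum geometric_sums)
     (auto simp: norm_power intro: summable_geometric)
  then show "((%m. case (d, m) of (d, m) => of_nat d * x ^ (m * d)) has_sum of_nat d * (x ^ d / (1 - x ^ d))) {1..}"
   by (subst (asm) has_sum_reindex_bij_witness[where T = "{1..}" and j = Suc and i = "%n. n - 1"
      and h = "%m. of_nat d * x ^ (m * d)" and s' = "of_nat d * x ^ d * (1 / (1 - x ^ d))"])
     (auto simp: power_add power_mult [symmetric] mult_ac)
 qed
 then have "((%k. of_nat (Suc k) * (x ^ Suc k / (1 - x ^ Suc k))) has_sum pow_series (%n. of_nat (sigma_pow 1 n)) x) UNIV"
  by (subst has_sum_reindex_bij_witness[where T = "{1..}" and j = Suc and i = "%n. n - 1"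
      and h = "%d. of_nat d * (x ^ d / (1 - x ^ d))" and s' = "pow_series (%n. of_nat (sigma_pow 1 n)) x"]) auto
 from sums_minus[OF has_sum_imp_sums[OF this]]
 have "x * (deriv euler_product x / euler_product x) = - pow_series (%n. of_nat (sigma_pow 1 n)) x"
  by (rule sums_unique2[OF s1])
 then show ?thesis using euler_product_nonzero[OF x] by (simp add: field_simps)
qed

section \<open>Forms of level 2 as functions of the nome\<close>

lemma norm_square_less_1: "norm (x :: complex) < 1 ==> norm (x ^ 2) < 1"
 by (simp add: norm_power power_less_one_iff)

lemma holomorphic_compose_square:
 "f holomorphic_on ball 0 1 ==> (%x. f (x ^ 2)) holomorphic_on ball 0 1"
 using norm_square_less_1
 by (intro holomorphic_on_compose_gen[where g = f and f = "%x. x ^ 2" and t = "ball 0 1", unfolded o_def])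
   (auto intro!: holomorphic_intros)

definition sigma_series :: "nat => complex => complex" where
 "sigma_series k = pow_series (%n. of_nat (sigma_pow k n))"

lemma holomorphic_sigma_series: "sigma_series k holomorphic_on ball 0 1"
 unfolding sigma_series_def by (rule holomorphic_pow_series[OF poly_growth_sigma])

definition M2_nome where "M2_nome x = 1 + 24 * sigma_series 1 x - 48 * sigma_series 1 (x ^ 2)"
definition M4_nome where "M4_nome x = 1 + 48 * sigma_series 3 x + 192 * sigma_series 3 (x ^ 2)"
definition M6_nome where "M6_nome x = 1 - 56 * sigma_series 5 x - 448 * sigma_series 5 (x ^ 2)"
definition M8_nome where "M8_nome x = (euler_product x * euler_product (x ^ 2)) ^ 8"
definition M2_star_nome where "M2_star_nome x = 1 - 8 * sigma_series 1 x - 16 * sigma_series 1 (x ^ 2)"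

lemmas holomorphic_sigma_series_square = holomorphic_compose_square[OF holomorphic_sigma_series]

lemma holomorphic_nome:
 "M2_nome holomorphic_on ball 0 1" "M4_nome holomorphic_on ball 0 1" "M6_nome holomorphic_on ball 0 1"
 "M8_nome holomorphic_on ball 0 1" "M2_star_nome holomorphic_on ball 0 1"
 unfolding M2_nome_def M4_nome_def M6_nome_def M8_nome_def M2_star_nome_def
 by (intro holomorphic_intros holomorphic_sigma_series holomorphic_sigma_series_square
    euler_product_holomorphic holomorphic_compose_square)+

lemma E4_eq: "Im z > 0 ==> E4 z = 1 + 240 * sigma_series 3 (qq z)"
 unfolding E4_def sigma_series_def by (subst suminf_Suc_eq_pow_series[OF poly_growth_sigma norm_qq_less_1]) auto

lemma E6_eq: "Im z > 0 ==> E6 z = 1 - 504 * sigma_series 5 (qq z)"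
 unfolding E6_def sigma_series_def by (subst suminf_Suc_eq_pow_series[OF poly_growth_sigma norm_qq_less_1]) auto

lemma E2_eq: "Im z > 0 ==> E2 z = 1 - 24 * sigma_series 1 (qq z)"
 unfolding sigma_series_def by (rule E2_eq_pow_series)

lemma Im_double: "Im (2 * z) > 0 \<longleftrightarrow> Im z > 0"
 by simp

lemma M2_eq: "Im z > 0 ==> M2 z = M2_nome (qq z)"
 by (simp only: M2_def M2_nome_def E2_eq Im_double qq_double) (simp add: algebra_simps add_divide_distrib diff_divide_distrib)
lemma M4_eq: "Im z > 0 ==> M4 z = M4_nome (qq z)"
 by (simp only: M4_def M4_nome_def E4_eq Im_double qq_double) (simp add: algebra_simps add_divide_distrib diff_divide_distrib)
lemma M6_eq: "Im z > 0 ==> M6 z = M6_nome (qq z)"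
 by (simp only: M6_def M6_nome_def E6_eq Im_double qq_double) (simp add: algebra_simps add_divide_distrib diff_divide_distrib)
lemma M2_star_eq: "Im z > 0 ==> M2_star z = M2_star_nome (qq z)"
 by (simp only: M2_star_def M2_star_nome_def E2_eq Im_double qq_double) (simp add: algebra_simps add_divide_distrib diff_divide_distrib)
lemma M8_eq: "Im z > 0 ==> M8 z = qq z * M8_nome (qq z)"
proof -
 assume z: "Im z > 0"
 have "exp (tpi * z / 24) ^ 8 * exp (tpi * (2 * z) / 24) ^ 8 = qq z"
  by (simp add: qq_def exp_of_nat_mult [symmetric] exp_add [symmetric] mult_ac)
 from this [symmetric] show ?thesis
  unfolding M8_def eta_def euler_product_def [symmetric] qq_double M8_nome_def power_mult_distrib
  by (simp only: mult_ac)
qed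

lemma M8_nome_nonzero: "norm x < 1 ==> M8_nome x ~= 0"
 by (simp add: M8_nome_def euler_product_nonzero norm_square_less_1)

lemma M8_nonzero: "Im z > 0 ==> M8 z ~= 0"
 by (simp add: M8_eq M8_nome_nonzero norm_qq_less_1)

lemma holomorphic_compose_qq:
 assumes "g holomorphic_on ball 0 1" shows "(%z. g (qq z)) holomorphic_on uhp"
 by (rule holomorphic_on_compose_gen[where g = g and f = qq and t = "ball 0 1", unfolded o_def])
   (use assms norm_qq_less_1 in \<open>auto intro!: holomorphic_qq\<close>)

lemma holomorphic_level2:
 "M2 holomorphic_on uhp" "M4 holomorphic_on uhp" "M6 holomorphic_on uhp" "M8 holomorphic_on uhp"
 "M2_star holomorphic_on uhp"
proof -
 have "(%z. qq z * M8_nome (qq z)) holomorphic_on uhp"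
  by (intro holomorphic_intros holomorphic_compose_qq holomorphic_nome)
 then show "M8 holomorphic_on uhp" by (rule holomorphic_transform) (simp add: M8_eq)
qed (auto intro: holomorphic_transform[OF holomorphic_compose_qq] holomorphic_nome simp: M2_eq M4_eq M6_eq M2_star_eq)

lemma level2_translation:
 "M2 (z + 1) = M2 z" "M4 (z + 1) = M4 z" "M6 (z + 1) = M6 z" "M2_star (z + 1) = M2_star z"
 "Im z > 0 ==> M8 (z + 1) = M8 z"
proof -
 have "qq (2 * (z + 1)) = qq (2 * z)" by (simp only: qq_double qq_plus_1)
 then show "M2 (z + 1) = M2 z" "M4 (z + 1) = M4 z" "M6 (z + 1) = M6 z" "M2_star (z + 1) = M2_star z"
  by (simp_all add: M2_def E2_def M4_def E4_def M6_def E6_def M2_star_def)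
qed (simp add: M8_eq)

lemma has_field_derivative_compose_qq:
 assumes "g holomorphic_on ball 0 1" "Im z > 0"
 shows "((%z. g (qq z)) has_field_derivative tpi * (qq z * deriv g (qq z))) (at z)"
proof -
 have "(g has_field_derivative deriv g (qq z)) (at (qq z))"
  using assms norm_qq_less_1[OF assms(2)] by (intro holomorphic_derivI[where S = "ball 0 1"]) auto
 from DERIV_chain2[OF this has_field_derivative_qq] show ?thesis by (simp add: mult_ac)
qed

text \<open>The logarithmic derivative of \<open>\<eta>\<^sup>8(z) \<eta>\<^sup>8(2z)\<close> is a combination of
  \<open>E2(z)\<close> and \<open>E2(2z)\<close>, namely \<open>2 \<pi> i\<close> times
  \<open>M2_star\<close>.\<close>

lemma has_field_derivative_M8:
 assumes z: "Im z > 0"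
 shows "(M8 has_field_derivative tpi * (M2_star z * M8 z)) (at z)"
proof -
 define x where "x = qq z"
 have x: "norm x < 1" "norm (x ^ 2) < 1"
  using norm_qq_less_1[OF z] norm_square_less_1 by (auto simp: x_def)
 have d: "(euler_product has_field_derivative deriv euler_product x) (at x)"
    "(euler_product has_field_derivative deriv euler_product (x ^ 2)) (at (x ^ 2))"
  using x by (auto intro!: holomorphic_derivI[where S = "ball 0 1"] euler_product_holomorphic)
 let ?p = "euler_product x" and ?p2 = "euler_product (x ^ 2)"
 have d2: "((%x. euler_product (x ^ 2)) has_field_derivative deriv euler_product (x ^ 2) * (2 * x)) (at x)"
 proof (rule DERIV_chain2[where f = euler_product and g = "%x. x ^ 2", OF d(2)])
  show "((%x. x ^ 2) has_field_derivative 2 * x) (at x)" by (auto intro!: derivative_eq_intros)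
 qed
 have "(M8_nome has_field_derivative 8 * (deriv euler_product x * ?p2 + deriv euler_product (x ^ 2) * (2 * x) * ?p) * (?p * ?p2) ^ 7) (at x)"
 proof -
  have "((%x. euler_product x * euler_product (x ^ 2)) has_field_derivative
    deriv euler_product x * ?p2 + deriv euler_product (x ^ 2) * (2 * x) * ?p) (at x)"
   by (rule DERIV_mult[OF d(1) d2])
  from DERIV_power[OF this, of 8] show ?thesis
   unfolding M8_nome_def[abs_def] by (rule DERIV_cong) (simp add: algebra_simps)
 qed
 then have "x * deriv M8_nome x = 8 * ((x * deriv euler_product x) * ?p2 + 2 * (x ^ 2 * deriv euler_product (x ^ 2)) * ?p) * (?p * ?p2) ^ 7"
  by (subst DERIV_imp_deriv) (auto simp: algebra_simps power2_eq_square)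
 also have "\<dots> = - 8 * (sigma_series 1 x + 2 * sigma_series 1 (x ^ 2)) * (?p * ?p2) ^ 8"
  unfolding euler_operator_euler_product[OF x(1)] euler_operator_euler_product[OF x(2)] sigma_series_def [symmetric]
  by (simp add: eval_nat_numeral algebra_simps)
 finally have e: "x * deriv M8_nome x = (M2_star_nome x - 1) * M8_nome x"
  by (simp add: M2_star_nome_def M8_nome_def algebra_simps)
 have "((%z. qq z * M8_nome (qq z)) has_field_derivative
   tpi * qq z * M8_nome (qq z) + tpi * (qq z * deriv M8_nome (qq z)) * qq z) (at z)"
  by (rule DERIV_mult[OF has_field_derivative_qq has_field_derivative_compose_qq[OF holomorphic_nome(4) z]])
 also have "tpi * qq z * M8_nome (qq z) + tpi * (qq z * deriv M8_nome (qq z)) * qq z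
   = tpi * (M2_star z * M8 z)"
 proof -
  have "tpi * x * M8_nome x + tpi * (x * deriv M8_nome x) * x
   = tpi * (x * (M8_nome x + x * deriv M8_nome x))" by (simp add: algebra_simps)
  also have "M8_nome x + x * deriv M8_nome x = M2_star_nome x * M8_nome x"
   using e by (simp add: algebra_simps)
  finally show ?thesis by (simp add: M2_star_eq[OF z] M8_eq[OF z] x_def [symmetric] mult_ac)
 qed
 finally show ?thesis
  by (rule has_field_derivative_transform_within_open[where S = uhp]) (use z in \<open>auto simp: M8_eq\<close>)
qed

section \<open>The Fricke involution\<close>

definition fricke :: "complex => complex" where "fricke z = - 1 / (2 * z)"

lemma Im_fricke: "Im (fricke z) = Im z / (2 * (norm z) ^ 2)"
proof -
 have "Im (- 1 / w) = Im w / (norm w) ^ 2" for w by (simp add: Im_divide cmod_power2)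
 from this[of "2 * z"] show ?thesis by (simp add: fricke_def norm_mult power_mult_distrib)
qed

lemma fricke_uhp [simp]: "Im z > 0 ==> Im (fricke z) > 0"
 by (auto simp: Im_fricke intro!: divide_pos_pos)

lemma fricke_fricke [simp]: "fricke (fricke z) = z"
 by (simp add: fricke_def)

lemma double_fricke: "2 * fricke z = - 1 / z"
 by (simp add: fricke_def)

lemma fricke_eq: "fricke z = - 1 / (2 * z)"
 by (simp add: fricke_def)

lemma has_field_derivative_fricke:
 "z ~= 0 ==> (fricke has_field_derivative 1 / (2 * z ^ 2)) (at z)"
 unfolding fricke_def[abs_def] by (auto intro!: derivative_eq_intros simp: power2_eq_square)

lemma M2_fricke: assumes z: "Im z > 0" shows "M2 (fricke z) = - (2 * z ^ 2) * M2 z"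
proof -
 have "Im (2 * z) > 0" using z by simp
 from E2_inversion[OF this] E2_inversion[OF z] show ?thesis
  by (simp add: M2_def double_fricke) (simp add: fricke_eq algebra_simps power2_eq_square)
qed

lemma M2_star_fricke:
 assumes z: "Im z > 0" shows "M2_star (fricke z) = 2 * z ^ 2 * M2_star z + 8 * z / (of_real pi * \<i>)"
proof -
 have "Im (2 * z) > 0" using z by simp
 from E2_inversion[OF this] E2_inversion[OF z] show ?thesis
  by (simp add: M2_star_def double_fricke)
    (simp add: fricke_eq algebra_simps power2_eq_square add_divide_distrib)
qed

lemma rho1_props: "Im rho1 > 0" "rho1 ^ 2 = - 1 / 2" "fricke rho1 = rho1" "rho1 ~= 0"
proof -
 show im: "Im rho1 > 0" by (simp add: rho1_def)
 then show nz: "rho1 ~= 0" by auto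
 have "complex_of_real (sqrt 2) ^ 2 = 2" by (metis of_real_numeral of_real_power real_sqrt_pow2 zero_le_numeral)
 then show sq: "rho1 ^ 2 = - 1 / 2" by (simp add: rho1_def power_divide)
 show "fricke rho1 = rho1" using sq nz by (simp add: fricke_def field_simps power2_eq_square)
qed

lemma connected_half_plane [simp]: "connected (half_plane C)"
 by (rule convex_connected[OF convex_half_plane])

text \<open>The quotient of \<open>M8(-1/(2z))\<close> by \<open>z\<^sup>8 M8(z)\<close> has logarithmic derivative
  zero by the law of \<open>M2_star\<close>; the constant is read off at the fixed point
  \<open>\<rho>\<^sub>1\<close>.\<close>

lemma M8_fricke:
 assumes z: "Im z > 0" shows "M8 (fricke z) = 16 * z ^ 8 * M8 z"
proof -
 define f where "f z = M8 (fricke z) / (z ^ 8 * M8 z)" for z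
 have "(f has_field_derivative 0) (at z)" if z: "Im z > 0" for z
 proof -
  have z0: "z ~= 0" using z by auto
  note nz = M8_nonzero[OF z] M8_nonzero[OF fricke_uhp[OF z]]
  have "((%z. M8 (fricke z)) has_field_derivative
    tpi * (M2_star (fricke z) * M8 (fricke z)) * (1 / (2 * z ^ 2))) (at z)"
   by (rule DERIV_chain2[OF has_field_derivative_M8 has_field_derivative_fricke]) (use z z0 in auto)
  also have "tpi * (M2_star (fricke z) * M8 (fricke z)) * (1 / (2 * z ^ 2)) =
    M8 (fricke z) * (tpi * M2_star z + 8 / z)"
   unfolding M2_star_fricke[OF z] using z0 by (simp add: field_simps power2_eq_square)
  finally have num: "((%z. M8 (fricke z)) has_field_derivative
    M8 (fricke z) * (tpi * M2_star z + 8 / z)) (at z)" .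
  have den: "((%z. z ^ 8 * M8 z) has_field_derivative
    z ^ 8 * M8 z * (tpi * M2_star z + 8 / z)) (at z)"
   using z0 by (auto intro!: derivative_eq_intros has_field_derivative_M8[OF z] simp: field_simps eval_nat_numeral)
  show ?thesis
   unfolding f_def[abs_def] using DERIV_divide[OF num den] z0 nz by (simp add: mult_ac)
 qed
 then have "f constant_on uhp"
  by (intro has_field_derivative_0_imp_constant_on) auto
 then have "f z = f rho1" using z rho1_props(1) by (auto simp: constant_on_def)
 also have "\<dots> = 16"
 proof -
  have "rho1 ^ 8 = (rho1 ^ 2) ^ 4" by simp
  then have "rho1 ^ 8 = 1 / 16" unfolding rho1_props(2) by (simp add: power_divide)
  then show ?thesis using M8_nonzero[OF rho1_props(1)] by (simp only: f_def rho1_props(3)) simp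
 qed
 finally have "M8 (fricke z) / (z ^ 8 * M8 z) = 16" by (simp add: f_def)
 moreover have "z ~= 0" using z by auto
 ultimately show ?thesis using M8_nonzero[OF z] by (simp add: field_simps)
qed

section \<open>Reduction to a neighbourhood of the cusp\<close>

lemma eventually_at_ii_inf: "eventually P at_ii_inf \<longleftrightarrow> (\<exists>C. \<forall>z. Im z > C \<longrightarrow> P z)"
proof -
 have "eventually P at_ii_inf \<longleftrightarrow> (\<exists>Q. eventually Q at_top \<and> (\<forall>z. Q (Im z) \<longrightarrow> P z))"
  by (simp add: at_ii_inf_def eventually_filtercomap)
 also have "\<dots> \<longleftrightarrow> (\<exists>C. \<forall>z. Im z > C \<longrightarrow> P z)"
  by (auto simp: eventually_at_top_dense)
 finally show ?thesis .
qed

lemma at_ii_inf_neq_bot [simp]: "at_ii_inf ~= bot"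
proof -
 have "\<exists>z. Im z > C" for C by (rule exI[of _ "Complex 0 (C + 1)"]) simp
 then show ?thesis unfolding trivial_limit_def eventually_at_ii_inf by blast
qed

lemma eventually_Im_gt_at_ii_inf: "eventually (%z. Im z > C) at_ii_inf"
 by (auto simp: eventually_at_ii_inf)

lemma tendsto_qq: "(qq \<longlongrightarrow> 0) at_ii_inf"
proof (rule tendsto_norm_zero_cancel)
 have "filterlim Im at_top at_ii_inf" by (simp add: at_ii_inf_def filterlim_filtercomap)
 then have "filterlim (%z. - (2 * pi) * Im z) at_bot at_ii_inf"
  by (intro filterlim_tendsto_neg_mult_at_bot[OF tendsto_const]) auto
 from exp_at_bot[THEN filterlim_compose, OF this]
 show "((%z. norm (qq z)) \<longlongrightarrow> 0) at_ii_inf" by (simp add: norm_qq)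
qed

lemma tendsto_compose_qq:
 assumes "isCont g 0" shows "((%z. g (qq z)) \<longlongrightarrow> g 0) at_ii_inf"
 using isCont_tendsto_compose[OF assms tendsto_qq] .

lemma translation_int:
 assumes "!!w. Im w > 0 ==> P (w + 1) \<longleftrightarrow> P w" "Im w > 0"
 shows "P (w + of_int n) \<longleftrightarrow> P w"
proof (induction n rule: int_induct[where k = 0])
 case (step1 i)
 then show ?case using assms(1)[of "w + of_int i"] assms(2) by (simp add: add_ac)
next
 case (step2 i)
 then show ?case using assms(1)[of "w + of_int (i - 1)"] assms(2) by (simp add: add_ac)
qed simp

text \<open>Translations and the Fricke involution move every point to height at least \<open>2/5\<close>: below that
  height, the involution increases the height by a fixed factor.\<close>

lemma uhp_reduction_induct:
 assumes z: "Im z > 0"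
  and base: "!!w. Im w >= 2 / 5 ==> \<bar>Re w\<bar> <= 1 / 2 ==> P w"
  and trans: "!!w. Im w > 0 ==> P (w + 1) \<longleftrightarrow> P w"
  and inv: "!!w. Im w > 0 ==> P (fricke w) ==> P w"
 shows "P z"
proof -
 have "\<forall>w. Im w > 0 \<and> Im w >= 2 / 5 * (82 / 100) ^ n \<longrightarrow> P w" for n
 proof (induction n)
  case 0
  show ?case
  proof (intro allI impI)
   fix w :: complex assume w: "Im w > 0 \<and> Im w >= 2 / 5 * (82 / 100) ^ 0"
   have "P (w + of_int (- round (Re w)))"
    using w of_int_round_abs_le[of "Re w"] by (intro base) (auto simp: abs_minus_commute)
   then show "P w" using translation_int[of P w, OF trans] w by blast
  qed
 next
  case (Suc n)
  show ?case
  proof (intro allI impI)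
   fix w :: complex assume w: "Im w > 0 \<and> Im w >= 2 / 5 * (82 / 100) ^ Suc n"
   define v where "v = w + of_int (- round (Re w))"
   have v: "Im v = Im w" "\<bar>Re v\<bar> <= 1 / 2"
    using of_int_round_abs_le[of "Re w"] by (auto simp: v_def abs_minus_commute)
   have "P v"
   proof (cases "Im v >= 2 / 5")
    case False
    have "(norm v) ^ 2 = (Re v) ^ 2 + (Im v) ^ 2" by (rule cmod_power2)
    also have "(Re v) ^ 2 <= (1 / 2) ^ 2" using v(2) by (intro power2_le_iff_abs_le[THEN iffD2]) auto
    also have "(Im v) ^ 2 <= (2 / 5) ^ 2" using False v w by (intro power_mono) auto
    finally have le: "2 * (norm v) ^ 2 <= 82 / 100" by (simp add: power2_eq_square)
    have v0: "v ~= 0" using v w by auto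
    have "2 / 5 * (82 / 100) ^ n <= Im v / (82 / 100)" using w v(1) by simp
    also have "\<dots> <= Im v / (2 * (norm v) ^ 2)"
     using le v w v0 by (intro divide_left_mono) auto
    finally have "Im (fricke v) >= 2 / 5 * (82 / 100) ^ n" by (simp add: Im_fricke)
    then have "P (fricke v)" using Suc.IH fricke_uhp[of v] v w by simp
    then show ?thesis using inv v w by simp
   qed (use base v in auto)
   then show "P w" using translation_int[of P w, OF trans] w unfolding v_def by blast
  qed
 qed
 moreover have "\<exists>n. (82 / 100 :: real) ^ n < Im z * (5 / 2)" using z by (intro real_arch_pow_inv) auto
 then obtain n where "(82 / 100 :: real) ^ n < Im z * (5 / 2)" by blast
 ultimately show ?thesis using z by (metis less_eq_real_def mult.commute mult_less_cancel_right_pos times_divide_eq_left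
    divide_less_eq_numeral1(1) less_divide_eq_numeral1(1) times_divide_eq_right)
qed

text \<open>There is no nonzero cusp form of weight 0, by the maximum principle.\<close>

theorem cusp_form_weight_0_vanishes:
 assumes holo: "f holomorphic_on uhp"
  and trans: "!!w. Im w > 0 ==> f (w + 1) = f w"
  and inv: "!!w. Im w > 0 ==> f (fricke w) = f w"
  and cusp: "(f \<longlongrightarrow> 0) at_ii_inf"
  and z: "Im z > 0"
 shows "f z = 0"
proof (rule ccontr)
 assume nz: "f z ~= 0"
 define e where "e = norm (f z) / 2"
 have e: "e > 0" using nz by (simp add: e_def)
 obtain C where C: "!!w. Im w > C ==> norm (f w) < e"
  using tendstoD[OF cusp e] by (auto simp: eventually_at_ii_inf)
 define D where "D = max C 1"
 define K where "K = cbox (Complex (- 1 / 2) (2 / 5)) (Complex (1 / 2) D)"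
 have K: "w \<in> K \<longleftrightarrow> \<bar>Re w\<bar> <= 1 / 2 \<and> Im w >= 2 / 5 \<and> Im w <= D" for w
  by (auto simp: K_def in_cbox_complex_iff)
 have "compact K" by (simp add: K_def)
 moreover have "\<i> \<in> K" by (simp add: K D_def)
 moreover have "continuous_on K (%w. norm (f w))"
  by (intro continuous_on_norm holomorphic_on_imp_continuous_on holomorphic_on_subset[OF holo]) (auto simp: K)
 ultimately obtain p where p: "p \<in> K" "!!w. w \<in> K ==> norm (f w) <= norm (f p)"
  using continuous_attains_sup[of K "%w. norm (f w)"] by blast
 have bound: "norm (f w) <= max (norm (f p)) e" if "Im w > 0" for w
  using that
 proof (rule uhp_reduction_induct)
  fix w assume "Im w >= 2 / 5" "\<bar>Re w\<bar> <= 1 / 2"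
  then show "norm (f w) <= max (norm (f p)) e"
   using p(2)[of w] C[of w] by (cases "Im w <= D") (auto simp: K D_def max_def split: if_splits)
 qed (auto simp: trans inv)
 have "norm (f z) <= max (norm (f p)) e" by (rule bound[OF z])
 then have "e <= norm (f p)" using e by (auto simp: e_def max_def split: if_splits)
 with bound have "norm (f w) <= norm (f p)" if "Im w > 0" for w using that by fastforce
 then have "f constant_on uhp"
  by (intro maximum_modulus_principle[OF holo, where U = uhp and \<xi> = p]) (use p(1) in \<open>auto simp: K\<close>)
 then obtain c where c: "!!w. Im w > 0 ==> f w = c" by (auto simp: constant_on_def)
 have "eventually (%w. c = f w) at_ii_inf"
  using eventually_Im_gt_at_ii_inf[of 0] by eventually_elim (simp add: c)
 with cusp have "((%_. c) \<longlongrightarrow> 0) at_ii_inf" by (simp add: tendsto_cong)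
 then have "c = 0" by (simp add: tendsto_const_iff)
 with nz c[OF z] show False by simp
qed

section \<open>Algebraic relations between the forms of level 2\<close>

text \<open>The fourth power of \<open>f\<close>, divided by a power of \<open>M8\<close>, which has no zeros, has
  weight 0; it vanishes at the cusp if the order of \<open>f\<close> there is large enough.\<close>

lemma level2_form_vanishes:
 assumes holo: "f holomorphic_on uhp"
  and trans: "!!w. Im w > 0 ==> f (w + 1) = f w"
  and inv: "!!w. Im w > 0 ==> f (fricke w) = (2 * w ^ 2) ^ j * f w"
  and nome: "!!w. Im w > 0 ==> f w = qq w ^ a * h (qq w)" and h: "isCont h 0"
  and order: "j < 4 * a" and z: "Im z > 0"
 shows "f z = 0"
proof -
 have "f z ^ 4 / M8 z ^ j = 0"
 proof (rule cusp_form_weight_0_vanishes[where f = "%z. f z ^ 4 / M8 z ^ j"])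
  show "(%z. f z ^ 4 / M8 z ^ j) holomorphic_on uhp"
   by (intro holomorphic_intros holo holomorphic_level2) (auto simp: M8_nonzero)
  show "f (w + 1) ^ 4 / M8 (w + 1) ^ j = f w ^ 4 / M8 w ^ j" if "Im w > 0" for w
   using that by (simp add: trans level2_translation)
  show "f (fricke w) ^ 4 / M8 (fricke w) ^ j = f w ^ 4 / M8 w ^ j" if "Im w > 0" for w
  proof -
   have w0: "w ~= 0" using that by auto
   have "M8 (fricke w) = (2 * w ^ 2) ^ 4 * M8 w" using M8_fricke[OF that] by simp
   moreover have "(x ^ 4 * y) ^ j = (x ^ j) ^ 4 * y ^ j" for x y :: complex
    by (simp only: power_mult_distrib power_mult [symmetric] mult.commute[of j 4])
   ultimately have "M8 (fricke w) ^ j = ((2 * w ^ 2) ^ j) ^ 4 * M8 w ^ j" by (simp only:)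
   moreover have "f (fricke w) ^ 4 = ((2 * w ^ 2) ^ j) ^ 4 * f w ^ 4"
    by (simp only: inv[OF that] power_mult_distrib)
   moreover have "((2 * w ^ 2) ^ j) ^ 4 ~= 0" using w0 by simp
   ultimately show ?thesis using mult_divide_mult_cancel_left by metis
  qed
  have cont: "isCont M8_nome 0"
   using holomorphic_on_imp_continuous_on[OF holomorphic_nome(4)]
   by (simp add: continuous_on_eq_continuous_at)
  have "((%w. qq w ^ (4 * a - j) * h (qq w) ^ 4 / M8_nome (qq w) ^ j) \<longlongrightarrow> 0 ^ (4 * a - j) * h 0 ^ 4 / M8_nome 0 ^ j) at_ii_inf"
   using M8_nome_nonzero[of 0] by (intro tendsto_intros tendsto_qq tendsto_compose_qq h cont) auto
  moreover have "(0 :: complex) ^ (4 * a - j) = 0" using order by (simp add: power_0_left)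
  ultimately have lim: "((%w. qq w ^ (4 * a - j) * h (qq w) ^ 4 / M8_nome (qq w) ^ j) \<longlongrightarrow> 0) at_ii_inf"
   by simp
  show "((%z. f z ^ 4 / M8 z ^ j) \<longlongrightarrow> 0) at_ii_inf"
  proof (rule Lim_transform_eventually[OF lim])
   show "\<forall>\<^sub>F w in at_ii_inf. qq w ^ (4 * a - j) * h (qq w) ^ 4 / M8_nome (qq w) ^ j = f w ^ 4 / M8 w ^ j"
    using eventually_Im_gt_at_ii_inf[of 0]
   proof eventually_elim
    case (elim w)
    have "qq w ^ (a * 4) = qq w ^ (4 * a - j) * qq w ^ j"
     using order by (simp add: mult.commute flip: power_add)
    then show ?case
     using M8_nome_nonzero[OF norm_qq_less_1[OF elim]]
     by (simp add: nome[OF elim] M8_eq[OF elim] power_mult_distrib power_mult [symmetric])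
   qed
  qed
 qed (use z in auto)
 then show ?thesis using M8_nonzero[OF z] by simp
qed

lemma divide_by_nome:
 assumes "g holomorphic_on ball 0 1" "g 0 = 0"
 obtains h where "h holomorphic_on ball 0 1" "!!x. g x = x * h x" "h 0 = deriv g 0"
proof
 show "(%z. if z = 0 then deriv g 0 else (g z - g 0) / (z - 0)) holomorphic_on ball 0 1"
  by (rule pole_lemma_open[OF assms(1)]) auto
qed (use assms(2) in auto)

lemma holomorphic_unit_disc_isCont: "g holomorphic_on ball 0 1 ==> isCont g 0"
 using holomorphic_on_imp_continuous_on by (force simp: continuous_on_eq_continuous_at)

lemma qq_surj:
 assumes "x ~= 0" "norm x < exp (- 2 * pi * C)"
 obtains z where "Im z > C" "qq z = x"
proof
 define z where "z = Ln x / tpi"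
 show "qq z = x" using assms(1) by (simp add: z_def qq_def)
 have "norm x = exp (- 2 * pi * Im z)" using norm_qq[of z] \<open>qq z = x\<close> by simp
 then show "Im z > C" using assms(2) by simp
qed

text \<open>The nome maps the half-plane onto the punctured disc, so identities between forms are identities between
  functions of the nome.\<close>

lemma nome_function_zero:
 assumes g: "g holomorphic_on ball 0 1" and "!!z. Im z > 0 ==> g (qq z) = 0" and x: "norm x < 1"
 shows "g x = 0"
proof (cases "x = 0")
 case False
 then show ?thesis using qq_surj[of x 0] assms by auto
next
 case True
 have "((%z. g (qq z)) \<longlongrightarrow> g 0) at_ii_inf"
  by (rule tendsto_compose_qq[OF holomorphic_unit_disc_isCont[OF g]])
 moreover have "eventually (%z. g (qq z) = 0) at_ii_inf"
  using eventually_Im_gt_at_ii_inf[of 0] by eventually_elim (simp add: assms)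
 then have "((%z. g (qq z)) \<longlongrightarrow> 0) at_ii_inf" by (simp add: tendsto_cong)
 ultimately show ?thesis using tendsto_unique[OF at_ii_inf_neq_bot] True by blast
qed

lemma level2_nome_vanishes:
 assumes g: "g holomorphic_on ball 0 1" "g 0 = 0"
  and inv: "!!w. Im w > 0 ==> g (qq (fricke w)) = (2 * w ^ 2) ^ j * g (qq w)"
  and order: "j < 4 \<or> j < 8 \<and> deriv g 0 = 0"
  and x: "norm x < 1"
 shows "g x = 0"
proof (rule nome_function_zero[OF g(1) _ x])
 fix z :: complex assume z: "Im z > 0"
 obtain h where h: "h holomorphic_on ball 0 1" "!!x. g x = x * h x" "h 0 = deriv g 0"
  by (rule divide_by_nome[OF g]) (rule that; assumption)
 have holo: "(%z. g (qq z)) holomorphic_on uhp" by (rule holomorphic_compose_qq[OF g(1)])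
 show "g (qq z) = 0"
 proof (cases "j < 4")
  case True
  show ?thesis
   by (rule level2_form_vanishes[where f = "%z. g (qq z)" and a = 1 and h = h and j = j])
     (use True z h holo inv holomorphic_unit_disc_isCont in auto)
 next
  case False
  then have "h 0 = 0" "j < 8" using order h(3) by auto
  obtain k where k: "k holomorphic_on ball 0 1" "!!x. h x = x * k x" "k 0 = deriv h 0"
   by (rule divide_by_nome[OF h(1) \<open>h 0 = 0\<close>]) (rule that; assumption)
  show ?thesis
   by (rule level2_form_vanishes[where f = "%z. g (qq z)" and a = 2 and h = k and j = j])
     (use \<open>j < 8\<close> z h k holo inv holomorphic_unit_disc_isCont in \<open>auto simp: power2_eq_square\<close>)
 qed
qed

lemma sigma_series_0 [simp]: "sigma_series k 0 = 0"
 by (simp add: sigma_series_def pow_series_def)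

lemma sigma_pow_1 [simp]: "sigma_pow k (Suc 0) = 1"
 by (simp add: sigma_pow_def)

lemma has_field_derivative_sigma_series_0:
 "(sigma_series k has_field_derivative 1) (at 0)"
 using has_field_derivative_pow_series[OF poly_growth_sigma, of 0 k]
 by (simp add: sigma_series_def pow_series_def)

lemma has_field_derivative_sigma_series_square_0:
 "((%x. sigma_series k (x ^ 2)) has_field_derivative 0) (at 0)"
proof -
 have "(sigma_series k has_field_derivative 1) (at ((0 :: complex) ^ 2))"
  using has_field_derivative_sigma_series_0 by simp
 moreover have "((%x :: complex. x ^ 2) has_field_derivative 0) (at 0)"
  by (auto intro!: derivative_eq_intros)
 ultimately show ?thesis
  using DERIV_chain2[where f = "sigma_series k" and g = "%x. x ^ 2"] by fastforce
qed

lemmas sigma_series_derivative_0 =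
 has_field_derivative_sigma_series_0 has_field_derivative_sigma_series_square_0

lemma nome_at_0 [simp]:
 "M2_nome 0 = 1" "M4_nome 0 = 1" "M6_nome 0 = 1" "M2_star_nome 0 = 1" "M8_nome 0 = 1"
proof -
 have "euler_product 0 = 1" unfolding euler_product_def by simp
 then show "M8_nome 0 = 1" by (simp add: M8_nome_def)
qed (simp_all add: M2_nome_def M4_nome_def M6_nome_def M2_star_nome_def)

lemma nome_derivative_0:
 "(M2_nome has_field_derivative 24) (at 0)" "(M4_nome has_field_derivative 48) (at 0)"
 "(M6_nome has_field_derivative - 56) (at 0)" "(M2_star_nome has_field_derivative - 8) (at 0)"
 unfolding M2_nome_def[abs_def] M4_nome_def[abs_def] M6_nome_def[abs_def] M2_star_nome_def[abs_def]
 by (auto intro!: derivative_eq_intros sigma_series_derivative_0)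

text \<open>The space of forms of weight 4 is spanned by \<open>M2\<^sup>2\<close>. Comparing coefficients also
  determines the constant term that the lattice sum left open.\<close>

theorem M4_eq_M2_square:
 assumes z: "Im z > 0" shows "M4 z = M2 z ^ 2"
proof -
 obtain c where c: "!!t. Im t > 0 ==>
   c + sigma_series 3 (qq (- 1 / t)) = t ^ 4 * (c + sigma_series 3 (qq t))"
  using eisenstein_inversion[of 4] by (auto simp: sigma_series_def)
 define g where "g x = 4 * (c + sigma_series 3 (x ^ 2)) + (c + sigma_series 3 x) - 5 * c * M2_nome x ^ 2" for x
 have holo: "g holomorphic_on ball 0 1"
  unfolding g_def by (intro holomorphic_intros holomorphic_sigma_series holomorphic_sigma_series_square holomorphic_nome)
 have g0: "g x = 0" if "norm x < 1" for x
 proof (rule level2_nome_vanishes[OF holo _ _ _ that, where j = 2])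
  fix w :: complex assume w: "Im w > 0"
  have Gw: "c + sigma_series 3 (qq (fricke w)) = (2 * w) ^ 4 * (c + sigma_series 3 (qq w ^ 2))"
   using c[of "2 * w"] w unfolding qq_double fricke_def by simp
  have "qq (fricke w) ^ 2 = qq (- 1 / w)" by (simp only: qq_double [symmetric] double_fricke)
  then have G2w: "c + sigma_series 3 (qq (fricke w) ^ 2) = w ^ 4 * (c + sigma_series 3 (qq w))"
   using c[OF w] by simp
  have "M2_nome (qq (fricke w)) = - (2 * w ^ 2) * M2_nome (qq w)"
   using M2_fricke[OF w] w by (simp add: M2_eq)
  then show "g (qq (fricke w)) = (2 * w ^ 2) ^ 2 * g (qq w)"
   unfolding g_def Gw G2w by (simp add: algebra_simps power2_eq_square eval_nat_numeral)
 qed (simp_all add: g_def)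
 have "(g has_field_derivative 1 - 5 * c * 48) (at 0)"
  unfolding g_def[abs_def]
  by (auto intro!: derivative_eq_intros sigma_series_derivative_0 nome_derivative_0)
 moreover have "(g has_field_derivative 0) (at 0)"
  by (rule has_field_derivative_transform_within_open[of "%_. 0" _ _ "ball 0 1"]) (auto simp: g0)
 ultimately have "1 - 5 * c * 48 = 0" by (rule DERIV_unique)
 then have c: "c = 1 / 240" by (simp add: field_simps)
 have "48 * g (qq z) = 0" using g0[OF norm_qq_less_1[OF z]] by simp
 then show ?thesis
  using z unfolding g_def c by (simp add: M4_eq M2_eq M4_nome_def algebra_simps)
qed

definition D_M2_nome :: "complex => complex" where "D_M2_nome x = x * deriv M2_nome x"

lemma deriv_M2: "Im z > 0 ==> (M2 has_field_derivative tpi * D_M2_nome (qq z)) (at z)"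
 unfolding D_M2_nome_def
 by (rule has_field_derivative_transform_within_open[OF has_field_derivative_compose_qq[OF holomorphic_nome(1)], where S = uhp])
   (auto simp: M2_eq)

text \<open>\<open>N4 = M6 / M2\<close> is \<open>-4\<close> times the Serre derivative of \<open>M2\<close>; the inhomogeneous terms in the
  transformation laws of \<open>M2_star\<close> and of the derivative cancel, so it is a form of weight 4.\<close>

definition N4_nome :: "complex => complex" where
 "N4_nome x = M2_nome x * M2_star_nome x - 4 * D_M2_nome x"

definition N4 :: "complex => complex" where "N4 z = N4_nome (qq z)"

lemma N4_fricke:
 assumes w: "Im w > 0" shows "N4 (fricke w) = - (4 * w ^ 4) * N4 w"
proof -
 have w0: "w ~= 0" using w by auto
 have "((%w. M2 (fricke w)) has_field_derivative tpi * D_M2_nome (qq (fricke w)) * (1 / (2 * w ^ 2))) (at w)"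
  by (rule DERIV_chain2[OF deriv_M2 has_field_derivative_fricke]) (use w w0 in auto)
 moreover have "((%w. - (2 * w ^ 2) * M2 w) has_field_derivative
   - (4 * w) * M2 w - 2 * w ^ 2 * (tpi * D_M2_nome (qq w))) (at w)"
  by (auto intro!: derivative_eq_intros deriv_M2[OF w])
 then have "((%w. M2 (fricke w)) has_field_derivative
   - (4 * w) * M2 w - 2 * w ^ 2 * (tpi * D_M2_nome (qq w))) (at w)"
  by (rule has_field_derivative_transform_within_open[where S = uhp]) (use w M2_fricke in auto)
 ultimately have "tpi * D_M2_nome (qq (fricke w)) * (1 / (2 * w ^ 2)) =
   - (4 * w) * M2 w - 2 * w ^ 2 * (tpi * D_M2_nome (qq w))"
  by (rule DERIV_unique)
 then have D: "D_M2_nome (qq (fricke w)) = - 4 * w ^ 3 * M2 w / (of_real pi * \<i>) - 4 * w ^ 4 * D_M2_nome (qq w)"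
  using w0 by (simp add: field_simps eval_nat_numeral)
 have "M2_nome (qq (fricke w)) = - (2 * w ^ 2) * M2 w" using M2_fricke[OF w] w by (simp add: M2_eq)
 moreover have "M2_star_nome (qq (fricke w)) = 2 * w ^ 2 * M2_star w + 8 * w / (of_real pi * \<i>)"
  using M2_star_fricke[OF w] w by (simp add: M2_star_eq)
 moreover have "(- (2 * w ^ 2) * a) * (2 * w ^ 2 * b + 8 * w / p) -
   4 * (- 4 * w ^ 3 * a / p - 4 * w ^ 4 * d) = - (4 * w ^ 4) * (a * b - 4 * d)" for a b d p :: complex
  by (simp add: algebra_simps eval_nat_numeral)
 ultimately show ?thesis
  unfolding N4_def N4_nome_def D M2_eq[OF w, symmetric] M2_star_eq[OF w, symmetric] by simp
qed

lemma holomorphic_N4_nome: "N4_nome holomorphic_on ball 0 1"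
 unfolding N4_nome_def[abs_def] D_M2_nome_def[abs_def]
 by (intro holomorphic_intros holomorphic_deriv holomorphic_nome) auto

lemma holomorphic_N4: "N4 holomorphic_on uhp"
 unfolding N4_def[abs_def] by (rule holomorphic_compose_qq[OF holomorphic_N4_nome])

lemma N4_nome_0: "N4_nome 0 = 1" "(N4_nome has_field_derivative - 80) (at 0)"
proof -
 have "deriv M2_nome 0 = 24" by (rule DERIV_imp_deriv[OF nome_derivative_0(1)])
 moreover have "((deriv M2_nome) has_field_derivative deriv (deriv M2_nome) 0) (at 0)"
  by (rule holomorphic_derivI[where S = "ball 0 1"]) (auto intro!: holomorphic_deriv holomorphic_nome)
 ultimately have D0: "(D_M2_nome has_field_derivative 24) (at 0)" "D_M2_nome 0 = 0"
  unfolding D_M2_nome_def[abs_def] by (auto intro!: derivative_eq_intros)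
 then show "N4_nome 0 = 1" by (simp add: N4_nome_def)
 show "(N4_nome has_field_derivative - 80) (at 0)"
  unfolding N4_nome_def[abs_def] by (auto intro!: derivative_eq_intros nome_derivative_0 D0)
qed

text \<open>Both sides are forms of weight 6 with constant term 1; they agree to the order that forces a form of this
  weight to vanish.\<close>

theorem M6_eq_M2_N4:
 assumes z: "Im z > 0" shows "M6 z = M2 z * N4 z"
proof -
 obtain c where c: "!!t. Im t > 0 ==>
   c + sigma_series 5 (qq (- 1 / t)) = t ^ 6 * (c + sigma_series 5 (qq t))"
  using eisenstein_inversion[of 6] by (auto simp: sigma_series_def)
 define g where "g x = 8 * (c + sigma_series 5 (x ^ 2)) + (c + sigma_series 5 x) - 9 * c * (M2_nome x * N4_nome x)" for x
 have holo: "g holomorphic_on ball 0 1"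
  unfolding g_def by (intro holomorphic_intros holomorphic_sigma_series holomorphic_sigma_series_square
    holomorphic_nome holomorphic_N4_nome)
 have g0: "g x = 0" if "norm x < 1" for x
 proof (rule level2_nome_vanishes[OF holo _ _ _ that, where j = 3])
  fix w :: complex assume w: "Im w > 0"
  have Gw: "c + sigma_series 5 (qq (fricke w)) = (2 * w) ^ 6 * (c + sigma_series 5 (qq w ^ 2))"
   using c[of "2 * w"] w unfolding qq_double fricke_def by simp
  have "qq (fricke w) ^ 2 = qq (- 1 / w)" by (simp only: qq_double [symmetric] double_fricke)
  then have G2w: "c + sigma_series 5 (qq (fricke w) ^ 2) = w ^ 6 * (c + sigma_series 5 (qq w))"
   using c[OF w] by simp
  have MN: "M2_nome (qq (fricke w)) = - (2 * w ^ 2) * M2_nome (qq w)"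
    "N4_nome (qq (fricke w)) = - (4 * w ^ 4) * N4_nome (qq w)"
   using M2_fricke[OF w] N4_fricke[OF w] w by (simp_all add: M2_eq N4_def)
  show "g (qq (fricke w)) = (2 * w ^ 2) ^ 3 * g (qq w)"
   unfolding g_def Gw G2w MN by (simp add: algebra_simps eval_nat_numeral)
 qed (simp_all add: g_def N4_nome_0)
 have "(g has_field_derivative 1 - 9 * c * (- 56)) (at 0)"
  unfolding g_def[abs_def]
  by (auto intro!: derivative_eq_intros sigma_series_derivative_0 nome_derivative_0 N4_nome_0 simp: N4_nome_0(1))
 moreover have "(g has_field_derivative 0) (at 0)"
  by (rule has_field_derivative_transform_within_open[of "%_. 0" _ _ "ball 0 1"]) (auto simp: g0)
 ultimately have "1 - 9 * c * (- 56) = 0" by (rule DERIV_unique)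
 then have "9 * 56 * c = - 1" by (simp add: eq_neg_iff_add_eq_0 algebra_simps)
 then have c: "c = - 1 / 504" by (simp add: field_simps)
 have "56 * g (qq z) = 0" using g0[OF norm_qq_less_1[OF z]] by simp
 then have "M6_nome (qq z) = M2_nome (qq z) * N4_nome (qq z)"
  unfolding g_def c by (simp add: M6_nome_def algebra_simps)
 then show ?thesis using z by (simp add: M6_eq M2_eq N4_def)
qed

text \<open>The difference is a form of weight 8 whose first two coefficients vanish.\<close>

theorem N4_square:
 assumes z: "Im z > 0" shows "N4 z ^ 2 = M2 z ^ 4 - 256 * M8 z"
proof -
 define g where "g x = N4_nome x ^ 2 - (M2_nome x ^ 4 - 256 * (x * M8_nome x))" for x
 have holo: "g holomorphic_on ball 0 1"
  unfolding g_def by (intro holomorphic_intros holomorphic_nome holomorphic_N4_nome)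
 have M8d: "(M8_nome has_field_derivative deriv M8_nome 0) (at 0)"
  by (rule holomorphic_derivI[OF holomorphic_nome(4)]) auto
 have "(g has_field_derivative 0) (at 0)"
  unfolding g_def[abs_def] by (auto intro!: derivative_eq_intros nome_derivative_0 N4_nome_0 M8d simp: N4_nome_0(1))
 then have "deriv g 0 = 0" by (rule DERIV_imp_deriv)
 have "g (qq z) = 0"
 proof (rule level2_nome_vanishes[OF holo _ _ _ norm_qq_less_1[OF z], where j = 4])
  fix w :: complex assume w: "Im w > 0"
  have eq: "g (qq v) = N4 v ^ 2 - (M2 v ^ 4 - 256 * M8 v)" if "Im v > 0" for v
   using that by (simp add: g_def N4_def M2_eq M8_eq)
  show "g (qq (fricke w)) = (2 * w ^ 2) ^ 4 * g (qq w)"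
   unfolding eq[OF w] eq[OF fricke_uhp[OF w]] N4_fricke[OF w] M2_fricke[OF w] M8_fricke[OF w]
   by (simp add: algebra_simps power_mult_distrib flip: power_mult)
 qed (use \<open>deriv g 0 = 0\<close> in \<open>simp_all add: g_def N4_nome_0\<close>)
 then show ?thesis using z by (simp add: g_def N4_def M2_eq M8_eq)
qed

lemma has_field_derivative_M2:
 assumes z: "Im z > 0"
 shows "(M2 has_field_derivative tpi * ((M2 z * M2_star z - N4 z) / 4)) (at z)"
 using deriv_M2[OF z] z by (simp add: N4_def N4_nome_def M2_eq M2_star_eq)

section \<open>The Hauptmodul\<close>

text \<open>A function invariant under the whole group with a simple pole at the cusp.\<close>

definition hauptmodul :: "complex => complex" where "hauptmodul z = M2 z ^ 4 / M8 z"

lemma holomorphic_hauptmodul: "hauptmodul holomorphic_on uhp"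
 unfolding hauptmodul_def[abs_def] by (intro holomorphic_intros holomorphic_level2) (auto simp: M8_nonzero)

lemma hauptmodul_translation: "Im z > 0 ==> hauptmodul (z + 1) = hauptmodul z"
 by (simp add: hauptmodul_def level2_translation)

lemma hauptmodul_fricke:
 assumes z: "Im z > 0" shows "hauptmodul (fricke z) = hauptmodul z"
proof -
 have "z ~= 0" using z by auto
 then show ?thesis
  by (simp add: hauptmodul_def M2_fricke[OF z] M8_fricke[OF z] power_mult_distrib flip: power_mult)
qed

lemma has_field_derivative_hauptmodul:
 assumes z: "Im z > 0"
 shows "(hauptmodul has_field_derivative - 2 * of_real pi * \<i> * (M2 z ^ 3 * N4 z / M8 z)) (at z)"
proof -
 define p where "p = tpi"
 define m m8 ms n where "m = M2 z" and "m8 = M8 z" and "ms = M2_star z" and "n = N4 z"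
 have nz: "m8 ~= 0" using M8_nonzero[OF z] by (simp add: m8_def)
 have "(M2 has_field_derivative p * ((m * ms - n) / 4)) (at z)"
  using has_field_derivative_M2[OF z] by (simp add: p_def m_def ms_def n_def)
 from DERIV_power[OF this, of 4]
 have num: "((%z. M2 z ^ 4) has_field_derivative p * m ^ 3 * (m * ms - n)) (at z)"
  by (rule DERIV_cong) (simp add: m_def [symmetric] eval_nat_numeral)
 have den: "(M8 has_field_derivative p * (ms * m8)) (at z)"
  using has_field_derivative_M8[OF z] by (simp add: p_def ms_def m8_def)
 have "(hauptmodul has_field_derivative
   ((p * m ^ 3 * (m * ms - n)) * m8 - m ^ 4 * (p * (ms * m8))) / (m8 * m8)) (at z)"
  unfolding hauptmodul_def[abs_def] using DERIV_divide[OF num den] nz by (simp add: m_def m8_def)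
 also have "((p * m ^ 3 * (m * ms - n)) * m8 - m ^ 4 * (p * (ms * m8))) / (m8 * m8) = - p * (m ^ 3 * n / m8)"
  using nz by (simp add: field_simps eval_nat_numeral)
 finally show ?thesis by (simp add: p_def m_def m8_def n_def)
qed

text \<open>The Hauptmodul ramifies at most over \<open>0\<close> and \<open>256\<close>.\<close>

lemma hauptmodul_eq_0_iff: "Im z > 0 ==> hauptmodul z = 0 \<longleftrightarrow> M2 z = 0"
 by (simp add: hauptmodul_def M8_nonzero)

lemma hauptmodul_eq_256_iff: "Im z > 0 ==> hauptmodul z = 256 \<longleftrightarrow> N4 z = 0"
 using N4_square[of z] M8_nonzero[of z] by (auto simp: hauptmodul_def field_simps)

lemma deriv_hauptmodul_nonzero:
 assumes "Im z > 0" "hauptmodul z ~= 0" "hauptmodul z ~= 256" shows "deriv hauptmodul z ~= 0"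
 using assms DERIV_imp_deriv[OF has_field_derivative_hauptmodul[OF assms(1)]]
 by (simp add: hauptmodul_eq_0_iff hauptmodul_eq_256_iff M8_nonzero)

text \<open>At a common zero of \<open>M2\<close> and its derivative \<open>N4\<close> would vanish too, and then
  \<open>M8\<close> by the relation \<open>N4\<^sup>2 = M2\<^sup>4 - 256 M8\<close>.\<close>

lemma deriv_M2_nonzero:
 assumes z: "Im z > 0" and "M2 z = 0" shows "deriv M2 z ~= 0"
proof -
 have "N4 z ~= 0" using N4_square[OF z] M8_nonzero[OF z] assms(2) by auto
 then show ?thesis
  using DERIV_imp_deriv[OF has_field_derivative_M2[OF z]] assms(2) by simp
qed

text \<open>Where \<open>N4\<close> vanishes, so does the derivative of the Hauptmodul, and dividing by \<open>N4\<close> the two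
  expressions of that derivative shows that the zero of \<open>N4\<close> is simple.\<close>

lemma deriv_N4_nonzero:
 assumes z: "Im z > 0" and N: "N4 z = 0" shows "deriv N4 z ~= 0"
proof
 assume D0: "deriv N4 z = 0"
 define p where "p = tpi"
 define E where "E w = 2 * deriv N4 w - p * (M2_star w * N4 w) + p * M2 w ^ 3" for w
 have eq: "N4 w * E w = 0" if w: "Im w > 0" for w
 proof -
  have nz: "M8 w ~= 0" using M8_nonzero[OF w] .
  have dN: "(N4 has_field_derivative deriv N4 w) (at w)"
   by (rule holomorphic_derivI[OF holomorphic_N4]) (use w in auto)
  have dM8: "(M8 has_field_derivative p * (M2_star w * M8 w)) (at w)"
   unfolding p_def by (rule has_field_derivative_M8[OF w])
  have "((%w. N4 w ^ 2 / M8 w) has_field_derivative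
    ((2 * N4 w * deriv N4 w) * M8 w - N4 w ^ 2 * (p * (M2_star w * M8 w))) / (M8 w * M8 w)) (at w)"
   using DERIV_divide[OF DERIV_power[OF dN, of 2] dM8 nz] by (rule DERIV_cong) simp
  then have "((%w. hauptmodul w - 256) has_field_derivative
    ((2 * N4 w * deriv N4 w) * M8 w - N4 w ^ 2 * (p * (M2_star w * M8 w))) / (M8 w * M8 w)) (at w)"
   by (rule has_field_derivative_transform_within_open[where S = uhp])
     (use w N4_square M8_nonzero in \<open>auto simp: hauptmodul_def field_simps\<close>)
  moreover have "((%w. hauptmodul w - 256) has_field_derivative - p * (M2 w ^ 3 * N4 w / M8 w)) (at w)"
   unfolding p_def using has_field_derivative_hauptmodul[OF w] by (auto intro!: derivative_eq_intros)
  ultimately have "((2 * N4 w * deriv N4 w) * M8 w - N4 w ^ 2 * (p * (M2_star w * M8 w))) / (M8 w * M8 w) =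
    - p * (M2 w ^ 3 * N4 w / M8 w)" by (rule DERIV_unique)
  moreover have "n * (2 * d - p * (s * n) + p * b) = 0"
   if "(2 * n * d * m - n ^ 2 * (p * (s * m))) / (m * m) = - p * (b * n / m)" "m ~= 0" for b d n m s :: complex
  proof -
   have "(2 * n * d * m - n ^ 2 * (p * (s * m))) / (m * m) = n * (2 * d - p * (s * n)) / m"
    using that(2) by (simp add: field_simps power2_eq_square)
   with that have "n * (2 * d - p * (s * n)) / m = - p * (b * n) / m" by simp
   then have "n * (2 * d - p * (s * n)) = - p * (b * n)" using that(2) by (auto simp only: divide_cancel_right)
   then show ?thesis by (simp add: algebra_simps)
  qed
  ultimately show ?thesis unfolding E_def using nz by blast
 qed
 have holoE: "E holomorphic_on uhp"
  unfolding E_def[abs_def] by (intro holomorphic_intros holomorphic_level2 holomorphic_N4 holomorphic_deriv) auto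
 have "M2 z ~= 0" using N4_square[OF z] N M8_nonzero[OF z] by auto
 then have "E z ~= 0" using N D0 by (simp add: E_def p_def)
 moreover have "isCont E z"
  using holomorphic_on_imp_continuous_on[OF holoE] z by (simp add: continuous_on_eq_continuous_at)
 ultimately obtain r where r: "r > 0" "!!w. dist z w < r ==> E w ~= 0"
  using continuous_at_avoid[of z E 0] by auto
 have zero: "N4 w = 0" if "w \<in> uhp" for w
 proof (rule analytic_continuation_open[where s = "ball z r \<inter> uhp" and s' = uhp and f = N4 and g = "%_. 0"])
  show "N4 v = 0" if "v \<in> ball z r \<inter> uhp" for v using eq[of v] r(2)[of v] that by auto
  have "z \<in> ball z r \<inter> uhp" using z r(1) by simp
  then show "ball z r \<inter> uhp ~= {}" by blast
 qed (use that in \<open>auto intro: holomorphic_N4\<close>)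
 have "N4_nome 0 = 0"
  by (rule nome_function_zero[OF holomorphic_N4_nome]) (use zero in \<open>auto simp: N4_def\<close>)
 then show False by (simp add: N4_nome_0)
qed

section \<open>The group and its action\<close>

text \<open>The infix for coefficients of power series would make the notation for matrix entries ambiguous.\<close>

no_notation fps_nth (infixl "$" 75)

definition mat2 :: "real => real => real => real => real^2^2" where
 "mat2 a b c d = vector [vector [a, b], vector [c, d]]"

lemma mat2_nth [simp]:
 "mat2 a b c d $ 1 $ 1 = a" "mat2 a b c d $ 1 $ 2 = b" "mat2 a b c d $ 2 $ 1 = c" "mat2 a b c d $ 2 $ 2 = d"
 by (simp_all only: mat2_def vector_2)

lemma mat2_eq_iff: "A = B \<longleftrightarrow> A $ 1 $ 1 = B $ 1 $ 1 \<and> A $ 1 $ 2 = B $ 1 $ 2 \<and> A $ 2 $ 1 = B $ 2 $ 1 \<and> A $ 2 $ 2 = (B :: real^2^2) $ 2 $ 2"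
 by (auto simp: vec_eq_iff forall_2)

lemma mat2_eta: "mat2 (A $ 1 $ 1) (A $ 1 $ 2) (A $ 2 $ 1) (A $ 2 $ 2) = A"
 by (simp add: mat2_eq_iff)

lemma mat2_mult: "mat2 a b c d ** mat2 a' b' c' d' = mat2 (a * a' + b * c') (a * b' + b * d') (c * a' + d * c') (c * b' + d * d')"
 by (simp add: mat2_eq_iff matrix_matrix_mult_def sum_2)

lemma mat2_one: "mat 1 = mat2 1 0 0 1"
 by (simp add: mat2_eq_iff mat_def)

lemma det_mat2: "det (mat2 a b c d) = a * d - b * c"
 by (simp add: det_2)

lemma automorphy_mat2: "automorphy (mat2 a b c d) z = of_real c * z + of_real d"
 by (simp add: automorphy_def)

lemma moebius_mat2: "moebius (mat2 a b c d) z = (of_real a * z + of_real b) / (of_real c * z + of_real d)"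
 by (simp add: moebius_def automorphy_def)

text \<open>The numbers \<open>c\<close> and \<open>d\<close> are not both zero, and \<open>z\<close> is not
  real.\<close>

lemma automorphy_nonzero:
 assumes "det A = 1" "Im z > 0" shows "automorphy A z ~= 0"
proof
 assume 0: "automorphy A z = 0"
 from arg_cong[OF this, of Im] assms(2) have "A $ 2 $ 1 = 0" by (simp add: automorphy_def)
 moreover with 0 have "A $ 2 $ 2 = 0" by (simp add: automorphy_def)
 ultimately show False using assms(1) by (simp add: det_2)
qed

lemma Im_moebius:
 assumes "det A = 1" "Im z > 0" shows "Im (moebius A z) = Im z / (norm (automorphy A z)) ^ 2"
proof -
 define w where "w = automorphy A z"
 have "Im ((of_real (A $ 1 $ 1) * z + of_real (A $ 1 $ 2)) * cnj w) = det A * Im z"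
  by (simp add: w_def automorphy_def det_2 algebra_simps)
 moreover have "moebius A z = (of_real (A $ 1 $ 1) * z + of_real (A $ 1 $ 2)) * cnj w / of_real ((norm w) ^ 2)"
  unfolding moebius_def w_def [symmetric] by (subst complex_div_cnj) simp
 ultimately show ?thesis using assms(1) by (simp add: w_def Im_divide_of_real)
qed

lemma moebius_uhp:
 assumes "det A = 1" "Im z > 0" shows "Im (moebius A z) > 0"
 unfolding Im_moebius[OF assms] using automorphy_nonzero[OF assms] assms(2) by simp

lemma automorphy_mult:
 assumes "det B = 1" "Im z > 0"
 shows "automorphy (A ** B) z = automorphy A (moebius B z) * automorphy B z"
proof -
 have "moebius B z * automorphy B z = of_real (B $ 1 $ 1) * z + of_real (B $ 1 $ 2)"
  using automorphy_nonzero[OF assms] by (simp add: moebius_def)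
 moreover have "automorphy (A ** B) z = of_real (A $ 2 $ 1) * (of_real (B $ 1 $ 1) * z + of_real (B $ 1 $ 2)) +
   of_real (A $ 2 $ 2) * automorphy B z"
  by (simp add: matrix_matrix_mult_def sum_2 automorphy_def algebra_simps)
 moreover have "(a * m + b) * w = a * (m * w) + b * w" for a b m w :: complex
  by (simp add: algebra_simps)
 ultimately show ?thesis by (simp add: automorphy_def[of A])
qed

lemma moebius_mult:
 assumes "det A = 1" "det B = 1" "Im z > 0"
 shows "moebius (A ** B) z = moebius A (moebius B z)"
proof -
 have nz: "automorphy B z ~= 0" "automorphy A (moebius B z) ~= 0"
  using automorphy_nonzero moebius_uhp assms by auto
 have "of_real ((A ** B) $ 1 $ 1) * z + of_real ((A ** B) $ 1 $ 2) =
   (of_real (A $ 1 $ 1) * moebius B z + of_real (A $ 1 $ 2)) * automorphy B z"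
 proof -
  have "moebius B z * automorphy B z = of_real (B $ 1 $ 1) * z + of_real (B $ 1 $ 2)"
   using nz by (simp add: moebius_def)
  moreover have "of_real ((A ** B) $ 1 $ 1) * z + of_real ((A ** B) $ 1 $ 2) =
   of_real (A $ 1 $ 1) * (of_real (B $ 1 $ 1) * z + of_real (B $ 1 $ 2)) + of_real (A $ 1 $ 2) * automorphy B z"
   by (simp add: matrix_matrix_mult_def sum_2 automorphy_def algebra_simps)
  moreover have "(a * m + b) * w = a * (m * w) + b * w" for a b m w :: complex
   by (simp add: algebra_simps)
  ultimately show ?thesis by simp
 qed
 then show ?thesis
  using nz unfolding moebius_def[of "A ** B"] moebius_def[of A] automorphy_mult[OF assms(2,3)] by simp
qed

lemma slash_mult:
 assumes "det A = 1" "det B = 1" "Im z > 0"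
 shows "slash k (A ** B) f z = slash k B (slash k A f) z"
 unfolding slash_def moebius_mult[OF assms] automorphy_mult[OF assms(2,3)]
 by (simp only: power_int_mult_distrib mult_ac)

abbreviation T_power :: "real => real^2^2" where "T_power n \<equiv> mat2 1 n 0 1"
abbreviation U_power :: "real => real^2^2" where "U_power n \<equiv> mat2 1 0 (2 * n) 1"

lemma S_mat_eq: "S_mat = mat2 0 (- 1 / sqrt 2) (sqrt 2) 0"
 by (simp add: S_mat_def mat2_def real_div_sqrt)

lemma det_generators [simp]: "det S_mat = 1" "det (T_power n) = 1" "det (U_power n) = 1"
 by (simp_all add: S_mat_eq det_mat2)

lemma moebius_T_power [simp]: "moebius (T_power n) z = z + of_real n"
 by (simp add: moebius_mat2)

lemma automorphy_T_power [simp]: "automorphy (T_power n) z = 1"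
 by (simp add: automorphy_mat2)

lemma sqrt2_square: "complex_of_real (sqrt 2) * complex_of_real (sqrt 2) = 2"
 by (metis of_real_mult of_real_numeral real_sqrt_mult_self abs_numeral)

lemma moebius_S [simp]: "moebius S_mat z = fricke z"
proof -
 have "complex_of_real (- 1 / sqrt 2) / (complex_of_real (sqrt 2) * z) = - 1 / ((complex_of_real (sqrt 2) * complex_of_real (sqrt 2)) * z)"
  by simp
 then show ?thesis unfolding sqrt2_square by (simp add: S_mat_eq moebius_mat2 fricke_def)
qed

lemma automorphy_S [simp]: "automorphy S_mat z = of_real (sqrt 2) * z"
 by (simp add: S_mat_eq automorphy_mat2)

subsection \<open>Generators\<close>

text \<open>Products of the letters \<open>T\<^sup>n\<close>, \<open>U\<^sup>n\<close> and \<open>-1\<close> exhaust \<open>\<Gamma>\<^sub>0(2)\<close>: for even \<open>c\<close> the entry \<open>a\<close>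
  is odd, and a Euclidean step with the letters reduces first \<open>a\<close> below \<open>c\<close> and then \<open>c\<close> below \<open>a\<close>.\<close>

inductive_set gamma0_words :: "(real^2^2) set" where
 one: "mat 1 \<in> gamma0_words"
| neg: "A \<in> gamma0_words ==> mat2 (-1) 0 0 (-1) ** A \<in> gamma0_words"
| T: "A \<in> gamma0_words ==> T_power (of_int n) ** A \<in> gamma0_words"
| U: "A \<in> gamma0_words ==> U_power (of_int n) ** A \<in> gamma0_words"

text \<open>Division with a remainder of least absolute value, which drives the Euclidean descent below.\<close>

lemma nearest_multiple:
 fixes a c :: int assumes "c ~= 0" obtains k where "2 * \<bar>a + k * c\<bar> <= \<bar>c\<bar>"
proof
 define k where "k = - round (of_int a / of_int c :: real)"
 have "\<bar>of_int a / of_int c - of_int (- k) :: real\<bar> <= 1 / 2"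
  using of_int_round_abs_le[of "of_int a / of_int c :: real"] by (simp add: k_def abs_minus_commute)
 then have "\<bar>of_int a / of_int c - of_int (- k) :: real\<bar> * \<bar>of_int c\<bar> <= 1 / 2 * \<bar>of_int c\<bar>"
  by (intro mult_right_mono) auto
 moreover have "\<bar>of_int a / of_int c - of_int (- k) :: real\<bar> * \<bar>of_int c\<bar> = \<bar>of_int a + of_int k * of_int c\<bar>"
  using assms by (simp add: abs_mult [symmetric] field_simps)
 ultimately have "2 * \<bar>of_int a + of_int k * of_int c\<bar> <= \<bar>of_int c :: real\<bar>" by simp
 then have "real_of_int (2 * \<bar>a + k * c\<bar>) <= real_of_int \<bar>c\<bar>" by simp
 then show "2 * \<bar>a + k * c\<bar> <= \<bar>c\<bar>" by (simp only: of_int_le_iff)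
qed

lemma mat2_int_in_gamma0_words:
 fixes a b c d :: int
 assumes "a * d - b * c = 1" "even c"
 shows "mat2 (of_int a) (of_int b) (of_int c) (of_int d) \<in> gamma0_words"
 using assms
proof (induction "nat \<bar>c\<bar>" arbitrary: a b c d rule: less_induct)
 case less
 show ?case
 proof (cases "c = 0")
  case True
  then have "a * d = 1" using less.prems by simp
  then have "a = 1 \<and> d = 1 \<or> a = - 1 \<and> d = - 1" using zmult_eq_1_iff[of a d] by auto
  then show ?thesis
  proof
   assume ad: "a = 1 \<and> d = 1"
   have "T_power (of_int b) ** mat 1 \<in> gamma0_words" by (intro gamma0_words.intros)
   then show ?thesis using ad True by simp
  next
   assume ad: "a = - 1 \<and> d = - 1"
   have "mat2 (-1) 0 0 (-1) ** (T_power (of_int (- b)) ** mat 1) \<in> gamma0_words" by (intro gamma0_words.intros)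
   then show ?thesis using ad True by (simp add: mat2_mult)
  qed
 next
  case False
  obtain k where k: "2 * \<bar>a + k * c\<bar> <= \<bar>c\<bar>" by (rule nearest_multiple[OF False])
  define a' b' where "a' = a + k * c" and "b' = b + k * d"
  have det': "a' * d - b' * c = 1" using less.prems by (simp add: a'_def b'_def algebra_simps)
  have "odd a'"
  proof
   assume "even a'"
   then have "even (a' * d - b' * c)" using less.prems(2) by simp
   then show False by (simp add: det')
  qed
  then have a'0: "a' ~= 0" by auto
  obtain l where l: "2 * \<bar>c + l * (2 * a')\<bar> <= \<bar>2 * a'\<bar>" using nearest_multiple[of "2 * a'"] a'0 by auto
  define c' d' where "c' = c + l * (2 * a')" and "d' = d + l * (2 * b')"
  have "\<bar>c'\<bar> <= \<bar>a'\<bar>" using l by (simp add: c'_def abs_mult)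
  also have "\<bar>a'\<bar> < \<bar>c\<bar>" 
  proof -
   have "x < y" if "2 * x <= y" "0 <= x" "0 < y" for x y :: int using that by linarith
   from this[OF k] show ?thesis using False by (simp add: a'_def)
  qed
  finally have "nat \<bar>c'\<bar> < nat \<bar>c\<bar>" by simp
  moreover have "a' * d' - b' * c' = 1" using det' by (simp add: c'_def d'_def algebra_simps)
  moreover have "even c'" using less.prems(2) by (simp add: c'_def)
  ultimately have "mat2 (of_int a') (of_int b') (of_int c') (of_int d') \<in> gamma0_words" by (rule less.hyps)
  then have "T_power (of_int (- k)) ** (U_power (of_int (- l)) ** mat2 (of_int a') (of_int b') (of_int c') (of_int d')) \<in> gamma0_words"
   by (intro gamma0_words.intros)
  also have "T_power (of_int (- k)) ** (U_power (of_int (- l)) ** mat2 (of_int a') (of_int b') (of_int c') (of_int d'))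
    = mat2 (of_int a) (of_int b) (of_int c) (of_int d)"
   by (simp add: mat2_mult mat2_eq_iff a'_def b'_def c'_def d'_def algebra_simps)
  finally show ?thesis .
 qed
qed

lemma Gamma0_2_cases:
 assumes "A \<in> Gamma0_2"
 obtains a b c d :: int where "A = mat2 (of_int a) (of_int b) (of_int c) (of_int d)" "a * d - b * c = 1" "even c"
proof -
 from assms have ints: "!!i j. A $ i $ j \<in> \<int>" and det: "det A = 1" and "\<exists>k::int. A $ 2 $ 1 = 2 * of_int k"
  by (auto simp: Gamma0_2_def SL2Z_def)
 then obtain k where k: "A $ 2 $ 1 = of_int (2 * k)" by auto
 obtain a b d where abd: "A $ 1 $ 1 = of_int a" "A $ 1 $ 2 = of_int b" "A $ 2 $ 2 = of_int d"
  using ints[of 1 1] ints[of 1 2] ints[of 2 2] by (auto elim!: Ints_cases)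
 have A: "A = mat2 (of_int a) (of_int b) (of_int (2 * k)) (of_int d)"
  using mat2_eta[of A] by (simp only: abd k)
 from det have "real_of_int (a * d - b * (2 * k)) = of_int 1" unfolding A by (simp add: det_mat2)
 then have "a * d - b * (2 * k) = 1" by (simp only: of_int_eq_iff)
 then show thesis by (intro that[OF A]) auto
qed

lemma Gamma0_2_subset_words: "Gamma0_2 \<subseteq> gamma0_words"
proof
 fix A assume "A \<in> Gamma0_2"
 then show "A \<in> gamma0_words" by (elim Gamma0_2_cases) (auto intro: mat2_int_in_gamma0_words)
qed

text \<open>Words in the translations and \<open>S\<close>. Induction over words replaces induction over the generated
  group, whose definition also allows inverses and arbitrary elements of \<open>\<Gamma>\<^sub>0(2)\<close> as
  letters.\<close>

inductive_set gamma_words :: "(real^2^2) set" where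
 one: "mat 1 \<in> gamma_words"
| T: "A \<in> gamma_words ==> T_power 1 ** A \<in> gamma_words"
| T_inv: "A \<in> gamma_words ==> T_power (-1) ** A \<in> gamma_words"
| S: "A \<in> gamma_words ==> S_mat ** A \<in> gamma_words"

lemma S_square: "S_mat ** S_mat = mat2 (-1) 0 0 (-1)"
 by (simp add: S_mat_eq mat2_mult)

lemma gamma_words_mult: "A \<in> gamma_words ==> B \<in> gamma_words ==> A ** B \<in> gamma_words"
 by (induction A rule: gamma_words.induct) (auto simp: matrix_mul_assoc [symmetric] intro: gamma_words.intros)

lemma gamma_words_T_power: "T_power (of_int n) \<in> gamma_words"
proof (induction n rule: int_induct[where k = 0])
 case base
 show ?case using gamma_words.one by (simp add: mat2_one)
next
 case (step1 i)
 from gamma_words.T[OF step1.IH] show ?case by (simp add: mat2_mult add_ac)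
next
 case (step2 i)
 from gamma_words.T_inv[OF step2.IH] show ?case by (simp add: mat2_mult)
qed

lemma gamma_words_S: "S_mat \<in> gamma_words"
 using gamma_words.S[OF gamma_words.one] by simp

lemma gamma_words_neg: "mat2 (-1) 0 0 (-1) \<in> gamma_words"
 using gamma_words.S[OF gamma_words_S] by (simp add: S_square)

text \<open>The lower unipotent letters are conjugates of translations under \<open>S\<close>, up to sign.\<close>

lemma U_power_eq: "U_power n = S_mat ** (T_power (- n) ** (S_mat ** mat2 (-1) 0 0 (-1)))"
 by (simp add: S_mat_eq mat2_mult mat2_eq_iff)

lemma gamma_words_U_power: "U_power (of_int n) \<in> gamma_words"
 unfolding U_power_eq
 using gamma_words_T_power[of "- n"] by (intro gamma_words_mult gamma_words_S gamma_words_neg) auto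

lemma gamma0_words_subset: "gamma0_words \<subseteq> gamma_words"
proof
 fix A assume "A \<in> gamma0_words"
 then show "A \<in> gamma_words"
  by induction (auto intro: gamma_words.one gamma_words_mult gamma_words_neg gamma_words_T_power gamma_words_U_power)
qed

lemma inv_SL2R: "det A = 1 ==> A ** B = mat 1 ==> det B = 1 ==> inv\<^bsub>SL2R\<^esub> A = B"
 by (rule group.inv_equality[OF group_SL2R]) (auto simp: SL2R_def matrix_left_right_inverse)

lemma gamma_words_det: "A \<in> gamma_words ==> det A = 1"
 by (induction rule: gamma_words.induct) (auto simp: det_mul)

lemma gamma_words_inverse: "A \<in> gamma_words ==> \<exists>B\<in>gamma_words. A ** B = mat 1"
proof (induction rule: gamma_words.induct)
 case one
 show ?case using gamma_words.one by (intro bexI[of _ "mat 1"]) auto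
next
 have step: "\<exists>B\<in>gamma_words. (X ** A) ** B = mat 1"
  if "Y \<in> gamma_words" "X ** Y = mat 1" "\<exists>B\<in>gamma_words. A ** B = mat 1" for X Y A
 proof -
  from that(3) obtain B where B: "B \<in> gamma_words" "A ** B = mat 1" by blast
  have "(X ** A) ** (B ** Y) = X ** ((A ** B) ** Y)" by (simp add: matrix_mul_assoc)
  also have "\<dots> = mat 1" using B that(2) by simp
  finally show ?thesis using gamma_words_mult[OF B(1) that(1)] by blast
 qed
 {
  case (T A)
  show ?case by (rule step[OF gamma_words_T_power[of "-1"] _ T.IH]) (simp add: mat2_mult mat2_one)
 next
  case (T_inv A)
  show ?case by (rule step[OF gamma_words_T_power[of 1] _ T_inv.IH]) (simp add: mat2_mult mat2_one)
 next
  case (S A)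
  show ?case
   by (rule step[OF gamma_words_mult[OF gamma_words_S gamma_words_neg] _ S.IH])
     (simp add: matrix_mul_assoc S_square, simp add: mat2_mult mat2_one)
 }
qed

lemma Gamma0_2_det: "A \<in> Gamma0_2 ==> det A = 1"
 by (simp add: Gamma0_2_def SL2Z_def)

lemma Gamma0p_2_subset_words: "Gamma0p_2 \<subseteq> gamma_words"
proof
 fix A assume "A \<in> Gamma0p_2"
 then show "A \<in> gamma_words"
  unfolding Gamma0p_2_def
 proof (induction rule: generate.induct)
  case one
  show ?case using gamma_words.one by (simp add: SL2R_def)
 next
  case (incl h)
  then show ?case using Gamma0_2_subset_words gamma0_words_subset gamma_words_S by auto
 next
  case (inv h)
  then have h: "h \<in> gamma_words" using Gamma0_2_subset_words gamma0_words_subset gamma_words_S by auto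
  then obtain B where B: "B \<in> gamma_words" "h ** B = mat 1" using gamma_words_inverse by blast
  then show ?case using inv_SL2R[OF gamma_words_det[OF h] B(2) gamma_words_det[OF B(1)]] by simp
 next
  case (eng h1 h2)
  then show ?case using gamma_words_mult by (simp add: SL2R_def)
 qed
qed

lemma T_power_in_Gamma0_2: "T_power (of_int n) \<in> Gamma0_2"
 by (auto simp: Gamma0_2_def SL2Z_def forall_2 intro!: exI[of _ 0])

lemma Gamma0p_2_one: "mat 1 \<in> Gamma0p_2"
 using generate.one[of SL2R] by (simp add: Gamma0p_2_def SL2R_def)

lemma Gamma0p_2_mult: "A \<in> Gamma0p_2 ==> B \<in> Gamma0p_2 ==> A ** B \<in> Gamma0p_2"
 using generate.eng[of A SL2R _ B] by (simp add: Gamma0p_2_def SL2R_def)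

lemma Gamma0p_2_incl: "A \<in> Gamma0_2 ==> A \<in> Gamma0p_2" "S_mat \<in> Gamma0p_2"
 by (auto simp: Gamma0p_2_def intro: generate.incl)

lemma Gamma0p_2_T: "T_power (of_int n) \<in> Gamma0p_2"
 by (rule Gamma0p_2_incl(1)[OF T_power_in_Gamma0_2])

lemma Gamma0p_2_eq_words: "Gamma0p_2 = gamma_words"
proof
 show "gamma_words \<subseteq> Gamma0p_2"
 proof
  fix A assume "A \<in> gamma_words"
  then show "A \<in> Gamma0p_2"
  proof induction
   case (T A)
   then show ?case using Gamma0p_2_mult[OF Gamma0p_2_T[of 1]] by simp
  next
   case (T_inv A)
   then show ?case using Gamma0p_2_mult[OF Gamma0p_2_T[of "-1"]] by simp
  qed (auto intro: Gamma0p_2_one Gamma0p_2_mult Gamma0p_2_incl)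
 qed
qed (rule Gamma0p_2_subset_words)

lemma Gamma0p_2_det: "A \<in> Gamma0p_2 ==> det A = 1"
 by (simp add: Gamma0p_2_eq_words gamma_words_det)

lemma Gamma0p_2_inverse: "A \<in> Gamma0p_2 ==> \<exists>B\<in>Gamma0p_2. A ** B = mat 1"
 by (simp add: Gamma0p_2_eq_words gamma_words_inverse)

lemma moebius_one: "moebius (mat 1) z = z"
 by (simp add: mat2_one moebius_mat2)

lemma automorphy_one: "automorphy (mat 1) z = 1"
 by (simp add: mat2_one automorphy_mat2)

lemma Gamma_equiv_refl: "Gamma_equiv z z"
 unfolding Gamma_equiv_def using Gamma0p_2_one by (intro bexI[of _ "mat 1"]) (auto simp: moebius_one)

lemma Gamma_equiv_uhp: "Gamma_equiv z w ==> Im z > 0 ==> Im w > 0"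
 by (auto simp: Gamma_equiv_def moebius_uhp Gamma0p_2_det)

lemma Gamma_equiv_trans:
 assumes "Gamma_equiv z w" "Gamma_equiv w v" "Im z > 0" shows "Gamma_equiv z v"
proof -
 obtain A B where "A \<in> Gamma0p_2" "w = moebius A z" "B \<in> Gamma0p_2" "v = moebius B w"
  using assms by (auto simp: Gamma_equiv_def)
 then show ?thesis
  using assms(3) Gamma0p_2_mult moebius_mult Gamma0p_2_det unfolding Gamma_equiv_def by metis
qed

lemma Gamma_equiv_sym:
 assumes "Gamma_equiv z w" "Im z > 0" shows "Gamma_equiv w z"
proof -
 obtain A where A: "A \<in> Gamma0p_2" "w = moebius A z" using assms by (auto simp: Gamma_equiv_def)
 obtain B where B: "B \<in> Gamma0p_2" "A ** B = mat 1" using Gamma0p_2_inverse[OF A(1)] by blast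
 then have "B ** A = mat 1" using matrix_left_right_inverse by blast
 then have "moebius B w = z"
  using moebius_mult[of B A z] A B assms(2) Gamma0p_2_det by (simp add: moebius_one)
 then show ?thesis using B(1) by (auto simp: Gamma_equiv_def)
qed

lemma Gamma_equiv_plus_int: "Gamma_equiv z (z + of_int n)"
 unfolding Gamma_equiv_def using Gamma0p_2_T[of n] by (intro bexI[of _ "T_power (of_int n)"]) auto

lemma Gamma_equiv_fricke: "Gamma_equiv z (fricke z)"
 unfolding Gamma_equiv_def using Gamma0p_2_incl(2) by (intro bexI[of _ S_mat]) auto

text \<open>Induction over words: the letters act as translations and as the Fricke involution.\<close>

lemma Gamma_invariant:
 assumes "Gamma_equiv z w" "Im z > 0"
  and trans: "!!v. Im v > 0 ==> P (v + 1) \<longleftrightarrow> P v"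
  and inv: "!!v. Im v > 0 ==> P (fricke v) \<longleftrightarrow> P v"
 shows "P w \<longleftrightarrow> P z"
proof -
 have "P (moebius A z) \<longleftrightarrow> P z" if "A \<in> gamma_words" for A
  using that
 proof induction
  case one
  show ?case by (simp add: moebius_one)
 next
  case (T A)
  then show ?case using trans[of "moebius A z"] moebius_uhp[OF gamma_words_det[OF T.hyps] assms(2)]
   by (simp add: moebius_mult gamma_words_det assms(2))
 next
  case (T_inv A)
  then show ?case using trans[of "moebius A z - 1"] moebius_uhp[OF gamma_words_det[OF T_inv.hyps] assms(2)]
   by (simp add: moebius_mult gamma_words_det assms(2))
 next
  case (S A)
  then show ?case using inv[of "moebius A z"] moebius_uhp[OF gamma_words_det[OF S.hyps] assms(2)]
   by (simp add: moebius_mult gamma_words_det assms(2))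
 qed
 then show ?thesis using assms(1) by (auto simp: Gamma_equiv_def Gamma0p_2_eq_words)
qed

subsection \<open>Discreteness\<close>

text \<open>Two shapes of matrices: those of \<open>\<Gamma>\<^sub>0(2)\<close> and those of its coset under
  \<open>S\<close>. In both cases twice the square of an entry is an integer, which makes the group discrete.\<close>

lemma gamma_words_entries:
 assumes "A \<in> gamma_words"
 shows "(\<exists>a b c d :: int. A = mat2 (of_int a) (of_int b) (2 * of_int c) (of_int d)) \<or>
     (\<exists>a b c d :: int. A = mat2 (sqrt 2 * of_int a) (of_int b / sqrt 2) (sqrt 2 * of_int c) (sqrt 2 * of_int d))"
  (is "?P A \<or> ?R A")
 using assms
proof induction
 case one
 have "mat 1 = mat2 (of_int 1) (of_int 0) (2 * of_int 0) (of_int 1)" by (simp add: mat2_one)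
 then show ?case by blast
next
 have step: "?P (T_power (of_int n) ** A) \<or> ?R (T_power (of_int n) ** A)" if "?P A \<or> ?R A" for A n
  using that
 proof (elim disjE exE)
  fix a b c d :: int assume "A = mat2 (of_int a) (of_int b) (2 * of_int c) (of_int d)"
  then have "T_power (of_int n) ** A = mat2 (of_int (a + 2 * n * c)) (of_int (b + n * d)) (2 * of_int c) (of_int d)"
   by (simp add: mat2_mult algebra_simps)
  then show ?thesis by blast
 next
  fix a b c d :: int assume "A = mat2 (sqrt 2 * of_int a) (of_int b / sqrt 2) (sqrt 2 * of_int c) (sqrt 2 * of_int d)"
  moreover have "of_int b / sqrt 2 + of_int n * (sqrt 2 * of_int d) = of_int (b + 2 * n * d) / sqrt 2"
   by (simp add: field_simps)
  ultimately have "T_power (of_int n) ** A =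
    mat2 (sqrt 2 * of_int (a + n * c)) (of_int (b + 2 * n * d) / sqrt 2) (sqrt 2 * of_int c) (sqrt 2 * of_int d)"
   by (simp add: mat2_mult algebra_simps)
  then show ?thesis by blast
 qed
 {
  case (T A)
  from step[OF T.IH, of 1] show ?case by simp
 next
  case (T_inv A)
  from step[OF T_inv.IH, of "-1"] show ?case by simp
 }
next
 case (S A)
 from S.IH show ?case
 proof (elim disjE exE)
  fix a b c d :: int assume "A = mat2 (of_int a) (of_int b) (2 * of_int c) (of_int d)"
  then have "S_mat ** A = mat2 (sqrt 2 * of_int (- c)) (of_int (- d) / sqrt 2) (sqrt 2 * of_int a) (sqrt 2 * of_int b)"
  proof -
   have "2 * of_int c / sqrt 2 = sqrt 2 * of_int c" by (simp add: field_simps)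
   then show ?thesis using \<open>A = _\<close> by (simp add: S_mat_eq mat2_mult)
  qed
  then show ?thesis by blast
 next
  fix a b c d :: int assume "A = mat2 (sqrt 2 * of_int a) (of_int b / sqrt 2) (sqrt 2 * of_int c) (sqrt 2 * of_int d)"
  then have "S_mat ** A = mat2 (of_int (- c)) (of_int (- d)) (2 * of_int a) (of_int b)"
   by (simp add: S_mat_eq mat2_mult mult.assoc [symmetric])
  then show ?thesis by blast
 qed
qed

lemma gamma_words_entry_square:
 assumes "A \<in> gamma_words" shows "2 * (A $ i $ j) ^ 2 \<in> \<int>"
proof -
 have ij: "(i = 1 \<or> i = 2) \<and> (j = 1 \<or> j = 2)" by (metis exhaust_2)
 from gamma_words_entries[OF assms] show ?thesis
  using ij by (elim disjE exE conjE) (auto simp: power_mult_distrib power_divide)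
qed

lemma finite_Gamma0p_2_bounded: "finite {A \<in> Gamma0p_2. \<forall>i j. \<bar>A $ i $ j\<bar> <= B}"
proof -
 define X where "X = {x :: real. 2 * x ^ 2 \<in> \<int> \<and> \<bar>x\<bar> <= B}"
 have "finite X"
 proof (rule finite_subset)
  show "X \<subseteq> (%n. sqrt (of_int n / 2)) ` {0..\<lfloor>2 * B ^ 2\<rfloor>} \<union> (%n. - sqrt (of_int n / 2)) ` {0..\<lfloor>2 * B ^ 2\<rfloor>}"
  proof
   fix x assume x: "x \<in> X"
   then obtain n where n: "2 * x ^ 2 = of_int n" by (auto simp: X_def elim: Ints_cases)
   have "x ^ 2 <= B ^ 2" using x power_mono[of "\<bar>x\<bar>" B 2] by (simp add: X_def)
   then have "n \<in> {0..\<lfloor>2 * B ^ 2\<rfloor>}"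
   proof -
    have "0 <= real_of_int n" using n zero_le_power2[of x] by linarith
    then show ?thesis using n \<open>x ^ 2 <= B ^ 2\<close> by (simp add: le_floor_iff)
   qed
   moreover have "\<bar>x\<bar> = sqrt (of_int n / 2)" by (simp add: n [symmetric])
   then have "x = sqrt (of_int n / 2) \<or> x = - sqrt (of_int n / 2)" by linarith
   ultimately show "x \<in> (%n. sqrt (of_int n / 2)) ` {0..\<lfloor>2 * B ^ 2\<rfloor>} \<union> (%n. - sqrt (of_int n / 2)) ` {0..\<lfloor>2 * B ^ 2\<rfloor>}"
    by blast
  qed
 qed auto
 have "{A \<in> Gamma0p_2. \<forall>i j. \<bar>A $ i $ j\<bar> <= B} \<subseteq> (%(a, b, c, d). mat2 a b c d) ` (X \<times> X \<times> X \<times> X)"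
 proof
  fix A assume "A \<in> {A \<in> Gamma0p_2. \<forall>i j. \<bar>A $ i $ j\<bar> <= B}"
  then have "A $ i $ j \<in> X" for i j
   using gamma_words_entry_square[of A i j] by (simp add: X_def Gamma0p_2_eq_words)
  moreover have "A = (%(a, b, c, d). mat2 a b c d) (A $ 1 $ 1, A $ 1 $ 2, A $ 2 $ 1, A $ 2 $ 2)"
   by (simp add: mat2_eta)
  ultimately show "A \<in> (%(a, b, c, d). mat2 a b c d) ` (X \<times> X \<times> X \<times> X)" by blast
 qed
 then show ?thesis by (rule finite_subset) (use \<open>finite X\<close> in auto)
qed

subsection \<open>Behaviour at the cusps\<close>

lemma slash_T: "slash k (T_power n) f z = f (z + of_real n)"
 by (simp add: slash_def)

lemma slash_cong:
 assumes "!!w. Im w > 0 ==> f w = g w" "det A = 1" "Im z > 0"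
 shows "slash k A f z = slash k A g z"
 using assms moebius_uhp by (simp add: slash_def)

lemma slash_scale: "slash k A (%w. e * f w) z = e * slash k A f z"
 by (simp add: slash_def)

text \<open>Since \<open>\<Gamma>\<^sub>0(2)\<close> is generated by \<open>T\<close>, its conjugate under \<open>S\<close> and \<open>-1\<close>, and since \<open>S\<close> exchanges
  the two cusps, periodicity, the behaviour under \<open>S\<close> and a limit at one cusp suffice.\<close>

lemma Gamma0_2_invariant:
 assumes k: "even k" and e: "e * e = 1"
  and T: "!!w. Im w > 0 ==> f (w + 1) = f w"
  and S: "!!w. Im w > 0 ==> slash k S_mat f w = e * f w"
  and A: "A \<in> Gamma0_2" and z: "Im z > 0"
 shows "slash k A f z = f z"
proof -
 have Tn: "f (w + of_int n) = f w" if "Im w > 0" for w n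
  using translation_int[of "%w'. f w' = f w" w n] T that by simp
 have neg: "slash k (mat2 (-1) 0 0 (-1)) f w = f w" for w
  using k by (simp add: slash_def automorphy_mat2 moebius_mat2 power_int_minus_left)
 have U: "slash k (U_power (of_int n)) f w = f w" if w: "Im w > 0" for w n
 proof -
  define g where "g = slash k S_mat f"
  have "slash k (U_power (of_int n)) f w = slash k (T_power (- of_int n) ** (S_mat ** mat2 (-1) 0 0 (-1))) g w"
   unfolding U_power_eq g_def using w by (intro slash_mult) (auto simp: det_mul det_mat2)
  also have "\<dots> = slash k (T_power (- of_int n) ** (S_mat ** mat2 (-1) 0 0 (-1))) (%w. e * f w) w"
   using w by (intro slash_cong) (auto simp: g_def S det_mul det_mat2)
  also have "\<dots> = e * slash k (S_mat ** mat2 (-1) 0 0 (-1)) (slash k (T_power (- of_int n)) f) w"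
   using w by (subst slash_mult) (simp_all add: det_mul det_mat2 slash_def mult_ac)
  also have "slash k (S_mat ** mat2 (-1) 0 0 (-1)) (slash k (T_power (- of_int n)) f) w =
    slash k (S_mat ** mat2 (-1) 0 0 (-1)) f w"
   using w Tn[of _ "- n"] by (intro slash_cong) (auto simp: slash_T det_mul det_mat2)
  also have "\<dots> = slash k (mat2 (-1) 0 0 (-1)) (slash k S_mat f) w"
   using w by (intro slash_mult) (auto simp: det_mat2)
  also have "\<dots> = slash k (mat2 (-1) 0 0 (-1)) (%w. e * f w) w"
   using w by (intro slash_cong) (auto simp: S det_mat2)
  also have "\<dots> = e * f w" by (simp add: slash_scale neg)
  finally show ?thesis using e by (simp add: mult.assoc [symmetric])
 qed
 have det: "det A = 1" if "A \<in> gamma0_words" for A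
  using that gamma0_words_subset gamma_words_det by blast
 have "\<forall>z. Im z > 0 \<longrightarrow> slash k A f z = f z" if "A \<in> gamma0_words" for A
  using that
 proof induction
  case one
  show ?case by (simp add: slash_def automorphy_one moebius_one)
 next
  case (neg A)
  show ?case
  proof (intro allI impI)
   fix z :: complex assume z: "Im z > 0"
   have "slash k (mat2 (-1) 0 0 (-1) ** A) f z = slash k A (slash k (mat2 (-1) 0 0 (-1)) f) z"
    using z neg.hyps det by (intro slash_mult) (auto simp: det_mat2)
   also have "\<dots> = slash k A f z" unfolding \<open>slash k (mat2 (-1) 0 0 (-1)) f _ = _\<close>[abs_def] ..
   finally show "slash k (mat2 (-1) 0 0 (-1) ** A) f z = f z" using neg.IH z by simp
  qed
 next
  case (T A n)
  show ?case
  proof (intro allI impI)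
   fix z :: complex assume z: "Im z > 0"
   have "slash k (T_power (of_int n) ** A) f z = slash k A (slash k (T_power (of_int n)) f) z"
    using z T.hyps det by (intro slash_mult) auto
   also have "\<dots> = slash k A f z" using z T.hyps det Tn by (intro slash_cong) (auto simp: slash_T)
   finally show "slash k (T_power (of_int n) ** A) f z = f z" using T.IH z by simp
  qed
 next
  case (U A n)
  show ?case
  proof (intro allI impI)
   fix z :: complex assume z: "Im z > 0"
   have "slash k (U_power (of_int n) ** A) f z = slash k A (slash k (U_power (of_int n)) f) z"
    using z U.hyps det by (intro slash_mult) auto
   also have "\<dots> = slash k A f z" using z U.hyps det \<open>!!w n. Im w > 0 ==> slash k (U_power (of_int n)) f w = f w\<close>
    by (intro slash_cong) auto
   finally show "slash k (U_power (of_int n) ** A) f z = f z" using U.IH z by simp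
  qed
 qed
 then show ?thesis using A Gamma0_2_subset_words z by blast
qed

text \<open>Up to translations on the right there are two cosets of \<open>\<Gamma>\<^sub>0(2)\<close> in the full
  modular group, one for each cusp.\<close>

lemma SL2Z_cases:
 assumes "A \<in> SL2Z"
 obtains "A \<in> Gamma0_2" | B n where "B \<in> Gamma0_2" "A = B ** (mat2 0 (-1) 1 0 ** T_power (of_int n))"
proof -
 from assms have ints: "!!i j. A $ i $ j \<in> \<int>" and det: "det A = 1" by (auto simp: SL2Z_def)
 obtain a b c d where abcd: "A $ 1 $ 1 = of_int a" "A $ 1 $ 2 = of_int b" "A $ 2 $ 1 = of_int c" "A $ 2 $ 2 = of_int d"
  using ints[of 1 1] ints[of 1 2] ints[of 2 1] ints[of 2 2] by (auto elim!: Ints_cases)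
 have A: "A = mat2 (of_int a) (of_int b) (of_int c) (of_int d)"
  using mat2_eta[of A] by (simp only: abcd)
 show thesis
 proof (cases "even c")
  case True
  then have "A \<in> Gamma0_2" using assms abcd(3) by (auto simp: Gamma0_2_def elim!: evenE)
  then show thesis by (rule that(1))
 next
  case False
  define B where "B = mat2 (of_int (d * a - b)) (of_int a) (of_int (d * c - d)) (of_int c)"
  have "det B = det A" unfolding A by (simp add: B_def det_mat2 algebra_simps)
  then have "det B = 1" using det by simp
  moreover have "even (d * c - d)" using False by simp
  then obtain k where "d * c - d = 2 * k" by (elim evenE)
  then have "B $ 2 $ 1 = 2 * of_int k" by (simp only: B_def mat2_nth)
  ultimately have "B \<in> Gamma0_2" by (auto simp: Gamma0_2_def SL2Z_def forall_2 B_def)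
  moreover have "A = B ** (mat2 0 (-1) 1 0 ** T_power (of_int d))"
   by (simp add: A B_def mat2_mult mat2_eq_iff algebra_simps)
  ultimately show thesis by (rule that(2))
 qed
qed

text \<open>The involution exchanges the two cusps, so a limit at one of them yields a limit at the other, up to the
  substitution \<open>z \<mapsto> z/2\<close>.\<close>

lemma finite_at_cusps_level2:
 assumes k: "even k" and e: "e * e = 1"
  and T: "!!w. Im w > 0 ==> f (w + 1) = f w"
  and S: "!!w. Im w > 0 ==> slash k S_mat f w = e * f w"
  and L: "(f \<longlongrightarrow> L) at_ii_inf"
 shows "finite_at_cusps k f"
 unfolding finite_at_cusps_def
proof
 fix A assume "A \<in> SL2Z"
 then show "\<exists>L. (slash k A f \<longlongrightarrow> L) at_ii_inf"
 proof (cases rule: SL2Z_cases)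
  case 1
  have "eventually (%z. f z = slash k A f z) at_ii_inf"
   using eventually_Im_gt_at_ii_inf[of 0] by eventually_elim (simp add: Gamma0_2_invariant[OF k e T S 1])
  then show ?thesis using L Lim_transform_eventually by blast
 next
  case (2 B n)
  define c where "c = e * of_real (sqrt 2) powi (- k)"
  have eq: "c * f ((z + of_int n) / 2) = slash k A f z" if z: "Im z > 0" for z
  proof -
   define w where "w = z + of_int n"
   have w: "Im w > 0" "Im (w / 2) > 0" using z by (auto simp: w_def)
   have dets: "det (mat2 0 (-1) 1 0) = 1" "det B = 1" using 2 by (auto simp: det_mat2 Gamma0_2_det)
   have "slash k A f z = slash k (mat2 0 (-1) 1 0 ** T_power (of_int n)) (slash k B f) z"
    unfolding 2(2) using z dets by (intro slash_mult) (auto simp: det_mul)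
   also have "\<dots> = slash k (mat2 0 (-1) 1 0 ** T_power (of_int n)) f z"
    using z dets Gamma0_2_invariant[OF k e T S 2(1)] by (intro slash_cong) (auto simp: det_mul)
   also have "\<dots> = slash k (T_power (of_int n)) (slash k (mat2 0 (-1) 1 0) f) z"
    using z dets by (intro slash_mult) auto
   also have "\<dots> = w powi (- k) * f (fricke (w / 2))"
   proof -
    have "fricke (w / 2) = - 1 / w" by (simp add: fricke_def)
    then show ?thesis by (simp add: slash_T slash_def automorphy_mat2 moebius_mat2 flip: w_def)
   qed
   also have "w powi (- k) = of_real (sqrt 2) powi (- k) * (of_real (sqrt 2) * (w / 2)) powi (- k)"
   proof -
    have "w = of_real (sqrt 2) * (of_real (sqrt 2) * (w / 2))" using sqrt2_square by (simp add: field_simps)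
    then show ?thesis by (metis power_int_mult_distrib)
   qed
   also have "of_real (sqrt 2) powi (- k) * (of_real (sqrt 2) * (w / 2)) powi (- k) * f (fricke (w / 2)) =
     of_real (sqrt 2) powi (- k) * slash k S_mat f (w / 2)"
    by (simp add: slash_def)
   also have "\<dots> = c * f (w / 2)" using S[OF w(2)] by (simp add: c_def)
   finally show ?thesis by (simp add: w_def)
  qed
  have "filterlim (%z. (z + of_int n) / 2) at_ii_inf at_ii_inf"
   unfolding filterlim_iff
  proof (intro allI impI)
   fix P assume "eventually P at_ii_inf"
   then obtain C where C: "!!z. Im z > C ==> P z" by (auto simp: eventually_at_ii_inf)
   show "\<forall>\<^sub>F z in at_ii_inf. P ((z + of_int n) / 2)"
    using eventually_Im_gt_at_ii_inf[of "2 * C"] by eventually_elim (rule C, simp)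
  qed
  from tendsto_mult_left[OF filterlim_compose[OF L this], of c]
  have "((%z. c * f ((z + of_int n) / 2)) \<longlongrightarrow> c * L) at_ii_inf" .
  moreover have "eventually (%z. c * f ((z + of_int n) / 2) = slash k A f z) at_ii_inf"
   using eventually_Im_gt_at_ii_inf[of 0] by eventually_elim (rule eq)
  ultimately show ?thesis using Lim_transform_eventually by blast
 qed
qed

section \<open>The Hauptmodul separates orbits\<close>

lemma hauptmodul_equiv:
 assumes "Gamma_equiv z w" "Im z > 0" shows "hauptmodul w = hauptmodul z"
proof -
 have "hauptmodul w = hauptmodul z \<longleftrightarrow> hauptmodul z = hauptmodul z"
  by (rule Gamma_invariant[OF assms]) (simp_all add: hauptmodul_translation hauptmodul_fricke)
 then show ?thesis by simp
qed

lemma holomorphic_moebius: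
 assumes "det A = 1" shows "moebius A holomorphic_on uhp"
proof -
 have "of_real (A $ 2 $ 1) * z + of_real (A $ 2 $ 2) ~= 0" if "z \<in> uhp" for z
  using automorphy_nonzero[OF assms, of z] that by (simp add: automorphy_def)
 then show ?thesis
  unfolding moebius_def[abs_def] automorphy_def[abs_def] by (intro holomorphic_intros) auto
qed

lemma qq_eq_imp:
 assumes "qq z = qq w" obtains n :: int where "w = z + of_int n"
proof -
 from assms obtain n :: int where "tpi * w = tpi * z + of_real (of_int (2 * n) * pi) * \<i>"
  unfolding qq_def exp_eq[of "tpi * w"] eq_commute[of "exp (tpi * z)"] by blast
 also have "\<dots> = tpi * (z + of_int n)" by (simp add: algebra_simps)
 finally have "w = z + of_int n" by simp
 then show thesis by (rule that)
qed

text \<open>Near the cusp, \<open>1 / t\<close> is a local coordinate in the nome.\<close>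

lemma hauptmodul_injective_near_cusp:
 obtains C where "C > 0" "!!z w. Im z > C ==> Im w > C ==> hauptmodul z = hauptmodul w ==> Gamma_equiv z w"
proof -
 have "isCont M2_nome 0" by (rule holomorphic_unit_disc_isCont[OF holomorphic_nome(1)])
 then obtain r where r: "r > 0" "!!x. dist 0 x < r ==> M2_nome x ~= 0"
  using continuous_at_avoid[of 0 M2_nome 0] by auto
 define U where "U = ball (0 :: complex) (min r 1)"
 have U: "U \<subseteq> ball 0 1" "open U" "0 \<in> U" "!!x. x \<in> U ==> M2_nome x ~= 0" using r by (auto simp: U_def)
 define s where "s x = x * M8_nome x / M2_nome x ^ 4" for x
 have holo: "s holomorphic_on U"
  unfolding s_def[abs_def] using U
  by (intro holomorphic_intros holomorphic_on_subset[OF holomorphic_nome(4)] holomorphic_on_subset[OF holomorphic_nome(1)]) auto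
 have "(M8_nome has_field_derivative deriv M8_nome 0) (at 0)"
  by (rule holomorphic_derivI[OF holomorphic_nome(4)]) auto
 then have "(s has_field_derivative 1) (at 0)"
  unfolding s_def[abs_def] by (auto intro!: derivative_eq_intros nome_derivative_0)
 then have "deriv s 0 ~= 0" by (simp add: DERIV_imp_deriv)
 from has_complex_derivative_locally_injective[OF holo \<open>0 \<in> U\<close> \<open>open U\<close> this]
 obtain e where e: "e > 0" "ball 0 e \<subseteq> U" "inj_on s (ball 0 e)" by blast
 have "eventually (%z. norm (qq z) < e) at_ii_inf"
  using tendstoD[OF tendsto_qq e(1)] by simp
 then obtain C where C: "!!z. Im z > C ==> norm (qq z) < e" by (auto simp: eventually_at_ii_inf)
 show thesis
 proof (rule that[of "max C 1"])
  fix z w assume zw: "Im z > max C 1" "Im w > max C 1" "hauptmodul z = hauptmodul w"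
  have q: "qq z \<in> ball 0 e" "qq w \<in> ball 0 e" using C zw by auto
  have "s (qq v) = 1 / hauptmodul v" if "Im v > 0" for v
   using that by (simp add: s_def hauptmodul_def M8_eq M2_eq)
  then have "s (qq z) = s (qq w)" using zw by simp
  with q e(3) have "qq z = qq w" by (auto dest: inj_onD)
  then show "Gamma_equiv z w" by (elim qq_eq_imp) (simp add: Gamma_equiv_plus_int)
 qed auto
qed

lemma hauptmodul_at_cusp: "filterlim hauptmodul at_infinity at_ii_inf"
proof -
 have cont: "isCont M8_nome 0" "isCont M2_nome 0"
  by (intro holomorphic_unit_disc_isCont holomorphic_nome)+
 have lim: "((%z. qq z * M8_nome (qq z) / M2_nome (qq z) ^ 4) \<longlongrightarrow> 0 * M8_nome 0 / M2_nome 0 ^ 4) at_ii_inf"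
  by (intro tendsto_intros tendsto_qq tendsto_compose_qq cont) auto
 have ev1: "eventually (%z. M2_nome (qq z) ~= 0) at_ii_inf"
  using tendsto_imp_eventually_ne[OF tendsto_compose_qq[OF cont(2)], of 0] by simp
 have "filterlim (%z. qq z * M8_nome (qq z) / M2_nome (qq z) ^ 4) (at 0) at_ii_inf"
  unfolding filterlim_at
 proof
  show "\<forall>\<^sub>F z in at_ii_inf. qq z * M8_nome (qq z) / M2_nome (qq z) ^ 4 \<in> UNIV \<and> qq z * M8_nome (qq z) / M2_nome (qq z) ^ 4 ~= 0"
   using ev1 eventually_Im_gt_at_ii_inf[of 0]
   by eventually_elim (simp add: M8_nome_nonzero norm_qq_less_1)
 qed (use lim in simp)
 from filterlim_compose[OF filterlim_inverse_at_infinity this]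
 show ?thesis
 proof (rule filterlim_cong[THEN iffD1, rotated -1])
  show "\<forall>\<^sub>F z in at_ii_inf. inverse (qq z * M8_nome (qq z) / M2_nome (qq z) ^ 4) = hauptmodul z"
   using eventually_Im_gt_at_ii_inf[of 0] by eventually_elim (simp add: hauptmodul_def M8_eq M2_eq)
 qed auto
qed

lemma hauptmodul_large_imp:
 obtains C where "!!z. Im z > C ==> norm (hauptmodul z) > R"
proof -
 have "eventually (%z. norm (hauptmodul z) >= R + 1) at_ii_inf"
  using hauptmodul_at_cusp unfolding filterlim_at_infinity[OF order_refl]
  by (cases "R + 1 > 0") (auto intro: always_eventually order_trans[OF _ norm_ge_zero] simp: not_less)
 then obtain C where "!!z. Im z > C ==> norm (hauptmodul z) >= R + 1" by (auto simp: eventually_at_ii_inf)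
 then show thesis by (intro that[of C]) fastforce
qed

text \<open>The reduced points of bounded height; every orbit on which the Hauptmodul is bounded has a representative
  in such a compact box.\<close>

definition reduced_box :: "real => complex set" where
 "reduced_box C = cbox (Complex (- 1 / 2) (2 / 5)) (Complex (1 / 2) C)"

lemma reduced_box_iff: "z \<in> reduced_box C \<longleftrightarrow> \<bar>Re z\<bar> <= 1 / 2 \<and> Im z >= 2 / 5 \<and> Im z <= C"
 by (auto simp: reduced_box_def in_cbox_complex_iff)

lemma compact_reduced_box: "compact (reduced_box C)"
 by (simp add: reduced_box_def)

lemma reduced_representative:
 assumes "Im z > 0" obtains w where "Gamma_equiv z w" "Im w >= 2 / 5" "\<bar>Re w\<bar> <= 1 / 2"
proof -
 define P where "P v \<longleftrightarrow> (\<exists>w. Gamma_equiv v w \<and> Im w >= 2 / 5 \<and> \<bar>Re w\<bar> <= 1 / 2)" for v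
 have "P z"
  using assms
 proof (rule uhp_reduction_induct)
  show "P w" if "Im w >= 2 / 5" "\<bar>Re w\<bar> <= 1 / 2" for w
   using that Gamma_equiv_refl by (auto simp: P_def)
  have step: "P v" if "P w" "Gamma_equiv v w" "Im v > 0" for v w
   using that Gamma_equiv_trans unfolding P_def by blast
  show "P (w + 1) \<longleftrightarrow> P w" if "Im w > 0" for w
   using step[of "w + 1" w] step[of w "w + 1"] Gamma_equiv_plus_int[of w 1] Gamma_equiv_plus_int[of "w + 1" "-1"] that
   by auto
  show "P w" if "Im w > 0" "P (fricke w)" for w
   using step[OF that(2) Gamma_equiv_fricke that(1)] .
 qed
 then show thesis using that by (auto simp: P_def)
qed

text \<open>A fibre of the Hauptmodul over a good value lies in a single orbit. Good values exist near the cusp; good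
  values and bad values are both open in the plane without the two ramification values, which is connected, so that
  all of these values are good.\<close>

definition good_value :: "complex => bool" where
 "good_value v \<longleftrightarrow> (\<forall>z w. Im z > 0 \<longrightarrow> Im w > 0 \<longrightarrow> hauptmodul z = v \<longrightarrow> hauptmodul w = v \<longrightarrow> Gamma_equiv z w)"

lemma large_good_value:
 obtains v where "good_value v" "v ~= 0" "v ~= 256"
proof -
 obtain C where C: "C > 0" "!!z w. Im z > C ==> Im w > C ==> hauptmodul z = hauptmodul w ==> Gamma_equiv z w"
  using hauptmodul_injective_near_cusp by blast
 have "compact ((%z. hauptmodul z) ` reduced_box C)"
  by (intro compact_continuous_image compact_reduced_box holomorphic_on_imp_continuous_on
     holomorphic_on_subset[OF holomorphic_hauptmodul]) (auto simp: reduced_box_iff)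
 from compact_imp_bounded[OF this] obtain R where "\<forall>x\<in>(%z. hauptmodul z) ` reduced_box C. norm x <= R"
  unfolding bounded_iff by (rule exE)
 then have R: "norm (hauptmodul z) <= R" if "z \<in> reduced_box C" for z using that by simp
 define v :: complex where "v = of_real (\<bar>R\<bar> + 257)"
 have normv: "norm v = \<bar>R\<bar> + 257" unfolding v_def norm_of_real by simp
 have "good_value v"
  unfolding good_value_def
 proof (intro allI impI)
  fix z w assume zw: "Im z > 0" "Im w > 0" "hauptmodul z = v" "hauptmodul w = v"
  obtain z' where z': "Gamma_equiv z z'" "Im z' >= 2 / 5" "\<bar>Re z'\<bar> <= 1 / 2" using reduced_representative[OF zw(1)] by blast
  obtain w' where w': "Gamma_equiv w w'" "Im w' >= 2 / 5" "\<bar>Re w'\<bar> <= 1 / 2" using reduced_representative[OF zw(2)] by blast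
  have t: "hauptmodul z' = v" "hauptmodul w' = v" using hauptmodul_equiv z'(1) w'(1) zw by auto
  then have "z' \<notin> reduced_box C" "w' \<notin> reduced_box C" using R[of z'] R[of w'] normv by auto
  then have "Im z' > C" "Im w' > C" using z' w' by (auto simp: reduced_box_iff)
  then have "Gamma_equiv z' w'" using C(2) t by simp
  moreover have "Gamma_equiv w' w" using Gamma_equiv_sym[OF w'(1) zw(2)] .
  ultimately show "Gamma_equiv z w"
   using Gamma_equiv_trans z'(1) Gamma_equiv_uhp zw by meson
 qed
 moreover have "v ~= 0" "v ~= 256" using normv by auto
 ultimately show thesis by (rule that)
qed

lemma hauptmodul_locally_injective:
 assumes z: "Im z > 0" and ram: "hauptmodul z ~= 0" "hauptmodul z ~= 256"
 obtains r where "r > 0" "ball z r \<subseteq> uhp" "inj_on hauptmodul (ball z r)"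
proof -
 have "z \<in> uhp" using z by simp
 from has_complex_derivative_locally_injective[OF holomorphic_hauptmodul this open_half_plane deriv_hauptmodul_nonzero[OF assms]]
 show thesis using that by metis
qed

text \<open>If bad values accumulated at a good value, reduced representatives of inequivalent points would converge
  to two points of the same fibre; the element relating them, and local injectivity, would relate the
  representatives.\<close>

lemma open_good_values: "open {v. v ~= 0 \<and> v ~= 256 \<and> good_value v}"
 unfolding open_contains_ball
proof (rule ballI, rule ccontr)
 fix v assume v: "v \<in> {v. v ~= 0 \<and> v ~= 256 \<and> good_value v}"
  and no: "\<not> (\<exists>e>0. ball v e \<subseteq> {v. v ~= 0 \<and> v ~= 256 \<and> good_value v})"
 obtain e where e: "e > 0" "!!u. u \<in> ball v e ==> u ~= 0 \<and> u ~= 256"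
 proof (rule that[of "min (norm v) (norm (v - 256))"])
  show "min (norm v) (norm (v - 256)) > 0" using v by auto
 qed (auto simp: dist_norm)
 have "\<exists>u. u \<in> ball v (min e (1 / real (Suc n))) \<and> \<not> good_value u" for n
 proof -
  have "min e (1 / real (Suc n)) > 0" using e(1) by simp
  then have "\<not> ball v (min e (1 / real (Suc n))) \<subseteq> {v. v ~= 0 \<and> v ~= 256 \<and> good_value v}" using no by blast
  then obtain u where u: "u \<in> ball v (min e (1 / real (Suc n)))" "\<not> (u ~= 0 \<and> u ~= 256 \<and> good_value u)" by blast
  then have "u ~= 0 \<and> u ~= 256" using e(2) by simp
  then show ?thesis using u by blast
 qed
 then obtain u where u: "!!n. u n \<in> ball v (min e (1 / real (Suc n)))" "!!n. \<not> good_value (u n)" by metis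
 obtain C where C: "!!z. Im z > C ==> norm (hauptmodul z) > norm v + e"
  using hauptmodul_large_imp[of "norm v + e"] by blast
 have "\<exists>z w. z \<in> reduced_box C \<and> w \<in> reduced_box C \<and> hauptmodul z = u n \<and> hauptmodul w = u n \<and> \<not> Gamma_equiv z w" for n
 proof -
  obtain z w where zw: "Im z > 0" "Im w > 0" "hauptmodul z = u n" "hauptmodul w = u n" "\<not> Gamma_equiv z w"
   using u(2)[of n] by (auto simp: good_value_def)
  obtain z' where z': "Gamma_equiv z z'" "Im z' >= 2 / 5" "\<bar>Re z'\<bar> <= 1 / 2" using reduced_representative[OF zw(1)] by blast
  obtain w' where w': "Gamma_equiv w w'" "Im w' >= 2 / 5" "\<bar>Re w'\<bar> <= 1 / 2" using reduced_representative[OF zw(2)] by blast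
  have t: "hauptmodul z' = u n" "hauptmodul w' = u n" using hauptmodul_equiv z'(1) w'(1) zw by auto
  have "norm (u n) <= norm v + norm (u n - v)" using norm_triangle_sub[of "u n" v] by simp
  also have "norm (u n - v) < e" using u(1)[of n] by (simp add: dist_norm norm_minus_commute)
  finally have "norm (u n) < norm v + e" by simp
  then have "Im z' <= C" "Im w' <= C" using C[of z'] C[of w'] t by fastforce+
  moreover have "\<not> Gamma_equiv z' w'"
  proof
   assume "Gamma_equiv z' w'"
   then have "Gamma_equiv z w" using Gamma_equiv_trans z'(1) Gamma_equiv_sym[OF w'(1) zw(2)] Gamma_equiv_uhp zw(1) by meson
   with zw(5) show False ..
  qed
  ultimately show ?thesis using z' w' t by (auto simp: reduced_box_iff)
 qed
 then obtain z w where zw: "!!n. z n \<in> reduced_box C" "!!n. w n \<in> reduced_box C"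
   "!!n. hauptmodul (z n) = u n" "!!n. hauptmodul (w n) = u n" "!!n. \<not> Gamma_equiv (z n) (w n)" by metis
 obtain l r where l: "l \<in> reduced_box C \<times> reduced_box C" "strict_mono r" "((%n. (z n, w n)) \<circ> r) \<longlonglongrightarrow> l"
  using compact_Times[OF compact_reduced_box compact_reduced_box, of C C] zw(1,2)
  unfolding compact_eq_seq_compact_metric by (auto elim!: seq_compactE[where f = "%n. (z n, w n)"])
 obtain a b where ab: "l = (a, b)" by force
 have lims: "(%n. z (r n)) \<longlonglongrightarrow> a" "(%n. w (r n)) \<longlonglongrightarrow> b"
  using tendsto_fst[OF l(3)] tendsto_snd[OF l(3)] by (simp_all add: ab o_def)
 have im: "Im a > 0" "Im b > 0" using l(1) by (auto simp: ab reduced_box_iff)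
 have ulim: "(%n. u (r n)) \<longlonglongrightarrow> v"
 proof -
  have "u \<longlonglongrightarrow> v"
  proof (rule metric_LIMSEQ_I)
   fix d :: real assume "d > 0"
   then obtain N where N: "1 / real (Suc N) < d" using nat_approx_posE by metis
   have "dist (u n) v < d" if "n >= N" for n
   proof -
    have "dist (u n) v < 1 / real (Suc n)" using u(1)[of n] by (simp add: dist_commute)
    also have "\<dots> <= 1 / real (Suc N)" using that by (simp add: frac_le)
    finally show ?thesis using N by simp
   qed
   then show "\<exists>N. \<forall>n\<ge>N. dist (u n) v < d" by blast
  qed
  then show ?thesis using LIMSEQ_subseq_LIMSEQ[OF _ l(2)] by (simp add: o_def)
 qed
 have cont: "isCont hauptmodul x" if "Im x > 0" for x
  using holomorphic_on_imp_continuous_on[OF holomorphic_hauptmodul] that by (simp add: continuous_on_eq_continuous_at)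
 have ta: "hauptmodul a = v" "hauptmodul b = v"
  using LIMSEQ_unique[OF isCont_tendsto_compose[OF cont[OF im(1)] lims(1)]] ulim
     LIMSEQ_unique[OF isCont_tendsto_compose[OF cont[OF im(2)] lims(2)]] by (simp_all add: zw)
 with v im have "Gamma_equiv a b" by (auto simp: good_value_def)
 then obtain A where A: "A \<in> Gamma0p_2" "b = moebius A a" by (auto simp: Gamma_equiv_def)
 obtain d where d: "d > 0" "ball b d \<subseteq> uhp" "inj_on hauptmodul (ball b d)"
  using hauptmodul_locally_injective[OF im(2)] ta v by auto
 have "isCont (moebius A) a"
  using holomorphic_on_imp_continuous_on[OF holomorphic_moebius[OF Gamma0p_2_det[OF A(1)]]] im
  by (simp add: continuous_on_eq_continuous_at)
 from isCont_tendsto_compose[OF this lims(1)]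
 have "(%n. moebius A (z (r n))) \<longlonglongrightarrow> b" by (simp add: A(2))
 then have "eventually (%n. moebius A (z (r n)) \<in> ball b d) sequentially"
  using d(1) by (auto dest!: tendstoD simp: dist_commute)
 moreover have "eventually (%n. w (r n) \<in> ball b d) sequentially"
  using lims(2) d(1) by (auto dest!: tendstoD simp: dist_commute)
 ultimately have "eventually (%n. moebius A (z (r n)) \<in> ball b d \<and> w (r n) \<in> ball b d) sequentially"
  by (rule eventually_conj)
 then obtain n where n: "moebius A (z (r n)) \<in> ball b d" "w (r n) \<in> ball b d"
  by (auto simp: eventually_sequentially)
 have eq: "Gamma_equiv (z (r n)) (moebius A (z (r n)))" using A(1) by (auto simp: Gamma_equiv_def)
 then have "hauptmodul (moebius A (z (r n))) = hauptmodul (w (r n))"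
  using hauptmodul_equiv[OF eq] zw(1)[of "r n"] by (auto simp: zw reduced_box_iff)
 then have "moebius A (z (r n)) = w (r n)" using d(3) n by (auto dest: inj_onD)
 then show False using eq zw(5) by simp
qed

text \<open>Badness is open too: if nearby points \<open>z'\<close>, \<open>w'\<close> with equal values were related by an element of
  the group, then this element would agree with the local lift of the identity near \<open>z'\<close>, hence
  on a whole neighbourhood, and would relate \<open>z\<close> to \<open>w\<close>.\<close>

lemma open_bad_values: "open {v. v ~= 0 \<and> v ~= 256 \<and> \<not> good_value v}"
proof (rule open_subopen[THEN iffD2], rule ballI)
 fix v assume "v \<in> {v. v ~= 0 \<and> v ~= 256 \<and> \<not> good_value v}"
 then obtain z w where v: "v ~= 0" "v ~= 256" and zw: "Im z > 0" "Im w > 0" "hauptmodul z = v" "hauptmodul w = v"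
   "\<not> Gamma_equiv z w" by (auto simp: good_value_def)
 obtain d where d: "d > 0" "ball w d \<subseteq> uhp" "inj_on hauptmodul (ball w d)"
  using hauptmodul_locally_injective[of w] zw v by auto
 have holo_d: "hauptmodul holomorphic_on ball w d" by (rule holomorphic_on_subset[OF holomorphic_hauptmodul d(2)])
 obtain g where g: "g holomorphic_on (hauptmodul ` ball w d)" "!!x. x \<in> ball w d ==> g (hauptmodul x) = x"
  using holomorphic_has_inverse[OF holo_d open_ball d(3)] by metis
 have open_img: "open (hauptmodul ` ball w d)" by (rule open_mapping_thm3[OF holo_d open_ball d(3)])
 moreover have "v \<in> hauptmodul ` ball w d" using d(1) zw(4) by force
 ultimately obtain s where s: "s > 0" "ball v s \<subseteq> hauptmodul ` ball w d" by (auto simp: open_contains_ball)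
 obtain e where e: "e > 0" "ball z e \<subseteq> uhp" "inj_on hauptmodul (ball z e)"
  using hauptmodul_locally_injective[of z] zw v by auto
 have "isCont hauptmodul z"
  using holomorphic_on_imp_continuous_on[OF holomorphic_hauptmodul] zw(1) by (simp add: continuous_on_eq_continuous_at)
 then obtain f where f: "f > 0" "!!x. dist x z < f ==> dist (hauptmodul x) v < s"
  using s(1) zw(3) unfolding continuous_at_eps_delta by metis
 define B where "B = ball z (min e f)"
 have B: "B \<subseteq> ball z e" "B \<subseteq> uhp" "open B" "connected B" "z \<in> B" using e f by (auto simp: B_def)
 have BV: "hauptmodul x \<in> ball v s" if "x \<in> B" for x using that f(2)[of x] by (auto simp: B_def dist_commute)
 have holo_B: "hauptmodul holomorphic_on B" by (rule holomorphic_on_subset[OF holomorphic_hauptmodul B(2)])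
 have "open (hauptmodul ` B)"
  by (rule open_mapping_thm3[OF holo_B B(3) inj_on_subset[OF e(3) B(1)]])
 then have op: "open (hauptmodul ` B \<inter> - {0, 256})" by (intro open_Int open_Compl) auto
 have bad: "\<not> good_value u" if u: "u \<in> hauptmodul ` B" for u
 proof
  assume good: "good_value u"
  obtain x where x: "x \<in> B" "hauptmodul x = u" using u by auto
  have "u \<in> hauptmodul ` ball w d" using BV[OF x(1)] s(2) x(2) by auto
  then obtain y where y: "y \<in> ball w d" "hauptmodul y = u" by auto
  have "Im x > 0" "Im y > 0" using subsetD[OF B(2) x(1)] subsetD[OF d(2) y(1)] by auto
  then have "Gamma_equiv x y" using good x(2) y(2) by (simp add: good_value_def)
  then obtain A where A: "A \<in> Gamma0p_2" "y = moebius A x" by (auto simp: Gamma_equiv_def)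
  have holoA: "moebius A holomorphic_on B"
   by (rule holomorphic_on_subset[OF holomorphic_moebius[OF Gamma0p_2_det[OF A(1)]] B(2)])
  have "continuous_on B (moebius A)" by (rule holomorphic_on_imp_continuous_on[OF holoA])
  then have "open {x \<in> B. moebius A x \<in> ball w d}"
   using continuous_open_preimage[OF _ B(3) open_ball, of "moebius A" w d] by (simp add: vimage_def Int_def)
  moreover have "x \<in> {x \<in> B. moebius A x \<in> ball w d}" using x y A by auto
  moreover have "(%x. g (hauptmodul x)) holomorphic_on B"
   using BV s(2) by (intro holomorphic_on_compose_gen[OF holo_B g(1), unfolded o_def]) auto
  moreover have "moebius A x' = g (hauptmodul x')" if "x' \<in> {x \<in> B. moebius A x \<in> ball w d}" for x'
  proof -
   have "hauptmodul (moebius A x') = hauptmodul x'"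
    by (rule hauptmodul_equiv) (use that A B(2) in \<open>auto simp: Gamma_equiv_def\<close>)
   then show ?thesis using g(2)[of "moebius A x'"] that by simp
  qed
  moreover have "{x \<in> B. moebius A x \<in> ball w d} ~= {}" using x y A by blast
  moreover have "{x \<in> B. moebius A x \<in> ball w d} \<subseteq> B" by blast
  ultimately have "moebius A z = g (hauptmodul z)"
   using analytic_continuation_open[of "{x \<in> B. moebius A x \<in> ball w d}" B "moebius A" "%x. g (hauptmodul x)" z]
    B(3-5) holoA by blast
  also have "\<dots> = w" using g(2)[of w] d(1) zw by simp
  finally have "Gamma_equiv z w" using A(1) by (auto simp: Gamma_equiv_def)
  with zw(5) show False ..
 qed
 have v_in: "v \<in> hauptmodul ` B \<inter> - {0, 256}" using v zw(3) B(5) by blast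
 have sub: "hauptmodul ` B \<inter> - {0, 256} \<subseteq> {v. v ~= 0 \<and> v ~= 256 \<and> \<not> good_value v}" using bad by blast
 show "\<exists>T. open T \<and> v \<in> T \<and> T \<subseteq> {v. v ~= 0 \<and> v ~= 256 \<and> \<not> good_value v}"
  by (rule exI[of _ "hauptmodul ` B \<inter> - {0, 256}"], intro conjI, rule op, rule v_in, rule sub)
qed

lemma good_value_generic: "v ~= 0 ==> v ~= 256 ==> good_value v"
proof -
 assume v: "v ~= 0" "v ~= 256"
 have "connected (UNIV - {0, 256 :: complex})"
  by (rule connected_open_diff_countable) (auto simp: DIM_complex)
 then have "{v. v ~= 0 \<and> v ~= 256 \<and> \<not> good_value v} = {} \<or> {v. v ~= 0 \<and> v ~= 256 \<and> good_value v} = {}"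
  using connectedD[of "UNIV - {0, 256}" "{v. v ~= 0 \<and> v ~= 256 \<and> good_value v}" "{v. v ~= 0 \<and> v ~= 256 \<and> \<not> good_value v}",
    OF _ open_good_values open_bad_values] by auto
 moreover have "{v. v ~= 0 \<and> v ~= 256 \<and> good_value v} ~= {}" using large_good_value by blast
 ultimately show ?thesis using v by blast
qed

text \<open>The two exceptional fibres are limits of generic ones, and the elements of the group that occur
  in the limit range over a finite set.\<close>

lemma linear_form_bound:
 assumes "norm (of_real x * z + of_real y) <= E" "Im z >= d" "d > 0" "norm z <= M"
 shows "\<bar>x\<bar> <= E / d" "\<bar>y\<bar> <= E + E / d * M"
proof -
 have "\<bar>x\<bar> * d <= \<bar>x\<bar> * Im z" using assms by (intro mult_left_mono) auto
 also have "\<dots> = \<bar>Im (of_real x * z + of_real y)\<bar>" using assms by (simp add: abs_mult)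
 also have "\<dots> <= E" using abs_Im_le_cmod assms(1) order_trans by blast
 finally show x: "\<bar>x\<bar> <= E / d" using assms(3) by (simp add: field_simps)
 have "\<bar>y\<bar> = norm ((of_real x * z + of_real y) - of_real x * z)" by simp
 also have "\<dots> <= norm (of_real x * z + of_real y) + norm (of_real x * z)" by (rule norm_triangle_ineq4)
 also have "\<dots> <= E + E / d * M"
 proof (rule add_mono[OF assms(1)])
  have "\<bar>x\<bar> * norm z <= E / d * M"
   by (rule mult_mono[OF x assms(4) order_trans[OF abs_ge_zero x] norm_ge_zero])
  then show "norm (of_real x * z) <= E / d * M" by (simp add: norm_mult)
 qed
 finally show "\<bar>y\<bar> <= E + E / d * M" .
qed

text \<open>The action is properly discontinuous: bounds on height and size of \<open>z\<close> and its image bound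
  the bottom row and then all entries of the matrix.\<close>

lemma finite_transporters:
 assumes "d > 0"
 shows "finite {A \<in> Gamma0p_2. \<exists>z. Im z >= d \<and> norm z <= M \<and> Im (moebius A z) >= d \<and> norm (moebius A z) <= M}"
proof (rule finite_subset[OF _ finite_Gamma0p_2_bounded])
 define E where "E = sqrt (M / d) * (1 + M)"
 define B where "B = E / d + (E + E / d * M)"
 show "{A \<in> Gamma0p_2. \<exists>z. Im z >= d \<and> norm z <= M \<and> Im (moebius A z) >= d \<and> norm (moebius A z) <= M} \<subseteq>
   {A \<in> Gamma0p_2. \<forall>i j. \<bar>A $ i $ j\<bar> <= B}"
 proof safe
  fix A :: "real^2^2" and z and i j :: 2 assume A: "A \<in> Gamma0p_2" and z: "d <= Im z" "norm z <= M" "d <= Im (moebius A z)" "norm (moebius A z) <= M"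
  define J where "J = automorphy A z"
  have det: "det A = 1" by (rule Gamma0p_2_det[OF A])
  have imz: "Im z > 0" using z assms by simp
  have J0: "J ~= 0" unfolding J_def by (rule automorphy_nonzero[OF det imz])
  have M0: "M >= 0" using z(2) norm_ge_zero order_trans by blast
  have "d <= Im z / (norm J) ^ 2" using z(3) Im_moebius[OF det imz] by (simp add: J_def)
  then have "(norm J) ^ 2 * d <= Im z" using J0 by (simp add: field_simps)
  also have "\<dots> <= M" using abs_Im_le_cmod[of z] z(2) by linarith
  finally have "(norm J) ^ 2 <= M / d" using assms by (simp add: field_simps)
  then have J: "norm J <= sqrt (M / d)" by (rule real_le_rsqrt)
  have E1: "norm (of_real (A $ 2 $ 1) * z + of_real (A $ 2 $ 2)) <= E"
  proof -
   have "norm J <= sqrt (M / d) * 1" using J by simp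
   also have "\<dots> <= E" unfolding E_def using M0 assms by (intro mult_left_mono) auto
   finally show ?thesis by (simp add: J_def automorphy_def)
  qed
  have E2: "norm (of_real (A $ 1 $ 1) * z + of_real (A $ 1 $ 2)) <= E"
  proof -
   have "of_real (A $ 1 $ 1) * z + of_real (A $ 1 $ 2) = J * moebius A z" using J0 by (simp add: moebius_def J_def)
   then have "norm (of_real (A $ 1 $ 1) * z + of_real (A $ 1 $ 2)) = norm J * norm (moebius A z)" by (simp add: norm_mult)
   also have "\<dots> <= sqrt (M / d) * (1 + M)" using J z(4) M0 assms by (intro mult_mono) auto
   finally show ?thesis by (simp add: E_def)
  qed
  have E0: "E >= 0" using E1 norm_ge_zero order_trans by blast
  have pos: "E / d >= 0" "E / d * M >= 0" using E0 M0 assms by auto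
  have le: "E / d <= B" "E + E / d * M <= B" using E0 pos unfolding B_def by linarith+
  note bounds = order_trans[OF linear_form_bound(1)[OF E1 z(1) assms z(2)] le(1)]
   order_trans[OF linear_form_bound(2)[OF E1 z(1) assms z(2)] le(2)]
   order_trans[OF linear_form_bound(1)[OF E2 z(1) assms z(2)] le(1)]
   order_trans[OF linear_form_bound(2)[OF E2 z(1) assms z(2)] le(2)]
  have "i = 1 \<or> i = 2" "j = 1 \<or> j = 2" using exhaust_2[of i] exhaust_2[of j] by simp_all
  then show "\<bar>A $ i $ j\<bar> <= B" by (elim disjE; simp only: bounds)
 qed
qed

text \<open>The nonconstant holomorphic map is open, so points over a ramification value are limits of points over
  generic values.\<close>

lemma hauptmodul_open_mapping:
 assumes z: "Im z > 0" and e: "e > 0"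
 obtains s where "s > 0" "ball (hauptmodul z) s \<subseteq> hauptmodul ` (ball z e \<inter> uhp)"
proof -
 have nonconst: "\<not> hauptmodul constant_on uhp"
 proof
  assume "hauptmodul constant_on uhp"
  then obtain c where c: "!!z. Im z > 0 ==> hauptmodul z = c" by (auto simp: constant_on_def)
  obtain C where C: "!!z. Im z > C ==> norm (hauptmodul z) > norm c" using hauptmodul_large_imp[of "norm c"] by blast
  have "norm (hauptmodul (Complex 0 (\<bar>C\<bar> + 1))) > norm c" by (rule C) simp
  moreover have "hauptmodul (Complex 0 (\<bar>C\<bar> + 1)) = c" by (rule c) simp
  ultimately show False by simp
 qed
 have "open (hauptmodul ` (ball z e \<inter> uhp))"
  by (rule open_mapping_thm[OF holomorphic_hauptmodul _ _ _ _ nonconst]) (auto intro: open_Int)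
 moreover have "hauptmodul z \<in> hauptmodul ` (ball z e \<inter> uhp)" using z e by auto
 ultimately obtain s where "s > 0" "ball (hauptmodul z) s \<subseteq> hauptmodul ` (ball z e \<inter> uhp)"
  by (metis open_contains_ball)
 then show thesis by (rule that)
qed

theorem hauptmodul_eq_iff:
 assumes zw: "Im z > 0" "Im w > 0"
 shows "hauptmodul z = hauptmodul w \<longleftrightarrow> Gamma_equiv z w"
proof
 assume eq: "hauptmodul z = hauptmodul w"
 define v where "v = hauptmodul z"
 define d where "d = min (Im z) (Im w) / 2"
 define M where "M = norm z + norm w + d"
 have d: "d > 0" using zw by (simp add: d_def)
 define F where "F = {A \<in> Gamma0p_2. \<exists>z. Im z >= d \<and> norm z <= M \<and> Im (moebius A z) >= d \<and> norm (moebius A z) <= M}"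
 have finF: "finite F" unfolding F_def by (rule finite_transporters[OF d])
 have near: "\<exists>z' w' A. A \<in> F \<and> w' = moebius A z' \<and> Im z' > 0 \<and> dist z' z < e \<and> dist w' w < e" if e: "e > 0" for e
 proof -
  define e' where "e' = min e d"
  have e': "e' > 0" using e d by (simp add: e'_def)
  obtain s1 where s1: "s1 > 0" "ball v s1 \<subseteq> hauptmodul ` (ball z e' \<inter> uhp)"
   using hauptmodul_open_mapping[OF zw(1) e'] unfolding v_def by blast
  obtain s2 where s2: "s2 > 0" "ball v s2 \<subseteq> hauptmodul ` (ball w e' \<inter> uhp)"
   using hauptmodul_open_mapping[OF zw(2) e'] unfolding v_def eq by blast
  have "\<not> ball v (min s1 s2) \<subseteq> {0, 256}"
   using countable_subset[of "ball v (min s1 s2)" "{0, 256}"] uncountable_ball[of "min s1 s2" v] s1 s2 by auto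
  then obtain u where u: "u \<in> ball v (min s1 s2)" "u ~= 0" "u ~= 256" by blast
  then have "u \<in> ball v s1" "u \<in> ball v s2" by auto
  then obtain z' w' where z': "z' \<in> ball z e'" "Im z' > 0" "hauptmodul z' = u" and w': "w' \<in> ball w e'" "Im w' > 0" "hauptmodul w' = u"
   using s1(2) s2(2) by (force simp: image_iff subset_iff)
  have "Gamma_equiv z' w'" using good_value_generic[OF u(2,3)] z' w' by (auto simp: good_value_def)
  then obtain A where A: "A \<in> Gamma0p_2" "w' = moebius A z'" by (auto simp: Gamma_equiv_def)
  have im: "Im x' >= d" "norm x' <= M" if "x' \<in> ball x e'" "x \<in> {z, w}" for x x'
  proof -
   have dist: "norm (x - x') < d" using that(1) by (simp add: dist_norm e'_def)
   have "Im x - Im x' <= norm (x - x')" using abs_Im_le_cmod[of "x - x'"] by simp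
   moreover have "Im x >= 2 * d" using that(2) by (auto simp: d_def)
   ultimately show "Im x' >= d" using dist by linarith
   have "norm x' <= norm x + norm (x - x')" using norm_triangle_sub[of x' x] by (simp add: norm_minus_commute)
   moreover have "norm x <= norm z + norm w" using that(2) by auto
   ultimately show "norm x' <= M" using dist by (simp add: M_def)
  qed
  have "A \<in> F" unfolding F_def using A im[OF z'(1)] im[OF w'(1)] by auto
  then show ?thesis using A z' w' by (intro exI[of _ z'] exI[of _ w'] exI[of _ A]) (auto simp: e'_def dist_commute)
 qed
 show "Gamma_equiv z w"
 proof (rule ccontr)
  assume no: "\<not> Gamma_equiv z w"
  have "\<exists>e>0. \<forall>z'. dist z' z < e \<longrightarrow> \<not> dist (moebius A z') w < e" if A: "A \<in> F" for A
  proof -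
   have AG: "A \<in> Gamma0p_2" using A by (simp add: F_def)
   define D where "D = dist (moebius A z) w"
   have D: "D > 0" using no AG by (auto simp: D_def Gamma_equiv_def)
   have "isCont (moebius A) z"
    using holomorphic_on_imp_continuous_on[OF holomorphic_moebius[OF Gamma0p_2_det[OF AG]]] zw(1)
    by (simp add: continuous_on_eq_continuous_at)
   then obtain e where e: "e > 0" "!!z'. dist z' z < e ==> dist (moebius A z') (moebius A z) < D / 2"
    using D unfolding continuous_at_eps_delta by (metis half_gt_zero)
   have "\<not> dist (moebius A z') w < min e (D / 2)" if "dist z' z < min e (D / 2)" for z'
    using e(2)[of z'] that dist_triangle2[of "moebius A z" w "moebius A z'"] dist_triangle[of "moebius A z" w "moebius A z'"]
    by (auto simp: D_def dist_commute)
   then show ?thesis using e(1) D by (intro exI[of _ "min e (D / 2)"]) auto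
  qed
  then obtain e where e: "!!A. A \<in> F ==> e A > 0" "!!A z'. A \<in> F ==> dist z' z < e A ==> \<not> dist (moebius A z') w < e A"
   by metis
  define m where "m = Min (insert 1 (e ` F))"
  have m: "m > 0" "!!A. A \<in> F ==> m <= e A" using finF e(1) by (auto simp: m_def)
  obtain z' w' A where "A \<in> F" "w' = moebius A z'" "dist z' z < m" "dist w' w < m" using near[OF m(1)] by blast
  then show False using e(2)[of A z'] m(2)[of A] by auto
 qed
qed (use hauptmodul_equiv assms in metis)

section \<open>The zeros of the basic forms\<close>

lemma rho2_props: "Im rho2 > 0" "rho2 ^ 2 = \<i> / 2" "fricke rho2 = rho2 - 1" "rho2 ~= 0"
proof -
 show "Im rho2 > 0" by (simp add: rho2_def)
 then show nz: "rho2 ~= 0" by auto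
 show sq: "rho2 ^ 2 = \<i> / 2" by (simp add: rho2_def power2_eq_square complex_eq_iff)
 have "rho2 * (rho2 - 1) = - 1 / 2" by (simp add: rho2_def complex_eq_iff)
 then show "fricke rho2 = rho2 - 1" using nz by (simp add: fricke_def field_simps)
qed

lemma M2_rho2: "M2 rho2 = 0"
proof -
 have "M2 (fricke rho2) = M2 rho2" using level2_translation(1)[of "rho2 - 1"] by (simp add: rho2_props)
 then have "M2 rho2 = - (\<i> * M2 rho2)" using M2_fricke[OF rho2_props(1)] by (simp add: rho2_props(2))
 then have "M2 rho2 + \<i> * M2 rho2 = 0" using eq_neg_iff_add_eq_0 by blast
 then have "(1 + \<i>) * M2 rho2 = 0" by (simp add: ring_distribs)
 moreover have "1 + \<i> ~= 0" by (simp add: complex_eq_iff)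
 ultimately show ?thesis by simp
qed

lemma N4_rho1: "N4 rho1 = 0"
proof -
 have "rho1 ^ 4 = (rho1 ^ 2) ^ 2" by simp
 then have "4 * rho1 ^ 4 = 1" unfolding rho1_props(2) by (simp add: power_divide mult.commute)
 then show ?thesis using N4_fricke[OF rho1_props(1)] unfolding rho1_props(3) by simp
qed

lemma M2_zero_iff: "Im z > 0 ==> M2 z = 0 \<longleftrightarrow> Gamma_equiv z rho2"
 using hauptmodul_eq_iff[of z rho2] hauptmodul_eq_0_iff[of z] hauptmodul_eq_0_iff[of rho2] rho2_props M2_rho2 by auto

lemma N4_zero_iff: "Im z > 0 ==> N4 z = 0 \<longleftrightarrow> Gamma_equiv z rho1"
 using hauptmodul_eq_iff[of z rho1] hauptmodul_eq_256_iff[of z] hauptmodul_eq_256_iff[of rho1] rho1_props N4_rho1 by auto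

lemma elliptic_point_iff: "Im z > 0 ==> elliptic_point z \<longleftrightarrow> hauptmodul z = 0 \<or> hauptmodul z = 256"
 unfolding elliptic_point_def by (simp only: hauptmodul_eq_0_iff hauptmodul_eq_256_iff M2_zero_iff N4_zero_iff disj_commute)

text \<open>As \<open>M4 = M2\<^sup>2\<close>, the form \<open>F_pt w\<close> is \<open>M8\<close> times the
  difference of two values of the Hauptmodul, so its zeros form the orbit of \<open>w\<close>.\<close>

lemma F_pt_eq:
 assumes "Im z > 0" "Im w > 0" shows "F_pt w z = M8 z * (hauptmodul z - hauptmodul w)"
proof -
 have "F_pt w z = M2 z ^ 4 - M2 w ^ 4 / M8 w * M8 z"
  using assms by (simp add: F_pt_def M4_eq_M2_square flip: power_mult)
 also have "\<dots> = M8 z * (hauptmodul z - hauptmodul w)"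
  using M8_nonzero[OF assms(1)] by (simp add: hauptmodul_def right_diff_distrib)
 finally show ?thesis .
qed

lemma F_pt_zero_iff: "Im z > 0 ==> Im w > 0 ==> F_pt w z = 0 \<longleftrightarrow> Gamma_equiv z w"
 by (simp add: F_pt_eq M8_nonzero flip: hauptmodul_eq_iff)

lemma holomorphic_F_pt: "Im w > 0 ==> F_pt w holomorphic_on uhp"
 unfolding F_pt_def[abs_def] by (intro holomorphic_intros holomorphic_level2)

lemma deriv_F_pt_nonzero:
 assumes "Im z > 0" "Im w > 0" "F_pt w z = 0" "\<not> elliptic_point w"
 shows "deriv (F_pt w) z ~= 0"
proof -
 have eq: "hauptmodul z = hauptmodul w" using assms by (simp add: F_pt_eq M8_nonzero)
 then have ram: "hauptmodul z ~= 0" "hauptmodul z ~= 256" using assms elliptic_point_iff[of w] by auto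
 have "(hauptmodul has_field_derivative deriv hauptmodul z) (at z)"
  by (rule holomorphic_derivI[OF holomorphic_hauptmodul]) (use assms in auto)
 then have "((%z. hauptmodul z - hauptmodul w) has_field_derivative deriv hauptmodul z) (at z)"
  by (auto intro!: derivative_eq_intros)
 from DERIV_mult[OF has_field_derivative_M8[OF assms(1)] this]
 have "((%z. M8 z * (hauptmodul z - hauptmodul w)) has_field_derivative M8 z * deriv hauptmodul z) (at z)"
  by (rule DERIV_cong) (simp add: eq)
 then have "(F_pt w has_field_derivative M8 z * deriv hauptmodul z) (at z)"
  by (rule has_field_derivative_transform_within_open[where S = uhp]) (use assms F_pt_eq in auto)
 then show ?thesis
  using deriv_hauptmodul_nonzero[OF assms(1) ram] M8_nonzero[OF assms(1)] by (simp add: DERIV_imp_deriv)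
qed

lemma F_pt_translation: "Im z > 0 ==> F_pt w (z + 1) = F_pt w z"
 by (simp add: F_pt_def level2_translation)

lemma M4_fricke: "Im z > 0 ==> M4 (fricke z) = 4 * z ^ 4 * M4 z"
 by (simp add: M4_eq_M2_square M2_fricke algebra_simps eval_nat_numeral)

lemma F_pt_fricke: "Im z > 0 ==> F_pt w (fricke z) = 16 * z ^ 8 * F_pt w z"
 unfolding F_pt_def by (simp add: M4_fricke M8_fricke algebra_simps eval_nat_numeral)

section \<open>Frobenius solutions\<close>

text \<open>The recursion for the coefficients of the solution belonging to the larger exponent; \<open>n\<close> is the
  difference of the exponents, so that the denominators do not vanish.\<close>

fun frobenius_coeff :: "(nat => complex) => nat => nat => complex" where
 "frobenius_coeff c n 0 = 1"
| "frobenius_coeff c n (Suc j) = (\<Sum>i\<le>j. c i * frobenius_coeff c n (j - i)) / of_nat (Suc j * (Suc j + n))"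

text \<open>By the recursion the partial sums of the weighted norms grow at most by factors \<open>1 +
  O(1/j\<^sup>2)\<close>, whose product converges.\<close>

lemma frobenius_coeff_bounded:
 assumes c: "!!i. norm (c i) * \<rho> ^ i <= M" and \<rho>: "\<rho> > 0" and M: "M >= 0"
 shows "\<exists>B. \<forall>j. norm (frobenius_coeff c n j) * \<rho> ^ j <= B"
proof -
 define a where "a = frobenius_coeff c n"
 define A where "A j = (\<Sum>i\<le>j. norm (a i) * \<rho> ^ i)" for j
 have A0: "A j >= 0" for j using \<rho> by (auto simp: A_def intro!: sum_nonneg)
 have step: "norm (a (Suc j)) * \<rho> ^ Suc j <= \<rho> * M / real (Suc j) ^ 2 * A j" for j
 proof -
  have "norm (\<Sum>i\<le>j. c i * a (j - i)) * \<rho> ^ j <= (\<Sum>i\<le>j. norm (c i * a (j - i))) * \<rho> ^ j"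
   using \<rho> by (intro mult_right_mono norm_sum) auto
  also have "\<dots> = (\<Sum>i\<le>j. (norm (c i) * \<rho> ^ i) * (norm (a (j - i)) * \<rho> ^ (j - i)))"
   unfolding sum_distrib_right
  proof (intro sum.cong refl)
   fix i assume "i \<in> {..j}"
   then have "\<rho> ^ j = \<rho> ^ i * \<rho> ^ (j - i)" by (simp flip: power_add)
   then show "norm (c i * a (j - i)) * \<rho> ^ j = (norm (c i) * \<rho> ^ i) * (norm (a (j - i)) * \<rho> ^ (j - i))"
    by (simp add: norm_mult)
  qed
  also have "\<dots> <= (\<Sum>i\<le>j. M * (norm (a (j - i)) * \<rho> ^ (j - i)))"
   using c \<rho> by (intro sum_mono mult_right_mono) auto
  also have "\<dots> = M * (\<Sum>i\<le>j. norm (a (j - i)) * \<rho> ^ (j - i))" by (simp add: sum_distrib_left)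
  also have "(\<Sum>i\<le>j. norm (a (j - i)) * \<rho> ^ (j - i)) = A j"
   unfolding A_def by (rule sum.reindex_bij_witness[where i = "%i. j - i" and j = "%i. j - i"]) auto
  finally have le: "norm (\<Sum>i\<le>j. c i * a (j - i)) * \<rho> ^ j <= M * A j" .
  have "norm (a (Suc j)) = norm (\<Sum>i\<le>j. c i * a (j - i)) / real (Suc j * (Suc j + n))"
   unfolding a_def frobenius_coeff.simps norm_divide norm_of_nat ..
  also have "\<dots> <= norm (\<Sum>i\<le>j. c i * a (j - i)) / real (Suc j) ^ 2"
  proof (rule divide_left_mono)
   show "real (Suc j) ^ 2 <= real (Suc j * (Suc j + n))"
    unfolding of_nat_mult power2_eq_square by (intro mult_left_mono) auto
   have "real (Suc j * (Suc j + n)) > 0" "real (Suc j) > 0" by (simp_all only: of_nat_0_less_iff) simp_all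
   then show "0 < real (Suc j * (Suc j + n)) * real (Suc j) ^ 2" by (intro mult_pos_pos zero_less_power)
  qed simp
  finally have "norm (a (Suc j)) * \<rho> ^ Suc j <= norm (\<Sum>i\<le>j. c i * a (j - i)) / real (Suc j) ^ 2 * \<rho> ^ Suc j"
   using \<rho> by (intro mult_right_mono) auto
  also have "\<dots> = \<rho> / real (Suc j) ^ 2 * (norm (\<Sum>i\<le>j. c i * a (j - i)) * \<rho> ^ j)" by simp
  also have "\<dots> <= \<rho> / real (Suc j) ^ 2 * (M * A j)" using le \<rho> by (intro mult_left_mono) auto
  finally show ?thesis by (simp add: mult_ac)
 qed
 define s where "s j = (\<Sum>i<j. \<rho> * M * (1 / real (Suc i) ^ 2))" for j
 have bound: "A j <= exp (s j)" for j
 proof (induction j)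
  case 0
  show ?case by (simp add: A_def a_def s_def)
 next
  case (Suc j)
  have "A (Suc j) = A j + norm (a (Suc j)) * \<rho> ^ Suc j" by (simp add: A_def)
  also have "\<dots> <= A j * (1 + \<rho> * M / real (Suc j) ^ 2)" using step[of j] by (simp add: algebra_simps)
  also have "\<dots> <= exp (s j) * exp (\<rho> * M / real (Suc j) ^ 2)"
   using Suc A0[of j] \<rho> M by (intro mult_mono exp_ge_add_one_self) auto
  also have "\<dots> = exp (s (Suc j))" by (simp add: s_def exp_add)
  finally show ?case .
 qed
 have "summable (%i. inverse (real i ^ 2))" by (rule inverse_power_summable) simp
 then have summ: "summable (%i. \<rho> * M * (1 / real (Suc i) ^ 2))"
  by (subst (asm) summable_Suc_iff [symmetric]) (intro summable_mult, simp add: divide_inverse)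
 have "s j <= (\<Sum>i. \<rho> * M * (1 / real (Suc i) ^ 2))" for j
  unfolding s_def using \<rho> M by (intro sum_le_suminf summ) auto
 then have "A j <= exp (\<Sum>i. \<rho> * M * (1 / real (Suc i) ^ 2))" for j
  using bound[of j] order_trans exp_le_cancel_iff by blast
 moreover have "norm (a j) * \<rho> ^ j <= A j" for j
  unfolding A_def using \<rho> by (intro member_le_sum) auto
 ultimately show ?thesis unfolding a_def by (meson order_trans)
qed

lemma conv_radius_geI_bounded:
 assumes B: "!!j. norm (a j) * \<rho> ^ j <= B" and \<rho>: "\<rho> > 0"
 shows "conv_radius (a :: nat => complex) >= ereal \<rho>"
proof (rule conv_radius_geI_ex')
 fix r :: real assume r: "0 < r" "ereal r < ereal \<rho>"
 have "summable (%j. B * (r / \<rho>) ^ j)"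
  using r \<rho> by (intro summable_mult summable_geometric) auto
 then show "summable (%j. a j * of_real r ^ j)"
 proof (rule summable_comparison_test')
  fix j
  have "norm (a j * of_real r ^ j) = (norm (a j) * \<rho> ^ j) * (r / \<rho>) ^ j"
   using r \<rho> by (simp add: norm_mult norm_power power_divide)
  also have "\<dots> <= B * (r / \<rho>) ^ j" using B[of j] r \<rho> by (intro mult_right_mono) auto
  finally show "norm (a j * of_real r ^ j) <= B * (r / \<rho>) ^ j" .
 qed
qed

lemma holomorphic_fps:
 assumes f: "f holomorphic_on ball 0 r" and r: "r > 0"
 obtains F where "fps_conv_radius F >= ereal r" "!!z. norm z < r ==> eval_fps F z = f z"
proof
 have f': "f holomorphic_on eball 0 (ereal r)" using f by simp
 show "fps_conv_radius (fps_expansion f 0) >= ereal r" by (rule conv_radius_fps_expansion[OF f'])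
 show "eval_fps (fps_expansion f 0) z = f z" if "norm z < r" for z
  using eval_fps_expansion[OF f', of z] that by (simp add: in_eball_iff dist_norm)
qed

lemma fps_coeff_bounded:
 fixes F :: "complex fps"
 assumes "ereal \<rho> < fps_conv_radius F" "\<rho> > 0"
 obtains M where "M >= 0" "!!i. norm (fps_nth F i) * \<rho> ^ i <= M"
proof -
 have "summable (%i. norm (fps_nth F i * of_real \<rho> ^ i))"
  by (rule abs_summable_in_conv_radius) (use assms in \<open>simp add: fps_conv_radius_def\<close>)
 then have "Bseq (%i. norm (fps_nth F i * of_real \<rho> ^ i))"
  using summable_imp_Bseq by blast
 then obtain M where "M > 0" "!!i. norm (norm (fps_nth F i * of_real \<rho> ^ i)) <= M" by (auto elim: BseqE)
 then show thesis using assms(2) by (intro that[of M]) (auto simp: norm_mult norm_power)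
qed

text \<open>The series with the coefficients \<open>frobenius_coeff\<close> converges near \<open>0\<close> and solves
  the equation that remains when the factor \<open>w\<close> raised to the larger exponent is split off.\<close>

lemma frobenius_solution:
 assumes q: "q holomorphic_on ball 0 r" and r: "r > 0"
 obtains s v where "0 < s" "s <= r" "v holomorphic_on ball 0 s" "v 0 = 1" "!!w. norm w < s ==> v w ~= 0"
  "!!w. norm w < s ==> w * deriv (deriv v) w + of_nat (n + 1) * deriv v w = q w * v w"
proof -
 obtain C where C: "fps_conv_radius C >= ereal r" "!!z. norm z < r ==> eval_fps C z = q z"
  using holomorphic_fps[OF q r] by blast
 define \<rho> where "\<rho> = r / 2"
 have \<rho>: "\<rho> > 0" "\<rho> < r" using r by (auto simp: \<rho>_def)
 have "ereal \<rho> < fps_conv_radius C" using \<rho> C(1) by (meson less_ereal.simps(1) less_le_trans)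
 then obtain M where M: "M >= 0" "!!i. norm (fps_nth C i) * \<rho> ^ i <= M" using fps_coeff_bounded \<rho>(1) by blast
 define a where "a = frobenius_coeff (fps_nth C) n"
 define F where "F = Abs_fps a"
 obtain B where "!!j. norm (a j) * \<rho> ^ j <= B"
  using frobenius_coeff_bounded[of "fps_nth C" \<rho> M n] M \<rho> by (auto simp: a_def)
 from conv_radius_geI_bounded[OF this \<rho>(1)] have F: "fps_conv_radius F >= ereal \<rho>"
  by (simp add: F_def fps_conv_radius_def)
 have ode: "fps_X * fps_deriv (fps_deriv F) + fps_const (of_nat (n + 1)) * fps_deriv F = C * F"
 proof (rule fps_ext)
  fix j
  have lhs: "fps_nth (fps_X * fps_deriv (fps_deriv F) + fps_const (of_nat (n + 1)) * fps_deriv F) j =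
    of_nat (Suc j * (Suc j + n)) * a (Suc j)"
   by (cases j) (simp_all add: F_def algebra_simps)
  have "of_nat (Suc j * (Suc j + n)) * a (Suc j) = (\<Sum>i\<le>j. fps_nth C i * a (j - i))"
   unfolding a_def frobenius_coeff.simps
   using nonzero_mult_div_cancel_left[of "of_nat (Suc j * (Suc j + n)) :: complex"] by (simp del: of_nat_mult of_nat_add of_nat_Suc)
  also have "\<dots> = fps_nth (C * F) j" by (simp add: fps_mult_nth F_def atLeast0AtMost)
  finally show "fps_nth (fps_X * fps_deriv (fps_deriv F) + fps_const (of_nat (n + 1)) * fps_deriv F) j = fps_nth (C * F) j"
   unfolding lhs .
 qed
 define v where "v = eval_fps F"
 have v0: "v 0 = 1" by (simp add: v_def eval_fps_at_0 F_def a_def)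
 have holo: "v holomorphic_on ball 0 \<rho>"
  unfolding v_def
 proof (rule holomorphic_on_eval_fps)
  show "ball 0 \<rho> \<subseteq> eball 0 (fps_conv_radius F)" using F by (auto simp: in_eball_iff) (meson less_ereal.simps(1) less_le_trans)
 qed
 have "isCont v 0"
  using holomorphic_on_imp_continuous_on[OF holo] \<rho> by (simp add: continuous_on_eq_continuous_at)
 then obtain d where d: "d > 0" "!!w. dist 0 w < d ==> v w ~= 0"
  using continuous_at_avoid[of 0 v 0] v0 by auto
 define s where "s = min d \<rho>"
 have eq: "w * deriv (deriv v) w + of_nat (n + 1) * deriv v w = q w * v w" if w: "norm w < \<rho>" for w
 proof -
  have wF: "norm w < fps_conv_radius F" using w F by (meson less_ereal.simps(1) less_le_trans)
  have wF': "norm w < fps_conv_radius (fps_deriv F)" using wF fps_conv_radius_deriv less_le_trans by blast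
  have wF'': "norm w < fps_conv_radius (fps_deriv (fps_deriv F))" using wF' fps_conv_radius_deriv less_le_trans by blast
  have wC: "norm w < fps_conv_radius C" using w \<rho> C(1) by (meson less_ereal.simps(1) less_le_trans less_trans)
  have d1: "eval_fps (fps_deriv F) x = deriv v x" if "norm x < fps_conv_radius F" for x
   unfolding v_def by (rule eval_fps_deriv[OF that])
  have op: "open (eball (0 :: complex) (fps_conv_radius F))" by simp
  have d2: "eval_fps (fps_deriv (fps_deriv F)) w = deriv (deriv v) w"
  proof -
   have "eval_fps (fps_deriv (fps_deriv F)) w = deriv (eval_fps (fps_deriv F)) w" by (rule eval_fps_deriv[OF wF'])
   also have "\<dots> = deriv (deriv v) w"
   proof (rule deriv_cong_ev)
    show "\<forall>\<^sub>F x in nhds w. eval_fps (fps_deriv F) x = deriv v x"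
     using eventually_nhds_in_open[OF op, of w] wF by (auto simp: in_eball_iff elim!: eventually_mono intro: d1)
   qed auto
   finally show ?thesis .
  qed
  have r1: "norm w < fps_conv_radius (fps_X * fps_deriv (fps_deriv F))"
   using wF'' fps_conv_radius_mult[of fps_X "fps_deriv (fps_deriv F)"] by (simp add: min_def split: if_splits)
  have r2: "norm w < fps_conv_radius (fps_const (of_nat (n + 1)) * fps_deriv F)"
   using wF' fps_conv_radius_mult[of "fps_const (of_nat (n + 1))" "fps_deriv F"] less_le_trans by (simp add: min_def split: if_splits) 
  have "eval_fps (fps_X * fps_deriv (fps_deriv F) + fps_const (of_nat (n + 1)) * fps_deriv F) w = eval_fps (C * F) w"
   by (simp only: ode)
  then show ?thesis
   using wF wF' wF'' wC r1 r2 w \<rho> C(2)[of w]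
   by (simp add: eval_fps_add eval_fps_mult d1 d2 v_def [symmetric])
 qed
 show thesis
 proof (rule that[of s v])
  show "v holomorphic_on ball 0 s" by (rule holomorphic_on_subset[OF holo]) (auto simp: s_def)
 qed (use d \<rho> eq v0 in \<open>auto simp: s_def\<close>)
qed

text \<open>Termwise integration of \<open>w\<^sup>-\<^sup>n\<^sup>-\<^sup>1 h\<close>: the primitive is
  \<open>w\<^sup>-\<^sup>n G + c log w\<close>, where \<open>c\<close> is the coefficient of index \<open>n\<close> of
  \<open>h\<close>.\<close>

lemma integrate_pole:
 assumes h: "h holomorphic_on ball 0 r" and r: "r > 0"
 obtains G c where "G holomorphic_on ball 0 r" "!!w. norm w < r ==> w * deriv G w - of_nat n * G w = h w - c * w ^ n"
proof -
 obtain H where H: "fps_conv_radius H >= ereal r" "!!z. norm z < r ==> eval_fps H z = h z"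
  using holomorphic_fps[OF h r] by blast
 define g where "g j = (if j = n then 0 else fps_nth H j / (of_nat j - of_nat n))" for j
 define c where "c = fps_nth H n"
 define F where "F = Abs_fps g"
 have rad: "fps_conv_radius F >= fps_conv_radius H"
  unfolding fps_conv_radius_def
 proof (rule conv_radius_geI_ex')
  fix r :: real assume r: "0 < r" "ereal r < conv_radius (fps_nth H)"
  have "norm (g j) <= norm (fps_nth H j)" for j
  proof (cases "j = n")
   case False
   have "norm (of_nat j - of_nat n :: complex) = \<bar>real j - real n\<bar>"
    by (metis norm_of_real of_real_diff of_real_of_nat_eq)
   moreover have "\<bar>real j - real n\<bar> >= 1" using False by (cases "j < n") auto
   ultimately have "norm (fps_nth H j) / norm (of_nat j - of_nat n :: complex) <= norm (fps_nth H j) / 1"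
    by (intro divide_left_mono) auto
   then show ?thesis using False by (simp add: g_def norm_divide)
  qed (simp add: g_def)
  then have le: "norm (fps_nth F j) <= norm (fps_nth H j)" for j by (simp add: F_def)
  have "summable (%j. norm (fps_nth H j * of_real r ^ j))"
   by (rule abs_summable_in_conv_radius) (use r in simp)
  then show "summable (%j. fps_nth F j * of_real r ^ j)"
   by (rule summable_comparison_test') (use le r in \<open>auto simp: norm_mult norm_power intro!: mult_right_mono\<close>)
 qed
 show thesis
 proof (rule that[of "eval_fps F" c])
  have sub: "ball 0 r \<subseteq> eball 0 (fps_conv_radius F)"
   using rad H(1) by (auto simp: in_eball_iff) (meson less_ereal.simps(1) less_le_trans order_trans)
  show "eval_fps F holomorphic_on ball 0 r" by (rule holomorphic_on_eval_fps[OF sub])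
  fix w :: complex assume w: "norm w < r"
  have wH: "norm w < fps_conv_radius H" using w H(1) by (meson less_ereal.simps(1) less_le_trans)
  have wF: "norm w < fps_conv_radius F" using wH rad by (rule less_le_trans)
  have wF': "norm w < fps_conv_radius (fps_deriv F)" using wF fps_conv_radius_deriv less_le_trans by blast
  have eq: "fps_X * fps_deriv F - fps_const (of_nat n) * F = H - fps_const c * fps_X ^ n"
  proof (rule fps_ext)
   fix j
   have "fps_nth (fps_X * fps_deriv F) j = of_nat j * g j" by (cases j) (simp_all add: F_def)
   moreover have "of_nat j * g j - of_nat n * g j = (if j = n then 0 else fps_nth H j)"
    by (simp add: g_def left_diff_distrib [symmetric])
   ultimately show "fps_nth (fps_X * fps_deriv F - fps_const (of_nat n) * F) j = fps_nth (H - fps_const c * fps_X ^ n) j"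
    by (simp add: F_def c_def)
  qed
  have r1: "norm w < fps_conv_radius (fps_X * fps_deriv F)"
   using wF' fps_conv_radius_mult[of fps_X "fps_deriv F"] by (simp add: min_def split: if_splits)
  have r2: "norm w < fps_conv_radius (fps_const (of_nat n) * F)"
   using wF fps_conv_radius_mult[of "fps_const (of_nat n)" F] by (simp add: min_def split: if_splits)
  have r3: "norm w < fps_conv_radius (fps_const c * fps_X ^ n)"
   using fps_conv_radius_mult[of "fps_const c" "fps_X ^ n"] by (simp add: min_def split: if_splits)
  have "eval_fps (fps_X * fps_deriv F - fps_const (of_nat n) * F) w = eval_fps (H - fps_const c * fps_X ^ n) w"
   by (simp only: eq)
  then show "w * deriv (eval_fps F) w - of_nat n * eval_fps F w = h w - c * w ^ n"
   using wF wF' wH r1 r2 r3 w by (simp add: eval_fps_diff eval_fps_mult eval_fps_deriv eval_fps_power H(2))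
 qed
qed

lemma frobenius_pair:
 assumes q: "q holomorphic_on ball 0 r" and r: "r > 0"
 obtains s v G c where "0 < s" "s <= r" "v holomorphic_on ball 0 s" "G holomorphic_on ball 0 s"
  "v 0 = 1" "!!w. norm w < s ==> v w ~= 0"
  "!!w. norm w < s ==> w * deriv (deriv v) w + of_nat (n + 1) * deriv v w = q w * v w"
  "!!w. norm w < s ==> w * deriv G w - of_nat n * G w = 1 / v w ^ 2 - c * w ^ n"
proof -
 obtain s v where sv: "0 < s" "s <= r" "v holomorphic_on ball 0 s" "v 0 = 1" "!!w. norm w < s ==> v w ~= 0"
  "!!w. norm w < s ==> w * deriv (deriv v) w + of_nat (n + 1) * deriv v w = q w * v w"
  using frobenius_solution[OF q r, of n] by metis
 have "(%w. 1 / v w ^ 2) holomorphic_on ball 0 s" using sv by (intro holomorphic_intros) auto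
 then obtain G c where "G holomorphic_on ball 0 s" "!!w. norm w < s ==> w * deriv G w - of_nat n * G w = 1 / v w ^ 2 - c * w ^ n"
  using integrate_pole[OF _ sv(1), of "%w. 1 / v w ^ 2" n] by metis
 then show thesis using sv by (intro that[of s v G c]) auto
qed


section \<open>Twisted solutions\<close>

text \<open>If \<open>F' = L F\<close>, then \<open>Y / F\<close> solves the equation iff \<open>Y\<close> satisfies the following equation, which is
  single valued even where \<open>F\<close> is not.\<close>

definition nabla :: "(complex => complex) => (complex => complex) => complex => complex" where
 "nabla L Y z = deriv Y z - L z * Y z"

definition twisted_solution :: "(complex => complex) => (complex => complex) => complex set => (complex => complex) => bool" where
 "twisted_solution Q L U Y \<longleftrightarrow> Y holomorphic_on U \<and>
   (\<forall>z\<in>U. nabla L (nabla L Y) z = - 4 * of_real pi ^ 2 * Q z * Y z)"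

lemma holomorphic_nabla [holomorphic_intros]:
 "L holomorphic_on U ==> Y holomorphic_on U ==> open U ==> nabla L Y holomorphic_on U"
 unfolding nabla_def[abs_def] by (intro holomorphic_intros holomorphic_deriv) auto

lemma twisted_solutionD:
 assumes "twisted_solution Q L U Y" "L holomorphic_on U" "open U" "z \<in> U"
 shows "(Y has_field_derivative L z * Y z + nabla L Y z) (at z)"
  "(nabla L Y has_field_derivative L z * nabla L Y z - 4 * of_real pi ^ 2 * Q z * Y z) (at z)"
proof -
 have Y: "Y holomorphic_on U" using assms(1) by (simp add: twisted_solution_def)
 show "(Y has_field_derivative L z * Y z + nabla L Y z) (at z)"
  using holomorphic_derivI[OF Y assms(3,4)] by (simp add: nabla_def)
 have "(nabla L Y has_field_derivative deriv (nabla L Y) z) (at z)"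
  by (rule holomorphic_derivI[OF holomorphic_nabla assms(3,4)]) (use Y assms in auto)
 moreover have "deriv (nabla L Y) z = L z * nabla L Y z - 4 * of_real pi ^ 2 * Q z * Y z"
  using assms(1,4) by (auto simp: twisted_solution_def nabla_def[of L "nabla L Y"] algebra_simps)
 ultimately show "(nabla L Y has_field_derivative L z * nabla L Y z - 4 * of_real pi ^ 2 * Q z * Y z) (at z)" by simp
qed

lemma twisted_solutionI:
 assumes "open U"
  and "!!z. z \<in> U ==> (Y has_field_derivative L z * Y z + X z) (at z)"
  and "!!z. z \<in> U ==> (X has_field_derivative L z * X z - 4 * of_real pi ^ 2 * Q z * Y z) (at z)"
 shows "twisted_solution Q L U Y"
 unfolding twisted_solution_def
proof (intro conjI ballI)
 show "Y holomorphic_on U" using assms(1,2) by (auto simp: holomorphic_on_open)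
 have X: "nabla L Y z = X z" if "z \<in> U" for z
  using DERIV_imp_deriv[OF assms(2)[OF that]] by (simp add: nabla_def)
 fix z assume z: "z \<in> U"
 have "(nabla L Y has_field_derivative L z * X z - 4 * of_real pi ^ 2 * Q z * Y z) (at z)"
  by (rule has_field_derivative_transform_within_open[OF assms(3)[OF z] assms(1) z]) (simp add: X)
 then show "nabla L (nabla L Y) z = - 4 * of_real pi ^ 2 * Q z * Y z"
  by (simp add: nabla_def[of L "nabla L Y"] DERIV_imp_deriv X z)
qed

lemma twisted_solution_subset:
 "twisted_solution Q L U Y ==> V \<subseteq> U ==> twisted_solution Q L V Y"
 unfolding twisted_solution_def using holomorphic_on_subset by blast

lemma twisted_solution_cong:
 assumes "twisted_solution Q L U Y" "!!z. z \<in> U ==> Y z = Y' z" "open U" "L holomorphic_on U"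
 shows "twisted_solution Q L U Y'"
proof (rule twisted_solutionI[where X = "nabla L Y", OF assms(3)])
 fix z assume z: "z \<in> U"
 note d = twisted_solutionD[OF assms(1,4,3) z]
 show "(Y' has_field_derivative L z * Y' z + nabla L Y z) (at z)"
  using has_field_derivative_transform_within_open[OF d(1) assms(3) z] assms(2) z by simp
 show "(nabla L Y has_field_derivative L z * nabla L Y z - 4 * of_real pi ^ 2 * Q z * Y' z) (at z)"
  using d(2) assms(2)[OF z] by simp
qed

definition twisted_wronskian :: "(complex => complex) => (complex => complex) => (complex => complex) => complex => complex" where
 "twisted_wronskian L Y1 Y2 z = Y1 z * nabla L Y2 z - Y2 z * nabla L Y1 z"

lemma has_field_derivative_twisted_wronskian:
 assumes "twisted_solution Q L U Y1" "twisted_solution Q L U Y2" "L holomorphic_on U" "open U" "z \<in> U"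
 shows "(twisted_wronskian L Y1 Y2 has_field_derivative 2 * L z * twisted_wronskian L Y1 Y2 z) (at z)"
proof -
 note d = twisted_solutionD[OF assms(1,3-5)] twisted_solutionD[OF assms(2,3-5)]
 show ?thesis
  unfolding twisted_wronskian_def[abs_def]
  by (rule DERIV_cong[OF DERIV_diff[OF DERIV_mult[OF d(1,4)] DERIV_mult[OF d(3,2)]]]) (simp add: algebra_simps)
qed

text \<open>Wronskians of solutions all satisfy the same linear equation, so their quotients are constant.\<close>

lemma twisted_solution_span:
 assumes sol: "twisted_solution Q L U Y1" "twisted_solution Q L U Y2" "twisted_solution Q L U Y"
  and L: "L holomorphic_on U" and U: "open U" "connected U"
  and W: "!!z. z \<in> U ==> twisted_wronskian L Y1 Y2 z ~= 0"
 obtains a b where "!!z. z \<in> U ==> Y z = a * Y1 z + b * Y2 z"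
proof -
 have const: "\<exists>c. \<forall>z\<in>U. twisted_wronskian L A B z = c * twisted_wronskian L Y1 Y2 z"
  if "twisted_solution Q L U A" "twisted_solution Q L U B" for A B
 proof -
  have "((%z. twisted_wronskian L A B z / twisted_wronskian L Y1 Y2 z) has_field_derivative 0) (at z)" if z: "z \<in> U" for z
   by (rule DERIV_cong[OF DERIV_divide[OF has_field_derivative_twisted_wronskian[OF \<open>twisted_solution Q L U A\<close> \<open>twisted_solution Q L U B\<close> L U(1) z]
      has_field_derivative_twisted_wronskian[OF sol(1,2) L U(1) z] W[OF z]]]) simp
  then have "(%z. twisted_wronskian L A B z / twisted_wronskian L Y1 Y2 z) constant_on U"
   by (intro has_field_derivative_0_imp_constant_on U) auto
  then obtain c where "!!z. z \<in> U ==> twisted_wronskian L A B z / twisted_wronskian L Y1 Y2 z = c"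
   by (auto simp: constant_on_def)
  then show ?thesis using W by (intro exI[of _ c]) (auto simp: field_simps)
 qed
 obtain a where a: "!!z. z \<in> U ==> twisted_wronskian L Y Y2 z = a * twisted_wronskian L Y1 Y2 z"
  using const[OF sol(3,2)] by blast
 obtain b where b: "!!z. z \<in> U ==> twisted_wronskian L Y1 Y z = b * twisted_wronskian L Y1 Y2 z"
  using const[OF sol(1,3)] by blast
 show thesis
 proof (rule that[of a b])
  fix z assume z: "z \<in> U"
  have "Y z * twisted_wronskian L Y1 Y2 z = Y1 z * twisted_wronskian L Y Y2 z + Y2 z * twisted_wronskian L Y1 Y z"
   by (simp add: twisted_wronskian_def algebra_simps)
  also have "\<dots> = (a * Y1 z + b * Y2 z) * twisted_wronskian L Y1 Y2 z"
   unfolding a[OF z] b[OF z] by (simp add: algebra_simps)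
  finally show "Y z = a * Y1 z + b * Y2 z" using W[OF z] by simp
 qed
qed

lemma deriv2_eq: "(deriv ^^ 2) y = deriv (deriv y)"
 by (simp add: eval_nat_numeral)

lemma solves_odeD:
 assumes "solves_ode Q U y" "open U" "z \<in> U"
 shows "(y has_field_derivative deriv y z) (at z)"
  "(deriv y has_field_derivative - 4 * of_real pi ^ 2 * Q z * y z) (at z)"
proof -
 have y: "y holomorphic_on U" using assms(1) by (simp add: solves_ode_def)
 show "(y has_field_derivative deriv y z) (at z)" by (rule holomorphic_derivI[OF y assms(2,3)])
 show "(deriv y has_field_derivative - 4 * of_real pi ^ 2 * Q z * y z) (at z)"
  using holomorphic_derivI[OF holomorphic_deriv[OF y assms(2)] assms(2,3)] assms(1,3)
  by (simp add: solves_ode_def deriv2_eq)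
qed

lemma solves_odeI:
 assumes "open U" "!!z. z \<in> U ==> (y has_field_derivative y' z) (at z)"
  "!!z. z \<in> U ==> (y' has_field_derivative - 4 * of_real pi ^ 2 * Q z * y z) (at z)"
 shows "solves_ode Q U y"
 unfolding solves_ode_def deriv2_eq
proof (intro conjI ballI)
 show "y holomorphic_on U" using assms(1,2) by (auto simp: holomorphic_on_open)
 fix z assume z: "z \<in> U"
 have "(deriv y has_field_derivative - 4 * of_real pi ^ 2 * Q z * y z) (at z)"
  by (rule has_field_derivative_transform_within_open[OF assms(3)[OF z] assms(1) z]) (simp add: DERIV_imp_deriv[OF assms(2)])
 then show "deriv (deriv y) z = - 4 * of_real pi ^ 2 * Q z * y z" by (rule DERIV_imp_deriv)
qed

text \<open>Conjugation by \<open>F\<close> turns \<open>d/dz\<close> into \<open>nabla L\<close>.\<close>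

lemma twisted_iff_solves_ode:
 assumes U: "open U" and F: "!!z. z \<in> U ==> (F has_field_derivative L z * F z) (at z)" "!!z. z \<in> U ==> F z ~= 0"
  and L: "L holomorphic_on U"
 shows "twisted_solution Q L U Y \<longleftrightarrow> solves_ode Q U (%z. Y z / F z)"
proof
 assume sol: "twisted_solution Q L U Y"
 show "solves_ode Q U (%z. Y z / F z)"
 proof (rule solves_odeI[OF U])
  fix z assume z: "z \<in> U"
  note d = twisted_solutionD[OF sol L U z]
  show "((%z. Y z / F z) has_field_derivative nabla L Y z / F z) (at z)"
   by (rule DERIV_cong[OF DERIV_divide[OF d(1) F(1)[OF z] F(2)[OF z]]]) (use F(2)[OF z] in \<open>simp add: field_simps\<close>)
  show "((%z. nabla L Y z / F z) has_field_derivative - 4 * of_real pi ^ 2 * Q z * (Y z / F z)) (at z)"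
   by (rule DERIV_cong[OF DERIV_divide[OF d(2) F(1)[OF z] F(2)[OF z]]]) (use F(2)[OF z] in \<open>simp add: field_simps\<close>)
 qed
next
 assume sol: "solves_ode Q U (%z. Y z / F z)"
 define y where "y z = Y z / F z" for z
 have Y: "F z * y z = Y z" if "z \<in> U" for z using F(2)[OF that] by (simp add: y_def)
 have "twisted_solution Q L U (%z. F z * y z)"
 proof (rule twisted_solutionI[where X = "%z. F z * deriv y z", OF U])
  fix z assume z: "z \<in> U"
  note d = solves_odeD[OF sol [folded y_def] U z]
  show "((%z. F z * y z) has_field_derivative L z * (F z * y z) + F z * deriv y z) (at z)"
   by (rule DERIV_cong[OF DERIV_mult[OF F(1)[OF z] d(1)]]) (simp add: algebra_simps)
  show "((%z. F z * deriv y z) has_field_derivative L z * (F z * deriv y z) - 4 * of_real pi ^ 2 * Q z * (F z * y z)) (at z)"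
   by (rule DERIV_cong[OF DERIV_mult[OF F(1)[OF z] d(2)]]) (simp add: algebra_simps)
 qed
 then show "twisted_solution Q L U Y" by (rule twisted_solution_cong) (use Y U L in auto)
qed

text \<open>Reduction of order: the Wronskian of \<open>y\<close> and \<open>y I\<close> is the constant
  \<open>1\<close>.\<close>

lemma solves_ode_reduction_of_order:
 assumes y: "solves_ode Q U y" and U: "open U" and nz: "!!z. z \<in> U ==> y z ~= 0"
  and I: "!!z. z \<in> U ==> (I has_field_derivative 1 / y z ^ 2) (at z)"
 shows "solves_ode Q U (%z. y z * I z)"
proof (rule solves_odeI[OF U, where y' = "%z. deriv y z * I z + 1 / y z"])
 fix z assume z: "z \<in> U"
 note d = solves_odeD[OF y U z]
 show "((%z. y z * I z) has_field_derivative deriv y z * I z + 1 / y z) (at z)"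
  by (rule DERIV_cong[OF DERIV_mult[OF d(1) I[OF z]]]) (use nz[OF z] in \<open>simp add: power2_eq_square\<close>)
 have "((%z. 1 / y z) has_field_derivative - deriv y z / y z ^ 2) (at z)"
  by (rule DERIV_cong[OF DERIV_divide[OF DERIV_const d(1) nz[OF z]]]) (simp add: power2_eq_square)
 from DERIV_add[OF DERIV_mult[OF d(2) I[OF z]] this]
 show "((%z. deriv y z * I z + 1 / y z) has_field_derivative - 4 * of_real pi ^ 2 * Q z * (y z * I z)) (at z)"
  by (rule DERIV_cong) simp
qed

section \<open>Local structure at a point of the half-plane\<close>

text \<open>Near \<open>p\<close> let \<open>w = z - p\<close>, let \<open>n\<close> be the difference of the exponents, and let \<open>L\<close> have residue
  \<open>(n - 1) / 2\<close>, so that a branch of \<open>F\<close> shifts the exponents to \<open>0\<close> and \<open>n\<close>. The following data are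
  those of the Frobenius solution \<open>v\<close> and of the integral \<open>G\<close> in the reduction of order.\<close>

locale local_data =
 fixes Q L :: "complex => complex" and p :: complex and r :: real and n :: nat
  and q Lreg v G :: "complex => complex" and c :: complex
 assumes n: "n >= 1" and r: "r > 0"
  and q: "q holomorphic_on ball 0 r" and Lreg: "Lreg holomorphic_on ball p r"
  and Q_eq: "!!z. z \<in> ball p r - {p} ==>
    - 4 * of_real pi ^ 2 * Q z * (z - p) ^ 2 = (of_nat n ^ 2 - 1) / 4 + (z - p) * q (z - p)"
  and L_eq: "!!z. z \<in> ball p r - {p} ==> L z = (of_nat n - 1) / 2 / (z - p) + Lreg z"
  and v: "v holomorphic_on ball 0 r" "v 0 = 1" "!!w. norm w < r ==> v w ~= 0"
  and G: "G holomorphic_on ball 0 r"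
  and v_ode: "!!w. norm w < r ==> w * deriv (deriv v) w + of_nat (n + 1) * deriv v w = q w * v w"
  and G_eq: "!!w. norm w < r ==> w * deriv G w - of_nat n * G w = 1 / v w ^ 2 - c * w ^ n"
begin

lemma derivs:
 assumes "norm w < r"
 shows "(v has_field_derivative deriv v w) (at w)"
  "(deriv v has_field_derivative deriv (deriv v) w) (at w)"
  "(G has_field_derivative deriv G w) (at w)"
  "(deriv G has_field_derivative deriv (deriv G) w) (at w)"
 using assms v G by (auto intro!: holomorphic_derivI[where S = "ball 0 r"] holomorphic_deriv)

lemma shift_derivs:
 assumes "z \<in> ball p r"
 shows "((%z. v (z - p)) has_field_derivative deriv v (z - p)) (at z)"
  "((%z. deriv v (z - p)) has_field_derivative deriv (deriv v) (z - p)) (at z)"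
  "((%z. G (z - p)) has_field_derivative deriv G (z - p)) (at z)"
  "((%z. deriv G (z - p)) has_field_derivative deriv (deriv G) (z - p)) (at z)"
proof -
 have w: "norm (z - p) < r" using assms by (simp add: dist_norm norm_minus_commute)
 have "((%z. f (z - p)) has_field_derivative d) (at z)" if "(f has_field_derivative d) (at (z - p))" for f d
 proof (rule DERIV_cong)
  show "((%z. f (z - p)) has_field_derivative d * 1) (at z)"
  proof (rule DERIV_chain2[where f = f and g = "%z. z - p"])
   show "(f has_field_derivative d) (at (z - p))" by (rule that)
   show "((%z. z - p) has_field_derivative 1) (at z)" by (auto intro!: derivative_eq_intros)
  qed
 qed simp
 then show "((%z. v (z - p)) has_field_derivative deriv v (z - p)) (at z)"
  "((%z. deriv v (z - p)) has_field_derivative deriv (deriv v) (z - p)) (at z)"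
  "((%z. G (z - p)) has_field_derivative deriv G (z - p)) (at z)"
  "((%z. deriv G (z - p)) has_field_derivative deriv (deriv G) (z - p)) (at z)"
  using derivs[OF w] by blast+
qed

lemma G_0: "G 0 ~= 0"
 using G_eq[of 0] n r v(2) by (auto simp: power_0_left)

text \<open>The second solution obtained by reduction of order is \<open>w\<close> raised to the smaller exponent
  times \<open>v G + c w\<^sup>n v log w\<close>, so a nonzero \<open>c\<close> produces a logarithm.\<close>

lemma logarithmic_solution:
 assumes "c ~= 0"
 shows "\<exists>y. solves_ode Q (slit_disc p r) y \<and> log_singularity y p r"
proof -
 define U where "U = slit_disc p r"
 have U: "open U"
 proof -
  have "closed (\<real>\<^sub>\<le>\<^sub>0 :: complex set)" by simp
  then have "open ((%z. z - p) -` (- \<real>\<^sub>\<le>\<^sub>0))" by (intro open_vimage continuous_intros open_Compl)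
  then have "open (ball p r \<inter> (%z. z - p) -` (- \<real>\<^sub>\<le>\<^sub>0))" by (intro open_Int) auto
  also have "ball p r \<inter> (%z. z - p) -` (- \<real>\<^sub>\<le>\<^sub>0) = U" by (auto simp: U_def slit_disc_def)
  finally show ?thesis .
 qed
 have Uz: "z \<in> ball p r - {p}" "norm (z - p) < r" "z - p \<notin> \<real>\<^sub>\<le>\<^sub>0" "z - p ~= 0" if "z \<in> U" for z
  using that by (auto simp: U_def slit_disc_def dist_norm norm_minus_commute)
 define \<alpha> :: complex where "\<alpha> = (of_nat n + 1) / 2"
 define pw where "pw s z = exp (s * Ln (z - p))" for s z
 have pw: "(pw s has_field_derivative pw s z * (s / (z - p))) (at z)" if "z \<in> U" for s z
  unfolding pw_def[abs_def] using Uz[OF that] by (auto intro!: derivative_eq_intros simp: divide_inverse)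
 have pw_nat: "pw (of_nat k) z = (z - p) ^ k" if "z \<in> U" for k z
  using Uz[OF that] by (simp add: pw_def exp_of_nat_mult)
 have pw_add: "pw (s + t) z = pw s z * pw t z" for s t z by (simp add: pw_def ring_distribs exp_add)
 define y2 where "y2 z = pw \<alpha> z * v (z - p)" for z
 define I where "I z = pw (- of_nat n) z * G (z - p) + c * Ln (z - p)" for z
 have sol2: "solves_ode Q U y2"
 proof (rule solves_odeI[OF U, where y' = "%z. pw \<alpha> z * (\<alpha> / (z - p) * v (z - p) + deriv v (z - p))"])
  fix z assume z: "z \<in> U"
  note w = Uz[OF z]
  have zb: "z \<in> ball p r" using w(1) by simp
  define x where "x = z - p"
  have x0: "x ~= 0" using w by (simp add: x_def)
  show "(y2 has_field_derivative pw \<alpha> z * (\<alpha> / (z - p) * v (z - p) + deriv v (z - p))) (at z)"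
   unfolding y2_def[abs_def]
   by (rule DERIV_cong[OF DERIV_mult[OF pw[OF z] shift_derivs(1)[OF zb]]]) (simp add: algebra_simps)
  have "((%z. \<alpha> / (z - p)) has_field_derivative - \<alpha> / (z - p) ^ 2) (at z)"
   using w by (auto intro!: derivative_eq_intros simp: power2_eq_square)
  from DERIV_mult[OF pw[OF z] DERIV_add[OF DERIV_mult[OF this shift_derivs(1)[OF zb]] shift_derivs(2)[OF zb]]]
  show "((%z. pw \<alpha> z * (\<alpha> / (z - p) * v (z - p) + deriv v (z - p))) has_field_derivative
    - 4 * of_real pi ^ 2 * Q z * y2 z) (at z)"
  proof (rule DERIV_cong)
   have xr: "norm x < r" using w by (simp add: x_def)
   have "pw \<alpha> z * (\<alpha> / x) * (\<alpha> / x * v x + deriv v x) + (- \<alpha> / x ^ 2 * v x + deriv v x * (\<alpha> / x) + deriv (deriv v) x) * pw \<alpha> z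
     = pw \<alpha> z / x ^ 2 * (\<alpha> * (\<alpha> - 1) * v x + x * (x * deriv (deriv v) x + 2 * \<alpha> * deriv v x))"
    using x0 by (simp add: field_simps power2_eq_square)
   also have "2 * \<alpha> = of_nat (n + 1)" by (simp add: \<alpha>_def)
   also have "\<alpha> * (\<alpha> - 1) = (of_nat n ^ 2 - 1) / 4" by (simp add: \<alpha>_def field_simps power2_eq_square)
   also have "x * deriv (deriv v) x + of_nat (n + 1) * deriv v x = q x * v x" by (rule v_ode[OF xr])
   also have "(of_nat n ^ 2 - 1) / 4 * v x + x * (q x * v x) = - 4 * of_real pi ^ 2 * Q z * x ^ 2 * v x"
    using Q_eq[OF w(1)] by (simp add: x_def [symmetric] algebra_simps)
   also have "pw \<alpha> z / x ^ 2 * (- 4 * of_real pi ^ 2 * Q z * x ^ 2 * v x) = - 4 * of_real pi ^ 2 * Q z * y2 z"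
    using x0 by (simp add: y2_def x_def [symmetric])
   finally show "pw \<alpha> z * (\<alpha> / (z - p)) * (\<alpha> / (z - p) * v (z - p) + deriv v (z - p)) +
     (- \<alpha> / (z - p) ^ 2 * v (z - p) + deriv v (z - p) * (\<alpha> / (z - p)) + deriv (deriv v) (z - p)) * pw \<alpha> z =
     - 4 * of_real pi ^ 2 * Q z * y2 z" unfolding x_def .
  qed
 qed
 have I': "(I has_field_derivative 1 / y2 z ^ 2) (at z)" if z: "z \<in> U" for z
 proof -
  note w = Uz[OF z]
  have zb: "z \<in> ball p r" using w(1) by simp
  define x where "x = z - p"
  have x0: "x ~= 0" "norm x < r" using w by (auto simp: x_def)
  define m where "m = pw (- of_nat n) z"
  have m: "m * x ^ n = 1"
   using pw_add[of "- of_nat n" "of_nat n" z] pw_nat[OF z, of n] by (simp add: m_def x_def pw_def)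
  have "((%z. Ln (z - p)) has_field_derivative 1 / (z - p)) (at z)"
   using w by (auto intro!: derivative_eq_intros simp: divide_inverse)
  from DERIV_add[OF DERIV_mult[OF pw[OF z, of "- of_nat n"] shift_derivs(3)[OF zb]] DERIV_cmult[OF this, of c]]
  have "(I has_field_derivative m * (- of_nat n / x) * G x + deriv G x * m + c * (1 / x)) (at z)"
   unfolding I_def[abs_def] by (simp add: m_def x_def)
  also have "m * (- of_nat n / x) * G x + deriv G x * m + c * (1 / x) = m / x * (x * deriv G x - of_nat n * G x + c * x ^ n)"
   using x0 m by (simp add: field_simps)
  also have "x * deriv G x - of_nat n * G x + c * x ^ n = 1 / v x ^ 2" using G_eq[OF x0(2)] by simp
  also have "m / x * (1 / v x ^ 2) = 1 / y2 z ^ 2"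
  proof -
   have "pw \<alpha> z * pw \<alpha> z = pw (of_nat (Suc n)) z"
   proof -
    have "\<alpha> + \<alpha> = of_nat (Suc n)" by (simp add: \<alpha>_def field_simps)
    then show ?thesis by (simp add: pw_add [symmetric])
   qed
   then have "y2 z ^ 2 = x ^ Suc n * v x ^ 2"
    using pw_nat[OF z, of "Suc n"] by (simp add: y2_def power2_eq_square x_def [symmetric] mult_ac)
   moreover have "m / x = 1 / x ^ Suc n"
   proof -
    have xn: "x ^ n ~= 0" using x0 by simp
    have "m = 1 / x ^ n" using m xn by (simp add: field_simps)
    then show ?thesis by simp
   qed
   ultimately show ?thesis by simp
  qed
  finally show ?thesis .
 qed
 have nz: "y2 z ~= 0" if "z \<in> U" for z
  using v(3) Uz[OF that] by (simp add: y2_def pw_def)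
 have sol: "solves_ode Q U (%z. y2 z * I z)"
  by (rule solves_ode_reduction_of_order[OF sol2 U nz I'])
 have hol: "(%z. v (z - p)) holomorphic_on ball p r" "(%z. G (z - p)) holomorphic_on ball p r"
  unfolding holomorphic_on_open[OF open_ball] using shift_derivs(1,3) by blast+
 have nzp: "c * ((p + of_real (r / 2)) - p) ^ n * v ((p + of_real (r / 2)) - p) ~= 0"
  using assms r v(3)[of "of_real (r / 2)"] by (simp del: of_real_divide)
 have inb: "p + of_real (r / 2) \<in> ball p r" using r by (simp add: dist_norm del: of_real_divide)
 have form: "y2 z * I z = exp ((1 - of_nat n) / 2 * Ln (z - p)) *
    (v (z - p) * G (z - p) + Ln (z - p) * (c * (z - p) ^ n * v (z - p)))" if "z \<in> slit_disc p r" for z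
 proof -
  have zU: "z \<in> U" using that by (simp add: U_def)
  have e: "pw \<alpha> z = pw ((1 - of_nat n) / 2) z * pw (of_nat n) z"
   unfolding pw_add [symmetric] by (simp add: \<alpha>_def field_simps)
  have m: "pw (of_nat n) z * pw (- of_nat n) z = 1" by (simp add: pw_add [symmetric]) (simp add: pw_def)
  have "y2 z * I z = pw ((1 - of_nat n) / 2) z *
    ((pw (of_nat n) z * pw (- of_nat n) z) * (v (z - p) * G (z - p)) + Ln (z - p) * (c * pw (of_nat n) z * v (z - p)))"
   unfolding y2_def I_def e by (simp add: algebra_simps)
  then show ?thesis
   unfolding m unfolding pw_nat[OF zU] by (simp add: pw_def)
 qed
 have "log_singularity (%z. y2 z * I z) p r"
  unfolding log_singularity_def
  by (rule exI[of _ "(1 - of_nat n) / 2"], rule exI[of _ "%z. v (z - p) * G (z - p)"],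
    rule exI[of _ "%z. c * (z - p) ^ n * v (z - p)"])
    (use form nzp inb in \<open>intro conjI ballI holomorphic_intros hol bexI[OF _ inb]; blast\<close>)
 with sol show ?thesis unfolding U_def by blast
qed

text \<open>At a regular point the exponents are \<open>0\<close> and \<open>1\<close>, so \<open>n = 1\<close>, and
  \<open>c\<close> is the linear coefficient of \<open>1/v\<^sup>2\<close>; it vanishes because \<open>q(0) =
  0\<close> there.\<close>

lemma no_logarithm_regular:
 assumes "Q holomorphic_on ball p r" shows "c = 0"
proof -
 have cont: "isCont Q p" "isCont q 0"
  using holomorphic_on_imp_continuous_on[OF assms] holomorphic_on_imp_continuous_on[OF q] r
  by (auto simp: continuous_on_eq_continuous_at)
 have tq: "((%z. q (z - p)) \<longlongrightarrow> q 0) (at p)"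
  by (rule isCont_tendsto_compose[OF cont(2)]) (auto intro!: tendsto_eq_intros)
 have tQ: "(Q \<longlongrightarrow> Q p) (at p)" using cont(1) by (simp add: isCont_def)
 have ev: "eventually (%z. z \<in> ball p r - {p}) (at p)"
  using eventually_at_in_open[of "ball p r" p] r by simp
 have "((%z. (of_nat n ^ 2 - 1) / 4 + (z - p) * q (z - p)) \<longlongrightarrow> (of_nat n ^ 2 - 1) / 4 + (p - p) * q 0) (at p)"
  by (intro tendsto_intros tq)
 moreover have "((%z. - 4 * of_real pi ^ 2 * Q z * (z - p) ^ 2) \<longlongrightarrow> - 4 * of_real pi ^ 2 * Q p * (p - p) ^ 2) (at p)"
  by (intro tendsto_intros tQ)
 then have "((%z. (of_nat n ^ 2 - 1) / 4 + (z - p) * q (z - p)) \<longlongrightarrow> - 4 * of_real pi ^ 2 * Q p * (p - p) ^ 2) (at p)"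
  by (rule Lim_transform_eventually) (use ev Q_eq in \<open>auto elim!: eventually_mono\<close>)
 ultimately have "(of_nat n ^ 2 - 1) / 4 + (p - p) * q 0 = - 4 * of_real pi ^ 2 * Q p * (p - p) ^ 2"
  by (rule LIM_unique)
 then have "of_nat (n ^ 2) = (of_nat 1 :: complex)" by simp
 then have n1: "n = 1" by (simp only: of_nat_eq_iff) (simp add: power2_eq_square)
 have "((%z. - 4 * of_real pi ^ 2 * Q z * (z - p)) \<longlongrightarrow> - 4 * of_real pi ^ 2 * Q p * (p - p)) (at p)"
  by (intro tendsto_intros tQ)
 then have "((%z. q (z - p)) \<longlongrightarrow> - 4 * of_real pi ^ 2 * Q p * (p - p)) (at p)"
 proof (rule Lim_transform_eventually)
  show "\<forall>\<^sub>F z in at p. - 4 * of_real pi ^ 2 * Q z * (z - p) = q (z - p)"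
   using ev
  proof eventually_elim
   case (elim z)
   then have "z - p ~= 0" "(z - p) * (- 4 * of_real pi ^ 2 * Q z * (z - p)) = (z - p) * q (z - p)"
    using Q_eq[OF elim] n1 unfolding n1 by (simp_all add: power2_eq_square algebra_simps)
   then show ?case using mult_left_cancel[of "z - p" "- 4 * of_real pi ^ 2 * Q z * (z - p)" "q (z - p)"] by blast
  qed
 qed
 with tq have "q 0 = 0" using LIM_unique by fastforce
 then have v'0: "deriv v 0 = 0" using v_ode[of 0] r n1 by simp
 have r0: "norm (0 :: complex) < r" using r by simp
 note d = derivs[OF r0]
 have "((%w. w * deriv G w - G w) has_field_derivative 1 * deriv G 0 + deriv (deriv G) 0 * 0 - deriv G 0) (at 0)"
  by (intro DERIV_diff DERIV_mult DERIV_ident d)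
 moreover have "((%w. 1 / v w ^ 2 - c * w) has_field_derivative (0 * v 0 ^ 2 - 1 * (2 * (v 0 * deriv v 0))) / (v 0 ^ 2 * v 0 ^ 2) - c * 1) (at 0)"
  using DERIV_power[OF d(1), of 2] v(2) by (intro DERIV_diff DERIV_divide DERIV_const DERIV_cmult DERIV_ident) (simp_all add: mult_ac)
 then have "((%w. w * deriv G w - G w) has_field_derivative (0 * v 0 ^ 2 - 1 * (2 * (v 0 * deriv v 0))) / (v 0 ^ 2 * v 0 ^ 2) - c * 1) (at 0)"
  by (rule has_field_derivative_transform_within_open[where S = "ball 0 r"]) (use G_eq n1 r in auto)
 ultimately have "1 * deriv G 0 + deriv (deriv G) 0 * 0 - deriv G 0 = (0 * v 0 ^ 2 - 1 * (2 * (v 0 * deriv v 0))) / (v 0 ^ 2 * v 0 ^ 2) - c * 1"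
  by (rule DERIV_unique)
 then show ?thesis using v'0 by simp
qed

text \<open>Here \<open>E\<close> is the regular part of a branch of \<open>F\<close>; the factor \<open>(z -
  p)\<^sup>e\<close> with \<open>e = (n - 1)/2\<close> is split off, which leads to the Euler type equation in
  \<open>eq\<close> with exponents \<open>0\<close> and \<open>n\<close>.\<close>

lemma twisted_of_product:
 assumes E: "!!z. z \<in> ball p r ==> (E has_field_derivative Lreg z * E z) (at z)"
  and U1: "!!z. z \<in> ball p r ==> (U has_field_derivative U1 z) (at z)"
  and U2: "!!z. z \<in> ball p r ==> (U1 has_field_derivative U2 z) (at z)"
  and eq: "!!z. z \<in> ball p r - {p} ==>
    (z - p) ^ 2 * U2 z - (of_nat n - 1) * (z - p) * U1 z + (of_nat n ^ 2 - 1) / 4 * U z =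
    ((of_nat n ^ 2 - 1) / 4 + (z - p) * q (z - p)) * U z"
 shows "twisted_solution Q L (ball p r - {p}) (%z. E z * U z)"
  "!!z. z \<in> ball p r - {p} ==> nabla L (%z. E z * U z) z = E z * (U1 z - (of_nat n - 1) / 2 / (z - p) * U z)"
proof -
 define e :: complex where "e = (of_nat n - 1) / 2"
 have first: "((%z. E z * U z) has_field_derivative L z * (E z * U z) + E z * (U1 z - e / (z - p) * U z)) (at z)"
  if z: "z \<in> ball p r - {p}" for z
  by (rule DERIV_cong[OF DERIV_mult[OF E U1]]) (use z in \<open>auto simp: L_eq e_def [symmetric] algebra_simps\<close>)
 then show "nabla L (%z. E z * U z) z = E z * (U1 z - (of_nat n - 1) / 2 / (z - p) * U z)"
  if "z \<in> ball p r - {p}" for z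
  using DERIV_imp_deriv[OF first[OF that]] by (simp add: nabla_def e_def)
 show "twisted_solution Q L (ball p r - {p}) (%z. E z * U z)"
 proof (rule twisted_solutionI[where X = "%z. E z * (U1 z - e / (z - p) * U z)"])
  fix z assume z: "z \<in> ball p r - {p}"
  show "((%z. E z * U z) has_field_derivative L z * (E z * U z) + E z * (U1 z - e / (z - p) * U z)) (at z)"
   by (rule first[OF z])
  define x where "x = z - p"
  have x0: "x ~= 0" and zb: "z \<in> ball p r" using z by (auto simp: x_def)
  have "((%z. e / (z - p)) has_field_derivative - e / x ^ 2) (at z)"
   using x0 by (auto intro!: derivative_eq_intros simp: power2_eq_square x_def)
  from DERIV_mult[OF E[OF zb] DERIV_diff[OF U2[OF zb] DERIV_mult[OF this U1[OF zb]]]]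
  show "((%z. E z * (U1 z - e / (z - p) * U z)) has_field_derivative
    L z * (E z * (U1 z - e / (z - p) * U z)) - 4 * of_real pi ^ 2 * Q z * (E z * U z)) (at z)"
  proof (rule DERIV_cong)
   have QU: "x ^ 2 * U2 z - 2 * e * x * U1 z + (e ^ 2 + e) * U z = - 4 * of_real pi ^ 2 * Q z * x ^ 2 * U z"
   proof -
    have "(of_nat n ^ 2 - 1) / 4 = e ^ 2 + e" by (simp add: e_def field_simps power2_eq_square)
    moreover have "of_nat n - 1 = 2 * e" by (simp add: e_def)
    ultimately have e: "(z - p) ^ 2 * U2 z - 2 * e * (z - p) * U1 z + (e ^ 2 + e) * U z = ((e ^ 2 + e) + (z - p) * q (z - p)) * U z"
     "- 4 * of_real pi ^ 2 * Q z * (z - p) ^ 2 = (e ^ 2 + e) + (z - p) * q (z - p)"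
     using eq[OF z] Q_eq[OF z] by (simp_all only:)
    show ?thesis unfolding x_def e ..
   qed
   have "U2 z - e / x * U1 z + e / x ^ 2 * U z - e / x * (U1 z - e / x * U z) = - 4 * of_real pi ^ 2 * Q z * U z"
   proof -
    have "x ^ 2 * (U2 z - e / x * U1 z + e / x ^ 2 * U z - e / x * (U1 z - e / x * U z)) =
      x ^ 2 * U2 z - 2 * e * x * U1 z + (e ^ 2 + e) * U z"
     using x0 by (simp add: field_simps power2_eq_square)
    also have "\<dots> = x ^ 2 * (- 4 * of_real pi ^ 2 * Q z * U z)" unfolding QU by simp
    finally show ?thesis using x0 mult_left_cancel[of "x ^ 2" "U2 z - e / x * U1 z + e / x ^ 2 * U z - e / x * (U1 z - e / x * U z)"] by fastforce
   qed
   then have key: "U2 z - e / x * U1 z + e / x ^ 2 * U z = e / x * (U1 z - e / x * U z) - 4 * of_real pi ^ 2 * Q z * U z"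
    by (simp add: algebra_simps)
   have "Lreg z * E z * (U1 z - e / x * U z) + (U2 z - (- e / x ^ 2 * U z + U1 z * (e / x))) * E z =
     Lreg z * E z * (U1 z - e / x * U z) + E z * (U2 z - e / x * U1 z + e / x ^ 2 * U z)"
    by (simp add: algebra_simps)
   also have "\<dots> = (e / x + Lreg z) * (E z * (U1 z - e / x * U z)) - 4 * of_real pi ^ 2 * Q z * (E z * U z)"
    unfolding key by (simp add: algebra_simps add_divide_distrib)
   finally show "Lreg z * E z * (U1 z - e / (z - p) * U z) + (U2 z - (- e / x ^ 2 * U z + U1 z * (e / (z - p)))) * E z =
     L z * (E z * (U1 z - e / (z - p) * U z)) - 4 * of_real pi ^ 2 * Q z * (E z * U z)"
    using L_eq[OF z] by (simp add: x_def e_def)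
  qed
 qed (auto intro: open_Diff)
qed

text \<open>Without the logarithm, \<open>v G\<close> and \<open>w\<^sup>n v\<close> are holomorphic solutions of the
  equation of \<open>twisted_of_product\<close>; the first does not vanish at \<open>p\<close> and belongs to the
  exponent \<open>0\<close>.\<close>

lemma twisted_basis:
 assumes "c = 0"
 obtains u1 u2 where "u1 holomorphic_on ball p r" "u2 holomorphic_on ball p r" "u1 p ~= 0"
  "twisted_solution Q L (ball p r - {p}) u1" "twisted_solution Q L (ball p r - {p}) u2"
  "!!z. z \<in> ball p r - {p} ==> twisted_wronskian L u1 u2 z ~= 0"
proof -
 obtain g where g: "!!z. z \<in> ball p r ==> (g has_field_derivative Lreg z) (at z)"
  using holomorphic_convex_primitive'[OF convex_ball open_ball Lreg] by (metis at_within_open open_ball)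
 define E where "E z = exp (g z)" for z
 have E: "(E has_field_derivative Lreg z * E z) (at z)" if "z \<in> ball p r" for z
  unfolding E_def[abs_def] using g[OF that] by (auto intro!: derivative_eq_intros)
 have E0: "E z ~= 0" for z by (simp add: E_def)
 define A A1 A2 where "A z = v (z - p) * G (z - p)" and "A1 z = deriv v (z - p) * G (z - p) + v (z - p) * deriv G (z - p)"
  and "A2 z = deriv (deriv v) (z - p) * G (z - p) + 2 * deriv v (z - p) * deriv G (z - p) + v (z - p) * deriv (deriv G) (z - p)" for z
 have A: "(A has_field_derivative A1 z) (at z)" "(A1 has_field_derivative A2 z) (at z)" if z: "z \<in> ball p r" for z
 proof -
  note d = shift_derivs[OF z]
  show "(A has_field_derivative A1 z) (at z)"
   unfolding A_def[abs_def] by (rule DERIV_cong[OF DERIV_mult[OF d(1,3)]]) (simp add: A1_def algebra_simps)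
  show "(A1 has_field_derivative A2 z) (at z)"
   unfolding A1_def[abs_def]
   by (rule DERIV_cong[OF DERIV_add[OF DERIV_mult[OF d(2,3)] DERIV_mult[OF d(1,4)]]]) (simp add: A2_def algebra_simps)
 qed
 define B B1 B2 where "B z = (z - p) ^ n * v (z - p)"
  and "B1 z = of_nat n * (z - p) ^ (n - 1) * v (z - p) + (z - p) ^ n * deriv v (z - p)"
  and "B2 z = of_nat n * (of_nat (n - 1) * (z - p) ^ (n - 1 - 1)) * v (z - p) + 2 * of_nat n * (z - p) ^ (n - 1) * deriv v (z - p)
     + (z - p) ^ n * deriv (deriv v) (z - p)" for z
 have pow: "((%z. (z - p) ^ k) has_field_derivative of_nat k * (z - p) ^ (k - 1)) (at z)" for k z
  by (rule DERIV_cong[OF DERIV_power[of "%z. z - p" 1]]) (auto intro!: derivative_eq_intros)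
 have B: "(B has_field_derivative B1 z) (at z)" "(B1 has_field_derivative B2 z) (at z)" if z: "z \<in> ball p r" for z
 proof -
  note d = shift_derivs[OF z]
  show "(B has_field_derivative B1 z) (at z)"
   unfolding B_def[abs_def] by (rule DERIV_cong[OF DERIV_mult[OF pow d(1)]]) (simp add: B1_def algebra_simps)
  show "(B1 has_field_derivative B2 z) (at z)"
   unfolding B1_def[abs_def]
   by (rule DERIV_cong[OF DERIV_add[OF DERIV_mult[OF DERIV_cmult[OF pow] d(1)] DERIV_mult[OF pow d(2)]]])
     (simp add: B2_def algebra_simps)
 qed
 have wG: "x * deriv (deriv G) x = (of_nat n - 1) * deriv G x - 2 * deriv v x / v x ^ 3" if x: "norm x < r" for x
 proof -
  note d = derivs[OF x]
  have "((%w. w * deriv G w - of_nat n * G w) has_field_derivative 1 * deriv G x + deriv (deriv G) x * x - of_nat n * deriv G x) (at x)"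
   by (intro DERIV_diff DERIV_mult DERIV_ident DERIV_cmult d)
  moreover have "((%w. 1 / v w ^ 2) has_field_derivative (0 * v x ^ 2 - 1 * (2 * (v x * deriv v x))) / (v x ^ 2 * v x ^ 2)) (at x)"
   using DERIV_power[OF d(1), of 2] v(3)[OF x] by (intro DERIV_divide DERIV_const) (simp_all add: mult_ac)
  then have "((%w. w * deriv G w - of_nat n * G w) has_field_derivative (0 * v x ^ 2 - 1 * (2 * (v x * deriv v x))) / (v x ^ 2 * v x ^ 2)) (at x)"
   by (rule has_field_derivative_transform_within_open[where S = "ball 0 r"]) (use G_eq x assms in auto)
  ultimately have "1 * deriv G x + deriv (deriv G) x * x - of_nat n * deriv G x =
    (0 * v x ^ 2 - 1 * (2 * (v x * deriv v x))) / (v x ^ 2 * v x ^ 2)" by (rule DERIV_unique)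
  also have "\<dots> = - 2 * deriv v x / v x ^ 3" using v(3)[OF x] by (simp add: field_simps eval_nat_numeral)
  finally show ?thesis by (simp add: algebra_simps)
 qed
 have Aeq: "(z - p) ^ 2 * A2 z - (of_nat n - 1) * (z - p) * A1 z + (of_nat n ^ 2 - 1) / 4 * A z =
    ((of_nat n ^ 2 - 1) / 4 + (z - p) * q (z - p)) * A z" if z: "z \<in> ball p r - {p}" for z
 proof -
  define x where "x = z - p"
  have x: "norm x < r" using z by (simp add: x_def dist_norm norm_minus_commute)
  have v0: "v x ~= 0" by (rule v(3)[OF x])
  have "x ^ 2 * A2 z - (of_nat n - 1) * x * A1 z =
    x * G x * (x * deriv (deriv v) x + of_nat (n + 1) * deriv v x)
    + 2 * x * deriv v x * (x * deriv G x - of_nat n * G x - 1 / v x ^ 2)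
    + x * v x * (x * deriv (deriv G) x - (of_nat n - 1) * deriv G x + 2 * deriv v x / v x ^ 3)"
   unfolding A2_def A1_def x_def [symmetric] using v0 by (simp add: field_simps eval_nat_numeral)
  also have "\<dots> = x * q x * A z"
   using v_ode[OF x] G_eq[OF x] wG[OF x] assms by (simp add: A_def x_def [symmetric])
  finally show ?thesis by (simp add: x_def algebra_simps)
 qed
 have Beq: "(z - p) ^ 2 * B2 z - (of_nat n - 1) * (z - p) * B1 z + (of_nat n ^ 2 - 1) / 4 * B z =
    ((of_nat n ^ 2 - 1) / 4 + (z - p) * q (z - p)) * B z" if z: "z \<in> ball p r - {p}" for z
 proof -
  define x where "x = z - p"
  have x: "norm x < r" "x ~= 0" using z by (auto simp: x_def dist_norm norm_minus_commute)
  obtain k where k: "n = Suc k" using n by (cases n) auto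
  have p1: "x * x ^ k = x ^ n" by (simp add: k)
  have p2: "x ^ 2 * (of_nat k * x ^ (k - 1)) = of_nat k * x ^ n" by (cases k) (simp_all add: k power2_eq_square)
  have "x ^ 2 * B2 z - (of_nat n - 1) * x * B1 z =
    of_nat n * (x ^ 2 * (of_nat k * x ^ (k - 1))) * v x + 2 * of_nat n * x * (x * x ^ k) * deriv v x + x ^ 2 * x ^ n * deriv (deriv v) x
    - of_nat k * (of_nat n * (x * x ^ k) * v x + x * x ^ n * deriv v x)"
   unfolding B2_def B1_def x_def [symmetric] by (simp add: k algebra_simps power2_eq_square)
  also have "\<dots> = x ^ n * (x * (x * deriv (deriv v) x + of_nat (n + 1) * deriv v x))"
   unfolding p1 p2 by (simp add: k algebra_simps power2_eq_square)
  also have "\<dots> = x * q x * B z" using v_ode[OF x(1)] by (simp add: B_def x_def [symmetric])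
  finally show ?thesis by (simp add: x_def algebra_simps)
 qed
 have nA: "nabla L (%z. E z * A z) z = E z * (A1 z - (of_nat n - 1) / 2 / (z - p) * A z)" if "z \<in> ball p r - {p}" for z
  using that by (intro twisted_of_product(2)[OF E A Aeq])
 have nB: "nabla L (%z. E z * B z) z = E z * (B1 z - (of_nat n - 1) / 2 / (z - p) * B z)" if "z \<in> ball p r - {p}" for z
  using that by (intro twisted_of_product(2)[OF E B Beq])
 show thesis
 proof (rule that[of "%z. E z * A z" "%z. E z * B z"])
  have "E holomorphic_on ball p r" "A holomorphic_on ball p r" "B holomorphic_on ball p r"
   unfolding holomorphic_on_open[OF open_ball] using E A(1) B(1) by blast+
  then show "(%z. E z * A z) holomorphic_on ball p r" "(%z. E z * B z) holomorphic_on ball p r"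
   by (auto intro!: holomorphic_intros)
  show "E p * A p ~= 0" using E0 G_0 v(2) by (simp add: A_def)
  show "twisted_solution Q L (ball p r - {p}) (%z. E z * A z)" by (rule twisted_of_product(1)[OF E A Aeq])
  show "twisted_solution Q L (ball p r - {p}) (%z. E z * B z)" by (rule twisted_of_product(1)[OF E B Beq])
  fix z assume z: "z \<in> ball p r - {p}"
  define x where "x = z - p"
  have x: "norm x < r" "x ~= 0" using z by (auto simp: x_def dist_norm norm_minus_commute)
  obtain k where k: "n = Suc k" using n by (cases n) auto
  have v0: "v x ~= 0" by (rule v(3)[OF x(1)])
  have "twisted_wronskian L (%z. E z * A z) (%z. E z * B z) z = E z ^ 2 * (A z * B1 z - B z * A1 z)"
   unfolding twisted_wronskian_def nA[OF z] nB[OF z] by (simp add: algebra_simps power2_eq_square)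
  also have "A z * B1 z - B z * A1 z = - (v x ^ 2 * x ^ k * (x * deriv G x - of_nat n * G x))"
   unfolding A_def B_def A1_def B1_def x_def [symmetric] by (simp add: k algebra_simps power2_eq_square)
  also have "\<dots> = - (x ^ k)" using G_eq[OF x(1)] assms v0 by simp
  finally show "twisted_wronskian L (%z. E z * A z) (%z. E z * B z) z ~= 0" using E0 x(2) by simp
 qed
qed

end

text \<open>At an apparent point the constant \<open>c\<close> vanishes because it would produce a logarithm, at a
  regular point by the Taylor expansion.\<close>

theorem local_twisted_basis:
 fixes n :: nat
 assumes n: "n >= 1" and r: "r > 0" and uhp: "ball p r \<subseteq> uhp"
  and Q: "Q holomorphic_on (ball p r - {p})"
  and q: "q holomorphic_on ball 0 r" and Lreg: "Lreg holomorphic_on ball p r"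
  and Q_eq: "!!z. z \<in> ball p r - {p} ==>
    - 4 * of_real pi ^ 2 * Q z * (z - p) ^ 2 = (of_nat n ^ 2 - 1) / 4 + (z - p) * q (z - p)"
  and L_eq: "!!z. z \<in> ball p r - {p} ==> L z = (of_nat n - 1) / 2 / (z - p) + Lreg z"
  and nolog: "apparent Q p \<or> Q holomorphic_on ball p r"
 obtains s u1 u2 where "0 < s" "s <= r" "u1 holomorphic_on ball p s" "u2 holomorphic_on ball p s" "u1 p ~= 0"
  "twisted_solution Q L (ball p s - {p}) u1" "twisted_solution Q L (ball p s - {p}) u2"
  "!!z. z \<in> ball p s - {p} ==> twisted_wronskian L u1 u2 z ~= 0"
proof -
 obtain s v G c where s: "0 < s" "s <= r" and vG: "v holomorphic_on ball 0 s" "G holomorphic_on ball 0 s"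
  "v 0 = 1" "!!w. norm w < s ==> v w ~= 0"
  "!!w. norm w < s ==> w * deriv (deriv v) w + of_nat (n + 1) * deriv v w = q w * v w"
  "!!w. norm w < s ==> w * deriv G w - of_nat n * G w = 1 / v w ^ 2 - c * w ^ n"
  using frobenius_pair[OF q r, of n] by metis
 have sub: "ball p s \<subseteq> ball p r" "ball (0 :: complex) s \<subseteq> ball 0 r" using s by auto
 interpret local_data Q L p s n q Lreg v G c
 proof
  show "q holomorphic_on ball 0 s" "Lreg holomorphic_on ball p s"
   using q Lreg holomorphic_on_subset sub by blast+
  show "- 4 * of_real pi ^ 2 * Q z * (z - p) ^ 2 = (of_nat n ^ 2 - 1) / 4 + (z - p) * q (z - p)"
   "L z = (of_nat n - 1) / 2 / (z - p) + Lreg z" if "z \<in> ball p s - {p}" for z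
   using Q_eq[of z] L_eq[of z] that sub by auto
 qed (use n s vG in auto)
 have "c = 0"
 proof (rule ccontr)
  assume c: "c ~= 0"
  have "Q holomorphic_on (ball p s - {p})" by (rule holomorphic_on_subset[OF Q]) (use sub in auto)
  moreover have "ball p s \<subseteq> uhp" using uhp sub by blast
  moreover have "\<not> Q holomorphic_on ball p r"
   using no_logarithm_regular holomorphic_on_subset sub(1) c by blast
  then have "apparent Q p" using nolog by blast
  ultimately show False using logarithmic_solution[OF c] s(1) unfolding apparent_def by blast
 qed
 then show thesis using twisted_basis that[OF s] by metis
qed

section \<open>Logarithmic derivatives\<close>

definition log_deriv :: "(complex => complex) => complex => complex" where
 "log_deriv f z = deriv f z / f z"

lemma holomorphic_log_deriv:
 assumes "f holomorphic_on U" "open U" "!!z. z \<in> U ==> f z ~= 0" shows "log_deriv f holomorphic_on U"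
 unfolding log_deriv_def[abs_def] using assms by (intro holomorphic_intros holomorphic_deriv) auto

lemma open_uhp_ball:
 assumes "Im p > 0" obtains r where "r > 0" "ball p r \<subseteq> uhp"
proof -
 have "open uhp" "p \<in> uhp" using assms by (auto simp: open_half_plane)
 then show thesis using that open_contains_ball by blast
qed

text \<open>At a simple zero write \<open>f(z) = (z - p) h(z)\<close> with \<open>h(p) \<noteq> 0\<close>; the
  logarithmic derivative of \<open>h\<close> is regular at \<open>p\<close>.\<close>

lemma log_deriv_local:
 assumes f: "f holomorphic_on uhp" and p: "Im p > 0" and simple: "f p = 0 ==> deriv f p ~= 0"
 shows "\<exists>r g. r > 0 \<and> g holomorphic_on ball p r \<and>
  (\<forall>z\<in>ball p r - {p}. f z ~= 0 \<and> log_deriv f z = (if f p = 0 then 1 else 0) / (z - p) + g z)"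
proof -
 obtain r0 where r0: "r0 > 0" "ball p r0 \<subseteq> uhp" using open_uhp_ball[OF p] by blast
 have fb: "f holomorphic_on ball p r0" using f r0(2) holomorphic_on_subset by blast
 define h where "h = (%z. if f p = 0 then (if z = p then deriv f p else (f z - f p) / (z - p)) else f z)"
 have h: "h holomorphic_on ball p r0"
  unfolding h_def using fb pole_lemma_open[OF fb open_ball, of p] by (cases "f p = 0") simp_all
 have hp: "h p ~= 0" using simple by (simp add: h_def)
 have fh: "f z = (if f p = 0 then z - p else 1) * h z" for z by (simp add: h_def)
 have "open (ball p r0 \<inter> h -` (- {0}))"
  by (rule continuous_open_preimage[OF holomorphic_on_imp_continuous_on[OF h]]) auto
 moreover have "p \<in> ball p r0 \<inter> h -` (- {0})" using hp r0 by simp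
 ultimately obtain r where r: "r > 0" "ball p r \<subseteq> ball p r0 \<inter> h -` (- {0})" using open_contains_ball by blast
 have hb: "h holomorphic_on ball p r" using holomorphic_on_subset[OF h] r(2) by blast
 have nz: "h z ~= 0" if "z \<in> ball p r" for z using r(2) that by blast
 have "f z ~= 0 \<and> log_deriv f z = (if f p = 0 then 1 else 0) / (z - p) + log_deriv h z" if z: "z \<in> ball p r - {p}" for z
 proof
  have zb: "z \<in> ball p r" "z - p ~= 0" using z by auto
  show "f z ~= 0" using fh[of z] nz[OF zb(1)] zb(2) by simp
  show "log_deriv f z = (if f p = 0 then 1 else 0) / (z - p) + log_deriv h z"
  proof (cases "f p = 0")
   case True
   have "((%z. (z - p) * h z) has_field_derivative 1 * h z + deriv h z * (z - p)) (at z)"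
    by (intro DERIV_mult holomorphic_derivI[OF hb open_ball zb(1)]) (auto intro!: derivative_eq_intros)
   moreover have "(%z. (z - p) * h z) = f" using fh True by auto
   ultimately have "deriv f z = h z + deriv h z * (z - p)" by (simp add: DERIV_imp_deriv)
   then show ?thesis using True zb nz[OF zb(1)] fh[of z] by (simp add: log_deriv_def add_divide_distrib)
  next
   case False
   then have "h = f" by (auto simp: h_def)
   then show ?thesis using False by simp
  qed
 qed
 then show ?thesis using r(1) holomorphic_log_deriv[OF hb open_ball nz] by blast
qed

lemma log_deriv_translation:
 assumes f: "f holomorphic_on uhp" and T: "!!z. Im z > 0 ==> f (z + 1) = f z" and z: "Im z > 0"
 shows "log_deriv f (z + 1) = log_deriv f z"
proof -
 have z1: "z + 1 \<in> uhp" using z by simp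
 have d: "(f has_field_derivative deriv f (z + 1)) (at (z + 1))"
  by (rule holomorphic_derivI[OF f open_half_plane z1])
 have "((%w. f (w + 1)) has_field_derivative deriv f (z + 1)) (at z)"
  using d by (simp add: DERIV_shift)
 then have "(f has_field_derivative deriv f (z + 1)) (at z)"
  by (rule has_field_derivative_transform_within_open[OF _ open_half_plane[of 0]]) (use z T in auto)
 then show ?thesis using T[OF z] by (simp add: log_deriv_def DERIV_imp_deriv)
qed

text \<open>In weight \<open>k\<close> the factor \<open>z\<^sup>k\<close> contributes \<open>k/z\<close>.\<close>

lemma log_deriv_fricke:
 assumes f: "f holomorphic_on uhp" and S: "!!z. Im z > 0 ==> f (fricke z) = c * z ^ k * f z"
  and z: "Im z > 0" and nz: "f z ~= 0" "c ~= 0"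
 shows "log_deriv f (fricke z) / (2 * z ^ 2) = log_deriv f z + of_nat k / z"
proof -
 have z0: "z ~= 0" using z by auto
 have fz: "fricke z \<in> uhp" using z by simp
 have d1: "((%z. f (fricke z)) has_field_derivative deriv f (fricke z) * (1 / (2 * z ^ 2))) (at z)"
  by (rule DERIV_chain2[where f = f and g = fricke, OF holomorphic_derivI[OF f open_half_plane fz] has_field_derivative_fricke[OF z0]])
 have pw: "((%z. z ^ k) has_field_derivative of_nat k * z ^ (k - 1)) (at z)" using DERIV_power[OF DERIV_ident, of k z UNIV] by simp
 have fd: "(f has_field_derivative deriv f z) (at z)" by (rule holomorphic_derivI[OF f open_half_plane[of 0]]) (use z in simp)
 have "((%z. c * z ^ k * f z) has_field_derivative (c * (of_nat k * z ^ (k - 1))) * f z + deriv f z * (c * z ^ k)) (at z)"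
  by (rule DERIV_mult[OF DERIV_cmult[OF pw] fd])
 then have "((%z. f (fricke z)) has_field_derivative (c * (of_nat k * z ^ (k - 1))) * f z + deriv f z * (c * z ^ k)) (at z)"
  by (rule has_field_derivative_transform_within_open[OF _ open_half_plane[of 0]]) (use z S in auto)
 with d1 have "deriv f (fricke z) * (1 / (2 * z ^ 2)) = (c * (of_nat k * z ^ (k - 1))) * f z + deriv f z * (c * z ^ k)"
  by (rule DERIV_unique)
 moreover have "of_nat k * z ^ (k - 1) = of_nat k * (z ^ k / z)" using z0 by (cases k) auto
 ultimately have "deriv f (fricke z) * (1 / (2 * z ^ 2)) = (c * (of_nat k * (z ^ k / z))) * f z + deriv f z * (c * z ^ k)"
  by (simp only:)
 then have "deriv f (fricke z) / (2 * z ^ 2) = c * z ^ k * (deriv f z + of_nat k / z * f z)"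
  by (simp add: algebra_simps)
 then have "deriv f (fricke z) / (2 * z ^ 2) / f (fricke z) = (deriv f z + of_nat k / z * f z) / f z"
  using S[OF z] nz z0 by simp
 then show ?thesis using nz by (simp add: log_deriv_def add_divide_distrib mult.commute)
qed

section \<open>Exponents and Laurent coefficients\<close>

text \<open>The coefficient of \<open>(z - p)\<^sup>-\<^sup>2\<close>, which determines the exponents at
  \<open>p\<close>.\<close>

definition acoef :: "(complex => complex) => complex => complex" where
 "acoef Q p = fls_nth (laurent_expansion Q p) (- 2)"

lemma has_kappa_acoef:
 assumes "has_kappa Q z k" shows "- 4 * of_real pi ^ 2 * acoef Q z = of_real k ^ 2 - 1 / 4"
proof -
 have "1 / 2 + complex_of_real k \<in> local_exponents Q z" using assms by (simp add: has_kappa_def)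
 then have "(1 / 2 + complex_of_real k) * (complex_of_real k - 1 / 2) = - 4 * of_real pi ^ 2 * acoef Q z"
  by (simp add: local_exponents_def acoef_def)
 moreover have "(1 / 2 + complex_of_real k) * (complex_of_real k - 1 / 2) = of_real k ^ 2 - 1 / 4"
  by (simp add: field_simps power2_eq_square)
 ultimately show ?thesis by simp
qed

lemma has_kappa_unique:
 assumes "has_kappa Q z k" "has_kappa Q z k'" shows "k = k'"
proof -
 have "complex_of_real (k ^ 2) = complex_of_real (k' ^ 2)"
  using has_kappa_acoef[OF assms(1)] has_kappa_acoef[OF assms(2)] by simp
 then have "k ^ 2 = k' ^ 2" by (simp only: of_real_eq_iff)
 then show ?thesis using assms by (simp add: has_kappa_def power2_eq_iff_nonneg)
qed

text \<open>A double pole at worst: \<open>(z - p)\<^sup>2 Q(z)\<close> is holomorphic at \<open>p\<close>.\<close>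

lemma double_pole_local:
 assumes mero: "Q meromorphic_on uhp" and p: "Im p > 0" and fuchs: "is_pole Q p \<longrightarrow> zorder Q p >= - 2"
 obtains r f where "r > 0" "ball p r \<subseteq> uhp" "f holomorphic_on ball 0 r" "f 0 = acoef Q p"
  "!!z. z \<in> ball p r - {p} ==> (z - p) ^ 2 * Q z = f (z - p)"
proof -
 define F where "F = laurent_expansion Q p"
 have F: "(%w. Q (p + w)) has_laurent_expansion F"
  unfolding F_def by (rule meromorphic_on_imp_has_laurent_expansion[OF mero]) (use p in simp)
 have sub: "fls_subdegree F >= - 2" if "F ~= 0"
 proof (cases "is_pole Q p")
  case True
  then show ?thesis using has_laurent_expansion_zorder[OF F that] fuchs by simp
 next
  case False
  then show ?thesis using has_laurent_expansion_imp_is_pole_iff[OF F] by simp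
 qed
 (* the Laurent series of (z - p)^2 Q, which has no principal part *)
 define G where "G = fls_shift (- 2) F"
 have G: "(%w. w ^ 2 * Q (p + w)) has_laurent_expansion G"
  using has_laurent_expansion_mult[OF has_laurent_expansion_fps_X_power[of 2] F]
  by (simp add: G_def fls_X_intpow_times_conv_shift)
 have G0: "fps_to_fls (fls_regpart G) = G"
 proof (rule fls_regpart_to_fls_trivial)
  show "fls_subdegree G >= 0"
  proof (cases "F = 0")
   case False then show ?thesis using sub by (simp add: G_def)
  qed (simp add: G_def)
 qed
 define f where "f w = (if w = 0 then acoef Q p else w ^ 2 * Q (p + w))" for w
 have "f has_laurent_expansion G"
  using has_laurent_expansion_cong[of "%w. w ^ 2 * Q (p + w)" f G G] G
  by (simp add: f_def eventually_at_filter)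
 then have "f has_fps_expansion fls_regpart G"
  unfolding has_fps_expansion_to_laurent G0 by (simp add: f_def G_def F_def acoef_def)
 then obtain s where s: "open s" "0 \<in> s" "f holomorphic_on s" by (rule has_fps_expansion_imp_holomorphic)
 obtain r1 where r1: "r1 > 0" "ball 0 r1 \<subseteq> s" using s open_contains_ball by blast
 obtain r2 where r2: "r2 > 0" "ball p r2 \<subseteq> uhp" using open_uhp_ball[OF p] by blast
 show thesis
 proof (rule that[of "min r1 r2" f])
  show "f holomorphic_on ball 0 (min r1 r2)" by (rule holomorphic_on_subset[OF s(3)]) (use r1 in auto)
  show "ball p (min r1 r2) \<subseteq> uhp" using r2 by auto
 qed (use r1 r2 in \<open>auto simp: f_def\<close>)
qed

lemma acoef_tendsto:
 assumes mero: "Q meromorphic_on uhp" and p: "Im p > 0" and fuchs: "is_pole Q p \<longrightarrow> zorder Q p >= - 2"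
 shows "((%z. (z - p) ^ 2 * Q z) \<longlongrightarrow> acoef Q p) (at p)"
proof -
 obtain r f where r: "r > 0" "f holomorphic_on ball 0 r" "f 0 = acoef Q p"
  "!!z. z \<in> ball p r - {p} ==> (z - p) ^ 2 * Q z = f (z - p)"
  using double_pole_local[OF assms] by metis
 have "isCont f 0" using holomorphic_on_imp_continuous_on[OF r(2)] r(1) by (auto simp: continuous_on_eq_continuous_at)
 then have "((%z. f (z - p)) \<longlongrightarrow> f 0) (at p)"
  by (rule isCont_tendsto_compose) (auto intro!: tendsto_eq_intros)
 then have "((%z. (z - p) ^ 2 * Q z) \<longlongrightarrow> f 0) (at p)"
  by (rule Lim_transform_eventually) (use eventually_at_in_open[of "ball p r" p] r in \<open>auto elim!: eventually_mono\<close>)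
 then show ?thesis using r(3) by simp
qed

text \<open>The coefficient is unchanged by a local change of variable that transforms \<open>Q\<close> like a quadratic
  differential.\<close>

lemma acoef_transform:
 assumes mero: "Q meromorphic_on uhp" and fuchs: "!!p. Im p > 0 ==> is_pole Q p \<longrightarrow> zorder Q p >= - 2"
  and p: "Im p > 0" and gp: "Im (g p) > 0" and cont: "isCont g p" and inj: "!!z. Im z > 0 ==> g z = g p ==> z = p"
  and h: "(h \<longlongrightarrow> 1) (at p)"
  and eq: "!!z. Im z > 0 ==> (g z - g p) ^ 2 * Q (g z) = h z * ((z - p) ^ 2 * Q z)"
 shows "acoef Q (g p) = acoef Q p"
proof -
 have ev: "eventually (%z. z \<in> uhp \<and> z ~= p) (at p)"
  using eventually_at_in_open[of uhp p] p by (simp add: open_half_plane)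
 have "filterlim g (at (g p)) (at p)"
  unfolding filterlim_at using cont ev inj by (auto simp: isCont_def elim!: eventually_mono)
 from filterlim_compose[OF acoef_tendsto[OF mero gp fuchs[OF gp]] this]
 have "((%z. (g z - g p) ^ 2 * Q (g z)) \<longlongrightarrow> acoef Q (g p)) (at p)" .
 then have "((%z. h z * ((z - p) ^ 2 * Q z)) \<longlongrightarrow> acoef Q (g p)) (at p)"
  by (rule Lim_transform_eventually) (use ev eq in \<open>auto elim!: eventually_mono\<close>)
 moreover have "((%z. h z * ((z - p) ^ 2 * Q z)) \<longlongrightarrow> 1 * acoef Q p) (at p)"
  by (intro tendsto_mult h acoef_tendsto[OF mero p fuchs[OF p]])
 ultimately show ?thesis using LIM_unique by fastforce
qed

section \<open>The twisting factors\<close>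

locale modular_ode =
 fixes Q :: "complex => complex" and kinf k1 k2 :: real
  and m :: nat and zs :: "nat => complex" and ks :: "nat => real"
 assumes mer: "meromorphic_modular_form 4 Q"
  and cond: "condition_H Q"
  and cusp: "has_kappa_cusp Q kinf" and kinf_half: "\<exists>n::nat. kinf = real n / 2"
  and kappa1: "has_kappa Q rho1 k1" and kappa2: "has_kappa Q rho2 k2"
  and reps: "pole_representatives Q m zs"
  and kappas: "\<forall>j\<in>{1..m}. has_kappa Q (zs j) (ks j)"
begin

lemma Q_meromorphic: "Q nicely_meromorphic_on uhp" "Q meromorphic_on uhp"
 using mer by (auto simp: meromorphic_modular_form_def nicely_meromorphic_on_def)

lemma Q_fuchsian: "Im p > 0 ==> is_pole Q p \<longrightarrow> zorder Q p >= - 2"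
 using cond by (auto simp: condition_H_def fuchsian_on_uhp_def)

lemma Q_translation: "Im z > 0 ==> Q (z + 1) = Q z"
 using mer Gamma0p_2_T[of 1] slash_T[of 4 1 Q z] by (auto simp: meromorphic_modular_form_def)

lemma Q_fricke:
 assumes "Im z > 0" shows "Q (fricke z) = 4 * z ^ 4 * Q z"
proof -
 have "slash 4 S_mat Q z = Q z" using mer Gamma0p_2_incl(2) assms by (auto simp: meromorphic_modular_form_def)
 moreover have z: "z ~= 0" using assms by auto
 moreover have "(of_real (sqrt 2) * z) ^ 4 = 4 * z ^ 4"
 proof -
  have "(of_real (sqrt 2) * z) ^ 4 = (complex_of_real (sqrt 2) * complex_of_real (sqrt 2)) ^ 2 * z ^ 4"
   by (simp add: power_mult_distrib eval_nat_numeral)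
  then show ?thesis by (simp add: sqrt2_square)
 qed
 ultimately show ?thesis by (simp add: slash_def power_int_minus field_simps)
qed

lemma acoef_Gamma:
 assumes "Gamma_equiv z w" "Im z > 0" shows "acoef Q w = acoef Q z"
proof -
 have "acoef Q w = acoef Q z \<longleftrightarrow> acoef Q z = acoef Q z"
 proof (rule Gamma_invariant[OF assms, where P = "%v. acoef Q v = acoef Q z"])
  fix v assume v: "Im v > 0"
  have "acoef Q (v + 1) = acoef Q v"
   by (rule acoef_transform[where h = "%_. 1", OF Q_meromorphic(2) Q_fuchsian v]) (use v Q_translation in auto)
  then show "acoef Q (v + 1) = acoef Q z \<longleftrightarrow> acoef Q v = acoef Q z" by simp
  have v0: "v ~= 0" using v by auto
  have "acoef Q (fricke v) = acoef Q v"
  proof (rule acoef_transform[where h = "%z. z ^ 2 / v ^ 2", OF Q_meromorphic(2) Q_fuchsian v])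
   show "isCont fricke v" using has_field_derivative_fricke[OF v0] DERIV_isCont by blast
   show "x = v" if "fricke x = fricke v" for x using that fricke_fricke by metis
   show "((%z. z ^ 2 / v ^ 2) \<longlongrightarrow> 1) (at v)" using v0 by (auto intro!: tendsto_eq_intros)
   fix x assume x: "Im x > 0"
   then have x0: "x ~= 0" by auto
   have "fricke x - fricke v = (x - v) / (2 * x * v)" using x0 v0 by (simp add: fricke_def field_simps)
   then have "(fricke x - fricke v) ^ 2 * Q (fricke x) = ((x - v) / (2 * x * v)) ^ 2 * (4 * x ^ 4 * Q x)"
    by (simp add: Q_fricke[OF x])
   also have "\<dots> = x ^ 2 / v ^ 2 * ((x - v) ^ 2 * Q x)"
    using x0 v0 by (simp add: field_simps eval_nat_numeral)
   finally show "(fricke x - fricke v) ^ 2 * Q (fricke x) = x ^ 2 / v ^ 2 * ((x - v) ^ 2 * Q x)" .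
  qed (use v in auto)
  then show "acoef Q (fricke v) = acoef Q z \<longleftrightarrow> acoef Q v = acoef Q z" by simp
 qed
 then show ?thesis by simp
qed

text \<open>The two elliptic factors and the factors attached to the poles form one family: index \<open>0\<close>
  belongs to \<open>\<rho>\<^sub>1\<close>, index \<open>Suc m\<close> to \<open>\<rho>\<^sub>2\<close>, and the
  indices between them to the representatives. The functions \<open>pt\<close>, \<open>ex\<close> and
  \<open>wt\<close> give the zero, the exponent in \<open>F\<close> and the weight.\<close>

definition fac :: "nat => complex => complex" where
 "fac j = (if j = 0 then N4 else if j = Suc m then M2 else F_pt (zs j))"
definition pt :: "nat => complex" where
 "pt j = (if j = 0 then rho1 else if j = Suc m then rho2 else zs j)"
definition ex :: "nat => real" where
 "ex j = (if j = 0 then k1 else if j = Suc m then k2 else ks j) - 1 / 2"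
definition wt :: "nat => nat" where
 "wt j = (if j = 0 then 4 else if j = Suc m then 2 else 8)"

lemma index_cases:
 assumes "j <= Suc m" obtains "j = 0" | "j = Suc m" | "j \<in> {1..m}" "j ~= 0" "j ~= Suc m"
 using assms by (cases "j = 0"; cases "j = Suc m") auto

lemma sum_index: "(\<Sum>j\<le>Suc m. g j) = g 0 + g (Suc m) + (\<Sum>j=1..m. g j)" for g :: "nat => 'b::comm_monoid_add"
proof -
 have "(\<Sum>j\<le>Suc m. g j) = (\<Sum>j\<le>m. g j) + g (Suc m)" by simp
 also have "(\<Sum>j\<le>m. g j) = g 0 + (\<Sum>j=1..m. g j)"
  by (simp add: atMost_atLeast0 sum.atLeast_Suc_atMost)
 finally show ?thesis by (simp add: add_ac)
qed

lemma zs_props: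
 assumes "j \<in> {1..m}" shows "Im (zs j) > 0" "is_pole Q (zs j)" "\<not> elliptic_point (zs j)"
 using reps assms by (auto simp: pole_representatives_def nonelliptic_poles_def)

lemma pt_uhp: "j <= Suc m ==> Im (pt j) > 0"
 by (erule index_cases) (auto simp: pt_def rho1_props rho2_props zs_props)

lemma holomorphic_fac: "j <= Suc m ==> fac j holomorphic_on uhp"
 by (erule index_cases) (auto simp: fac_def holomorphic_N4 holomorphic_level2 intro!: holomorphic_F_pt zs_props)

lemma fac_zero_iff: "j <= Suc m ==> Im z > 0 ==> fac j z = 0 \<longleftrightarrow> Gamma_equiv z (pt j)"
 by (erule index_cases) (auto simp: fac_def pt_def N4_zero_iff M2_zero_iff F_pt_zero_iff zs_props)

lemma fac_simple: "j <= Suc m ==> Im z > 0 ==> fac j z = 0 ==> deriv (fac j) z ~= 0"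
 by (erule index_cases) (auto simp: fac_def deriv_N4_nonzero deriv_M2_nonzero deriv_F_pt_nonzero zs_props)

lemma fac_translation: "j <= Suc m ==> Im z > 0 ==> fac j (z + 1) = fac j z"
 by (erule index_cases) (auto simp: fac_def F_pt_translation level2_translation N4_def qq_plus_1)

lemma fac_fricke: "j <= Suc m ==> \<exists>c. c ~= 0 \<and> (\<forall>z. Im z > 0 \<longrightarrow> fac j (fricke z) = c * z ^ wt j * fac j z)"
proof (erule index_cases)
 show ?thesis if "j = 0" using that by (intro exI[of _ "- 4"]) (auto simp: fac_def wt_def N4_fricke)
 show ?thesis if "j = Suc m" using that by (intro exI[of _ "- 2"]) (auto simp: fac_def wt_def M2_fricke)
 show ?thesis if "j \<in> {1..m}" "j ~= 0" "j ~= Suc m"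
  using that by (intro exI[of _ 16]) (auto simp: fac_def wt_def F_pt_fricke)
qed

text \<open>The orbits are distinguished by the values \<open>256\<close> and \<open>0\<close> of the Hauptmodul at
  the elliptic points and by the choice of representatives.\<close>

lemma pt_inequivalent:
 assumes "i <= Suc m" "j <= Suc m" "Gamma_equiv (pt i) (pt j)" shows "i = j"
proof -
 have r1: "hauptmodul rho1 = 256" and r2: "hauptmodul rho2 = 0"
  using hauptmodul_eq_256_iff[of rho1] hauptmodul_eq_0_iff[of rho2] N4_rho1 M2_rho2 rho1_props rho2_props by auto
 have z: "hauptmodul (zs j) ~= 0" "hauptmodul (zs j) ~= 256" if "j \<in> {1..m}" for j
  using elliptic_point_iff zs_props[OF that] by auto
 have zz: "i = j" if "i \<in> {1..m}" "j \<in> {1..m}" "Gamma_equiv (zs i) (zs j)" for i j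
 proof -
  have "zs i \<in> nonelliptic_poles Q" using reps that by (auto simp: pole_representatives_def)
  then have "\<exists>!j. j \<in> {1..m} \<and> Gamma_equiv (zs i) (zs j)" using reps by (auto simp: pole_representatives_def)
  then show ?thesis using that Gamma_equiv_refl by blast
 qed
 have "hauptmodul (pt i) = hauptmodul (pt j)" using hauptmodul_eq_iff pt_uhp assms by blast
 then show ?thesis
  using assms r1 r2 z zz by (auto simp: pt_def split: if_splits elim!: index_cases)
qed

lemma has_kappa_pt:
 assumes "j <= Suc m" obtains n :: nat where "n >= 1" "has_kappa Q (pt j) (real n / 2)" "ex j = (real n - 1) / 2" "j \<notin> {1..m} ==> odd n"
 using assms
proof (cases rule: index_cases)
 case 1
 obtain n :: nat where n: "n >= 1" "has_kappa Q rho1 (real n / 2)" "gcd n 2 = 1" using cond by (auto simp: condition_H_def)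
 have "odd n"
 proof
  assume "even n"
  then have "2 dvd gcd n 2" by simp
  then show False using n(3) by simp
 qed
 then show ?thesis using that[of n] n 1 has_kappa_unique[OF n(2) kappa1] by (auto simp: pt_def ex_def field_simps)
next
 case 2
 obtain n :: nat where n: "n >= 1" "has_kappa Q rho2 (real n / 2)" "gcd n 4 = 1" using cond by (auto simp: condition_H_def)
 have "odd n"
 proof
  assume "even n"
  then have "2 dvd gcd n 4" by simp
  then show False using n(3) by simp
 qed
 then show ?thesis using that[of n] n 2 has_kappa_unique[OF n(2) kappa2] by (auto simp: pt_def ex_def field_simps)
next
 case 3
 obtain n :: nat where n: "n >= 1" "has_kappa Q (zs j) (real n / 2)"
  using cond zs_props[OF 3(1)] by (auto simp: condition_H_def)
 have "has_kappa Q (zs j) (ks j)" using kappas 3 by blast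
 then show ?thesis using that[of n] n 3 has_kappa_unique[OF n(2)] by (auto simp: pt_def ex_def field_simps)
qed

lemma pole_equiv_pt:
 assumes "is_pole Q z" "Im z > 0" shows "\<exists>j\<le>Suc m. Gamma_equiv z (pt j)"
proof (cases "elliptic_point z")
 case True
 then have "Gamma_equiv z (pt 0) \<or> Gamma_equiv z (pt (Suc m))" by (simp add: elliptic_point_def pt_def)
 then show ?thesis by auto
next
 case False
 then have "z \<in> nonelliptic_poles Q" using assms by (simp add: nonelliptic_poles_def)
 then obtain j where "j \<in> {1..m}" "Gamma_equiv z (zs j)" using reps by (auto simp: pole_representatives_def)
 then show ?thesis by (intro exI[of _ j]) (auto simp: pt_def)
qed

definition ell :: int where "ell = (THE l. real_of_int l = ell_real kinf k1 k2 m ks)"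

text \<open>The exponents at \<open>\<rho>\<^sub>1\<close> and at the poles are half integers that occur with factors
  4 and 8, and at \<open>\<rho>\<^sub>2\<close> the condition on the greatest common divisor makes the exponent an
  integer; hence the weight is \<open>-1\<close> plus an even number. It is one less than the formal weight of
  \<open>F\<close>.\<close>

lemma ell_props: "odd ell" "real_of_int ell = ell_real kinf k1 k2 m ks"
 "8 * kinf + (\<Sum>j\<le>Suc m. ex j * real (wt j)) = real_of_int ell + 1"
proof -
 obtain n :: nat where n: "kinf = real n / 2" using kinf_half by blast
 have "\<exists>n::nat. ex j = real n / 2" if j: "j <= Suc m" for j
 proof -
  obtain n :: nat where "n >= 1" "ex j = (real n - 1) / 2" using has_kappa_pt[OF j] by metis
  then show ?thesis by (intro exI[of _ "n - 1"]) (simp add: of_nat_diff)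
 qed
 then obtain d :: "nat => nat" where d: "!!j. j <= Suc m ==> ex j = real (d j) / 2" by metis
 have k2: "\<exists>e::nat. ex (Suc m) = real e"
 proof -
  obtain n :: nat where "n >= 1" "odd n" "ex (Suc m) = (real n - 1) / 2" using has_kappa_pt[of "Suc m"] by auto
  then show ?thesis by (auto elim!: oddE)
 qed
 then obtain e2 :: nat where e2: "k2 - 1 / 2 = real e2" by (auto simp: ex_def)
 have e1: "k1 - 1 / 2 = real (d 0) / 2" using d[of 0] by (simp add: ex_def)
 have e3: "(\<Sum>j=1..m. ks j - 1 / 2) = (\<Sum>j=1..m. real (d j)) / 2"
 proof -
  have "ks j - 1 / 2 = real (d j) / 2" if "j \<in> {1..m}" for j using d[of j] that by (auto simp: ex_def)
  then show ?thesis unfolding sum_divide_distrib by (intro sum.cong refl) blast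
 qed
 define l :: int where "l = - 1 + 4 * int n + 2 * int (d 0) + 2 * int e2 + 4 * (\<Sum>j=1..m. int (d j))"
 have l: "real_of_int l = ell_real kinf k1 k2 m ks"
  unfolding ell_real_def e1 e2 e3 n by (simp add: l_def)
 have "ell = l" unfolding ell_def by (rule the_equality) (use l in auto)
 then show "odd ell" "real_of_int ell = ell_real kinf k1 k2 m ks" using l by (auto simp: l_def)
 then show "8 * kinf + (\<Sum>j\<le>Suc m. ex j * real (wt j)) = real_of_int ell + 1"
  unfolding sum_index by (simp add: ell_real_def ex_def wt_def sum_distrib_left sum_subtractf algebra_simps)
qed

section \<open>The connection form\<close>

text \<open>The logarithmic derivative of \<open>F\<close>, which is single valued.\<close>

definition lam :: "complex => complex" where
 "lam z = of_real kinf * log_deriv M8 z + (\<Sum>j\<le>Suc m. of_real (ex j) * log_deriv (fac j) z)"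

definition Z :: "complex set" where "Z = {z \<in> uhp. \<exists>j\<le>Suc m. fac j z = 0}"

lemma open_minus_Z: "open (uhp - Z)"
proof -
 have "uhp - Z = uhp \<inter> (\<Inter>j\<in>{..Suc m}. uhp \<inter> fac j -` (- {0}))" by (auto simp: Z_def)
 moreover have "open (uhp \<inter> fac j -` (- {0}))" if "j <= Suc m" for j
  by (rule continuous_open_preimage[OF holomorphic_on_imp_continuous_on[OF holomorphic_fac[OF that]] open_half_plane]) auto
 then have "open (\<Inter>j\<in>{..Suc m}. uhp \<inter> fac j -` (- {0}))" by (intro open_INT) auto
 ultimately show ?thesis using open_Int[OF open_half_plane] by metis
qed

lemma holomorphic_lam: "lam holomorphic_on uhp - Z"
proof -
 have sub: "f holomorphic_on uhp - Z" if "f holomorphic_on uhp" for f using that holomorphic_on_subset by blast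
 show ?thesis
  unfolding lam_def[abs_def]
  by (intro holomorphic_intros holomorphic_log_deriv open_minus_Z sub holomorphic_level2 holomorphic_fac)
    (auto simp: Z_def M8_nonzero)
qed

lemma Z_translation: "Im z > 0 ==> z + 1 \<in> Z \<longleftrightarrow> z \<in> Z"
 using fac_translation by (auto simp: Z_def)

lemma Z_fricke: assumes "Im z > 0" shows "fricke z \<in> Z \<longleftrightarrow> z \<in> Z"
proof -
 have "fac j (fricke z) = 0 \<longleftrightarrow> fac j z = 0" if j: "j <= Suc m" for j
 proof -
  obtain c where "c ~= 0" "fac j (fricke z) = c * z ^ wt j * fac j z" using fac_fricke[OF j] assms by blast
  moreover have "z ~= 0" using assms by auto
  ultimately show ?thesis by simp
 qed
 then show ?thesis using assms by (auto simp: Z_def)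
qed

lemma lam_translation: "Im z > 0 ==> lam (z + 1) = lam z"
 unfolding lam_def
 by (intro arg_cong2[where f = "(+)"] arg_cong2[where f = "(*)"] refl sum.cong log_deriv_translation holomorphic_level2 holomorphic_fac)
   (auto simp: level2_translation fac_translation)

text \<open>The weights of the factors add up to \<open>ell + 1\<close>.\<close>

lemma lam_fricke:
 assumes z: "z \<in> uhp - Z" shows "lam (fricke z) / (2 * z ^ 2) = lam z + (of_int ell + 1) / z"
proof -
 have zi: "Im z > 0" using z by simp
 have f: "log_deriv (fac j) (fricke z) / (2 * z ^ 2) = log_deriv (fac j) z + of_nat (wt j) / z" if j: "j <= Suc m" for j
 proof -
  obtain c where c: "c ~= 0" "!!z. Im z > 0 ==> fac j (fricke z) = c * z ^ wt j * fac j z" using fac_fricke[OF j] by blast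
  show ?thesis by (rule log_deriv_fricke[OF holomorphic_fac[OF j] c(2) zi _ c(1)]) (use z j in \<open>auto simp: Z_def\<close>)
 qed
 have m8: "log_deriv M8 (fricke z) / (2 * z ^ 2) = log_deriv M8 z + of_nat 8 / z"
  by (rule log_deriv_fricke[OF holomorphic_level2(4) M8_fricke zi M8_nonzero[OF zi]]) auto
 have "lam (fricke z) / (2 * z ^ 2) = of_real kinf * (log_deriv M8 (fricke z) / (2 * z ^ 2)) +
   (\<Sum>j\<le>Suc m. of_real (ex j) * (log_deriv (fac j) (fricke z) / (2 * z ^ 2)))"
  by (simp add: lam_def add_divide_distrib sum_divide_distrib del: sum.atMost_Suc)
 also have "\<dots> = of_real kinf * (log_deriv M8 z + of_nat 8 / z) +
   (\<Sum>j\<le>Suc m. of_real (ex j) * (log_deriv (fac j) z + of_nat (wt j) / z))"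
  unfolding m8 by (intro arg_cong2[where f = "(+)"] refl sum.cong) (simp only: f atMost_iff)
 also have "\<dots> = lam z + of_real (8 * kinf + (\<Sum>j\<le>Suc m. ex j * real (wt j))) / z"
  by (simp add: lam_def algebra_simps sum.distrib sum_divide_distrib sum_distrib_left sum_distrib_right add_divide_distrib del: sum.atMost_Suc)
 finally show ?thesis unfolding ell_props(3) by simp
qed

lemma Q_analytic: "z \<in> uhp - Z ==> \<not> is_pole Q z"
 using pole_equiv_pt fac_zero_iff by (force simp: Z_def)

lemma holomorphic_Q: "Q holomorphic_on uhp - Z"
proof -
 have "Q analytic_on {z}" if "z \<in> uhp - Z" for z
  by (rule nicely_meromorphic_on_imp_analytic_at[OF Q_meromorphic(1)]) (use that Q_analytic in auto)
 then show ?thesis using analytic_on_analytic_at analytic_imp_holomorphic by blast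
qed

text \<open>At most one factor vanishes at \<open>p\<close>, and it does so to first order; its exponent is the one
  that makes the residue of \<open>lam\<close> equal to \<open>(n - 1)/2\<close>, where \<open>n\<close> is the
  difference of the exponents of the equation at \<open>p\<close>.\<close>

theorem lam_local:
 assumes p: "Im p > 0"
 obtains r n g where "r > 0" "ball p r \<subseteq> uhp" "n >= (1::nat)" "g holomorphic_on ball p r"
  "!!z. z \<in> ball p r - {p} ==> z \<notin> Z"
  "!!z. z \<in> ball p r - {p} ==> lam z = (of_nat n - 1) / 2 / (z - p) + g z"
  "- 4 * of_real pi ^ 2 * acoef Q p = (of_nat n ^ 2 - 1) / 4"
proof -
 have "\<forall>j\<in>{..Suc m}. \<exists>rg. fst rg > 0 \<and> snd rg holomorphic_on ball p (fst rg) \<and>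
  (\<forall>z\<in>ball p (fst rg) - {p}. fac j z ~= 0 \<and> log_deriv (fac j) z = (if fac j p = 0 then 1 else 0) / (z - p) + snd rg z)"
 proof
  fix j assume "j \<in> {..Suc m}"
  then have j: "j <= Suc m" by simp
  obtain r g where "r > 0 \<and> g holomorphic_on ball p r \<and>
  (\<forall>z\<in>ball p r - {p}. fac j z ~= 0 \<and> log_deriv (fac j) z = (if fac j p = 0 then 1 else 0) / (z - p) + g z)"
   using log_deriv_local[OF holomorphic_fac[OF j] p fac_simple[OF j p]] by blast
  then show "\<exists>rg. fst rg > 0 \<and> snd rg holomorphic_on ball p (fst rg) \<and>
  (\<forall>z\<in>ball p (fst rg) - {p}. fac j z ~= 0 \<and> log_deriv (fac j) z = (if fac j p = 0 then 1 else 0) / (z - p) + snd rg z)"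
   by (intro exI[of _ "(r, g)"]) simp
 qed
 from bchoice[OF this] obtain rg where rg: "!!j. j <= Suc m ==> fst (rg j) > 0 \<and> snd (rg j) holomorphic_on ball p (fst (rg j)) \<and>
  (\<forall>z\<in>ball p (fst (rg j)) - {p}. fac j z ~= 0 \<and> log_deriv (fac j) z = (if fac j p = 0 then 1 else 0) / (z - p) + snd (rg j) z)"
  by auto
 obtain r0 where r0: "r0 > 0" "ball p r0 \<subseteq> uhp" using open_uhp_ball[OF p] by blast
 define r where "r = Min (insert r0 ((%j. fst (rg j)) ` {..Suc m}))"
 have r: "r > 0" unfolding r_def using r0 rg by (subst Min_gr_iff) auto
 have r_le: "r <= r0" "!!j. j <= Suc m ==> r <= fst (rg j)" unfolding r_def by (intro Min_le; force)+
 have sub: "ball p r \<subseteq> uhp" using r0 r_le by (meson subset_ball subset_trans)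
 define g where "g z = of_real kinf * log_deriv M8 z + (\<Sum>j\<le>Suc m. of_real (ex j) * snd (rg j) z)" for z
 have gh: "g holomorphic_on ball p r"
  unfolding g_def[abs_def]
 proof (intro holomorphic_intros holomorphic_log_deriv)
  show "M8 holomorphic_on ball p r" using holomorphic_level2(4) sub holomorphic_on_subset by blast
  show "M8 z ~= 0" if "z \<in> ball p r" for z using that sub M8_nonzero by auto
  show "snd (rg j) holomorphic_on ball p r" if "j \<in> {..Suc m}" for j
   using rg[of j] r_le(2)[of j] that holomorphic_on_subset[OF _ subset_ball] by auto
 qed auto
 have nz: "z \<notin> Z" and ld: "lam z = of_real (\<Sum>j\<le>Suc m. if fac j p = 0 then ex j else 0) / (z - p) + g z"
  if z: "z \<in> ball p r - {p}" for z
 proof -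
  have zj: "fac j z ~= 0" "log_deriv (fac j) z = (if fac j p = 0 then 1 else 0) / (z - p) + snd (rg j) z" if "j <= Suc m" for j
  proof -
   have "z \<in> ball p (fst (rg j)) - {p}" using z r_le(2)[OF that] by auto
   then show "fac j z ~= 0" "log_deriv (fac j) z = (if fac j p = 0 then 1 else 0) / (z - p) + snd (rg j) z"
    using rg[OF that] by blast+
  qed
  show "z \<notin> Z" using zj(1) by (auto simp: Z_def)
  have "(\<Sum>j\<le>Suc m. of_real (ex j) * log_deriv (fac j) z) =
    (\<Sum>j\<le>Suc m. complex_of_real (if fac j p = 0 then ex j else 0) / (z - p) + of_real (ex j) * snd (rg j) z)"
   by (rule sum.cong[OF refl]) (simp add: zj(2) algebra_simps)
  then show "lam z = of_real (\<Sum>j\<le>Suc m. if fac j p = 0 then ex j else 0) / (z - p) + g z"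
   by (simp add: lam_def g_def sum.distrib sum_divide_distrib del: sum.atMost_Suc)
 qed
 have "\<exists>n::nat. n >= 1 \<and> (\<Sum>j\<le>Suc m. if fac j p = 0 then ex j else 0) = (real n - 1) / 2 \<and>
   - 4 * of_real pi ^ 2 * acoef Q p = (of_nat n ^ 2 - 1) / 4"
 proof (cases "\<exists>i\<le>Suc m. fac i p = 0")
  case True
  then obtain i where i: "i <= Suc m" "fac i p = 0" by blast
  have equiv: "Gamma_equiv p (pt i)" using fac_zero_iff[OF i(1) p] i(2) by simp
  have uniq: "fac j p = 0 \<longleftrightarrow> j = i" if j: "j <= Suc m" for j
  proof
   assume "fac j p = 0"
   then have "Gamma_equiv p (pt j)" using fac_zero_iff[OF j p] by simp
   then show "j = i"
    using pt_inequivalent[OF j i(1)] Gamma_equiv_trans[OF Gamma_equiv_sym equiv] p pt_uhp[OF j] by blast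
  qed (use i in simp)
  have s: "(\<Sum>j\<le>Suc m. if fac j p = 0 then ex j else 0) = (\<Sum>j\<le>Suc m. if j = i then ex j else 0)"
   by (intro sum.cong refl) (simp add: uniq)
  obtain n :: nat where n: "n >= 1" "has_kappa Q (pt i) (real n / 2)" "ex i = (real n - 1) / 2"
   using has_kappa_pt[OF i(1)] by metis
  have "- 4 * of_real pi ^ 2 * acoef Q p = (of_nat n ^ 2 - 1) / 4"
   using has_kappa_acoef[OF n(2)] acoef_Gamma[OF equiv p] by (simp add: power_divide)
  then show ?thesis using n i(1) unfolding s by (intro exI[of _ n]) (simp del: sum.atMost_Suc)
 next
  case False
  then have "\<not> is_pole Q p" using Q_analytic[of p] p by (auto simp: Z_def)
  then have "fls_subdegree (laurent_expansion Q p) >= 0"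
   using has_laurent_expansion_imp_is_pole_iff[OF meromorphic_on_imp_has_laurent_expansion[OF Q_meromorphic(2)], of p] p by simp
  then have "acoef Q p = 0" by (simp add: acoef_def)
  moreover have "(\<Sum>j\<le>Suc m. if fac j p = 0 then ex j else 0) = 0" using False by (intro sum.neutral) auto
  ultimately show ?thesis by (intro exI[of _ 1]) (simp del: sum.atMost_Suc)
 qed
 then obtain n :: nat where n: "n >= 1" "(\<Sum>j\<le>Suc m. if fac j p = 0 then ex j else 0) = (real n - 1) / 2"
   "- 4 * of_real pi ^ 2 * acoef Q p = (of_nat n ^ 2 - 1) / 4" by blast
 show thesis
 proof (rule that[OF r sub n(1) gh nz _ n(3)])
  show "lam z = (of_nat n - 1) / 2 / (z - p) + g z" if "z \<in> ball p r - {p}" for z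
   using ld[OF that] unfolding n(2) by simp
 qed
qed

text \<open>Apparentness turns the condition on the exponents into a basis of single-valued solutions.\<close>

theorem local_basis:
 assumes p: "Im p > 0"
 obtains s u1 u2 where "s > 0" "ball p s \<subseteq> uhp" "ball p s - {p} \<subseteq> uhp - Z"
  "u1 holomorphic_on ball p s" "u2 holomorphic_on ball p s" "u1 p ~= 0"
  "twisted_solution Q lam (ball p s - {p}) u1" "twisted_solution Q lam (ball p s - {p}) u2"
  "!!z. z \<in> ball p s - {p} ==> twisted_wronskian lam u1 u2 z ~= 0"
proof -
 obtain r0 n g where r0: "r0 > 0" "ball p r0 \<subseteq> uhp" "n >= (1::nat)" "g holomorphic_on ball p r0"
  "!!z. z \<in> ball p r0 - {p} ==> z \<notin> Z"
  "!!z. z \<in> ball p r0 - {p} ==> lam z = (of_nat n - 1) / 2 / (z - p) + g z"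
  "- 4 * of_real pi ^ 2 * acoef Q p = (of_nat n ^ 2 - 1) / 4"
  using lam_local[OF p] by metis
 obtain r1 f where r1: "r1 > 0" "ball p r1 \<subseteq> uhp" "f holomorphic_on ball 0 r1" "f 0 = acoef Q p"
  "!!z. z \<in> ball p r1 - {p} ==> (z - p) ^ 2 * Q z = f (z - p)"
  using double_pole_local[OF Q_meromorphic(2) p Q_fuchsian[OF p]] by metis
 have "\<exists>r2>0. apparent Q p \<or> Q holomorphic_on ball p r2"
 proof (cases "is_pole Q p")
  case True
  then have "apparent Q p" using cond p by (auto simp: condition_H_def)
  then show ?thesis by (intro exI[of _ 1]) simp
 next
  case False
  then have "Q analytic_on {p}" using nicely_meromorphic_on_imp_analytic_at[OF Q_meromorphic(1)] p by simp
  then show ?thesis by (auto simp: analytic_on_def)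
 qed
 then obtain r2 where r2: "r2 > 0" "apparent Q p \<or> Q holomorphic_on ball p r2" by blast
 define r where "r = min r0 (min r1 r2)"
 have r: "r > 0" using r0 r1 r2 by (simp add: r_def)
 have sub: "ball p r \<subseteq> ball p r0" "ball p r \<subseteq> ball p r1" "ball p r \<subseteq> ball p r2" "ball (0::complex) r \<subseteq> ball 0 r1"
  by (auto simp: r_def)
 define q where "q w = - 4 * of_real pi ^ 2 * (if w = 0 then deriv f 0 else (f w - f 0) / (w - 0))" for w
 have qh: "q holomorphic_on ball 0 r"
  unfolding q_def[abs_def]
  by (intro holomorphic_intros holomorphic_on_subset[OF pole_lemma_open[OF r1(3) open_ball, of 0] sub(4)])
 have off: "ball p r - {p} \<subseteq> uhp - Z" using r0(2,5) sub(1) by blast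
 obtain s u1 u2 where s: "0 < s" "s <= r" "u1 holomorphic_on ball p s" "u2 holomorphic_on ball p s" "u1 p ~= 0"
  "twisted_solution Q lam (ball p s - {p}) u1" "twisted_solution Q lam (ball p s - {p}) u2"
  "!!z. z \<in> ball p s - {p} ==> twisted_wronskian lam u1 u2 z ~= 0"
 proof (rule local_twisted_basis[OF r0(3) r, of p Q q g lam])
  show "ball p r \<subseteq> uhp" using r0(2) sub(1) by blast
  show "Q holomorphic_on ball p r - {p}" using holomorphic_on_subset[OF holomorphic_Q off] .
  show "q holomorphic_on ball 0 r" by (rule qh)
  show "g holomorphic_on ball p r" using holomorphic_on_subset[OF r0(4) sub(1)] .
  show "lam z = (of_nat n - 1) / 2 / (z - p) + g z" if "z \<in> ball p r - {p}" for z
   using r0(6)[of z] that sub(1) by blast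
  show "apparent Q p \<or> Q holomorphic_on ball p r" using r2(2) holomorphic_on_subset[OF _ sub(3)] by blast
  fix z assume z: "z \<in> ball p r - {p}"
  then have "(z - p) ^ 2 * Q z = f (z - p)" using r1(5)[of z] sub(2) by blast
  then have "- 4 * of_real pi ^ 2 * Q z * (z - p) ^ 2 = - 4 * of_real pi ^ 2 * (f 0 + (f (z - p) - f 0))"
   by (simp add: mult_ac)
  also have "\<dots> = (of_nat n ^ 2 - 1) / 4 + (z - p) * q (z - p)"
   unfolding r0(7)[symmetric] r1(4)[symmetric] using z by (simp add: q_def field_simps)
  finally show "- 4 * of_real pi ^ 2 * Q z * (z - p) ^ 2 = (of_nat n ^ 2 - 1) / 4 + (z - p) * q (z - p)" .
 qed (rule that; assumption)
 have "ball p s \<subseteq> ball p r" using s(2) by auto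
 moreover have "ball p r \<subseteq> uhp" using r0(2) sub(1) by blast
 ultimately show thesis using that[OF s(1) _ _ s(3-8)] off by blast
qed

end

section \<open>Transformation of twisted solutions\<close>

context modular_ode
begin

lemma lam_shift:
 assumes "Im z > 0" shows "lam (z + of_int n) = lam z"
 using translation_int[where P = "%w. lam w = lam z" and w = z and n = n] lam_translation assms by simp

lemma Q_shift:
 assumes "Im z > 0" shows "Q (z + of_int n) = Q z"
 using translation_int[where P = "%w. Q w = Q z" and w = z and n = n] Q_translation assms by simp

lemma Z_shift:
 assumes "Im z > 0" shows "z + of_int n \<in> Z \<longleftrightarrow> z \<in> Z"
 using translation_int[where P = "%w. w \<in> Z" and w = z and n = n] Z_translation assms by simp

lemma twisted_shift:
 assumes Y: "twisted_solution Q lam V Y" and V: "open V" "V \<subseteq> uhp - Z"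
 shows "twisted_solution Q lam ((%z. z + of_int n) -` V) (%z. Y (z + of_int n))"
proof (rule twisted_solutionI[where X = "%z. nabla lam Y (z + of_int n)"])
 show "open ((%z. z + of_int n) -` V)" using V(1) by (intro open_vimage continuous_intros)
 fix z assume "z \<in> (%z. z + of_int n) -` V"
 then have zV: "z + of_int n \<in> V" by simp
 then have z: "Im z > 0" using V(2) by auto
 note d = twisted_solutionD[OF Y holomorphic_on_subset[OF holomorphic_lam V(2)] V(1) zV]
 show "((%z. Y (z + of_int n)) has_field_derivative lam z * Y (z + of_int n) + nabla lam Y (z + of_int n)) (at z)"
  using d(1) by (simp add: DERIV_shift lam_shift z)
 show "((%z. nabla lam Y (z + of_int n)) has_field_derivative
   lam z * nabla lam Y (z + of_int n) - 4 * of_real pi ^ 2 * Q z * Y (z + of_int n)) (at z)"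
  using d(2) by (simp add: DERIV_shift lam_shift Q_shift z)
qed

text \<open>The cancellation behind \<open>twisted_slash\<close>, with \<open>u = 1/z\<close>: the derivatives of the
  automorphy factor and of \<open>fricke\<close> contribute \<open>- l u\<close> and \<open>- 2 u\<close> to the
  logarithmic derivative, and the shift \<open>(l + 1) u\<close> of \<open>lam\<close> compensates them up to the
  terms with \<open>u\<close> in the first derivative.\<close>

lemma slash_derivative_identity:
 fixes u :: complex
 assumes "lf * (u ^ 2 / 2) = a + (l + 1) * u" "qf * (u ^ 4 / 4) = b"
 shows "(a * (s * Y) + (s * Y * u + s * (u ^ 2 / 2) * X)) * u + (- (u ^ 2)) * (s * Y) +
   ((s * (- l * u) * (u ^ 2 / 2) + (- (u ^ 3)) * s) * X + (lf * X - c * qf * Y) * (u ^ 2 / 2) * (s * (u ^ 2 / 2))) =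
  a * (s * Y * u + s * (u ^ 2 / 2) * X) - c * b * (s * Y)"
proof -
 have a: "a = lf * (u ^ 2 / 2) - (l + 1) * u" unfolding assms(1) by simp
 show ?thesis unfolding a assms(2)[symmetric] by (simp add: field_simps eval_nat_numeral)
qed

text \<open>The weight is dictated by \<open>lam_fricke\<close>.\<close>

theorem twisted_slash:
 assumes Y: "twisted_solution Q lam (uhp - Z) Y"
 shows "twisted_solution Q lam (uhp - Z) (slash ell S_mat Y)"
proof -
 define s where "s z = (of_real (sqrt 2) * z) powi (- ell)" for z :: complex
 have Y1: "slash ell S_mat Y = (%z. s z * Y (fricke z))" by (simp add: slash_def s_def fun_eq_iff)
 define X where "X = nabla lam Y"
 have main: "((%z. s z * Y (fricke z)) has_field_derivative
    lam z * (s z * Y (fricke z)) + (s z * Y (fricke z) * (1 / z) + s z * (1 / (2 * z ^ 2)) * X (fricke z))) (at z)"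
   "((%z. X (fricke z)) has_field_derivative
    (lam (fricke z) * X (fricke z) - 4 * of_real pi ^ 2 * Q (fricke z) * Y (fricke z)) * (1 / (2 * z ^ 2))) (at z)"
   "(s has_field_derivative s z * (- of_int ell * (1 / z))) (at z)"
  if z: "z \<in> uhp - Z" for z
 proof -
  have zi: "Im z > 0" and z0: "z ~= 0" using z by auto
  have fz: "fricke z \<in> uhp - Z" using z Z_fricke by simp
  note d = twisted_solutionD[OF Y holomorphic_lam open_minus_Z fz]
  show s': "(s has_field_derivative s z * (- of_int ell * (1 / z))) (at z)"
   unfolding s_def[abs_def]
  proof (rule DERIV_cong[OF DERIV_power_int])
   show "((%z. complex_of_real (sqrt 2) * z) has_field_derivative complex_of_real (sqrt 2)) (at z)"
    by (auto intro!: derivative_eq_intros)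
   show "of_int (- ell) * (complex_of_real (sqrt 2) * z) powi (- ell - 1) * complex_of_real (sqrt 2) =
     (complex_of_real (sqrt 2) * z) powi (- ell) * (- of_int ell * (1 / z))"
    using z0 by (simp add: power_int_diff)
  qed (use z0 in simp)
  have Yf: "((%z. Y (fricke z)) has_field_derivative (lam (fricke z) * Y (fricke z) + X (fricke z)) * (1 / (2 * z ^ 2))) (at z)"
   unfolding X_def by (rule DERIV_chain2[where f = Y and g = fricke, OF d(1) has_field_derivative_fricke[OF z0]])
  show "((%z. X (fricke z)) has_field_derivative
    (lam (fricke z) * X (fricke z) - 4 * of_real pi ^ 2 * Q (fricke z) * Y (fricke z)) * (1 / (2 * z ^ 2))) (at z)"
   unfolding X_def by (rule DERIV_chain2[where f = "nabla lam Y" and g = fricke, OF d(2) has_field_derivative_fricke[OF z0]])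
  have e: "(lam (fricke z) * Y (fricke z) + X (fricke z)) * (1 / (2 * z ^ 2)) =
    (lam z + (of_int ell + 1) / z) * Y (fricke z) + X (fricke z) * (1 / (2 * z ^ 2))"
   unfolding lam_fricke[OF z, symmetric] by (simp add: algebra_simps add_divide_distrib)
  show "((%z. s z * Y (fricke z)) has_field_derivative
    lam z * (s z * Y (fricke z)) + (s z * Y (fricke z) * (1 / z) + s z * (1 / (2 * z ^ 2)) * X (fricke z))) (at z)"
   by (rule DERIV_cong[OF DERIV_mult[OF s' Yf[unfolded e]]]) (simp add: algebra_simps add_divide_distrib)
 qed
 show ?thesis
  unfolding Y1
 proof (rule twisted_solutionI[where X = "%z. s z * Y (fricke z) * (1 / z) + s z * (1 / (2 * z ^ 2)) * X (fricke z)", OF open_minus_Z])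
  fix z assume z: "z \<in> uhp - Z"
  have zi: "Im z > 0" and z0: "z ~= 0" using z by auto
  show "((%z. s z * Y (fricke z)) has_field_derivative
    lam z * (s z * Y (fricke z)) + (s z * Y (fricke z) * (1 / z) + s z * (1 / (2 * z ^ 2)) * X (fricke z))) (at z)"
   by (rule main(1)[OF z])
  define u where "u = 1 / z"
  have u2: "1 / (2 * z ^ 2) = u ^ 2 / 2" by (simp add: u_def power_divide)
  have d1: "((%z. 1 / z) has_field_derivative - (u ^ 2)) (at z)"
   using z0 by (auto intro!: derivative_eq_intros simp: u_def power2_eq_square divide_simps)
  have d2: "((%z. 1 / (2 * z ^ 2)) has_field_derivative - (u ^ 3)) (at z)"
   using z0 by (auto intro!: derivative_eq_intros simp: u_def eval_nat_numeral divide_simps)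
  have "((%z. s z * Y (fricke z) * (1 / z) + s z * (1 / (2 * z ^ 2)) * X (fricke z)) has_field_derivative
    ((lam z * (s z * Y (fricke z)) + (s z * Y (fricke z) * u + s z * (u ^ 2 / 2) * X (fricke z))) * u + (- (u ^ 2)) * (s z * Y (fricke z)) +
    ((s z * (- of_int ell * u) * (u ^ 2 / 2) + (- (u ^ 3)) * s z) * X (fricke z) +
     (lam (fricke z) * X (fricke z) - 4 * of_real pi ^ 2 * Q (fricke z) * Y (fricke z)) * (u ^ 2 / 2) * (s z * (u ^ 2 / 2))))) (at z)"
   using DERIV_add[OF DERIV_mult[OF main(1)[OF z] d1] DERIV_mult[OF DERIV_mult[OF main(3)[OF z] d2] main(2)[OF z]]]
   unfolding u2 u_def[symmetric] .
  note deriv = this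
  have lf: "lam (fricke z) * (u ^ 2 / 2) = lam z + (of_int ell + 1) * u"
   using lam_fricke[OF z] by (simp add: u_def power_divide mult.commute)
  have qf: "Q (fricke z) * (u ^ 4 / 4) = Q z" using Q_fricke[OF zi] z0 by (simp add: u_def power_divide)
  note id = slash_derivative_identity[OF lf qf, of "s z" "Y (fricke z)" "X (fricke z)" "4 * of_real pi ^ 2"]
  from deriv[unfolded id] show "((%z. s z * Y (fricke z) * (1 / z) + s z * (1 / (2 * z ^ 2)) * X (fricke z)) has_field_derivative
    lam z * (s z * Y (fricke z) * (1 / z) + s z * (1 / (2 * z ^ 2)) * X (fricke z)) -
    4 * of_real pi ^ 2 * Q z * (s z * Y (fricke z))) (at z)"
   unfolding u2 u_def[symmetric] .
 qed
qed

section \<open>Continuation to the half-plane\<close>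

lemma Z_sparse: "Z sparse_in uhp"
 unfolding sparse_in_eventually_iff[OF open_half_plane]
proof
 fix p assume "p \<in> uhp"
 then have "Im p > 0" by simp
 then obtain r where r: "r > 0" "!!z. z \<in> ball p r - {p} ==> z \<notin> Z" using lam_local by metis
 show "\<forall>\<^sub>F y in at p. y \<notin> Z"
  using eventually_at_in_open[of "ball p r" p] r by (auto elim!: eventually_mono)
qed

lemma half_plane_minus_Z:
 assumes "c >= 0" shows "open (half_plane c - Z)" "connected (half_plane c - Z)" "half_plane c - Z \<subseteq> uhp - Z"
proof -
 have sub: "half_plane c \<subseteq> uhp" using assms by auto
 then show "half_plane c - Z \<subseteq> uhp - Z" by blast
 have "half_plane c - Z = half_plane c \<inter> (uhp - Z)" using sub by blast
 then show "open (half_plane c - Z)" using open_minus_Z open_half_plane by (simp add: open_Int)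
 show "connected (half_plane c - Z)"
  by (rule sparse_imp_connected) (auto simp: open_half_plane intro: sparse_in_subset[OF Z_sparse sub])
qed

lemma half_plane_nonempty: "half_plane c ~= {}"
proof -
 have "\<i> * of_real (c + 1) \<in> half_plane c" by simp
 then show ?thesis by blast
qed

lemma half_plane_identity:
 assumes "f holomorphic_on half_plane c" "g holomorphic_on half_plane c" "c <= C"
  and "!!z. Im z > C ==> f z = g z" and z: "Im z > c"
 shows "f z = g z"
 by (rule analytic_continuation_open[of "half_plane C" "half_plane c" f g z])
   (use assms half_plane_nonempty open_half_plane in auto)

text \<open>The equation is an identity between holomorphic functions on a connected set, since \<open>Z\<close> is
  discrete.\<close>

lemma twisted_identity:
 assumes c: "0 <= c" "c <= C" and Y: "Y holomorphic_on half_plane c"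
  and C: "half_plane C \<inter> Z = {}" and sol: "twisted_solution Q lam (half_plane C) Y"
 shows "twisted_solution Q lam (half_plane c - Z) Y"
proof -
 note U = half_plane_minus_Z[OF c(1)]
 have Y': "Y holomorphic_on half_plane c - Z" by (rule holomorphic_on_subset[OF Y]) auto
 have lam: "lam holomorphic_on half_plane c - Z" and Q: "Q holomorphic_on half_plane c - Z"
  using holomorphic_on_subset[OF _ U(3)] holomorphic_lam holomorphic_Q by blast+
 have "nabla lam (nabla lam Y) z = - 4 * of_real pi ^ 2 * Q z * Y z" if z: "z \<in> half_plane c - Z" for z
 proof (rule analytic_continuation_open[of "half_plane C" "half_plane c - Z" _ _ z])
  show "half_plane C \<subseteq> half_plane c - Z" using C c by force
  show "nabla lam (nabla lam Y) holomorphic_on half_plane c - Z"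
   by (intro holomorphic_nabla lam Y' U)
  show "(%z. - 4 * of_real pi ^ 2 * Q z * Y z) holomorphic_on half_plane c - Z"
   by (intro holomorphic_intros Q Y')
  show "nabla lam (nabla lam Y) z = - 4 * of_real pi ^ 2 * Q z * Y z" if "z \<in> half_plane C" for z
   using sol that by (simp add: twisted_solution_def)
 qed (use U half_plane_nonempty open_half_plane z in auto)
 then show ?thesis using Y' by (simp add: twisted_solution_def)
qed

definition continues :: "real => (complex => complex) => real => bool" where
 "continues C Y0 c \<longleftrightarrow> (\<exists>Y. Y holomorphic_on half_plane c \<and> (\<forall>z\<in>half_plane C. Y z = Y0 z))"

definition extends_across :: "complex => real => bool" where
 "extends_across q e \<longleftrightarrow> (\<forall>Y. Y holomorphic_on half_plane (Im q) \<longrightarrow> twisted_solution Q lam (half_plane (Im q) - Z) Y \<longrightarrow>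
   (\<exists>Y'. Y' holomorphic_on ball q e \<and> (\<forall>z\<in>ball q e. Im z > Im q \<longrightarrow> Y' z = Y z)))"

text \<open>In the half disc above \<open>p\<close> the solution is a combination of the local basis at
  \<open>p\<close>, and the same combination extends it to the disc.\<close>

lemma extends_across_local:
 assumes "Im p > 0" obtains s where "s > 0"
  "!!q e. ball q e \<subseteq> ball p s ==> Im q = Im p ==> extends_across q e"
proof -
 obtain s u1 u2 where s: "s > 0" "ball p s \<subseteq> uhp" "ball p s - {p} \<subseteq> uhp - Z"
  "u1 holomorphic_on ball p s" "u2 holomorphic_on ball p s"
  "twisted_solution Q lam (ball p s - {p}) u1" "twisted_solution Q lam (ball p s - {p}) u2"
  "!!z. z \<in> ball p s - {p} ==> twisted_wronskian lam u1 u2 z ~= 0"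
  using local_basis[OF assms] by metis
 show thesis
 proof (rule that[OF s(1)])
  fix q e assume q: "ball q e \<subseteq> ball p s" "Im q = Im p"
  show "extends_across q e"
   unfolding extends_across_def q(2)
  proof (intro allI impI)
   fix Y assume Y: "Y holomorphic_on half_plane (Im p)" "twisted_solution Q lam (half_plane (Im p) - Z) Y"
   define D where "D = ball p s \<inter> half_plane (Im p)"
   have D: "open D" "connected D" "D \<subseteq> ball p s - {p}" "D \<subseteq> half_plane (Im p) - Z" "D \<subseteq> uhp - Z"
    unfolding D_def using s(3) open_half_plane convex_half_plane by (auto intro!: convex_connected convex_Int)
   obtain a b where ab: "!!z. z \<in> D ==> Y z = a * u1 z + b * u2 z"
   proof (rule twisted_solution_span[of Q lam D u1 u2 Y])
    show "twisted_solution Q lam D u1" "twisted_solution Q lam D u2" "twisted_solution Q lam D Y"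
     using twisted_solution_subset s(6,7) Y(2) D(3,4) by blast+
    show "lam holomorphic_on D" using holomorphic_on_subset[OF holomorphic_lam D(5)] .
    show "twisted_wronskian lam u1 u2 z ~= 0" if "z \<in> D" for z using s(8) D(3) that by blast
   qed (use D in \<open>auto intro: that\<close>)
   show "\<exists>Y'. Y' holomorphic_on ball q e \<and> (\<forall>z\<in>ball q e. Im z > Im p \<longrightarrow> Y' z = Y z)"
   proof (intro exI[of _ "%z. a * u1 z + b * u2 z"] conjI ballI impI)
    show "(%z. a * u1 z + b * u2 z) holomorphic_on ball q e"
     by (intro holomorphic_intros holomorphic_on_subset[OF s(4) q(1)] holomorphic_on_subset[OF s(5) q(1)])
    show "a * u1 z + b * u2 z = Y z" if "z \<in> ball q e" "Im z > Im p" for z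
     using ab[of z] that q(1) by (auto simp: D_def)
   qed
  qed
 qed
qed

lemma extends_across_shift:
 assumes "extends_across q e" "Im q > 0" shows "extends_across (q + of_int n) e"
 unfolding extends_across_def
proof (intro allI impI)
 fix Y assume Y: "Y holomorphic_on half_plane (Im (q + of_int n))" "twisted_solution Q lam (half_plane (Im (q + of_int n)) - Z) Y"
 have im: "Im (q + of_int n) = Im q" by simp
 have "(%z. Y (z + of_int n)) holomorphic_on half_plane (Im q)"
 proof -
  have "(Y \<circ> (%z. z + of_int n)) holomorphic_on half_plane (Im q)"
   by (rule holomorphic_on_compose_gen[OF _ Y(1)]) (auto intro!: holomorphic_intros)
  then show ?thesis by (simp add: o_def)
 qed
 moreover have "twisted_solution Q lam (half_plane (Im q) - Z) (%z. Y (z + of_int n))"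
 proof (rule twisted_solution_subset[OF twisted_shift[OF Y(2)]])
  show "open (half_plane (Im (q + of_int n)) - Z)" "half_plane (Im (q + of_int n)) - Z \<subseteq> uhp - Z"
   using half_plane_minus_Z[of "Im (q + of_int n)"] assms(2) by auto
  show "half_plane (Im q) - Z \<subseteq> (%z. z + of_int n) -` (half_plane (Im (q + of_int n)) - Z)"
   using Z_shift assms(2) by auto
 qed
 ultimately obtain Y' where Y': "Y' holomorphic_on ball q e" "!!z. z \<in> ball q e ==> Im z > Im q ==> Y' z = Y (z + of_int n)"
  using assms(1) unfolding extends_across_def by blast
 have sh: "z - of_int n \<in> ball q e \<longleftrightarrow> z \<in> ball (q + of_int n) e" for z
  by (simp add: dist_norm algebra_simps)
 show "\<exists>Y'. Y' holomorphic_on ball (q + of_int n) e \<and> (\<forall>z\<in>ball (q + of_int n) e. Im z > Im (q + of_int n) \<longrightarrow> Y' z = Y z)"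
 proof (intro exI[of _ "%z. Y' (z - of_int n)"] conjI ballI impI)
  show "(%z. Y' (z - of_int n)) holomorphic_on ball (q + of_int n) e"
  proof -
   have "(Y' \<circ> (%z. z - of_int n)) holomorphic_on ball (q + of_int n) e"
    by (rule holomorphic_on_compose_gen[OF _ Y'(1)]) (use sh in \<open>auto intro!: holomorphic_intros\<close>)
   then show ?thesis by (simp add: o_def)
  qed
  show "Y' (z - of_int n) = Y z" if "z \<in> ball (q + of_int n) e" "Im z > Im (q + of_int n)" for z
   using Y'(2)[of "z - of_int n"] that sh by auto
 qed
qed

text \<open>By periodicity, the radii of extension on a horizontal line are bounded below.\<close>

lemma extends_across_uniform:
 assumes c: "c > 0" obtains e where "e > 0" "!!q. Im q = c ==> extends_across q e"
proof -
 (* one period of the line *)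
 define K where "K = closed_segment (Complex 0 c) (Complex 1 c)"
 have Kim: "Im q = c" if "q \<in> K" for q
  using that by (auto simp: K_def in_segment) (simp add: algebra_simps)
 have "\<forall>p\<in>K. \<exists>s>0. \<forall>q e. ball q e \<subseteq> ball p s \<longrightarrow> Im q = Im p \<longrightarrow> extends_across q e"
 proof
  fix p assume "p \<in> K"
  then have "Im p > 0" using Kim c by simp
  then show "\<exists>s>0. \<forall>q e. ball q e \<subseteq> ball p s \<longrightarrow> Im q = Im p \<longrightarrow> extends_across q e"
   using extends_across_local by metis
 qed
 from bchoice[OF this] obtain s where s: "!!p. p \<in> K ==> s p > 0"
  "!!p q e. p \<in> K ==> ball q e \<subseteq> ball p (s p) ==> Im q = Im p ==> extends_across q e" by metis
 have "compact K" by (simp add: K_def)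
 moreover have "K \<subseteq> \<Union>((%p. ball p (s p)) ` K)" using s(1) by fastforce
 ultimately obtain e where e: "e > 0" "!!q. q \<in> K ==> \<exists>G\<in>(%p. ball p (s p)) ` K. ball q e \<subseteq> G"
  by (rule Heine_Borel_lemma) auto
 show thesis
 proof (rule that[OF e(1)])
  fix q assume q: "Im q = c"
  define q0 where "q0 = q - of_int \<lfloor>Re q\<rfloor>"
  have "q0 = (1 - (Re q - of_int \<lfloor>Re q\<rfloor>)) *\<^sub>R Complex 0 c + (Re q - of_int \<lfloor>Re q\<rfloor>) *\<^sub>R Complex 1 c"
   using q by (simp add: q0_def complex_eq_iff algebra_simps)
  then have q0K: "q0 \<in> K"
   unfolding K_def in_segment by (intro exI[of _ "Re q - of_int \<lfloor>Re q\<rfloor>"]) (auto; linarith)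
  then obtain p where "p \<in> K" "ball q0 e \<subseteq> ball p (s p)" using e(2) by blast
  then have "extends_across q0 e" using s(2) Kim q0K by simp
  then have "extends_across (q0 + of_int \<lfloor>Re q\<rfloor>) e" by (rule extends_across_shift) (use Kim[OF q0K] c in simp)
  then show "extends_across q e" by (simp add: q0_def)
 qed
qed

text \<open>Two discs centred on a horizontal line overlap above the line as soon as they overlap at all, which
  makes the extensions match.\<close>

lemma discs_overlap_above:
 assumes "z \<in> ball p e \<inter> ball q e" "Im p = c" "Im q = c"
 shows "ball p e \<inter> ball q e \<inter> half_plane c ~= {}"
proof -
 (* z itself or its mirror image, whichever is not below the line; pushed up slightly, it lies in both discs *)
 define w where "w = Complex (Re z) (c + \<bar>Im z - c\<bar>)"
 have "dist x w = dist x z" if "Im x = c" for x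
  unfolding dist_norm cmod_def w_def using that by (simp add: power2_commute)
 then have w: "w \<in> ball p e \<inter> ball q e" using assms by simp
 moreover have "open (ball p e \<inter> ball q e)" by auto
 ultimately obtain r where r: "r > 0" "ball w r \<subseteq> ball p e \<inter> ball q e" using open_contains_ball by blast
 have "w + \<i> * of_real (r / 2) \<in> ball w r" using r(1) by (simp add: dist_norm norm_mult del: of_real_divide)
 moreover have "w + \<i> * of_real (r / 2) \<in> half_plane c" using r(1) by (simp add: w_def)
 ultimately show ?thesis using r(2) by blast
qed

text \<open>The extensions to discs of equal radius centred on the boundary line fit together.\<close>

lemma continues_step:
 assumes c: "0 < c" "c <= C" and C: "half_plane C \<inter> Z = {}" and sol: "twisted_solution Q lam (half_plane C) Y0"
  and cont: "continues C Y0 c"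
 obtains d where "0 <= d" "d < c" "continues C Y0 d"
proof -
 obtain Y where Y: "Y holomorphic_on half_plane c" "!!z. Im z > C ==> Y z = Y0 z"
  using cont unfolding continues_def by auto
 have "twisted_solution Q lam (half_plane C) Y"
 proof (rule twisted_solution_cong[OF sol])
  have "half_plane C \<subseteq> uhp - Z"
  proof
   fix z assume z: "z \<in> half_plane C"
   then have "z \<notin> Z" using C by blast
   then show "z \<in> uhp - Z" using z c by simp
  qed
  then show "lam holomorphic_on half_plane C" by (rule holomorphic_on_subset[OF holomorphic_lam])
 qed (use Y open_half_plane in auto)
 then have tw: "twisted_solution Q lam (half_plane c - Z) Y"
  using twisted_identity[OF _ c(2) Y(1) C] c by simp
 obtain e where e: "e > 0" "!!q. Im q = c ==> extends_across q e" using extends_across_uniform[OF c(1)] by blast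
 have "\<exists>Y'. Y' holomorphic_on ball q e \<and> (\<forall>z\<in>ball q e. Im z > c \<longrightarrow> Y' z = Y z)" if "Im q = c" for q
  using e(2)[OF that] Y(1) tw that unfolding extends_across_def by blast
 then obtain E where E: "!!q. Im q = c ==> E q holomorphic_on ball q e"
  "!!q z. Im q = c ==> z \<in> ball q e ==> Im z > c ==> E q z = Y z" by metis
 have match: "E p z = E q z" if z: "z \<in> ball p e \<inter> ball q e" and pq: "Im p = c" "Im q = c" for p q z
 proof (rule analytic_continuation_open[of "ball p e \<inter> ball q e \<inter> half_plane c" "ball p e \<inter> ball q e" "E p" "E q" z])
  show "ball p e \<inter> ball q e \<inter> half_plane c ~= {}" by (rule discs_overlap_above[OF z pq])
  show "E p holomorphic_on ball p e \<inter> ball q e" "E q holomorphic_on ball p e \<inter> ball q e"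
   using holomorphic_on_subset E(1) pq by blast+
  show "E p z = E q z" if "z \<in> ball p e \<inter> ball q e \<inter> half_plane c" for z using E(2) pq that by auto
 qed (use z in \<open>auto intro!: convex_connected convex_Int open_Int open_half_plane\<close>)
 define d where "d = max 0 (c - e)"
 define Y' where "Y' z = (if Im z > c then Y z else E (Complex (Re z) c) z)" for z
 have "Y' holomorphic_on half_plane c \<union> (\<Union>x. ball (Complex x c) e)"
 proof -
  have "Y' holomorphic_on half_plane c" by (rule holomorphic_transform[OF Y(1)]) (simp add: Y'_def)
  moreover have "Y' holomorphic_on ball (Complex x c) e" for x
  proof (rule holomorphic_transform[OF E(1)])
   fix z assume z: "z \<in> ball (Complex x c) e"
   show "E (Complex x c) z = Y' z"
   proof (cases "Im z > c")
    case True
    then show ?thesis using E(2) z by (simp add: Y'_def)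
   next
    case False
    have "dist (Complex (Re z) c) z <= dist (Complex x c) z"
     unfolding dist_norm cmod_def by (intro real_sqrt_le_mono) simp
    then have "z \<in> ball (Complex x c) e \<inter> ball (Complex (Re z) c) e" using z by simp
    from match[OF this] show ?thesis using False by (simp add: Y'_def)
   qed
  qed simp
  ultimately show ?thesis
   by (intro holomorphic_on_Un holomorphic_on_UN_open open_UN open_half_plane) auto
 qed
 moreover have "half_plane d \<subseteq> half_plane c \<union> (\<Union>x. ball (Complex x c) e)"
 proof
  fix z assume z: "z \<in> half_plane d"
  show "z \<in> half_plane c \<union> (\<Union>x. ball (Complex x c) e)"
  proof (cases "Im z > c")
   case False
   have "dist (Complex (Re z) c) z = \<bar>c - Im z\<bar>" by (simp add: dist_norm cmod_def)
   then have "z \<in> ball (Complex (Re z) c) e" using z False by (simp add: d_def)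
   then show ?thesis by blast
  qed simp
 qed
 ultimately have "Y' holomorphic_on half_plane d" using holomorphic_on_subset by blast
 moreover have "Y' z = Y0 z" if "Im z > C" for z using that c Y(2) by (simp add: Y'_def)
 ultimately have "continues C Y0 d" unfolding continues_def by auto
 then show thesis using that[of d] c e by (simp add: d_def)
qed

lemma continues_limit:
 assumes c: "c <= C" and C: "!!d. c < d ==> continues C Y0 d"
 shows "continues C Y0 c"
proof -
 have "\<forall>d\<in>{c<..}. \<exists>Y. Y holomorphic_on half_plane d \<and> (\<forall>z\<in>half_plane C. Y z = Y0 z)"
  using C unfolding continues_def by blast
 from bchoice[OF this] obtain Y where "\<forall>d\<in>{c<..}. Y d holomorphic_on half_plane d \<and> (\<forall>z\<in>half_plane C. Y d z = Y0 z)"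
  by blast
 then have Y: "!!d. c < d ==> Y d holomorphic_on half_plane d" "!!d z. c < d ==> Im z > C ==> Y d z = Y0 z" by auto
 have match: "Y d z = Y d' z" if d: "c < d" "d <= d'" "Im z > d'" for d d' z
 proof (rule half_plane_identity[of "Y d" d' "Y d'" "max d' C"])
  have "half_plane d' \<subseteq> half_plane d" using d(2) by auto
  then show "Y d holomorphic_on half_plane d'" by (rule holomorphic_on_subset[OF Y(1)[OF d(1)]])
  show "Y d' holomorphic_on half_plane d'" using Y(1) d by simp
  show "Y d w = Y d' w" if "Im w > max d' C" for w using Y(2)[of d w] Y(2)[of d' w] d that by simp
 qed (use d in auto)
 define F where "F z = Y ((c + Im z) / 2) z" for z
 have "F holomorphic_on half_plane d" if d: "c < d" for d
 proof (rule holomorphic_transform[OF Y(1)[OF d]])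
  fix z assume z: "z \<in> half_plane d"
  show "Y d z = F z"
   unfolding F_def
  proof (cases "d <= (c + Im z) / 2")
   case True
   show "Y d z = Y ((c + Im z) / 2) z" by (rule match[OF d True]) (use d z in simp)
  next
   case False
   show "Y d z = Y ((c + Im z) / 2) z" by (rule match[symmetric]) (use d z False in simp_all)
  qed
 qed
 then have "F holomorphic_on (\<Union>d\<in>{c<..}. half_plane d)" by (intro holomorphic_on_UN_open open_half_plane) auto
 moreover have "(\<Union>d\<in>{c<..}. half_plane d) = half_plane c" 
 proof (rule subset_antisym)
  show "half_plane c \<subseteq> (\<Union>d\<in>{c<..}. half_plane d)"
  proof
   fix z assume "z \<in> half_plane c"
   then obtain d where "c < d" "d < Im z" using dense[of c "Im z"] by auto
   then show "z \<in> (\<Union>d\<in>{c<..}. half_plane d)" by auto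
  qed
  show "(\<Union>d\<in>{c<..}. half_plane d) \<subseteq> half_plane c" by auto
 qed
 moreover have "F z = Y0 z" if "z \<in> half_plane C" for z using Y(2)[of "(c + Im z) / 2" z] that c by (simp add: F_def)
 ultimately show ?thesis unfolding continues_def by auto
qed

text \<open>The infimum of the heights that can be reached is reached, and every positive height can be undercut, so
  the infimum is \<open>0\<close>.\<close>

theorem continuation:
 assumes C: "C >= 0" "half_plane C \<inter> Z = {}" and sol: "twisted_solution Q lam (half_plane C) Y0"
 obtains Y where "Y holomorphic_on uhp" "!!z. Im z > C ==> Y z = Y0 z"
proof -
 define S where "S = {c. 0 <= c \<and> c <= C \<and> continues C Y0 c}"
 have CS: "C \<in> S" using C(1) sol by (auto simp: S_def continues_def twisted_solution_def)
 have bdd: "bdd_below S" by (rule bdd_belowI[of _ 0]) (simp add: S_def)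
 define c where "c = Inf S"
 have c: "0 <= c" "c <= C" unfolding c_def
  using CS bdd by (auto intro!: cInf_greatest cInf_lower simp: S_def)
 have cont: "continues C Y0 d" if d: "c < d" for d
 proof -
  have "\<exists>x\<in>S. x < d" by (rule cInf_lessD) (use CS d in \<open>auto simp: c_def\<close>)
  then obtain d' where d': "d' \<in> S" "d' < d" by blast
  then obtain Y where "Y holomorphic_on half_plane d'" "\<forall>z\<in>half_plane C. Y z = Y0 z" by (auto simp: S_def continues_def)
  moreover have "half_plane d \<subseteq> half_plane d'" using d'(2) by auto
  ultimately show ?thesis unfolding continues_def using holomorphic_on_subset by blast
 qed
 then have cc: "continues C Y0 c" using continues_limit[OF c(2)] by blast
 have "c = 0"
 proof (rule ccontr)
  assume "c ~= 0"
  then have "0 < c" using c(1) by simp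
  then obtain d where d: "0 <= d" "d < c" "continues C Y0 d" by (rule continues_step[OF _ c(2) C(2) sol cc])
  then have "d \<in> S" using c by (simp add: S_def)
  then have "c <= d" unfolding c_def by (rule cInf_lower[OF _ bdd])
  then show False using d by simp
 qed
 then show thesis using cc that unfolding continues_def by auto
qed

end

section \<open>Behaviour at the cusp\<close>

abbreviation nome_disc :: "real => complex set" where
 "nome_disc C \<equiv> ball 0 (exp (- 2 * pi * C))"

lemma qq_in_nome_disc: "Im z > C ==> qq z \<in> nome_disc C"
 by (simp add: norm_qq)

lemma nome_disc_mono: "C <= C' ==> nome_disc C' \<subseteq> nome_disc C"
 by (rule subset_ball) simp

lemma nome_disc_small:
 assumes "r > 0" obtains C where "C >= C0" "nome_disc C \<subseteq> ball 0 r"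
proof
 define C where "C = max C0 (- ln r / (2 * pi))"
 show "C >= C0" by (simp add: C_def)
 have "- ln r / (2 * pi) <= C" by (simp add: C_def)
 then have "- 2 * pi * C <= ln r" by (simp add: field_simps)
 then have "exp (- 2 * pi * C) <= r" using assms by (metis exp_le_cancel_iff exp_ln)
 then show "nome_disc C \<subseteq> ball 0 r" by auto
qed

lemma nonzero_near_0:
 assumes f: "f holomorphic_on ball 0 r" "r > 0" "f 0 ~= (0 :: complex)"
 obtains s where "0 < s" "s <= r" "!!w. w \<in> ball 0 s ==> f w ~= 0"
proof -
 have "isCont f 0" using holomorphic_on_imp_continuous_on[OF f(1)] f(2) by (auto simp: continuous_on_eq_continuous_at)
 from continuous_at_avoid[OF this f(3)] obtain e where e: "e > 0" "\<forall>w. dist 0 w < e \<longrightarrow> f w ~= 0" by blast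
 show thesis by (rule that[of "min e r"]) (use e f(2) in auto)
qed

lemma has_field_derivative_compose_nome:
 assumes f: "f holomorphic_on nome_disc C" and z: "Im z > C"
 shows "((%z. f (qq z)) has_field_derivative tpi * qq z * deriv f (qq z)) (at z)"
proof (rule DERIV_cong[OF DERIV_chain2[where f = f and g = qq]])
 show "(f has_field_derivative deriv f (qq z)) (at (qq z))"
  by (rule holomorphic_derivI[OF f open_ball qq_in_nome_disc[OF z]])
qed (auto intro!: derivative_eq_intros)

lemma log_deriv_of_nome:
 assumes f: "f holomorphic_on ball 0 1" and h: "!!z. Im z > 0 ==> h z = f (qq z)" and z: "Im z > 0"
 shows "log_deriv h z = tpi * (qq z * log_deriv f (qq z))"
proof -
 have "(h has_field_derivative tpi * (qq z * deriv f (qq z))) (at z)"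
  by (rule has_field_derivative_transform_within_open[OF has_field_derivative_compose_qq[OF f z] open_half_plane[of 0]]) (use h z in auto)
 then show ?thesis using h[OF z] by (simp add: log_deriv_def DERIV_imp_deriv)
qed

lemma log_branch:
 assumes U: "open U" "z \<in> U" and l: "l holomorphic_on U" "!!z. z \<in> U ==> exp (l z) = f z"
 shows "(l has_field_derivative log_deriv f z) (at z)" "f z ~= 0"
proof -
 have d: "(l has_field_derivative deriv l z) (at z)" by (rule holomorphic_derivI[OF l(1) U])
 have "((%z. exp (l z)) has_field_derivative exp (l z) * deriv l z) (at z)"
  by (rule DERIV_chain2[where f = exp and g = l, OF DERIV_exp d])
 then have "(f has_field_derivative exp (l z) * deriv l z) (at z)"
  by (rule has_field_derivative_transform_within_open[OF _ U]) (use l in auto)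
 then have "deriv f z = f z * deriv l z" using l(2)[OF U(2)] by (simp add: DERIV_imp_deriv)
 moreover show nz: "f z ~= 0" using l(2)[OF U(2)] by (metis exp_not_eq_zero)
 ultimately have "log_deriv f z = deriv l z" by (simp add: log_deriv_def)
 then show "(l has_field_derivative log_deriv f z) (at z)" using d by simp
qed

lemma solves_ode_subset: "solves_ode Q U y ==> V \<subseteq> U ==> solves_ode Q V y"
 unfolding solves_ode_def using holomorphic_on_subset by blast

lemma solves_ode_cong:
 assumes "solves_ode Q U y" "open U" "!!z. z \<in> U ==> y' z = y z" shows "solves_ode Q U y'"
proof (rule solves_odeI[where y' = "deriv y", OF assms(2)])
 fix z assume z: "z \<in> U"
 note d = solves_odeD[OF assms(1,2) z]
 show "(y' has_field_derivative deriv y z) (at z)"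
  by (rule has_field_derivative_transform_within_open[OF d(1) assms(2) z]) (simp add: assms(3))
 show "(deriv y has_field_derivative - 4 * of_real pi ^ 2 * Q z * y' z) (at z)"
  using d(2) by (simp add: assms(3)[OF z])
qed

context modular_ode
begin

text \<open>The limit at the cusp removes the singularity of the meromorphic function of the nome.\<close>

lemma Q_at_cusp:
 obtains C g where "C >= 0" "g holomorphic_on nome_disc C" "g 0 = of_real kinf ^ 2" "!!z. Im z > C ==> Q z = g (qq z)"
proof -
 obtain g0 where g0: "g0 meromorphic_on {0}" "eventually (%z. Q z = g0 (qq z)) at_ii_inf"
  using mer by (auto simp: meromorphic_modular_form_def)
 have lim: "(g0 \<longlongrightarrow> of_real kinf ^ 2) (at 0)"
 proof (rule tendstoI)
  fix e :: real assume "e > 0"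
  then have "eventually (%z. dist (Q z) (of_real kinf ^ 2) < e) at_ii_inf"
   using cusp by (auto simp: has_kappa_cusp_def dest: tendstoD)
  then have "eventually (%z. dist (g0 (qq z)) (of_real kinf ^ 2) < e) at_ii_inf"
   using g0(2) by eventually_elim auto
  then obtain C where C: "!!z. Im z > C ==> dist (g0 (qq z)) (of_real kinf ^ 2) < e" by (auto simp: eventually_at_ii_inf)
  have "dist (g0 w) (of_real kinf ^ 2) < e" if "w ~= 0" "dist w 0 < exp (- 2 * pi * C)" for w
   using qq_surj[of w C] that C by (metis dist_0_norm dist_commute)
  then show "eventually (%w. dist (g0 w) (of_real kinf ^ 2) < e) (at 0)"
   unfolding eventually_at using exp_gt_zero by blast
 qed
 obtain r where r: "r > 0" "(%w. if w = 0 then of_real kinf ^ 2 else g0 w) holomorphic_on ball 0 r"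
  using removable_singularity'[OF meromorphic_on_isolated_singularity[OF g0(1)] lim] by (auto simp: analytic_on_def)
 obtain C1 where C1: "!!z. Im z > C1 ==> Q z = g0 (qq z)" using g0(2) by (auto simp: eventually_at_ii_inf)
 obtain C where C: "C >= max 0 C1" "nome_disc C \<subseteq> ball 0 r" using nome_disc_small[OF r(1)] by blast
 show thesis
  by (rule that[of C "%w. if w = 0 then of_real kinf ^ 2 else g0 w"])
    (use C C1 holomorphic_on_subset[OF r(2) C(2)] in auto)
qed

lemma fac_nome:
 assumes "j <= Suc m" shows "\<exists>f. f holomorphic_on ball 0 1 \<and> f 0 = 1 \<and> (\<forall>z. Im z > 0 \<longrightarrow> fac j z = f (qq z))"
 using assms
proof (cases rule: index_cases)
 case 1
 then show ?thesis by (intro exI[of _ N4_nome]) (auto simp: fac_def N4_def holomorphic_N4_nome N4_nome_0)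
next
 case 2
 then show ?thesis by (intro exI[of _ M2_nome]) (auto simp: fac_def M2_eq holomorphic_nome)
next
 case 3
 then show ?thesis
  by (intro exI[of _ "%x. M4_nome x ^ 2 - M4 (zs j) ^ 2 / M8 (zs j) * (x * M8_nome x)"])
    (auto simp: fac_def F_pt_def M4_eq[symmetric] M8_eq[symmetric] intro!: holomorphic_intros holomorphic_nome)
qed

lemma lam_at_cusp:
 obtains C R where "C >= 0" "R holomorphic_on nome_disc C" "half_plane C \<inter> Z = {}"
  "!!z. Im z > C ==> lam z = tpi * (of_real kinf + qq z * R (qq z))"
proof -
 have "\<forall>j\<in>{..Suc m}. \<exists>f. f holomorphic_on ball 0 1 \<and> f 0 = 1 \<and> (\<forall>z. Im z > 0 \<longrightarrow> fac j z = f (qq z))"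
  using fac_nome by blast
 from bchoice[OF this] obtain f where f: "!!j. j <= Suc m ==> f j holomorphic_on ball 0 1" "!!j. j <= Suc m ==> f j 0 = 1"
  "!!j z. j <= Suc m ==> Im z > 0 ==> fac j z = f j (qq z)" by auto
 have "(%w. \<Prod>j\<le>Suc m. f j w) holomorphic_on ball 0 1" by (intro holomorphic_intros f) simp
 moreover have "(\<Prod>j\<le>Suc m. f j 0) ~= 0" using f(2) by (subst prod_zero_iff) auto
 ultimately obtain r where r: "0 < r" "r <= 1" "!!w. w \<in> ball 0 r ==> (\<Prod>j\<le>Suc m. f j w) ~= 0"
  using nonzero_near_0[of "%w. \<Prod>j\<le>Suc m. f j w" 1] by auto
 have nz: "f j w ~= 0" if "w \<in> ball 0 r" "j <= Suc m" for j w
  using r(3)[OF that(1)] that(2) by (subst (asm) prod_zero_iff) auto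
 have "(%w. M2_star_nome w - 1) holomorphic_on ball 0 1" by (intro holomorphic_intros holomorphic_nome)
 then obtain h where h: "h holomorphic_on ball 0 1" "!!w. M2_star_nome w - 1 = w * h w"
  by (rule divide_by_nome) (auto intro: that)
 obtain C where C: "C >= 0" "nome_disc C \<subseteq> ball 0 r" using nome_disc_small[OF r(1)] by blast
 have sub: "nome_disc C \<subseteq> ball 0 1" by (rule subset_trans[OF C(2) subset_ball[OF r(2)]])
 define R where "R w = of_real kinf * h w + (\<Sum>j\<le>Suc m. of_real (ex j) * log_deriv (f j) w)" for w
 show thesis
 proof (rule that[OF C(1)])
  show "R holomorphic_on nome_disc C"
   unfolding R_def[abs_def]
   by (intro holomorphic_intros holomorphic_log_deriv holomorphic_on_subset[OF _ sub] h f open_ball)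
     (use nz C(2) in auto)
  have "fac j z ~= 0" if "z \<in> half_plane C" "j <= Suc m" for j z
   using nz[OF _ that(2), of "qq z"] f(3)[OF that(2), of z] that(1) C qq_in_nome_disc[of C z] by auto
  then show "half_plane C \<inter> Z = {}" by (auto simp: Z_def)
  fix z assume z: "Im z > C"
  then have zi: "Im z > 0" using C(1) by simp
  have "log_deriv M8 z = tpi * M2_star z"
   using DERIV_imp_deriv[OF has_field_derivative_M8[OF zi]] M8_nonzero[OF zi] by (simp add: log_deriv_def)
  also have "M2_star z = 1 + qq z * h (qq z)" using h(2)[of "qq z"] M2_star_eq[OF zi] by (simp add: algebra_simps)
  finally have m8: "log_deriv M8 z = tpi * (1 + qq z * h (qq z))" .
  have "(\<Sum>j\<le>Suc m. of_real (ex j) * log_deriv (fac j) z) =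
    (\<Sum>j\<le>Suc m. tpi * (qq z * (of_real (ex j) * log_deriv (f j) (qq z))))"
   by (rule sum.cong[OF refl]) (simp add: log_deriv_of_nome[OF f(1) f(3) zi])
  then show "lam z = tpi * (of_real kinf + qq z * R (qq z))"
   unfolding lam_def m8 R_def by (simp add: sum_distrib_left[symmetric] algebra_simps del: sum.atMost_Suc)
 qed
qed

abbreviation Fbr :: "complex set => (complex => complex) => bool" where
 "Fbr \<equiv> F_branch kinf k1 k2 m zs ks"

text \<open>The product that defines a branch of \<open>F\<close> is the exponential of a linear combination of
  logarithms of the family \<open>fac\<close>.\<close>

lemma F_branch_product:
 "exp (of_real kinf * l8) * exp (of_real (k1 - 1 / 2) * l 0) * exp (of_real (k2 - 1 / 2) * l (Suc m)) *
   (\<Prod>j=1..m. exp (of_real (ks j - 1 / 2) * l j)) = exp (of_real kinf * l8 + (\<Sum>j\<le>Suc m. of_real (ex j) * l j))"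
 for l :: "nat => complex"
proof -
 have "(\<Sum>j=1..m. complex_of_real (ex j) * l j) = (\<Sum>j=1..m. of_real (ks j - 1 / 2) * l j)"
  by (rule sum.cong) (auto simp: ex_def)
 then show ?thesis
  unfolding sum_index by (simp add: exp_add exp_sum ex_def mult.assoc)
qed

lemma F_branch_props:
 assumes U: "open U" "U \<subseteq> uhp" and F: "Fbr U F"
 shows "U \<inter> Z = {}" "!!z. z \<in> U ==> F z ~= 0" "!!z. z \<in> U ==> (F has_field_derivative lam z * F z) (at z)"
proof -
 obtain L8 L6 L2 L where L: "L8 holomorphic_on U" "\<forall>z\<in>U. exp (L8 z) = M8 z"
  "L6 holomorphic_on U" "\<forall>z\<in>U. exp (L6 z) = M6 z / M2 z" "L2 holomorphic_on U" "\<forall>z\<in>U. exp (L2 z) = M2 z"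
  "\<forall>j\<in>{1..m}. L j holomorphic_on U \<and> (\<forall>z\<in>U. exp (L j z) = F_pt (zs j) z)"
  and F: "\<forall>z\<in>U. F z = exp (of_real kinf * L8 z) * exp (of_real (k1 - 1 / 2) * L6 z) *
          exp (of_real (k2 - 1 / 2) * L2 z) * (\<Prod>j=1..m. exp (of_real (ks j - 1 / 2) * L j z))"
  using F unfolding F_branch_def by (elim exE conjE) (rule that; assumption)
 define l where "l j = (if j = 0 then L6 else if j = Suc m then L2 else L j)" for j
 have l: "l j holomorphic_on U" "!!z. z \<in> U ==> exp (l j z) = fac j z" if "j <= Suc m" for j
 proof -
  show "l j holomorphic_on U" using that by (cases rule: index_cases) (use L in \<open>auto simp: l_def\<close>)
  fix z assume z: "z \<in> U"
  have "M2 z ~= 0" using L(6) z by (metis exp_not_eq_zero)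
  moreover have "M6 z = M2 z * N4 z" using M6_eq_M2_N4 z U by auto
  ultimately have "exp (L6 z) = N4 z" using L(4) z by simp
  with that show "exp (l j z) = fac j z" by (cases rule: index_cases) (use L z in \<open>auto simp: l_def fac_def\<close>)
 qed
 have Feq: "F z = exp (of_real kinf * L8 z + (\<Sum>j\<le>Suc m. of_real (ex j) * l j z))" if "z \<in> U" for z
 proof -
  have "(\<Prod>j=1..m. exp (of_real (ks j - 1 / 2) * L j z)) = (\<Prod>j=1..m. exp (of_real (ks j - 1 / 2) * l j z))"
   by (rule prod.cong) (auto simp: l_def)
  then show ?thesis using bspec[OF F that] F_branch_product[of "L8 z" "%j. l j z"] by (simp add: l_def del: of_real_diff sum.atMost_Suc)
 qed
 show "U \<inter> Z = {}" using l(2) by (auto simp: Z_def) (metis exp_not_eq_zero)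
 show "F z ~= 0" if "z \<in> U" for z using Feq[OF that] by simp
 show "(F has_field_derivative lam z * F z) (at z)" if z: "z \<in> U" for z
 proof (rule has_field_derivative_transform_within_open[OF _ U(1) z])
  have "((%z. of_real kinf * L8 z + (\<Sum>j\<le>Suc m. of_real (ex j) * l j z)) has_field_derivative lam z) (at z)"
   unfolding lam_def
   by (intro DERIV_add DERIV_cmult DERIV_sum log_branch(1)[OF U(1) z] l) (use L in auto)
  from DERIV_chain2[where f = exp and g = "%z. of_real kinf * L8 z + (\<Sum>j\<le>Suc m. of_real (ex j) * l j z)", OF DERIV_exp this]
  show "((%z. exp (of_real kinf * L8 z + (\<Sum>j\<le>Suc m. of_real (ex j) * l j z))) has_field_derivative lam z * F z) (at z)"
   by (rule DERIV_cong) (simp add: Feq[OF z] del: sum.atMost_Suc)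
 qed (simp add: Feq)
qed

lemma F_branch_exists:
 assumes C: "C >= 0" "half_plane C \<inter> Z = {}" shows "\<exists>F. Fbr (half_plane C) F"
proof -
 have sub: "half_plane C \<subseteq> uhp" using C(1) by auto
 have pt: "\<i> * of_real (C + 1) \<in> half_plane C" by simp
 have log: "\<exists>l. l holomorphic_on half_plane C \<and> (\<forall>z\<in>half_plane C. exp (l z) = f z)"
  if "f holomorphic_on uhp" "!!z. z \<in> half_plane C ==> f z ~= 0" for f
 proof -
  have "f holomorphic_on half_plane C" using holomorphic_on_subset[OF that(1) sub] .
  from holomorphic_logarithm_exists[OF convex_half_plane open_half_plane this that(2) pt]
  obtain l where "l holomorphic_on half_plane C" "!!z. z \<in> half_plane C ==> exp (l z) = f z" by blast
  then show ?thesis by blast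
 qed
 have nz: "fac j z ~= 0" if "z \<in> half_plane C" "j <= Suc m" for j z
 proof
  assume "fac j z = 0"
  then have "z \<in> Z" using that sub by (auto simp: Z_def)
  then show False using that C(2) by blast
 qed
 have "\<forall>j\<in>{..Suc m}. \<exists>l. l holomorphic_on half_plane C \<and> (\<forall>z\<in>half_plane C. exp (l z) = fac j z)"
  using log[OF holomorphic_fac nz] by simp
 from bchoice[OF this] obtain l where
  "\<forall>j\<in>{..Suc m}. l j holomorphic_on half_plane C \<and> (\<forall>z\<in>half_plane C. exp (l j z) = fac j z)" by blast
 then have l: "!!j. j <= Suc m ==> l j holomorphic_on half_plane C"
  "!!j z. j <= Suc m ==> z \<in> half_plane C ==> exp (l j z) = fac j z" by auto
 obtain L8 where L8: "L8 holomorphic_on half_plane C" "\<forall>z\<in>half_plane C. exp (L8 z) = M8 z"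
  using log[OF holomorphic_level2(4)] M8_nonzero C(1) by force
 have "exp (l 0 z) = M6 z / M2 z" "exp (l (Suc m) z) = M2 z" if z: "z \<in> half_plane C" for z
 proof -
  have "Im z > 0" using z sub by auto
  moreover have m2: "M2 z ~= 0" using nz[OF z, of "Suc m"] by (simp add: fac_def)
  ultimately show "exp (l 0 z) = M6 z / M2 z" using l(2)[OF _ z, of 0] M6_eq_M2_N4 by (simp add: fac_def)
  show "exp (l (Suc m) z) = M2 z" using l(2)[OF _ z, of "Suc m"] by (simp add: fac_def)
 qed
 moreover have "l j holomorphic_on half_plane C \<and> (\<forall>z\<in>half_plane C. exp (l j z) = F_pt (zs j) z)" if "j \<in> {1..m}" for j
  using l[of j] that by (auto simp: fac_def)
 ultimately have "Fbr (half_plane C) (%z. exp (of_real kinf * L8 z) * exp (of_real (k1 - 1 / 2) * l 0 z) *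
   exp (of_real (k2 - 1 / 2) * l (Suc m) z) * (\<Prod>j=1..m. exp (of_real (ks j - 1 / 2) * l j z)))"
  unfolding F_branch_def using L8 l(1)[of 0] l(1)[of "Suc m"]
  by (intro exI[of _ L8] exI[of _ "l 0"] exI[of _ "l (Suc m)"] exI[of _ l]) auto
 then show ?thesis by blast
qed

text \<open>The leading factor of solutions and of \<open>F\<close> at the cusp, the nome raised to the power
  \<open>kinf\<close>.\<close>

definition cexp :: "complex => complex" where "cexp z = exp (tpi * of_real kinf * z)"

lemma cexp_derivative: "(cexp has_field_derivative tpi * of_real kinf * cexp z) (at z)"
 unfolding cexp_def[abs_def] by (auto intro!: derivative_eq_intros)

lemma cexp_nonzero [simp]: "cexp z ~= 0" by (simp add: cexp_def)

text \<open>Integrating the regular part of \<open>lam\<close> in the nome gives one branch, and two branches differ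
  by a constant factor.\<close>

lemma F_cusp_form:
 assumes R: "R holomorphic_on nome_disc C" "!!z. Im z > C ==> lam z = tpi * (of_real kinf + qq z * R (qq z))"
  and F: "!!z. Im z > C ==> (F has_field_derivative lam z * F z) (at z)" "!!z. Im z > C ==> F z ~= 0"
 obtains E where "E holomorphic_on nome_disc C" "!!w. w \<in> nome_disc C ==> E w ~= 0" "!!z. Im z > C ==> F z = cexp z * E (qq z)"
proof -
 obtain T where T: "!!w. w \<in> nome_disc C ==> (T has_field_derivative R w) (at w)"
  using holomorphic_convex_primitive'[OF convex_ball open_ball R(1)] by (metis at_within_open open_ball)
 have Th: "T holomorphic_on nome_disc C" unfolding holomorphic_on_open[OF open_ball] using T by blast
 define N where "N z = cexp z * exp (T (qq z))" for z
 have N: "(N has_field_derivative lam z * N z) (at z)" if z: "Im z > C" for z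
 proof -
  have "((%z. T (qq z)) has_field_derivative tpi * qq z * R (qq z)) (at z)"
   using has_field_derivative_compose_nome[OF Th z] DERIV_imp_deriv[OF T[OF qq_in_nome_disc[OF z]]] by simp
  from DERIV_mult[OF cexp_derivative DERIV_chain2[where f = exp and g = "%z. T (qq z)", OF DERIV_exp this]]
  show ?thesis unfolding N_def[abs_def] by (rule DERIV_cong) (simp add: R(2)[OF z] algebra_simps)
 qed
 have N0: "N z ~= 0" for z by (simp add: N_def)
 have "((%z. F z / N z) has_field_derivative 0) (at z)" if "z \<in> half_plane C" for z
  by (rule DERIV_cong[OF DERIV_divide[OF F(1) N N0]]) (use that in auto)
 then have "(%z. F z / N z) constant_on half_plane C"
  by (intro has_field_derivative_0_imp_constant_on) (auto simp: open_half_plane)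
 then obtain a where a: "!!z. Im z > C ==> F z / N z = a" unfolding constant_on_def by auto
 then have a': "F z = a * N z" if "Im z > C" for z using a[OF that] N0 by (simp add: field_simps)
 have a0: "a ~= 0" using F(2)[of "\<i> * of_real (C + 1)"] a'[of "\<i> * of_real (C + 1)"] by auto
 show thesis
  by (rule that[of "%w. a * exp (T w)"]) (use a' a0 Th in \<open>auto simp: N_def intro!: holomorphic_intros\<close>)
qed

lemma cexp_square:
 assumes "kinf = real n / 2" shows "cexp z * cexp z = qq z ^ n"
proof -
 have "tpi * of_real kinf * z + tpi * of_real kinf * z = tpi * (of_nat n * z)"
  by (simp add: assms)
 then have "cexp z * cexp z = qq (of_nat n * z)" unfolding cexp_def qq_def exp_add[symmetric] by (simp only:)
 then show ?thesis by (simp add: qq_mult_nat)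
qed

text \<open>Splitting off \<open>cexp\<close>, the equation \<open>(q d/dq)\<^sup>2 y = Q y\<close> takes the normal
  form of \<open>frobenius_solution\<close> with \<open>n = 2 kinf\<close>.\<close>

lemma cusp_solution:
 assumes g: "g holomorphic_on nome_disc C" "g 0 = of_real kinf ^ 2" "!!z. Im z > C ==> Q z = g (qq z)"
  and n: "kinf = real n / 2" and V: "V holomorphic_on nome_disc C"
  and ode: "!!w. w \<in> nome_disc C ==> w * deriv (deriv V) w + of_nat (n + 1) * deriv V w = q w * V w"
  and q: "!!w. w \<in> nome_disc C ==> w * q w = g w - g 0"
 shows "solves_ode Q (half_plane C) (%z. cexp z * V (qq z))"
proof (rule solves_odeI[OF open_half_plane, where y' = "%z. tpi * (cexp z * (of_real kinf * V (qq z) + qq z * deriv V (qq z)))"])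
 fix z assume "z \<in> half_plane C"
 then have z: "Im z > C" by simp
 have V': "deriv V holomorphic_on nome_disc C" by (rule holomorphic_deriv[OF V open_ball])
 note d = has_field_derivative_compose_nome[OF V z] has_field_derivative_compose_nome[OF V' z]
 show "((%z. cexp z * V (qq z)) has_field_derivative tpi * (cexp z * (of_real kinf * V (qq z) + qq z * deriv V (qq z)))) (at z)"
  by (rule DERIV_cong[OF DERIV_mult[OF cexp_derivative d(1)]]) (simp add: algebra_simps)
 have w: "qq z \<in> nome_disc C" by (rule qq_in_nome_disc[OF z])
 have nk: "of_nat (n + 1) = 2 * complex_of_real kinf + 1" by (simp add: n)
 show "((%z. tpi * (cexp z * (of_real kinf * V (qq z) + qq z * deriv V (qq z)))) has_field_derivative
   - 4 * of_real pi ^ 2 * Q z * (cexp z * V (qq z))) (at z)"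
 proof (rule DERIV_cong[OF DERIV_cmult[OF DERIV_mult[OF cexp_derivative DERIV_add[OF DERIV_cmult[OF d(1)] DERIV_mult[OF has_field_derivative_qq d(2)]]]]])
  define p :: complex where "p = tpi"
  define w where "w = qq z"
  have wd: "w \<in> nome_disc C" using qq_in_nome_disc[OF z] by (simp add: w_def)
  have pp: "p * p = - 4 * of_real pi ^ 2" by (simp add: p_def power2_eq_square)
  have "p * (p * of_real kinf * cexp z * (of_real kinf * V w + w * deriv V w) +
     (of_real kinf * (p * w * deriv V w) + (p * w * deriv V w + p * w * deriv (deriv V) w * w)) * cexp z) =
    (p * p) * cexp z * (of_real kinf ^ 2 * V w + w * (w * deriv (deriv V) w + (2 * of_real kinf + 1) * deriv V w))"
   by (simp add: algebra_simps power2_eq_square)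
  also have "w * deriv (deriv V) w + (2 * of_real kinf + 1) * deriv V w = q w * V w" using ode[OF wd] unfolding nk .
  also have "of_real kinf ^ 2 * V w + w * (q w * V w) = g w * V w"
  proof -
   have "of_real kinf ^ 2 * V w + w * (q w * V w) = (g 0 + w * q w) * V w" by (simp add: g(2) algebra_simps)
   then show ?thesis by (simp add: q[OF wd])
  qed
  finally show "tpi * (tpi * of_real kinf * cexp z * (of_real kinf * V (qq z) + qq z * deriv V (qq z)) +
     (of_real kinf * (tpi * qq z * deriv V (qq z)) +
      (tpi * qq z * deriv V (qq z) + tpi * qq z * deriv (deriv V) (qq z) * qq z)) * cexp z) =
    - 4 * of_real pi ^ 2 * Q z * (cexp z * V (qq z))"
   unfolding p_def[symmetric] w_def[symmetric] pp g(3)[OF z] w_def[symmetric] by (simp add: mult_ac)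
 qed
qed

text \<open>Reduction of order at the cusp; the constant \<open>c\<close> multiplies the logarithm \<open>2 \<pi> i z\<close>.\<close>

lemma cusp_integral:
 assumes y: "!!z. Im z > C ==> y z = cexp z * V (qq z)" and n: "kinf = real n / 2"
  and V: "!!w. w \<in> nome_disc C ==> V w ~= 0" and G: "G holomorphic_on nome_disc C"
  and eq: "!!w. w \<in> nome_disc C ==> w * deriv G w - of_nat n * G w = 1 / V w ^ 2 - c * w ^ n" and z: "Im z > C"
 shows "((%z. G (qq z) / (tpi * qq z ^ n) + c * z) has_field_derivative 1 / y z ^ 2) (at z)"
proof -
 define w where "w = qq z"
 have w: "w ~= 0" "w \<in> nome_disc C" using qq_in_nome_disc[OF z] by (auto simp: w_def)
 have pow: "((%z. qq z ^ n) has_field_derivative tpi * of_nat n * w ^ n) (at z)"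
 proof (rule DERIV_cong[OF DERIV_power[OF has_field_derivative_qq]])
  show "of_nat n * (tpi * qq z * qq z ^ (n - Suc 0)) = tpi * of_nat n * w ^ n"
   by (cases n) (simp_all add: w_def)
 qed
 have y2: "y z ^ 2 = w ^ n * V w ^ 2"
 proof -
  have "cexp z ^ 2 = w ^ n" by (simp add: power2_eq_square cexp_square[OF n] w_def)
  then show ?thesis using y[OF z] by (simp add: power_mult_distrib w_def)
 qed
 have "((%z. G (qq z) / (tpi * qq z ^ n) + c * z) has_field_derivative
   ((tpi * w * deriv G w) * (tpi * w ^ n) - G w * (tpi * (tpi * of_nat n * w ^ n))) /
   ((tpi * w ^ n) * (tpi * w ^ n)) + c * 1) (at z)"
  unfolding w_def
  by (intro DERIV_add DERIV_divide DERIV_cmult DERIV_ident has_field_derivative_compose_nome[OF G z] pow[unfolded w_def]) simp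
 also have "((tpi * w * deriv G w) * (tpi * w ^ n) - G w * (tpi * (tpi * of_nat n * w ^ n))) /
   ((tpi * w ^ n) * (tpi * w ^ n)) + c * 1 = (w * deriv G w - of_nat n * G w) / w ^ n + c"
  using w(1) by (simp add: field_simps)
 also have "\<dots> = 1 / y z ^ 2" unfolding eq[OF w(2)] y2 using w V[OF w(2)] by (simp add: field_simps)
 finally show ?thesis .
qed

text \<open>The Frobenius solution times a branch of \<open>F\<close> is a twisted solution near the cusp, and
  continuation applies.\<close>

theorem exists_y_plus_hat: "\<exists>Yp. y_plus_hat Q kinf k1 k2 m zs ks Yp"
proof -
 obtain n where n: "kinf = real n / 2" using kinf_half by blast
 obtain C0 g where g: "C0 >= 0" "g holomorphic_on nome_disc C0" "g 0 = of_real kinf ^ 2" "!!z. Im z > C0 ==> Q z = g (qq z)"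
  using Q_at_cusp by metis
 obtain C1 R where R: "C1 >= 0" "half_plane C1 \<inter> Z = {}" using lam_at_cusp by metis
 define q where "q w = (if w = 0 then deriv g 0 else (g w - g 0) / (w - 0))" for w
 have qh: "q holomorphic_on nome_disc C0" unfolding q_def[abs_def] by (rule pole_lemma_open[OF g(2) open_ball])
 obtain s V where V: "0 < s" "s <= exp (- 2 * pi * C0)" "V holomorphic_on ball 0 s" "V 0 = 1"
  "!!w. norm w < s ==> w * deriv (deriv V) w + of_nat (n + 1) * deriv V w = q w * V w"
  using frobenius_solution[OF qh, of n] by (metis exp_gt_zero)
 obtain C where C: "C >= max C0 C1" "nome_disc C \<subseteq> ball 0 s" using nome_disc_small[OF V(1)] by blast
 have C0: "C >= 0" "half_plane C \<subseteq> uhp" "half_plane C \<subseteq> half_plane C1" using C g(1) by auto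
 have CZ: "half_plane C \<inter> Z = {}" using R(2) C0(3) by blast
 have Vh: "V holomorphic_on nome_disc C" by (rule holomorphic_on_subset[OF V(3) C(2)])
 have dsub: "nome_disc C \<subseteq> nome_disc C0" by (rule nome_disc_mono) (use C in simp)
 define y where "y z = cexp z * V (qq z)" for z
 have sol: "solves_ode Q (half_plane C) y"
  unfolding y_def[abs_def]
 proof (rule cusp_solution[where g = g and q = q, OF holomorphic_on_subset[OF g(2) dsub] g(3) _ n Vh])
  show "w * deriv (deriv V) w + of_nat (n + 1) * deriv V w = q w * V w" if "w \<in> nome_disc C" for w
   using V(5)[of w] that C(2) by auto
 qed (use g C in \<open>auto simp: q_def\<close>)
 have yp: "y_plus Q kinf C y"
  unfolding y_plus_def
 proof (intro conjI sol exI[of _ "%j. (deriv ^^ j) V 0 / fact j"] ballI)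
  fix z assume "z \<in> half_plane C"
  then have "qq z \<in> nome_disc C" by (intro qq_in_nome_disc) simp
  from holomorphic_power_series[OF Vh this]
  have sums: "(%j. (deriv ^^ j) V 0 / fact j * qq z ^ j) sums V (qq z)" by simp
  then show "summable (%j. (deriv ^^ j) V 0 / fact j * qq z ^ j)"
   "y z = exp (tpi * of_real kinf * z) * (\<Sum>j. (deriv ^^ j) V 0 / fact j * qq z ^ j)"
   by (auto simp: sums_iff y_def cexp_def)
 qed (simp add: V(4))
 obtain F where F: "Fbr (half_plane C) F" using F_branch_exists[OF C0(1) CZ] by blast
 note Fp = F_branch_props[OF open_half_plane C0(2) F]
 have lamC: "lam holomorphic_on half_plane C" and QC: "Q holomorphic_on half_plane C"
  using holomorphic_on_subset[of _ "uhp - Z" "half_plane C"] holomorphic_lam holomorphic_Q C0(2) CZ by blast+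
 have "twisted_solution Q lam (half_plane C) (%z. F z * y z)"
 proof -
  have "solves_ode Q (half_plane C) (%z. F z * y z / F z)"
   by (rule solves_ode_cong[OF sol open_half_plane]) (use Fp(2) in auto)
  then show ?thesis using twisted_iff_solves_ode[OF open_half_plane Fp(3,2) lamC] by blast
 qed
 from continuation[OF C0(1) CZ this] obtain Y where Y: "Y holomorphic_on uhp" "!!z. Im z > C ==> Y z = F z * y z" by blast
 have "y_plus_hat Q kinf k1 k2 m zs ks Y"
 proof -
  have "\<forall>z\<in>half_plane C. Y z = F z * y z" using Y(2) by simp
  then show ?thesis unfolding y_plus_hat_def using Y(1) C0(1) QC F yp by blast
 qed
 then show ?thesis by blast
qed

lemma F_times_solution:
 assumes C: "C >= 0" "half_plane C \<inter> Z = {}"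
  and F: "!!z. Im z > C ==> F z ~= 0" "!!z. Im z > C ==> (F has_field_derivative lam z * F z) (at z)"
  and y: "solves_ode Q (half_plane C) y"
 shows "twisted_solution Q lam (half_plane C) (%z. F z * y z)"
proof -
 have "half_plane C \<subseteq> uhp - Z"
 proof
  fix z assume z: "z \<in> half_plane C"
  then have "z \<notin> Z" using C(2) by blast
  then show "z \<in> uhp - Z" using z C(1) by simp
 qed
 then have lamC: "lam holomorphic_on half_plane C" by (rule holomorphic_on_subset[OF holomorphic_lam])
 have "solves_ode Q (half_plane C) (%z. F z * y z / F z)"
  by (rule solves_ode_cong[OF y open_half_plane]) (use F(1) in auto)
 then show ?thesis using twisted_iff_solves_ode[OF open_half_plane _ _ lamC, of F] F by auto
qed

text \<open>In the second solution, after multiplication by \<open>F\<close>, the negative power of the nome cancels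
  against \<open>cexp\<^sup>2\<close>, so that it is a function \<open>B\<close> of the nome plus \<open>c z
  Yp\<close>.\<close>

theorem y_plus_hat_at_cusp:
 assumes hat: "y_plus_hat Q kinf k1 k2 m zs ks Yp"
 obtains C n A B Y2 c where "C >= 0" "half_plane C \<inter> Z = {}" "A holomorphic_on nome_disc C" "B holomorphic_on nome_disc C"
  "!!w. w \<in> nome_disc C ==> A w ~= 0"
  "!!z. Im z > C ==> Yp z = qq z ^ n * A (qq z)" "!!z. Im z > C ==> Y2 z = B (qq z) + c * z * Yp z"
  "twisted_solution Q lam (half_plane C) Yp" "twisted_solution Q lam (half_plane C) Y2"
  "!!a b. (!!z. Im z > C ==> a * Yp z + b * Y2 z = 0) ==> a = 0 \<and> b = 0"
  "c ~= 0 ==> \<not> cusp_apparent Q"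
proof -
 obtain n where n: "kinf = real n / 2" using kinf_half by blast
 obtain C0 F yp where C0: "C0 >= 0" "Q holomorphic_on half_plane C0" and F: "Fbr (half_plane C0) F"
  and yp: "y_plus Q kinf C0 yp" and Yp: "!!z. Im z > C0 ==> Yp z = F z * yp z"
  using hat unfolding y_plus_hat_def by auto
 obtain a where sol0: "solves_ode Q (half_plane C0) yp" and a: "a 0 = 1"
  "!!z. Im z > C0 ==> summable (%j. a j * qq z ^ j) \<and>
    yp z = exp (tpi * of_real kinf * z) * (\<Sum>j. a j * qq z ^ j)"
  using yp unfolding y_plus_def by auto
 define V where "V w = (\<Sum>j. a j * w ^ j)" for w
 have V0: "V 0 = 1" using powser_sums_zero[of a] a(1) by (simp add: V_def sums_iff)
 have Vh: "V holomorphic_on nome_disc C0"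
 proof (rule power_series_holomorphic)
  fix w assume w: "w \<in> nome_disc C0"
  show "(%j. a j * (w - 0) ^ j) sums V w"
  proof (cases "w = 0")
   case True
   then show ?thesis using powser_sums_zero[of a] a(1) V0 by simp
  next
   case False
   then obtain z where "Im z > C0" "qq z = w" using qq_surj[of w C0] w by auto
   then show ?thesis using a(2)[of z] by (simp add: V_def summable_sums)
  qed
 qed
 obtain s where s: "0 < s" "s <= exp (- 2 * pi * C0)" "!!w. w \<in> ball 0 s ==> V w ~= 0"
  using nonzero_near_0[OF Vh] V0 by auto
 have "(%w. 1 / V w ^ 2) holomorphic_on ball 0 s"
  using s by (intro holomorphic_intros holomorphic_on_subset[OF Vh subset_ball]) auto
 then obtain G c where G: "G holomorphic_on ball 0 s"
  "!!w. norm w < s ==> w * deriv G w - of_nat n * G w = 1 / V w ^ 2 - c * w ^ n"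
  using integrate_pole[OF _ s(1), of "%w. 1 / V w ^ 2" n] by metis
 obtain C1 R where R: "C1 >= 0" "R holomorphic_on nome_disc C1" "half_plane C1 \<inter> Z = {}"
  "!!z. Im z > C1 ==> lam z = tpi * (of_real kinf + qq z * R (qq z))"
  using lam_at_cusp by metis
 obtain C where C: "C >= max C0 C1" "nome_disc C \<subseteq> ball 0 s" using nome_disc_small[OF s(1)] by blast
 have CC: "C >= 0" "half_plane C \<subseteq> half_plane C0" "half_plane C \<subseteq> half_plane C1" using C(1) C0(1) by auto
 have CZ: "half_plane C \<inter> Z = {}" using R(3) CC(3) by blast
 have "half_plane C0 \<subseteq> uhp" using C0(1) by auto
 note Fp = F_branch_props[OF open_half_plane this F]
 have F0: "F z ~= 0" and F1: "(F has_field_derivative lam z * F z) (at z)" if "Im z > C" for z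
  using Fp(2,3)[of z] that C(1) by auto
 have Vd: "V holomorphic_on nome_disc C" and Gd: "G holomorphic_on nome_disc C" and V1: "!!w. w \<in> nome_disc C ==> V w ~= 0"
  using holomorphic_on_subset[OF Vh subset_trans[OF C(2) subset_ball[OF s(2)]]] holomorphic_on_subset[OF G(1) C(2)] s(3) C(2) by blast+
 have Rd: "R holomorphic_on nome_disc C" by (rule holomorphic_on_subset[OF R(2) nome_disc_mono]) (use C in simp)
 obtain E where E: "E holomorphic_on nome_disc C" "!!w. w \<in> nome_disc C ==> E w ~= 0" "!!z. Im z > C ==> F z = cexp z * E (qq z)"
  by (rule F_cusp_form[OF Rd _ F1 F0]) (use R(4) C(1) that in auto)
 have sol: "solves_ode Q (half_plane C) yp" by (rule solves_ode_subset[OF sol0 CC(2)])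
 have y: "yp z = cexp z * V (qq z)" if "Im z > C" for z using a(2)[of z] that C(1) by (simp add: cexp_def V_def)
 have ynz: "yp z ~= 0" if "Im z > C" for z using y[OF that] V1[OF qq_in_nome_disc[OF that]] by simp
 define I where "I z = G (qq z) / (tpi * qq z ^ n) + c * z" for z
 have I: "(I has_field_derivative 1 / yp z ^ 2) (at z)" if "Im z > C" for z
  unfolding I_def[abs_def] by (rule cusp_integral[OF y n V1 Gd _ that]) (use G(2) C(2) in auto)
 have sol2: "solves_ode Q (half_plane C) (%z. yp z * I z)"
  by (rule solves_ode_reduction_of_order[OF sol open_half_plane]) (use ynz I in auto)
 define Y2 where "Y2 z = F z * (yp z * I z)" for z
 define A where "A w = E w * V w" for w
 define B where "B w = A w * G w / tpi" for w
 have YA: "Yp z = qq z ^ n * A (qq z)" if "Im z > C" for z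
  using Yp[of z] that C(1) by (simp add: E(3) y A_def cexp_square[OF n, symmetric] mult_ac)
 have Y2B: "Y2 z = B (qq z) + c * z * Yp z" if "Im z > C" for z
 proof -
  have "Y2 z = Yp z * I z" using Yp[of z] that C(1) by (simp add: Y2_def)
  also have "\<dots> = Yp z * (G (qq z) / (tpi * qq z ^ n)) + c * z * Yp z"
   by (simp add: I_def algebra_simps)
  also have "Yp z * (G (qq z) / (tpi * qq z ^ n)) = B (qq z)"
   by (simp add: YA[OF that] B_def)
  finally show ?thesis .
 qed
 show thesis
 proof (rule that[OF CC(1) CZ _ _ _ YA Y2B])
  show "A holomorphic_on nome_disc C" "B holomorphic_on nome_disc C"
   unfolding A_def[abs_def] B_def[abs_def] by (intro holomorphic_intros E Vd Gd; simp)+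
  show "A w ~= 0" if "w \<in> nome_disc C" for w using E(2) V1 that by (simp add: A_def)
  have "twisted_solution Q lam (half_plane C) (%z. F z * yp z)" by (rule F_times_solution[OF CC(1) CZ F0 F1 sol])
  then show "twisted_solution Q lam (half_plane C) Yp"
  proof (rule twisted_solution_cong)
   show "F z * yp z = Yp z" if "z \<in> half_plane C" for z using Yp[of z] that C(1) by simp
   have "half_plane C \<subseteq> uhp - Z"
   proof
    fix z assume z: "z \<in> half_plane C"
    then have "z \<notin> Z" using CZ by blast
    then show "z \<in> uhp - Z" using z CC(1) by simp
   qed
   then show "lam holomorphic_on half_plane C" by (rule holomorphic_on_subset[OF holomorphic_lam])
  qed (rule open_half_plane)
  show "twisted_solution Q lam (half_plane C) Y2"
   unfolding Y2_def[abs_def] by (rule F_times_solution[OF CC(1) CZ F0 F1 sol2])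
  show "a = 0 \<and> b = 0" if ab: "!!z. Im z > C ==> a * Yp z + b * Y2 z = 0" for a b
  proof -
   have e: "a + b * I z = 0" if z: "Im z > C" for z
   proof -
    have "F z * yp z * (a + b * I z) = 0" using ab[OF z] Yp[of z] z C(1) by (simp add: Y2_def algebra_simps)
    then show ?thesis using F0[OF z] ynz[OF z] by simp
   qed
   define z where "z = \<i> * of_real (C + 1)"
   have z: "Im z > C" by (simp add: z_def)
   have "((%z. a + b * I z) has_field_derivative 0 + b * (1 / yp z ^ 2)) (at z)"
    by (intro DERIV_add DERIV_const DERIV_cmult I z)
   then have "((%z. 0) has_field_derivative 0 + b * (1 / yp z ^ 2)) (at z)"
    by (rule has_field_derivative_transform_within_open[OF _ open_half_plane[of C]]) (use z e in auto)
   then have "0 + b * (1 / yp z ^ 2) = 0" using DERIV_const DERIV_unique by blast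
   then have "b = 0" using ynz[OF z] by simp
   then show ?thesis using e[OF z] by simp
  qed
  show "\<not> cusp_apparent Q" if c: "c ~= 0"
  proof -
   have "Q holomorphic_on half_plane C" by (rule holomorphic_on_subset[OF C0(2) CC(2)])
   moreover have "log_singularity_cusp (%z. yp z * I z) C"
    unfolding log_singularity_cusp_def
   proof (rule exI[of _ "- of_real kinf"], rule exI[of _ "%w. V w * G w / tpi"],
     rule exI[of _ "%w. c / tpi * w ^ n * V w"], intro conjI ballI)
    show "(%w. V w * G w / tpi) holomorphic_on nome_disc C"
     "(%w. c / tpi * w ^ n * V w) holomorphic_on nome_disc C"
     by (intro holomorphic_intros Vd Gd; simp)+
    have "qq (\<i> * of_real (C + 1)) \<in> nome_disc C" by (rule qq_in_nome_disc) simp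
    then show "\<exists>w\<in>nome_disc C. c / tpi * w ^ n * V w ~= 0"
     using c V1 by (intro bexI[of _ "qq (\<i> * of_real (C + 1))"]) auto
    fix z assume "z \<in> half_plane C"
    then have z: "Im z > C" by simp
    have e: "exp (tpi * - of_real kinf * z) = 1 / cexp z"
     by (simp add: cexp_def exp_minus divide_inverse)
    show "yp z * I z = exp (tpi * - of_real kinf * z) *
      (V (qq z) * G (qq z) / tpi + tpi * z * (c / tpi * qq z ^ n * V (qq z)))"
     unfolding e y[OF z] I_def cexp_square[OF n, symmetric] by (simp add: field_simps)
   qed
   ultimately show ?thesis using sol2 CC(1) unfolding cusp_apparent_def by blast
  qed
 qed
qed

end

section \<open>Monodromy\<close>

text \<open>The Wronskian satisfies a linear equation of first order, so it vanishes identically once it vanishes at a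
  point, and then the quotient of the two solutions is constant.\<close>

lemma dependent_if_wronskian_zero:
 assumes sol: "twisted_solution Q L V Y1" "twisted_solution Q L V Y2" and L: "L holomorphic_on V"
  and V: "open V" "connected V" and z0: "z0 \<in> V" "twisted_wronskian L Y1 Y2 z0 = 0"
 obtains a b where "a ~= 0 \<or> b ~= 0" "!!z. z \<in> V ==> a * Y1 z + b * Y2 z = 0"
proof -
 have hol: "Y1 holomorphic_on V" "Y2 holomorphic_on V" using sol by (auto simp: twisted_solution_def)
 note W' = has_field_derivative_twisted_wronskian[OF sol L V(1)]
 have Wh: "twisted_wronskian L Y1 Y2 holomorphic_on V" unfolding holomorphic_on_open[OF V(1)] using W' by blast
 obtain r where r: "r > 0" "ball z0 r \<subseteq> V" using V(1) z0(1) open_contains_ball by blast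
 obtain g where g: "!!z. z \<in> ball z0 r ==> (g has_field_derivative L z) (at z)"
  using holomorphic_convex_primitive'[OF convex_ball open_ball holomorphic_on_subset[OF L r(2)]]
  by (metis at_within_open open_ball)
 have "((%z. twisted_wronskian L Y1 Y2 z * exp (- 2 * g z)) has_field_derivative 0) (at z)" if z: "z \<in> ball z0 r" for z
 proof -
  have "((%z. exp (- 2 * g z)) has_field_derivative exp (- 2 * g z) * (- 2 * L z)) (at z)"
   by (rule DERIV_chain2[where f = exp and g = "%z. - 2 * g z", OF DERIV_exp DERIV_cmult[OF g[OF z]]])
  from DERIV_mult[OF W' this] show ?thesis using z r(2) by (auto elim!: DERIV_cong)
 qed
 then have "(%z. twisted_wronskian L Y1 Y2 z * exp (- 2 * g z)) constant_on ball z0 r"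
  by (intro has_field_derivative_0_imp_constant_on) auto
 then obtain k where k: "!!z. z \<in> ball z0 r ==> twisted_wronskian L Y1 Y2 z * exp (- 2 * g z) = k"
  unfolding constant_on_def by blast
 have "k = 0" using k[of z0] r(1) z0(2) by simp
 then have W0: "twisted_wronskian L Y1 Y2 z = 0" if "z \<in> ball z0 r" for z using k[OF that] by simp
 have W: "twisted_wronskian L Y1 Y2 z = 0" if "z \<in> V" for z
  by (rule analytic_continuation_open[of "ball z0 r" V "twisted_wronskian L Y1 Y2" "%_. 0" z])
    (use r V Wh W0 that in auto)
 show thesis
 proof (cases "\<forall>z\<in>V. Y2 z = 0")
  case True
  then show ?thesis using that[of 0 1] by simp
 next
  case False
  then obtain z1 where z1: "z1 \<in> V" "Y2 z1 ~= 0" by blast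
  have "open (V \<inter> Y2 -` (- {0}))"
   by (rule continuous_open_preimage[OF holomorphic_on_imp_continuous_on[OF hol(2)] V(1)]) auto
  moreover have "z1 \<in> V \<inter> Y2 -` (- {0})" using z1 by simp
  ultimately obtain s where s: "s > 0" "ball z1 s \<subseteq> V \<inter> Y2 -` (- {0})" using open_contains_ball by blast
  have "((%z. Y1 z / Y2 z) has_field_derivative 0) (at z)" if "z \<in> ball z1 s" for z
  proof -
   have z: "z \<in> V" "Y2 z ~= 0" using that s(2) by auto
   note d = twisted_solutionD[OF sol(1) L V(1) z(1)] twisted_solutionD[OF sol(2) L V(1) z(1)]
   show ?thesis
    by (rule DERIV_cong[OF DERIV_divide[OF d(1,3) z(2)]])
      (use W[OF z(1)] in \<open>simp add: twisted_wronskian_def algebra_simps\<close>)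
  qed
  then have "(%z. Y1 z / Y2 z) constant_on ball z1 s" by (intro has_field_derivative_0_imp_constant_on) auto
  then obtain c where c: "!!z. z \<in> ball z1 s ==> Y1 z / Y2 z = c" unfolding constant_on_def by blast
  have c': "1 * Y1 z + (- c) * Y2 z = 0" if "z \<in> ball z1 s" for z
  proof -
   have "Y2 z ~= 0" using that s(2) by blast
   then show ?thesis using c[OF that] by (simp add: field_simps)
  qed
  have "1 * Y1 z + (- c) * Y2 z = 0" if "z \<in> V" for z
   by (rule analytic_continuation_open[of "ball z1 s" V "%z. 1 * Y1 z + (- c) * Y2 z" "%_. 0" z])
     (use s V hol c' that in \<open>auto intro!: holomorphic_intros\<close>)
  then show ?thesis using that[of 1 "- c"] by simp
 qed
qed

abbreviation r2 :: complex where "r2 \<equiv> complex_of_real (sqrt 2)"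

lemma r2_props: "r2 * r2 = 2" "r2 ~= 0"
 using sqrt2_square by auto

lemma r2_rho2: "(r2 * rho2) ^ 2 = \<i>"
 using rho2_props(2) by (simp add: power_mult_distrib power2_eq_square r2_props mult_ac)

lemma jacobi2_square: "odd l ==> jacobi2 l * jacobi2 l = 1"
proof -
 assume "odd l"
 then have "l mod 8 \<in> {1, 3, 5, 7}" by (simp; presburger)
 then show ?thesis by (auto simp: jacobi2_def)
qed

text \<open>\<open>\<surd>2 \<rho>\<^sub>2\<close> is the primitive eighth root of unity \<open>exp (\<pi> i / 4)\<close>, so this is the classical evaluation
  of \<open>2 cos (\<pi> l / 4)\<close>.\<close>

lemma jacobi2_eighth_root:
 assumes "odd l" shows "(r2 * rho2) powi l + (r2 * rho2) powi (- l) = jacobi2 l * r2"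
proof -
 define x where "x = r2 * rho2"
 have x2: "x ^ 2 = \<i>" unfolding x_def by (rule r2_rho2)
 have x0: "x ~= 0" using x2 by auto
 have x8: "x ^ 8 = 1"
 proof -
  have "x ^ 8 = (x ^ 2) ^ 4" by (simp flip: power_mult)
  then show ?thesis by (simp add: x2)
 qed
 have red: "x powi k = x ^ nat (k mod 8)" for k
 proof -
  have "x powi k = x powi (8 * (k div 8) + k mod 8)" by simp
  also have "\<dots> = (x powi 8) powi (k div 8) * x powi (k mod 8)" 
  proof -
   have "x powi (8 * (k div 8) + k mod 8) = x powi (8 * (k div 8)) * x powi (k mod 8)"
    by (rule power_int_add) (use x0 in auto)
   then show ?thesis by (simp only: power_int_mult)
  qed
  also have "x powi 8 = 1" using x8 by simp
  finally show ?thesis by (simp add: power_int_def)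
 qed
 have e: "x * (1 - \<i>) = r2" "x * (\<i> - 1) = - r2"
  by (simp_all add: x_def rho2_def complex_eq_iff)
 have "l mod 8 = 1 \<and> - l mod 8 = 7 \<or> l mod 8 = 3 \<and> - l mod 8 = 5 \<or> l mod 8 = 5 \<and> - l mod 8 = 3 \<or> l mod 8 = 7 \<and> - l mod 8 = 1"
  using assms by presburger
 moreover have "x ^ 7 = - (x * \<i>)" "x ^ 3 = x * \<i>" "x ^ 5 = - x"
 proof -
  have "x ^ 3 = x * x ^ 2" "x ^ 5 = x * (x ^ 2) ^ 2" "x ^ 7 = x * (x ^ 2) ^ 3"
   by (simp_all add: eval_nat_numeral mult_ac)
  then show "x ^ 7 = - (x * \<i>)" "x ^ 3 = x * \<i>" "x ^ 5 = - x" unfolding x2 by (simp_all add: eval_nat_numeral)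
 qed
 ultimately have "x powi l + x powi (- l) = jacobi2 l * r2"
  unfolding red using e by (auto simp: jacobi2_def algebra_simps)
 then show ?thesis by (simp add: x_def)
qed

lemma tendsto_inverse_diff_cnj: "((%z. 1 / (z - cnj z)) \<longlongrightarrow> 0) at_ii_inf"
proof -
 have "filterlim Im at_top at_ii_inf" unfolding at_ii_inf_def by (rule filterlim_filtercomap)
 then have "((%z. inverse (Im z)) \<longlongrightarrow> 0) at_ii_inf" by (rule tendsto_inverse_0_at_top)
 then have "((%z. complex_of_real (inverse (Im z)) * (1 / (2 * \<i>))) \<longlongrightarrow> of_real 0 * (1 / (2 * \<i>))) at_ii_inf"
  by (intro tendsto_intros)
 moreover have "complex_of_real (inverse (Im z)) * (1 / (2 * \<i>)) = 1 / (z - cnj z)" for z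
  unfolding complex_diff_cnj by (cases "Im z = 0") (simp_all add: field_simps)
 ultimately show ?thesis by simp
qed

lemma slash_S: "slash k S_mat f z = (r2 * z) powi (- k) * f (fricke z)"
 by (simp add: slash_def)

lemma modular_formsI:
 assumes "even k" "e * e = 1" "f holomorphic_on uhp" "!!z. Im z > 0 ==> f (z + 1) = f z"
  and "!!z. Im z > 0 ==> slash k S_mat f z = e * f z" "(f \<longlongrightarrow> L) at_ii_inf"
 shows "f \<in> modular_forms k e"
proof -
 have "finite_at_cusps k f" by (rule finite_at_cusps_level2[OF assms(1,2,4,5,6)])
 moreover have "slash k A f z = f z" if "A \<in> Gamma0_2" "Im z > 0" for A z
  by (rule Gamma0_2_invariant[OF assms(1,2,4,5) that])
 ultimately show ?thesis using assms(3,5) by (simp add: modular_forms_def)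
qed

locale hat_solution = modular_ode +
 fixes Yp :: "complex => complex"
 assumes hat: "y_plus_hat Q kinf k1 k2 m zs ks Yp"
begin

definition Y1 :: "complex => complex" where "Y1 = slash ell S_mat Yp"

abbreviation eps :: complex where "eps \<equiv> jacobi2 ell"

lemma eps_square: "eps * eps = 1"
 by (rule jacobi2_square[OF ell_props(1)])

lemma holomorphic_Yp: "Yp holomorphic_on uhp"
 using hat by (simp add: y_plus_hat_def)

lemma holomorphic_Y1: "Y1 holomorphic_on uhp"
proof -
 have "fricke holomorphic_on uhp"
  unfolding holomorphic_on_open[OF open_half_plane]
 proof
  fix z assume "z \<in> uhp"
  then have "z ~= 0" by auto
  then show "\<exists>f'. (fricke has_field_derivative f') (at z)" using has_field_derivative_fricke by blast
 qed
 then have "(Yp \<circ> fricke) holomorphic_on uhp"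
  by (rule holomorphic_on_compose_gen[OF _ holomorphic_Yp]) auto
 then have "(%z. Yp (fricke z)) holomorphic_on uhp" by (simp add: o_def)
 then show ?thesis
  unfolding Y1_def slash_S[abs_def] by (intro holomorphic_intros) auto
qed

lemma Yp_fricke: assumes "Im z > 0" shows "Yp (fricke z) = (r2 * z) powi ell * Y1 z"
proof -
 have "z ~= 0" using assms by auto
 then show ?thesis by (simp add: Y1_def slash_S power_int_minus r2_props)
qed

text \<open>The square of \<open>S\<close> is \<open>-1\<close>, which acts by a sign in odd weight.\<close>

lemma Y1_fricke: assumes "Im z > 0" shows "Y1 (fricke z) = - ((r2 * z) powi ell) * Yp z"
proof -
 have z: "z ~= 0" using assms by auto
 have "r2 * fricke z = inverse (- (r2 * z))" using z r2_props by (simp add: fricke_def field_simps)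
 then have "(r2 * fricke z) powi (- ell) = (- (r2 * z)) powi ell"
  by (simp only: power_int_minus power_int_inverse inverse_inverse_eq)
 also have "\<dots> = - ((r2 * z) powi ell)" using ell_props(1) by (simp add: power_int_minus_left_odd)
 finally show ?thesis by (simp add: Y1_def slash_S)
qed

lemmas cusp_data = y_plus_hat_at_cusp[OF hat]

lemma Yp_nonzero: obtains C where "C >= 0" "!!z. Im z > C ==> Yp z ~= 0"
proof (rule cusp_data)
 fix C :: real and n :: nat and A
 assume C: "C >= 0" "!!w. w \<in> nome_disc C ==> A w ~= 0" "!!z. Im z > C ==> Yp z = qq z ^ n * A (qq z)"
 have "Yp z ~= 0" if "Im z > C" for z using C(2)[OF qq_in_nome_disc[OF that]] C(3)[OF that] by simp
 then show thesis using that C(1) by blast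
qed

lemma Yp_translation: assumes "Im z > 0" shows "Yp (z + 1) = Yp z"
proof (rule cusp_data)
 fix C :: real and n :: nat and A
 assume C: "C >= 0" "!!z. Im z > C ==> Yp z = qq z ^ n * A (qq z)"
 have "(Yp \<circ> (%z. z + 1)) holomorphic_on uhp"
  by (rule holomorphic_on_compose_gen[OF _ holomorphic_Yp]) (auto intro!: holomorphic_intros)
 then have "(%z. Yp (z + 1)) holomorphic_on uhp" by (simp add: o_def)
 then show "Yp (z + 1) = Yp z"
  by (rule half_plane_identity[OF _ holomorphic_Yp C(1)]) (use C(2) assms in auto)
qed

lemma Yp_twisted: "twisted_solution Q lam (uhp - Z) Yp"
proof (rule cusp_data)
 fix C :: real
 assume "C >= 0" "half_plane C \<inter> Z = {}" "twisted_solution Q lam (half_plane C) Yp"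
 then show ?thesis using twisted_identity[of 0 C Yp] holomorphic_Yp by simp
qed

lemma Y1_twisted: "twisted_solution Q lam (uhp - Z) Y1"
 unfolding Y1_def by (rule twisted_slash[OF Yp_twisted])

text \<open>If \<open>Y1\<close> were \<open>\<mu> Yp\<close>, then \<open>\<mu>\<^sup>2 = -1\<close>. The leading coefficient of \<open>Yp\<close> at the fixed point \<open>\<rho>\<^sub>2 - 1\<close> of
  \<open>z \<mapsto> -1/(2 (z + 1))\<close>, whose multiplier is \<open>- i\<close>, gives \<open>(- i)\<^sup>d = \<mu> exp (\<pi> i l / 4)\<close>. The fourth powers
  of the two sides differ in sign.\<close>

lemma Y1_not_multiple: "\<not> (\<forall>z\<in>uhp. Y1 z = \<mu> * Yp z)"
proof
 assume hyp: "\<forall>z\<in>uhp. Y1 z = \<mu> * Yp z"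
 obtain C where C: "C >= 0" "!!z. Im z > C ==> Yp z ~= 0" using Yp_nonzero by blast
 (* a point where Yp does not vanish *)
 define v where "v = \<i> * of_real (C + 1)"
 have v: "Im v > 0" "Yp v ~= 0" "v ~= 0" using C by (auto simp: v_def complex_eq_iff)
 have "- ((r2 * v) powi ell) * Yp v = \<mu> * ((r2 * v) powi ell * (\<mu> * Yp v))"
  using hyp v(1) Y1_fricke[OF v(1)] Yp_fricke[OF v(1)] by simp
 moreover define K where "K = (r2 * v) powi ell * Yp v"
 ultimately have K: "- K = \<mu> * (\<mu> * K)" by (simp add: mult_ac)
 have "(\<mu> ^ 2 + 1) * K = \<mu> * (\<mu> * K) + K" by (simp add: algebra_simps power2_eq_square)
 also have "\<dots> = 0" unfolding K[symmetric] by simp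
 finally have "\<mu> ^ 2 + 1 = 0" using v r2_props by (simp add: K_def)
 then have mu: "\<mu> ^ 2 = - 1" by (simp only: eq_neg_iff_add_eq_0)
 define z0 where "z0 = rho2 - 1"
 define g where "g z = fricke (z + 1)" for z
 have z0: "Im z0 > 0" "z0 + 1 = rho2" using rho2_props by (auto simp: z0_def)
 have gz0: "g z0 = z0" using rho2_props(3) by (simp add: g_def z0(2)) (simp add: z0_def)
 have func: "Yp (g z) = \<mu> * (r2 * (z + 1)) powi ell * Yp z" if "Im z > 0" for z
  using Yp_fricke[of "z + 1"] Yp_translation[OF that] hyp that by (simp add: g_def)
 have "\<exists>w\<in>uhp. Yp w ~= 0" using v by auto
 moreover have "z0 \<in> uhp" using z0(1) by simp
 ultimately obtain r where r: "r > 0" "cball z0 r \<subseteq> uhp" "zor_poly Yp z0 holomorphic_on cball z0 r"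
  "\<forall>w\<in>cball z0 r. Yp w = zor_poly Yp z0 w * (w - z0) ^ nat (zorder Yp z0) \<and> zor_poly Yp z0 w ~= 0"
  using zorder_exist_zero[OF holomorphic_Yp open_half_plane connected_half_plane] by blast
 define h where "h = zor_poly Yp z0"
 define d where "d = nat (zorder Yp z0)"
 have h: "!!w. w \<in> cball z0 r ==> Yp w = h w * (w - z0) ^ d" "h z0 ~= 0"
  using r(1,4) by (auto simp: h_def d_def)
 have hc: "isCont h z0"
  using holomorphic_on_imp_continuous_on[OF holomorphic_on_subset[OF r(3) ball_subset_cball]] r(1)
  by (simp add: continuous_on_eq_continuous_at h_def)
 have g': "(g has_field_derivative - \<i>) (at z0)"
 proof -
  have "(fricke has_field_derivative 1 / (2 * rho2 ^ 2)) (at (z0 + 1))"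
   using has_field_derivative_fricke[OF rho2_props(4)] by (simp add: z0(2))
  then have "((%z. fricke (z + 1)) has_field_derivative 1 / (2 * rho2 ^ 2)) (at z0)" by (simp add: DERIV_shift)
  then show ?thesis unfolding g_def[abs_def] rho2_props(2) by (rule DERIV_cong) (simp add: divide_simps)
 qed
 have gc: "isCont g z0" using g' DERIV_isCont by blast
 have quot: "((%z. (g z - z0) / (z - z0)) \<longlongrightarrow> - \<i>) (at z0)"
  using g' unfolding has_field_derivative_iff gz0 .
 have gl: "(g \<longlongrightarrow> z0) (at z0)" using gc by (simp add: isCont_def gz0)
 have "((%z. h (g z) * ((g z - z0) / (z - z0)) ^ d) \<longlongrightarrow> h z0 * (- \<i>) ^ d) (at z0)"
  by (intro tendsto_mult tendsto_power quot isCont_tendsto_compose[OF hc gl])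
 moreover have "eventually (%z. h (g z) * ((g z - z0) / (z - z0)) ^ d = \<mu> * (r2 * (z + 1)) powi ell * h z) (at z0)"
 proof -
  have "eventually (%z. g z \<in> ball z0 r) (at z0)" using topological_tendstoD[OF gl open_ball] r(1) by simp
  moreover have "eventually (%z. z \<in> ball z0 r - {z0}) (at z0)" using eventually_at_in_open[of "ball z0 r" z0] r(1) by simp
  ultimately show ?thesis
  proof eventually_elim
   case (elim z)
   then have "h (g z) * (g z - z0) ^ d = \<mu> * (r2 * (z + 1)) powi ell * (h z * (z - z0) ^ d)"
    using func[of z] h(1)[of z] h(1)[of "g z"] r(2) by (force simp: subset_iff)
   then show ?case using elim by (simp add: power_divide field_simps)
  qed
 qed
 ultimately have l1: "((%z. \<mu> * (r2 * (z + 1)) powi ell * h z) \<longlongrightarrow> h z0 * (- \<i>) ^ d) (at z0)"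
  by (rule Lim_transform_eventually)
 have "((%z. \<mu> * (r2 * (z + 1)) powi ell * h z) \<longlongrightarrow> \<mu> * (r2 * (z0 + 1)) powi ell * h z0) (at z0)"
  using hc r2_props rho2_props(4) by (intro tendsto_intros) (auto simp: isCont_def z0(2))
 with l1 have "h z0 * (- \<i>) ^ d = \<mu> * (r2 * (z0 + 1)) powi ell * h z0" by (rule LIM_unique)
 then have e: "(- \<i>) ^ d = \<mu> * (r2 * rho2) powi ell" using h(2) by (simp add: z0(2))
 have "((- \<i>) ^ d) ^ 4 = ((- \<i>) ^ 4) ^ d" by (simp flip: power_mult add: mult.commute)
 also have "\<dots> = 1" by simp
 finally have one: "((- \<i>) ^ d) ^ 4 = 1" .
 define x where "x = r2 * rho2"
 have x4: "x powi 4 = - 1"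
 proof -
  have "x powi 4 = (x ^ 2) ^ 2" by (simp flip: power_mult)
  then show ?thesis unfolding x_def r2_rho2 by simp
 qed
 have "(x powi ell) ^ 4 = (x powi ell) powi 4" by simp
 also have "\<dots> = x powi (ell * 4)" by (rule power_int_mult[symmetric])
 also have "\<dots> = x powi (4 * ell)" by (simp add: mult.commute)
 also have "\<dots> = (x powi 4) powi ell" by (rule power_int_mult)
 also have "\<dots> = - 1" unfolding x4 using ell_props(1) by (simp add: power_int_minus_left_odd)
 finally have x: "(x powi ell) ^ 4 = - 1" .
 have "(\<mu> * x powi ell) ^ 4 = (\<mu> ^ 2) ^ 2 * (x powi ell) ^ 4"
  unfolding power_mult_distrib by (simp flip: power_mult)
 also have "\<dots> = - 1" unfolding x mu by simp
 finally show False using one unfolding e x_def by simp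
qed

lemma independent:
 assumes U: "open U" "U ~= {}" "U \<subseteq> uhp" and ab: "!!z. z \<in> U ==> a * Yp z + b * Y1 z = 0"
 shows "a = 0" "b = 0"
proof -
 have ab': "a * Yp z + b * Y1 z = 0" if "z \<in> uhp" for z
  by (rule analytic_continuation_open[of U uhp "%z. a * Yp z + b * Y1 z" "%_. 0" z])
    (use U ab that in \<open>auto intro!: holomorphic_intros holomorphic_Yp holomorphic_Y1 open_half_plane\<close>)
 show b: "b = 0"
 proof (rule ccontr)
  assume "b ~= 0"
  then have "\<forall>z\<in>uhp. Y1 z = - a / b * Yp z" using ab' by (auto simp: field_simps add_eq_0_iff)
  then show False using Y1_not_multiple by blast
 qed
 obtain C where "C >= 0" "!!z. Im z > C ==> Yp z ~= 0" using Yp_nonzero by blast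
 then show "a = 0" using ab'[of "\<i> * of_real (C + 1)"] b by auto
qed

lemma wronskian_nonzero:
 assumes U: "open U" "connected U" "U \<subseteq> uhp - Z" and z: "z \<in> U"
 shows "twisted_wronskian lam Y1 Yp z ~= 0"
proof
 assume W: "twisted_wronskian lam Y1 Yp z = 0"
 obtain a b where ab: "a ~= 0 \<or> b ~= 0" "!!z. z \<in> U ==> a * Y1 z + b * Yp z = 0"
  by (rule dependent_if_wronskian_zero[OF twisted_solution_subset[OF Y1_twisted U(3)] twisted_solution_subset[OF Yp_twisted U(3)]
     holomorphic_on_subset[OF holomorphic_lam U(3)] U(1,2) z W]) (rule that, assumption, blast)
 have "b = 0" "a = 0"
  by (rule independent[where U = U and a = b and b = a]; use U z ab(2) in \<open>force simp: add.commute\<close>)+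
 then show False using ab(1) by simp
qed

text \<open>Being independent, \<open>Yp\<close> and \<open>Y1\<close> span the local solutions at \<open>p\<close>,
  among which there is one that does not vanish at \<open>p\<close>.\<close>

lemma no_common_zero:
 assumes p: "Im p > 0" shows "\<not> (Yp p = 0 \<and> Y1 p = 0)"
proof
 assume zero: "Yp p = 0 \<and> Y1 p = 0"
 obtain s u1 u2 where s: "s > 0" "ball p s \<subseteq> uhp" "ball p s - {p} \<subseteq> uhp - Z"
  "u1 holomorphic_on ball p s" "u2 holomorphic_on ball p s" "u1 p ~= 0"
  "twisted_solution Q lam (ball p s - {p}) u1" "twisted_solution Q lam (ball p s - {p}) u2"
  "!!z. z \<in> ball p s - {p} ==> twisted_wronskian lam u1 u2 z ~= 0"
  using local_basis[OF p] by metis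
 have V: "open (ball p s - {p})" "connected (ball p s - {p})" "ball p s - {p} ~= {}"
 proof -
  show "open (ball p s - {p})" by auto
  show "connected (ball p s - {p})" by (rule connected_punctured_ball) simp
  have "p + of_real (s / 2) \<in> ball p s - {p}" using s(1) by (simp add: dist_norm del: of_real_divide)
  then show "ball p s - {p} ~= {}" by blast
 qed
 have Vu: "ball p s - {p} \<subseteq> uhp" using s(2) by blast
 note span = twisted_solution_span[OF s(7,8) _ holomorphic_on_subset[OF holomorphic_lam s(3)] V(1,2) s(9)]
 obtain a b where ab: "!!z. z \<in> ball p s - {p} ==> Yp z = a * u1 z + b * u2 z"
  by (rule span[OF twisted_solution_subset[OF Yp_twisted s(3)]]) (auto intro: that)
 obtain a' b' where ab': "!!z. z \<in> ball p s - {p} ==> Y1 z = a' * u1 z + b' * u2 z"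
  by (rule span[OF twisted_solution_subset[OF Y1_twisted s(3)]]) (auto intro: that)
 define D where "D = a * b' - a' * b"
 have off: "b' * Yp z - b * Y1 z = D * u1 z" if "z \<in> ball p s - {p}" for z
  using ab[OF that] ab'[OF that] by (simp add: D_def algebra_simps)
 have "b' * Yp p - b * Y1 p = D * u1 p"
 proof (rule analytic_continuation_open[of "ball p s - {p}" "ball p s" "%z. b' * Yp z - b * Y1 z" "%z. D * u1 z" p])
  show "(%z. b' * Yp z - b * Y1 z) holomorphic_on ball p s"
   by (intro holomorphic_intros holomorphic_on_subset[OF holomorphic_Yp s(2)] holomorphic_on_subset[OF holomorphic_Y1 s(2)])
  show "(%z. D * u1 z) holomorphic_on ball p s" by (intro holomorphic_intros s(4))
 qed (use V s(1) off in auto)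
 then have D: "D = 0" using zero s(6) by simp
 have "- b = 0" "b' = 0"
  by (rule independent[OF V(1,3) Vu, of b' "- b"]; use off D in force)+
 moreover have "a' * Yp z + (- a) * Y1 z = 0" if "z \<in> ball p s - {p}" for z
  using ab[OF that] ab'[OF that] calculation by simp
 then have "- a = 0" by (rule independent(2)[OF V(1,3) Vu])
 ultimately have "1 * Yp z + 0 * Y1 z = 0" if "z \<in> ball p s - {p}" for z using ab[OF that] by simp
 then have "(1 :: complex) = 0" by (rule independent(1)[OF V(1,3) Vu])
 then show False by simp
qed

text \<open>Translation adds a multiple of \<open>Yp\<close> to \<open>Y1\<close>. The relation of order four at \<open>\<rho>\<^sub>2\<close> determines the
  multiple; as it is not zero, the logarithm occurs at the cusp.\<close>

theorem monodromy:
 "!!z. Im z > 0 ==> Y1 (z + 1) = Y1 z + eps * r2 * Yp z"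
 "\<not> cusp_apparent Q"
 "\<exists>L. (Yp \<longlongrightarrow> L) at_ii_inf"
 "\<exists>L. ((%z. Y1 z - eps * r2 * z * Yp z) \<longlongrightarrow> L) at_ii_inf"
proof -
 obtain C n A B Y2 c where C: "C >= 0" "half_plane C \<inter> Z = {}" and AB: "A holomorphic_on nome_disc C" "B holomorphic_on nome_disc C"
  and Ypc: "!!z. Im z > C ==> Yp z = qq z ^ n * A (qq z)" and Y2c: "!!z. Im z > C ==> Y2 z = B (qq z) + c * z * Yp z"
  and sol: "twisted_solution Q lam (half_plane C) Yp" "twisted_solution Q lam (half_plane C) Y2"
  and ind: "!!a b. (!!z. Im z > C ==> a * Yp z + b * Y2 z = 0) ==> a = 0 \<and> b = 0"
  and app: "c ~= 0 ==> \<not> cusp_apparent Q"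
  using cusp_data by metis
 have sub: "half_plane C \<subseteq> uhp - Z"
 proof
  fix z assume z: "z \<in> half_plane C"
  then have "z \<notin> Z" using C(2) by blast
  then show "z \<in> uhp - Z" using z C(1) by simp
 qed
 have lamC: "lam holomorphic_on half_plane C" by (rule holomorphic_on_subset[OF holomorphic_lam sub])
 have W: "twisted_wronskian lam Yp Y2 z ~= 0" if z: "z \<in> half_plane C" for z
 proof
  assume W0: "twisted_wronskian lam Yp Y2 z = 0"
  obtain a b where ab: "a ~= 0 \<or> b ~= 0" "!!z. z \<in> half_plane C ==> a * Yp z + b * Y2 z = 0"
   by (rule dependent_if_wronskian_zero[OF sol lamC open_half_plane connected_half_plane z W0]) (rule that, assumption, blast)
  have "a = 0 \<and> b = 0" by (rule ind) (use ab(2) in simp)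
  then show False using ab(1) by blast
 qed
 obtain \<alpha> \<beta> where Y1c: "!!z. z \<in> half_plane C ==> Y1 z = \<alpha> * Yp z + \<beta> * Y2 z"
  by (rule twisted_solution_span[OF sol twisted_solution_subset[OF Y1_twisted sub] lamC open_half_plane connected_half_plane W])
    (auto intro: that)
 define b where "b = \<beta> * c"
 have step: "Y1 (z + 1) = Y1 z + b * Yp z" if z: "Im z > 0" for z
 proof -
  have "(Y1 \<circ> (%z. z + 1)) holomorphic_on uhp"
   by (rule holomorphic_on_compose_gen[OF _ holomorphic_Y1]) (auto intro!: holomorphic_intros)
  then have h1: "(%z. Y1 (z + 1)) holomorphic_on uhp" by (simp add: o_def)
  have h2: "(%z. Y1 z + b * Yp z) holomorphic_on uhp" by (intro holomorphic_intros holomorphic_Yp holomorphic_Y1)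
  show ?thesis
  proof (rule half_plane_identity[OF h1 h2 C(1) _ z])
   fix w assume w: "Im w > C"
   have w0: "Im w > 0" using w C(1) by simp
   have "Y1 (w + 1) - Y1 w = \<alpha> * (Yp (w + 1) - Yp w) + \<beta> * (Y2 (w + 1) - Y2 w)"
    using Y1c[of w] Y1c[of "w + 1"] w by (simp add: algebra_simps)
   also have "\<dots> = b * Yp w" using Y2c[of w] Y2c[of "w + 1", unfolded qq_plus_1] w Yp_translation[OF w0] by (simp add: b_def algebra_simps)
   finally show "Y1 (w + 1) = Y1 w + b * Yp w" by (simp add: algebra_simps)
  qed
 qed
 have b: "b = eps * r2"
 proof -
  define z0 where "z0 = rho2 - 1"
  define x where "x = r2 * rho2"
  have z0: "Im z0 > 0" "z0 + 1 = rho2" "fricke rho2 = z0" using rho2_props by (auto simp: z0_def)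
  have P: "Yp rho2 = Yp z0" using Yp_translation[OF z0(1)] z0(2) by simp
  have "Y1 rho2 = x powi (- ell) * Yp z0" by (simp add: Y1_def slash_S z0(3) x_def)
  moreover have "Y1 rho2 = Y1 z0 + b * Yp z0" using step[OF z0(1)] z0(2) by simp
  moreover have R: "Y1 z0 = - (x powi ell) * Yp z0" using Y1_fricke[OF rho2_props(1)] z0(3) P by (simp add: x_def)
  ultimately have "(b - (x powi ell + x powi (- ell))) * Yp z0 = 0" by (simp add: algebra_simps)
  moreover have "Yp z0 ~= 0" using no_common_zero[OF z0(1)] R by auto
  ultimately have "b = x powi ell + x powi (- ell)" by simp
  then show ?thesis using jacobi2_eighth_root[OF ell_props(1)] by (simp add: x_def)
 qed
 show "!!z. Im z > 0 ==> Y1 (z + 1) = Y1 z + eps * r2 * Yp z" using step b by simp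
 have "b ~= 0" using b eps_square r2_props by auto
 then have "c ~= 0" by (auto simp: b_def)
 then show "\<not> cusp_apparent Q" by (rule app)
 have cont: "isCont A 0" "isCont B 0"
  using AB holomorphic_on_imp_continuous_on by (force simp: continuous_on_eq_continuous_at)+
 have "((%z. (%w. w ^ n * A w) (qq z)) \<longlongrightarrow> (%w. w ^ n * A w) 0) at_ii_inf"
  by (rule tendsto_compose_qq) (intro continuous_intros cont)
 then have "(Yp \<longlongrightarrow> (%w. w ^ n * A w) 0) at_ii_inf"
  by (rule Lim_transform_eventually) (use eventually_Im_gt_at_ii_inf[of C] Ypc in \<open>auto elim!: eventually_mono\<close>)
 then show "\<exists>L. (Yp \<longlongrightarrow> L) at_ii_inf" by blast
 have "((%z. (%w. \<alpha> * (w ^ n * A w) + \<beta> * B w) (qq z)) \<longlongrightarrow> (%w. \<alpha> * (w ^ n * A w) + \<beta> * B w) 0) at_ii_inf"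
  by (rule tendsto_compose_qq) (intro continuous_intros cont)
 then have "((%z. Y1 z - eps * r2 * z * Yp z) \<longlongrightarrow> (%w. \<alpha> * (w ^ n * A w) + \<beta> * B w) 0) at_ii_inf"
 proof (rule Lim_transform_eventually)
  show "\<forall>\<^sub>F z in at_ii_inf. (%w. \<alpha> * (w ^ n * A w) + \<beta> * B w) (qq z) = Y1 z - eps * r2 * z * Yp z"
   using eventually_Im_gt_at_ii_inf[of C]
  proof eventually_elim
   case (elim z)
   have "Y1 z - b * z * Yp z = \<alpha> * Yp z + \<beta> * B (qq z)"
    using Y1c[of z] elim Y2c[OF elim] by (simp add: b_def algebra_simps)
   then show ?case unfolding b[symmetric] using Ypc[OF elim] by simp
  qed
 qed
 then show "\<exists>L. ((%z. Y1 z - eps * r2 * z * Yp z) \<longlongrightarrow> L) at_ii_inf" by blast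
qed

end

section \<open>Modular forms from the connection\<close>

context hat_solution
begin

lemma powi_ell:
 fixes x y :: complex
 assumes "x ~= 0"
 shows "x powi (- (ell + 1)) * (x powi ell * y) = y / x" "x powi (- (ell - 1)) * (x powi ell * y) = x * y"
proof -
 have "x powi (- (ell + 1)) * x powi ell = x powi (- (ell + 1) + ell)"
  by (rule power_int_add[symmetric]) (use assms in simp)
 moreover have "x powi (- (ell - 1)) * x powi ell = x powi (- (ell - 1) + ell)"
  by (rule power_int_add[symmetric]) (use assms in simp)
 ultimately have "x powi (- (ell + 1)) * x powi ell = inverse x" "x powi (- (ell - 1)) * x powi ell = x" by simp_all
 then show "x powi (- (ell + 1)) * (x powi ell * y) = y / x" "x powi (- (ell - 1)) * (x powi ell * y) = x * y"
  unfolding mult.assoc[symmetric] by (simp_all add: divide_inverse)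
qed

definition m1 :: "complex => complex" where "m1 z = Y1 z - eps * r2 * z * Yp z"

text \<open>The constant is fixed by the anomaly \<open>8 z/(\<pi> i)\<close> of \<open>M2_star\<close>, see
  \<open>m2_modular\<close>.\<close>

definition m2 :: "complex => complex" where
 "m2 z = Yp z - eps * (of_real pi * \<i> / (4 * r2)) * m1 z * M2_star z"

lemma holomorphic_m: "m1 holomorphic_on uhp" "m2 holomorphic_on uhp"
 unfolding m1_def[abs_def] m2_def[abs_def]
 by (intro holomorphic_intros holomorphic_Yp holomorphic_Y1 holomorphic_level2; simp add: r2_props)+

lemma m1_translation:
 assumes z: "Im z > 0" shows "m1 (z + 1) = m1 z"
 unfolding m1_def monodromy(1)[OF z] Yp_translation[OF z] by (simp add: algebra_simps)

lemma m1_fricke: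
 assumes z: "Im z > 0" shows "m1 (fricke z) = (r2 * z) powi ell * (eps * m1 z / (r2 * z))"
proof -
 have z0: "z ~= 0" using z by auto
 define x where "x = r2 * z"
 have x0: "x ~= 0" using z0 r2_props by (simp add: x_def)
 have f: "r2 * fricke z = - 1 / x" using z0 r2_props by (simp add: x_def fricke_def field_simps)
 have "m1 (fricke z) = - (x powi ell) * Yp z - eps * (r2 * fricke z) * (x powi ell * Y1 z)"
  unfolding m1_def Y1_fricke[OF z] Yp_fricke[OF z] x_def[symmetric] by (simp add: mult_ac)
 also have "\<dots> = x powi ell * ((eps * Y1 z - 1 * x * Yp z) / x)"
  unfolding f using x0 by (simp add: field_simps)
 also have "eps * Y1 z - 1 * x * Yp z = eps * m1 z"
  unfolding m1_def eps_square[symmetric] by (simp add: x_def algebra_simps)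
 finally show ?thesis by (simp add: x_def)
qed

lemma Yp_fricke_m1:
 assumes z: "Im z > 0" shows "Yp (fricke z) = (r2 * z) powi ell * (eps * (r2 * z) * Yp z + m1 z)"
 using Yp_fricke[OF z] by (simp add: m1_def algebra_simps)

lemma m1_modular: "m1 \<in> modular_forms (ell - 1) eps"
proof -
 obtain L where L: "(m1 \<longlongrightarrow> L) at_ii_inf" using monodromy(4) unfolding m1_def[abs_def] by blast
 show ?thesis
 proof (rule modular_formsI[OF _ eps_square holomorphic_m(1) m1_translation _ L])
  show "even (ell - 1)" using ell_props(1) by simp
  fix z assume z: "Im z > 0"
  then have nz: "r2 * z ~= 0" using r2_props by auto
  show "slash (ell - 1) S_mat m1 z = eps * m1 z"
   unfolding slash_S m1_fricke[OF z] powi_ell(2)[OF nz] using nz by simp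
 qed
qed

lemma M2_star_limit: "(M2_star \<longlongrightarrow> M2_star_nome 0) at_ii_inf"
proof (rule Lim_transform_eventually)
 show "((%z. M2_star_nome (qq z)) \<longlongrightarrow> M2_star_nome 0) at_ii_inf"
  by (rule tendsto_compose_qq[OF holomorphic_unit_disc_isCont[OF holomorphic_nome(5)]])
 show "\<forall>\<^sub>F z in at_ii_inf. M2_star_nome (qq z) = M2_star z"
  using eventually_Im_gt_at_ii_inf[of 0] by eventually_elim (simp add: M2_star_eq)
qed

text \<open>The anomaly of \<open>M2_star\<close> under the Fricke involution cancels the term \<open>m1\<close> in the transformation
  of \<open>Yp\<close>; this is where the factor \<open>\<pi> i / (4 \<surd>2)\<close> comes from.\<close>

lemma m2_modular: "m2 \<in> modular_forms (ell + 1) eps"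
proof -
 obtain L1 where L1: "(m1 \<longlongrightarrow> L1) at_ii_inf" using monodromy(4) unfolding m1_def[abs_def] by blast
 obtain L where L: "(Yp \<longlongrightarrow> L) at_ii_inf" using monodromy(3) by blast
 have lim: "(m2 \<longlongrightarrow> L - eps * (of_real pi * \<i> / (4 * r2)) * L1 * M2_star_nome 0) at_ii_inf"
  unfolding m2_def[abs_def] by (intro tendsto_intros L L1 M2_star_limit)
 show ?thesis
 proof (rule modular_formsI[OF _ eps_square holomorphic_m(2) _ _ lim])
  show "even (ell + 1)" using ell_props(1) by simp
  show "m2 (z + 1) = m2 z" if "Im z > 0" for z
   using m1_translation[OF that] Yp_translation[OF that] by (simp add: m2_def level2_translation)
  fix z assume z: "Im z > 0"
  define x where "x = r2 * z"
  define k where "k = of_real pi * \<i> / (4 * r2)"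
  have z0: "z ~= 0" using z by auto
  have x: "x ~= 0" "x * x = 2 * z ^ 2" using z0 r2_props by (auto simp: x_def power2_eq_square mult_ac)
  have k: "k * (8 * z / (of_real pi * \<i>)) / (x * x) = 1 / x"
   unfolding x(2) using z0 r2_props by (simp add: k_def x_def field_simps power2_eq_square)
  have "m2 (fricke z) = x powi ell * (eps * x * Yp z + m1 z - (eps * eps) * k * (m1 z / x) * (2 * z ^ 2 * M2_star z + 8 * z / (of_real pi * \<i>)))"
   unfolding m2_def Yp_fricke_m1[OF z] m1_fricke[OF z] M2_star_fricke[OF z] x_def[symmetric] k_def[symmetric]
   by (simp add: algebra_simps)
  then have "slash (ell + 1) S_mat m2 z =
    (eps * x * Yp z + m1 z - (eps * eps) * k * (m1 z / x) * (2 * z ^ 2 * M2_star z + 8 * z / (of_real pi * \<i>))) / x"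
   unfolding slash_S x_def[symmetric] by (simp only: powi_ell(1)[OF x(1)])
  also have "\<dots> = eps * Yp z + m1 z / x - k * m1 z * (2 * z ^ 2 / (x * x) * M2_star z) - m1 z * (k * (8 * z / (of_real pi * \<i>)) / (x * x))"
   unfolding eps_square using x(1) by (simp add: diff_divide_distrib add_divide_distrib ring_distribs mult_ac)
  also have "\<dots> = eps * Yp z - 1 * k * m1 z * M2_star z"
   unfolding k unfolding x(2) using z0 by simp
  also have "\<dots> = eps * m2 z" unfolding eps_square[symmetric] by (simp add: m2_def k_def algebra_simps)
  finally show "slash (ell + 1) S_mat m2 z = eps * m2 z" .
 qed
qed

text \<open>The nearly holomorphic completion is \<open>Yp + (2/l) m1/(\<surd>2 (z - cnj z))\<close>: its correction
  term has the anomaly opposite to that of \<open>Yp\<close>.\<close>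

lemma Yp_quasimodular: "Yp \<in> quasimodular_forms (ell + 1) eps"
proof -
 define f1 where "f1 z = eps * m1 z / r2" for z
 define f where "f z = Yp z + f1 z / (z - cnj z)" for z
 have ev: "even (ell + 1)" using ell_props(1) by simp
 have T: "f (z + 1) = f z" if "Im z > 0" for z
  using Yp_translation[OF that] m1_translation[OF that] by (simp add: f_def f1_def)
 have S: "slash (ell + 1) S_mat f z = eps * f z" if z: "Im z > 0" for z
 proof -
  define x where "x = r2 * z"
  define y where "y = cnj z"
  have z0: "z ~= 0" "y ~= 0" "z - y ~= 0" using z by (auto simp: y_def complex_eq_iff)
  have x: "x ~= 0" "x * x = 2 * z ^ 2" using z0 r2_props by (auto simp: x_def power2_eq_square mult_ac)
  have fz: "fricke z - cnj (fricke z) = (z - y) / (2 * z * y)"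
   using z0 by (simp add: fricke_def y_def field_simps)
  have "f (fricke z) = x powi ell * (eps * x * Yp z + m1 z + eps * (eps * m1 z / x) / r2 / ((z - y) / (2 * z * y)))"
   unfolding f_def f1_def fz Yp_fricke_m1[OF z] m1_fricke[OF z] x_def[symmetric] by (simp add: algebra_simps)
  then have "slash (ell + 1) S_mat f z = (eps * x * Yp z + m1 z + eps * (eps * m1 z / x) / r2 / ((z - y) / (2 * z * y))) / x"
   unfolding slash_S x_def[symmetric] by (simp only: powi_ell(1)[OF x(1)])
  also have "\<dots> = eps * Yp z + m1 z / x + (eps * eps) * m1 z * (2 * z * y) / (x * x) / r2 / (z - y)"
   using x(1) r2_props z0 by (simp add: field_simps)
  also have "\<dots> = eps * Yp z + (m1 z / (r2 * z) + m1 z * y / (r2 * z * (z - y)))"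
   unfolding eps_square x(2) using z0 r2_props by (simp add: x_def power2_eq_square)
  also have "m1 z / (r2 * z) + m1 z * y / (r2 * z * (z - y)) = m1 z / (r2 * (z - y))"
  proof -
   have "m1 z / (r2 * z) = m1 z * (z - y) / (r2 * z * (z - y))" using z0 by simp
   then have "m1 z / (r2 * z) + m1 z * y / (r2 * z * (z - y)) = (m1 z * (z - y) + m1 z * y) / (r2 * z * (z - y))"
    by (simp only: add_divide_distrib)
   also have "m1 z * (z - y) + m1 z * y = m1 z * z" by (simp add: algebra_simps)
   finally show ?thesis using z0 by simp
  qed
  also have "eps * Yp z + m1 z / (r2 * (z - y)) = eps * Yp z + (eps * eps) * m1 z / (r2 * (z - y))"
   unfolding eps_square by simp
  also have "\<dots> = eps * f z" by (simp add: f_def f1_def y_def algebra_simps)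
  finally show ?thesis by (simp add: add.assoc)
 qed
 obtain L1 where L1: "(m1 \<longlongrightarrow> L1) at_ii_inf" using monodromy(4) unfolding m1_def[abs_def] by blast
 obtain L where L: "(Yp \<longlongrightarrow> L) at_ii_inf" using monodromy(3) by blast
 have "((%z. Yp z + eps * m1 z / r2 * (1 / (z - cnj z))) \<longlongrightarrow> L + eps * L1 / r2 * 0) at_ii_inf"
  by (intro tendsto_intros L L1 tendsto_inverse_diff_cnj r2_props)
 then have lim: "(f \<longlongrightarrow> L + eps * L1 / r2 * 0) at_ii_inf" unfolding f_def[abs_def] f1_def by simp
 have "f1 holomorphic_on uhp"
  unfolding f1_def[abs_def] by (intro holomorphic_intros holomorphic_m r2_props)
 moreover have "finite_at_cusps (ell + 1) f" by (rule finite_at_cusps_level2[OF ev eps_square T S lim])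
 moreover have "slash (ell + 1) A f z = f z" if "A \<in> Gamma0_2" "Im z > 0" for A z
  by (rule Gamma0_2_invariant[OF ev eps_square T S that])
 ultimately show ?thesis
  unfolding quasimodular_forms_def using holomorphic_Yp S
  by (intro CollectI exI[of _ f1] exI[of _ f]) (auto simp: f_def)
qed

section \<open>Equivariance and fundamental systems\<close>

text \<open>In this normalisation the vector \<open>(h1, Yp)\<close> transforms by the matrix itself, up to a scalar
  factor.\<close>

definition h1 :: "complex => complex" where "h1 z = eps * Y1 z / r2"

lemma h1_translation: "Im z > 0 ==> h1 (z + 1) = h1 z + Yp z"
proof -
 assume z: "Im z > 0"
 have "h1 (z + 1) = h1 z + (eps * eps) * Yp z" using monodromy(1)[OF z] r2_props by (simp add: h1_def field_simps)
 then show ?thesis by (simp add: eps_square)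
qed

lemma fricke_h1:
 assumes z: "Im z > 0"
 shows "Yp (fricke z) = ((r2 * z) powi ell * eps) * (r2 * h1 z)" "h1 (fricke z) = ((r2 * z) powi ell * eps) * (- (Yp z / r2))"
proof -
 have "(eps * eps) * Y1 z = eps * (r2 * h1 z)" using r2_props by (simp add: h1_def)
 then have "Y1 z = eps * (r2 * h1 z)" unfolding eps_square by simp
 then show "Yp (fricke z) = ((r2 * z) powi ell * eps) * (r2 * h1 z)" using Yp_fricke[OF z] by (simp add: mult.assoc)
 show "h1 (fricke z) = ((r2 * z) powi ell * eps) * (- (Yp z / r2))" by (simp add: h1_def Y1_fricke[OF z])
qed

text \<open>Induction over words: a letter \<open>S\<close> multiplies the scalar by the power \<open>ell\<close> of
  the automorphy factor, up to sign, and translations leave it unchanged.\<close>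

lemma vector_transformation:
 assumes "A \<in> gamma_words" "Im z > 0"
 shows "\<exists>x. x ~= 0 \<and> Yp (moebius A z) = x * (of_real (A $ 2 $ 1) * h1 z + of_real (A $ 2 $ 2) * Yp z) \<and>
  h1 (moebius A z) = x * (of_real (A $ 1 $ 1) * h1 z + of_real (A $ 1 $ 2) * Yp z)"
 using assms(1)
proof induction
 case one
 show ?case unfolding moebius_one unfolding mat2_one by (intro exI[of _ 1]) simp
next
 case (T A)
 define w where "w = moebius A z"
 have w: "Im w > 0" unfolding w_def by (rule moebius_uhp[OF gamma_words_det[OF T.hyps] assms(2)])
 have mw: "moebius (T_power 1 ** A) z = w + 1"
  using moebius_mult[OF _ gamma_words_det[OF T.hyps] assms(2), of "T_power 1"] by (simp add: w_def)
 obtain a b c d where A: "A = mat2 a b c d" using mat2_eta by metis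
 from T.IH obtain x where "x ~= 0" "Yp w = x * (of_real c * h1 z + of_real d * Yp z)" "h1 w = x * (of_real a * h1 z + of_real b * Yp z)"
  unfolding w_def A by auto
 then show ?case unfolding mw Yp_translation[OF w] h1_translation[OF w] unfolding A mat2_mult
  by (intro exI[of _ x]) (simp add: algebra_simps)
next
 case (T_inv A)
 define w where "w = moebius A z"
 have w: "Im (w - 1) > 0" unfolding w_def using moebius_uhp[OF gamma_words_det[OF T_inv.hyps] assms(2)] by simp
 have mw: "moebius (T_power (-1) ** A) z = w - 1"
  using moebius_mult[OF _ gamma_words_det[OF T_inv.hyps] assms(2), of "T_power (-1)"] by (simp add: w_def)
 have tr: "Yp (w - 1) = Yp w" "h1 (w - 1) = h1 w - Yp w"
  using Yp_translation[OF w] h1_translation[OF w] by simp_all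
 obtain a b c d where A: "A = mat2 a b c d" using mat2_eta by metis
 from T_inv.IH obtain x where "x ~= 0" "Yp w = x * (of_real c * h1 z + of_real d * Yp z)" "h1 w = x * (of_real a * h1 z + of_real b * Yp z)"
  unfolding w_def A by auto
 then show ?case unfolding mw tr unfolding A mat2_mult
  by (intro exI[of _ x]) (simp add: algebra_simps)
next
 case (S A)
 define w where "w = moebius A z"
 have w: "Im w > 0" unfolding w_def by (rule moebius_uhp[OF gamma_words_det[OF S.hyps] assms(2)])
 have mw: "moebius (S_mat ** A) z = fricke w"
  using moebius_mult[OF _ gamma_words_det[OF S.hyps] assms(2), of S_mat] by (simp add: w_def)
 define k where "k = (r2 * w) powi ell * eps"
 have "w ~= 0" using w by auto
 then have k: "k ~= 0" using eps_square r2_props by (auto simp: k_def power_int_not_zero)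
 obtain a b c d where A: "A = mat2 a b c d" using mat2_eta by metis
 from S.IH obtain x where "x ~= 0" "Yp w = x * (of_real c * h1 z + of_real d * Yp z)" "h1 w = x * (of_real a * h1 z + of_real b * Yp z)"
  unfolding w_def A by auto
 then show ?case unfolding mw fricke_h1[OF w] k_def[symmetric] unfolding A S_mat_eq mat2_mult
  using k r2_props by (intro exI[of _ "k * x"]) (simp add: field_simps)
qed

text \<open>As \<open>h1\<close> and \<open>Yp\<close> have no common zero, the zeros of \<open>Yp\<close> are the
  poles of the quotient, and elsewhere the vector law may be divided by \<open>Yp\<close>.\<close>

lemma equivariant_quotient: "equivariant (%z. eps * (Y1 z / (r2 * Yp z)))" (is "equivariant ?h")
proof -
 have an: "Yp analytic_on uhp" "Y1 analytic_on uhp"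
  using holomorphic_Yp holomorphic_Y1 by (simp_all add: analytic_on_open open_half_plane)
 have mero: "?h meromorphic_on uhp"
  by (intro meromorphic_intros analytic_on_imp_meromorphic_on an)
 have h: "?h z = h1 z / Yp z" for z by (simp add: h1_def)
 have nz: "Yp z ~= 0" if z: "Im z > 0" and np: "\<not> is_pole ?h z" for z
 proof
  assume zero: "Yp z = 0"
  then have Y1: "eps * Y1 z ~= 0" using no_common_zero[OF z] eps_square by auto
  obtain C where C: "C >= 0" "!!z. Im z > C ==> Yp z ~= 0" using Yp_nonzero by blast
  have "\<forall>\<^sub>F w in at z. Yp w ~= 0 \<and> w \<in> uhp"
   by (rule non_zero_neighbour_alt[OF holomorphic_Yp open_half_plane connected_half_plane, of z "\<i> * of_real (C + 1)"])
     (use z C in auto)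
  moreover have cont: "isCont Yp z" "isCont Y1 z"
   using holomorphic_on_imp_continuous_on[OF holomorphic_Yp] holomorphic_on_imp_continuous_on[OF holomorphic_Y1] z
   by (simp_all add: continuous_on_eq_continuous_at open_half_plane)
  ultimately have "filterlim (%w. r2 * Yp w) (at 0) (at z)"
   unfolding filterlim_at using r2_props zero
   by (auto simp: isCont_def elim!: eventually_mono intro!: tendsto_eq_intros)
  then have "is_pole (%w. eps * Y1 w / (r2 * Yp w)) z"
   by (intro is_pole_divide continuous_intros cont Y1)
  then show False using np by simp
 qed
 have "of_real (A $ 2 $ 1) * ?h z + of_real (A $ 2 $ 2) ~= 0 \<and>
    ?h (moebius A z) = (of_real (A $ 1 $ 1) * ?h z + of_real (A $ 1 $ 2)) / (of_real (A $ 2 $ 1) * ?h z + of_real (A $ 2 $ 2))"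
  if A: "A \<in> Gamma0p_2" and z: "Im z > 0" and np: "\<not> is_pole ?h z" "\<not> is_pole ?h (moebius A z)" for A z
 proof -
  have nz1: "Yp z ~= 0" "Yp (moebius A z) ~= 0"
   using nz[OF z np(1)] nz[OF moebius_uhp[OF Gamma0p_2_det[OF A] z] np(2)] by auto
  obtain x where x: "x ~= 0" "Yp (moebius A z) = x * (of_real (A $ 2 $ 1) * h1 z + of_real (A $ 2 $ 2) * Yp z)"
   "h1 (moebius A z) = x * (of_real (A $ 1 $ 1) * h1 z + of_real (A $ 1 $ 2) * Yp z)"
   using vector_transformation[OF _ z, of A] A unfolding Gamma0p_2_eq_words by blast
  have e: "of_real p * (h1 z / Yp z) + of_real q = (of_real p * h1 z + of_real q * Yp z) / Yp z" for p q :: real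
   using nz1(1) by (simp add: field_simps)
  show ?thesis unfolding h e using x nz1 by simp
 qed
 with mero show ?thesis unfolding equivariant_def by auto
qed

lemma fundamental: "hat_fundamental_system Q kinf k1 k2 m zs ks Y1 Yp"
 unfolding hat_fundamental_system_def
proof (intro allI impI)
 fix U F assume "open U \<and> connected U \<and> U ~= {} \<and> U \<subseteq> uhp \<and> Q holomorphic_on U \<and> Fbr U F"
 then have U: "open U" "connected U" "U ~= {}" "U \<subseteq> uhp" and F: "Fbr U F" by auto
 note Fp = F_branch_props[OF U(1,4) F]
 have UZ: "U \<subseteq> uhp - Z" using U(4) Fp(1) by blast
 have lam: "lam holomorphic_on U" by (rule holomorphic_on_subset[OF holomorphic_lam UZ])
 have iff: "twisted_solution Q lam U Y \<longleftrightarrow> solves_ode Q U (%z. Y z / F z)" for Y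
  by (rule twisted_iff_solves_ode[OF U(1) Fp(3,2) lam])
 have sol: "twisted_solution Q lam U Y1" "twisted_solution Q lam U Yp"
  using twisted_solution_subset[OF _ UZ] Y1_twisted Yp_twisted by blast+
 show "fundamental_system Q U (%z. Y1 z / F z) (%z. Yp z / F z)"
  unfolding fundamental_system_def
 proof (intro conjI allI impI)
  show "solves_ode Q U (%z. Y1 z / F z)" "solves_ode Q U (%z. Yp z / F z)" using sol iff by blast+
  fix a b assume ab: "\<forall>z\<in>U. a * (Y1 z / F z) + b * (Yp z / F z) = 0"
  have "b * Yp z + a * Y1 z = 0" if "z \<in> U" for z
  proof -
   have "(b * Yp z + a * Y1 z) / F z = 0" using bspec[OF ab that] by (simp add: add_divide_distrib add.commute)
   then show ?thesis using Fp(2)[OF that] by simp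
  qed
  from independent[OF U(1,3,4) this] show "a = 0" "b = 0" by auto
 next
  fix y assume y: "solves_ode Q U y"
  have "solves_ode Q U (%z. F z * y z / F z)" by (rule solves_ode_cong[OF y U(1)]) (simp add: Fp(2))
  then have "twisted_solution Q lam U (%z. F z * y z)" using iff by blast
  then obtain a b where ab: "!!z. z \<in> U ==> F z * y z = a * Y1 z + b * Yp z"
   by (rule twisted_solution_span[OF sol _ lam U(1,2) wronskian_nonzero[OF U(1,2) UZ]]) (auto intro: that)
  have "y z = a * (Y1 z / F z) + b * (Yp z / F z)" if "z \<in> U" for z
   using ab[OF that] Fp(2)[OF that] by (simp add: field_simps)
  then show "\<exists>a b. \<forall>z\<in>U. y z = a * (Y1 z / F z) + b * (Yp z / F z)" by blast
 qed
qed

end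

theorem theorem1p4:
  fixes Q :: "complex \<Rightarrow> complex"
    and kinf k1 k2 :: real
    and m :: nat and zs :: "nat \<Rightarrow> complex" and ks :: "nat \<Rightarrow> real"
  assumes "meromorphic_modular_form 4 Q"
    and "\<exists>z\<in>uhp. Q z \<noteq> 0"
    and "condition_H Q"
    and "has_kappa_cusp Q kinf" and "\<exists>n::nat. kinf = real n / 2"
    and "has_kappa Q rho1 k1" and "has_kappa Q rho2 k2"
    and "pole_representatives Q m zs"
    and "\<forall>j\<in>{1..m}. has_kappa Q (zs j) (ks j)"
  shows "\<not> cusp_apparent Q \<and>
    (\<exists>l::int. odd l \<and> real_of_int l = ell_real kinf k1 k2 m ks \<and>
      (\<exists>Yp. y_plus_hat Q kinf k1 k2 m zs ks Yp) \<and>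
      (\<forall>Yp Y1. y_plus_hat Q kinf k1 k2 m zs ks Yp \<and> Y1 = slash l S_mat Yp \<longrightarrow>
        hat_fundamental_system Q kinf k1 k2 m zs ks Y1 Yp \<and>
        equivariant (\<lambda>z. jacobi2 l * (Y1 z / (of_real (sqrt 2) * Yp z))) \<and>
        (\<exists>m1 m2.
          m1 \<in> modular_forms (l - 1) (jacobi2 l) \<and>
          (\<forall>z\<in>uhp. Y1 z = jacobi2 l * of_real (sqrt 2) * z * Yp z + m1 z) \<and>
          m2 \<in> modular_forms (l + 1) (jacobi2 l) \<and>
          (\<forall>z\<in>uhp. Yp z =
             jacobi2 l * (of_real pi * \<i> / (4 * of_real (sqrt 2))) * m1 z * M2_star z + m2 z)) \<and>
        Yp \<in> quasimodular_forms (l + 1) (jacobi2 l)))"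
proof -
 interpret modular_ode Q kinf k1 k2 m zs ks by unfold_locales (use assms in auto)
 have hat_case: "\<not> cusp_apparent Q \<and> hat_fundamental_system Q kinf k1 k2 m zs ks (slash ell S_mat Yp) Yp \<and>
    equivariant (%z. jacobi2 ell * (slash ell S_mat Yp z / (of_real (sqrt 2) * Yp z))) \<and>
    (\<exists>m1 m2.
     m1 \<in> modular_forms (ell - 1) (jacobi2 ell) \<and>
     (\<forall>z\<in>uhp. slash ell S_mat Yp z = jacobi2 ell * of_real (sqrt 2) * z * Yp z + m1 z) \<and>
     m2 \<in> modular_forms (ell + 1) (jacobi2 ell) \<and>
     (\<forall>z\<in>uhp. Yp z =
       jacobi2 ell * (of_real pi * \<i> / (4 * of_real (sqrt 2))) * m1 z * M2_star z + m2 z)) \<and>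
    Yp \<in> quasimodular_forms (ell + 1) (jacobi2 ell)"
  if "y_plus_hat Q kinf k1 k2 m zs ks Yp" for Yp
 proof -
  interpret hat_solution Q kinf k1 k2 m zs ks Yp by unfold_locales (rule that)
  have "\<forall>z\<in>uhp. Y1 z = eps * r2 * z * Yp z + m1 z"
   "\<forall>z\<in>uhp. Yp z = eps * (of_real pi * \<i> / (4 * r2)) * m1 z * M2_star z + m2 z"
   by (simp_all add: m1_def m2_def)
  then show ?thesis
   using monodromy(2) fundamental equivariant_quotient m1_modular m2_modular Yp_quasimodular
   unfolding Y1_def by blast
 qed
 show ?thesis
 proof (intro conjI exI[of _ ell])
  show "\<not> cusp_apparent Q" using exists_y_plus_hat hat_case by blast
 qed (use ell_props exists_y_plus_hat hat_case in blast)+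
qed

end
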